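(* Let $\alpha\ge0$, $1<p<\infty$ and $\beta,\mu\in\mathbb{R}$ with $0<\beta-\frac1p<\mu$. Let $\mathcal{H}f(t)=\mathrm{p.v.}\,\frac i\pi\int_{-\infty}^\infty\frac{f(s)}{t-s}ds$ be the Hilbert transform and $\mathcal{S}_{\beta,\mu}f(t)=\int_0^\infty\frac{u^{\beta-1}}{(1+u)^\mu}f(tu)\,du$, $t\in\mathbb{R}$, the generalized Stieltjes operator. Then $\mathcal{H}$ and $\mathcal{S}_{\beta,\mu}$ commute as bounded operators on $\mathcal{T}_p^{(\alpha)}(|t|^\alpha)$: $$\mathcal{H}\,\mathcal{S}_{\beta,\mu}=\mathcal{S}_{\beta,\mu}\,\mathcal{H}.$$
   Context: p.v. denotes the Cauchy principal value. For $f$ in the Schwartz class on $\mathbb{R}$, $\alpha>0$ and an integer $n>\alpha$ put $W_+^\alpha f(x)=\frac{(-1)^n}{\Gamma(n-\alpha)}\frac{d^n}{dx^n}\int_x^\infty(t-x)^{n-\alpha-1}f(t)\,dt$ and $W_-^\alpha f(x)=\frac1{\Gamma(n-\alpha)}\frac{d^n}{dx^n}\int_{-\infty}^x(x-t)^{n-\alpha-1}f(t)\,dt$; $W_\pm^0f=f$. Let $W_0^\alpha f(t)=W_-^\alpha f(t)$ for $t<0$ and $W_0^\alpha f(t)=W_+^\alpha f(t)$ for $t>0$. For $1\le p<\infty$, $\mathcal{T}_p^{(\alpha)}(|t|^\alpha)$ is the completion of the Schwartz class on $\mathbb{R}$ in the norm $|||f|||_{\alpha,p}=\frac1{\Gamma(\alpha+1)}\left(\int_{-\infty}^\infty(|W_0^\alpha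 f(t)|\,|t|^\alpha)^pdt\right)^{1/p}$; $\mathcal{T}_p^{(0)}(|t|^0)=L^p(\mathbb{R})$. It embeds continuously in $L^p(\mathbb{R})$ and is regarded as a subspace of it. Both $\mathcal{H}$ and $\mathcal{S}_{\beta,\mu}$ are bounded on $\mathcal{T}_p^{(\alpha)}(|t|^\alpha)$ under the stated conditions. *)

theory Defs
  imports "HOL-Analysis.Analysis"
begin

definition nth_vderiv :: "nat \<Rightarrow> (real \<Rightarrow> complex) \<Rightarrow> real \<Rightarrow> complex" where
  "nth_vderiv m f = ((\<lambda>g x. vector_derivative g (at x)) ^^ m) f"

definition schwartz :: "(real \<Rightarrow> complex) set" where
  "schwartz = {f. (\<forall>m x. nth_vderiv m f differentiable (at x)) \<and>
                  (\<forall>k m. bounded (range (\<lambda>x. x ^ k *\<^sub>R nth_vderiv m f x)))}"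

text \<open>Elements of \<open>L\<^sup>p\<close> are represented by functions; equality in \<open>L\<^sup>p\<close> is equality almost everywhere.\<close>

definition lp_space :: "real \<Rightarrow> (real \<Rightarrow> complex) set" where
  "lp_space p = {f \<in> borel_measurable lebesgue. integrable lebesgue (\<lambda>x. norm (f x) powr p)}"

definition lp_norm :: "real \<Rightarrow> (real \<Rightarrow> complex) \<Rightarrow> real" where
  "lp_norm p f = (LINT x|lebesgue. norm (f x) powr p) powr (1 / p)"

text \<open>The integer \<open>n > \<alpha>\<close> in the Weyl derivatives is kept as an explicit parameter; on Schwartz
  functions the value does not depend on it.\<close>

definition weyl_plus :: "nat \<Rightarrow> real \<Rightarrow> (real \<Rightarrow> complex) \<Rightarrow> real \<Rightarrow> complex" where
  "weyl_plus n \<alpha> f x =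
     (if \<alpha> = 0 then f x
      else ((-1) ^ n / Gamma (real n - \<alpha>)) *\<^sub>R
             nth_vderiv n (\<lambda>y. LINT t:{y<..}|lebesgue. (t - y) powr (real n - \<alpha> - 1) *\<^sub>R f t) x)"

definition weyl_minus :: "nat \<Rightarrow> real \<Rightarrow> (real \<Rightarrow> complex) \<Rightarrow> real \<Rightarrow> complex" where
  "weyl_minus n \<alpha> f x =
     (if \<alpha> = 0 then f x
      else (1 / Gamma (real n - \<alpha>)) *\<^sub>R
             nth_vderiv n (\<lambda>y. LINT t:{..<y}|lebesgue. (y - t) powr (real n - \<alpha> - 1) *\<^sub>R f t) x)"

text \<open>The value at \<open>0\<close> is immaterial.\<close>

definition weyl_zero :: "nat \<Rightarrow> real \<Rightarrow> (real \<Rightarrow> complex) \<Rightarrow> real \<Rightarrow> complex" where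
  "weyl_zero n \<alpha> f t = (if t < 0 then weyl_minus n \<alpha> f t else weyl_plus n \<alpha> f t)"

definition tp_prenorm :: "nat \<Rightarrow> real \<Rightarrow> real \<Rightarrow> (real \<Rightarrow> complex) \<Rightarrow> real" where
  "tp_prenorm n \<alpha> p f =
     1 / Gamma (\<alpha> + 1) *
     (LINT t|lebesgue. (norm (weyl_zero n \<alpha> f t) * \<bar>t\<bar> powr \<alpha>) powr p) powr (1 / p)"

text \<open>The completion is realised inside \<open>L\<^sup>p\<close>: the class of a Cauchy sequence of Schwartz functions
  is identified with its \<open>L\<^sup>p\<close>-limit, and its norm is the limit of the norms.\<close>

definition tp_represents ::
    "nat \<Rightarrow> real \<Rightarrow> real \<Rightarrow> (nat \<Rightarrow> real \<Rightarrow> complex) \<Rightarrow> (real \<Rightarrow> complex) \<Rightarrow> bool" where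
  "tp_represents n \<alpha> p \<phi> f \<longleftrightarrow>
     (\<forall>k. \<phi> k \<in> schwartz) \<and>
     (\<forall>e>0. \<exists>N. \<forall>j\<ge>N. \<forall>k\<ge>N. tp_prenorm n \<alpha> p (\<lambda>t. \<phi> j t - \<phi> k t) < e) \<and>
     (\<lambda>k. lp_norm p (\<lambda>t. \<phi> k t - f t)) \<longlonglongrightarrow> 0"

definition tp_space :: "nat \<Rightarrow> real \<Rightarrow> real \<Rightarrow> (real \<Rightarrow> complex) set" where
  "tp_space n \<alpha> p = {f \<in> lp_space p. \<exists>\<phi>. tp_represents n \<alpha> p \<phi> f}"

definition tp_norm :: "nat \<Rightarrow> real \<Rightarrow> real \<Rightarrow> (real \<Rightarrow> complex) \<Rightarrow> real" where
  "tp_norm n \<alpha> p f =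
     (THE N. \<forall>\<phi>. tp_represents n \<alpha> p \<phi> f \<longrightarrow> (\<lambda>k. tp_prenorm n \<alpha> p (\<phi> k)) \<longlonglongrightarrow> N)"

definition tp_bounded_operator ::
    "nat \<Rightarrow> real \<Rightarrow> real \<Rightarrow> ((real \<Rightarrow> complex) \<Rightarrow> real \<Rightarrow> complex) \<Rightarrow> bool" where
  "tp_bounded_operator n \<alpha> p A \<longleftrightarrow>
     (\<forall>f\<in>tp_space n \<alpha> p. A f \<in> tp_space n \<alpha> p) \<and>
     (\<forall>f\<in>tp_space n \<alpha> p. \<forall>g\<in>tp_space n \<alpha> p.
        (AE t in lebesgue. f t = g t) \<longrightarrow> (AE t in lebesgue. A f t = A g t)) \<and>
     (\<forall>f\<in>tp_space n \<alpha> p. \<forall>g\<in>tp_space n \<alpha> p. \<forall>a b.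
        AE t in lebesgue. A (\<lambda>s. a * f s + b * g s) t = a * A f t + b * A g t) \<and>
     (\<exists>C. \<forall>f\<in>tp_space n \<alpha> p. tp_norm n \<alpha> p (A f) \<le> C * tp_norm n \<alpha> p f)"

definition truncated_hilbert :: "real \<Rightarrow> (real \<Rightarrow> complex) \<Rightarrow> real \<Rightarrow> complex" where
  "truncated_hilbert \<epsilon> f t =
     \<i> / of_real pi * (LINT s:{s. \<epsilon> < \<bar>t - s\<bar>}|lebesgue. f s / of_real (t - s))"

definition hilbert :: "(real \<Rightarrow> complex) \<Rightarrow> real \<Rightarrow> complex" where
  "hilbert f t = Lim (at_right 0) (\<lambda>\<epsilon>. truncated_hilbert \<epsilon> f t)"

definition hilbert_defined_at :: "(real \<Rightarrow> complex) \<Rightarrow> real \<Rightarrow> bool" where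
  "hilbert_defined_at f t \<longleftrightarrow>
     (\<forall>\<epsilon>>0. set_integrable lebesgue {s. \<epsilon> < \<bar>t - s\<bar>} (\<lambda>s. f s / of_real (t - s))) \<and>
     (\<exists>l. ((\<lambda>\<epsilon>. truncated_hilbert \<epsilon> f t) \<longlongrightarrow> l) (at_right 0))"

definition stieltjes :: "real \<Rightarrow> real \<Rightarrow> (real \<Rightarrow> complex) \<Rightarrow> real \<Rightarrow> complex" where
  "stieltjes \<beta> \<mu> f t =
     (LINT u:{0<..}|lebesgue. (u powr (\<beta> - 1) / (1 + u) powr \<mu>) *\<^sub>R f (t * u))"

definition stieltjes_defined_at :: "real \<Rightarrow> real \<Rightarrow> (real \<Rightarrow> complex) \<Rightarrow> real \<Rightarrow> bool" where
  "stieltjes_defined_at \<beta> \<mu> f t \<longleftrightarrow>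
     set_integrable lebesgue {0<..} (\<lambda>u. (u powr (\<beta> - 1) / (1 + u) powr \<mu>) *\<^sub>R f (t * u))"

end

theory Submission
  imports Defs "HOL-Complex_Analysis.Complex_Analysis"
begin

text \<open>
For \<open>\<alpha> > 0\<close> the fractional integral inverts the Weyl derivative, so a Schwartz function \<open>f\<close> is recovered
from \<open>g = |t|^\<alpha> W\<^sub>0^\<alpha> f\<close> as \<open>f = R g\<close>, where
\<open>R g(t) = 1/\<Gamma>(\<alpha>) \<integral> (u - 1)^(\<alpha> - 1) u^(-\<alpha>) g(t u) du\<close> over \<open>u > 1\<close> is a dilation operator
\<open>g \<mapsto> \<integral> k(u) g(t u) du\<close>. Minkowski's inequality bounds such operators on \<open>L\<^sup>p\<close>, and by Fubini they
commute. Since \<open>R\<close> is injective on \<open>L\<^sup>p\<close> and the functions \<open>|t|^\<alpha> W\<^sub>0^\<alpha> f\<close> are dense in \<open>L\<^sup>p\<close>, the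
completion is \<open>R(L\<^sup>p)\<close> with the transported norm, and a bounded operator on \<open>L\<^sup>p\<close> that commutes with
\<open>R\<close> is bounded on it. The Stieltjes operator is itself a dilation operator. The Hilbert transform
is the boundary value of the Cauchy integral minus the identity. Its \<open>L\<^sup>p\<close> bound is the theorem of
M. Riesz (integrate \<open>F^p\<close> over half discs for \<open>p \<le> 2\<close>, dualise for \<open>p > 2\<close>), the principal value
exists at Lebesgue points, and since the Cauchy kernel is homogeneous of degree \<open>-1\<close>, taking
boundary values commutes with every dilation operator, in particular with \<open>R\<close> and with the
Stieltjes operator.
\<close>

text \<open>The principal value does not converge absolutely, so Fubini cannot move it past a
  dilation integral. At height y > 0 every integral is absolutely convergent, and a dilation by u
  only turns the height y into y * u; what remains is a limit in y, harmless because the norm bound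
  is uniform in y. The kernel is twice the usual Cauchy kernel, so that its real part is the Poisson
  kernel: nonnegative data then give values in the right half plane, where the power p is
  holomorphic. As \<open>hilbert\<close> is a pointwise limit, convergence in norm is not enough; a
  maximal inequality supplies the points of convergence. Density is delicate at 0: the fractional
  integral of a function supported away from 0 need not vanish near 0, and cutting it off at scale e
  costs derivatives of size e^(-n). The gain of e^n from the weight and the remaining fractional
  integral balances this exactly, so the error stays bounded on an interval of length 2e.
  Injectivity of R is reduced to integer order by a second dilation operator of complementary order,
  which commutes with R.\<close>

abbreviation nn_real_lborel :: "(real => real) => ennreal" (binder "NR " 10) where
 "nn_real_lborel f \<equiv> nn_integral lborel (\<lambda>x. ennreal (f x))"

abbreviation nn_lborel :: "(real => ennreal) => ennreal" (binder "NN " 10) where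
 "nn_lborel f \<equiv> nn_integral lborel f"

abbreviation borel_fun :: "(real => 'a::topological_space) => bool" where
 "borel_fun f \<equiv> f \<in> borel_measurable borel"

section \<open>Powers of the Lebesgue norm\<close>

text \<open>The p-th power of the norm, without the root and with values in \<open>ennreal\<close>,
  so that integrals can be compared before finiteness is known.\<close>

definition lp_mass :: "real => (real => complex) => ennreal" where
 "lp_mass p f = (NR x. norm (f x) powr p)"

text \<open>The tangent line of z^p at m gives p m^(p-1) z \<le> z^p + (p-1) m^p; integrating it at
  z = h against w yields the claim. The real number x, allowed to lie below a possibly infinite
  integral, lets the lemma serve for norms of Bochner integrals and for truncations alike.\<close>

lemma nn_integral_weighted_Jensen:
 fixes w h :: "'a => real"
 assumes [measurable]: "w \<in> borel_measurable M" "h \<in> borel_measurable M"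
  and w0: "\<And>y. 0 \<le> w y" and h0: "\<And>y. 0 \<le> h y" and p: "1 < p"
  and W: "(\<integral>\<^sup>+y. ennreal (w y) \<partial>M) \<le> ennreal W" "0 < W"
  and x: "0 \<le> x" "ennreal x \<le> (\<integral>\<^sup>+y. ennreal (w y * h y) \<partial>M)"
 shows "ennreal (x powr p) \<le> ennreal (W powr (p - 1)) * (\<integral>\<^sup>+y. ennreal (w y * h y powr p) \<partial>M)"
proof (cases "x = 0 \<or> (\<integral>\<^sup>+y. ennreal (w y * h y powr p) \<partial>M) = \<infinity>")
 case True
 then show ?thesis using W p by (auto simp: ennreal_mult_top)
next
 case False
 then obtain b where b: "0 \<le> b" "(\<integral>\<^sup>+y. ennreal (w y * h y powr p) \<partial>M) = ennreal b"
  by (cases "\<integral>\<^sup>+y. ennreal (w y * h y powr p) \<partial>M") auto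
 \<comment> \<open>W bounds the total weight, so x / W plays the part of the mean of
   \<open>h\<close>, the point where the tangent line gives the best constant.\<close>
 define m where "m = x / W"
 have m: "0 < m" using False x W by (simp add: m_def)
 define q where "q = p / (p - 1)"
 have q: "1 < q" "1/p + 1/q = 1" "(p - 1) * q = p" using p by (auto simp: q_def field_simps)
 have pt: "p * m powr (p - 1) * (w y * h y) \<le> w y * h y powr p + w y * ((p - 1) * m powr p)" for y
 proof -
  have "h y * m powr (p - 1) \<le> h y powr p / p + (m powr (p - 1)) powr q / q"
   using p q h0[of y] by (intro Youngs_inequality) auto
  also have "(m powr (p - 1)) powr q = m powr p" by (simp add: powr_powr q)
  finally have "p * (h y * m powr (p - 1)) \<le> p * (h y powr p / p + m powr p / q)"
   using p by (intro mult_left_mono) auto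
  also have "\<dots> = h y powr p + (p - 1) * m powr p" using p by (simp add: q_def field_simps)
  finally show ?thesis using mult_left_mono[OF _ w0[of y]] by (fastforce simp: algebra_simps)
 qed
 have "ennreal (p * m powr (p - 1) * x) = ennreal (p * m powr (p - 1)) * ennreal x"
  using p by (subst ennreal_mult) (auto simp: x)
 also have "\<dots> \<le> ennreal (p * m powr (p - 1)) * (\<integral>\<^sup>+y. ennreal (w y * h y) \<partial>M)"
  by (intro mult_left_mono x) auto
 also have "\<dots> = (\<integral>\<^sup>+y. ennreal (p * m powr (p - 1) * (w y * h y)) \<partial>M)"
  using p w0 h0 by (subst nn_integral_cmult[symmetric]) (auto simp: ennreal_mult)
 also have "\<dots> \<le> (\<integral>\<^sup>+y. ennreal (w y * h y powr p) + ennreal ((p - 1) * m powr p) * ennreal (w y) \<partial>M)"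
 proof (intro nn_integral_mono)
  fix y
  have "ennreal (p * m powr (p - 1) * (w y * h y)) \<le> ennreal (w y * h y powr p + w y * ((p - 1) * m powr p))"
   by (intro ennreal_leI pt)
  also have "\<dots> = ennreal (w y * h y powr p) + ennreal ((p - 1) * m powr p) * ennreal (w y)"
   using w0[of y] p by (subst ennreal_plus) (auto simp: ennreal_mult[symmetric] mult.commute)
  finally show "ennreal (p * m powr (p - 1) * (w y * h y)) \<le> \<dots>" .
 qed
 also have "\<dots> = ennreal b + ennreal ((p - 1) * m powr p) * (\<integral>\<^sup>+y. ennreal (w y) \<partial>M)"
  using b by (subst nn_integral_add) (auto simp: nn_integral_cmult)
 also have "\<dots> \<le> ennreal b + ennreal ((p - 1) * m powr p) * ennreal W"
  by (intro add_left_mono mult_left_mono W) auto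
 also have "\<dots> = ennreal (b + (p - 1) * m powr p * W)"
  using p b W by (subst ennreal_mult[symmetric]) (auto simp: ennreal_plus[symmetric] simp del: ennreal_plus)
 finally have "p * m powr (p - 1) * x \<le> b + (p - 1) * m powr p * W"
  using p b W by (subst (asm) ennreal_le_iff) (auto intro!: add_nonneg_nonneg)
 moreover have "(p - 1) * m powr p * W = (p - 1) * m powr (p - 1) * x"
 proof -
  have "m powr p = m powr (p - 1) * m" using m by (simp add: powr_diff)
  moreover have "m * W = x" using W by (simp add: m_def)
  ultimately show ?thesis by (simp add: mult.assoc)
 qed
 ultimately have *: "m powr (p - 1) * x \<le> b"
  by (simp add: left_diff_distrib mult.assoc)
 have "x powr p = x powr (p - 1) * x" using False x by (simp add: powr_diff)
 also have "x powr (p - 1) = W powr (p - 1) * m powr (p - 1)"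
  using W m by (subst powr_mult[symmetric]) (auto simp: m_def)
 finally have "x powr p \<le> W powr (p - 1) * b"
  using * W by (simp add: mult.assoc)
 then have "ennreal (x powr p) \<le> ennreal (W powr (p - 1) * b)" by (rule ennreal_leI)
 then show ?thesis using b by (simp add: ennreal_mult)
qed

text \<open>Jensen with weight b^q and integrand a b^(1-q), where q is the conjugate exponent: the
  product of the two is a b, and b^q (b^(1-q))^p is 1 or 0 because q + (1-q) p = 0.\<close>

lemma nn_integral_Hoelder:
 fixes a b :: "'a => real"
 assumes [measurable]: "a \<in> borel_measurable M" "b \<in> borel_measurable M"
  and a0: "\<And>y. 0 \<le> a y" and b0: "\<And>y. 0 \<le> b y" and p: "1 < p"
  and W: "(\<integral>\<^sup>+y. ennreal (b y powr (p / (p - 1))) \<partial>M) \<le> ennreal W" "0 < W"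
  and x: "0 \<le> x" "ennreal x \<le> (\<integral>\<^sup>+y. ennreal (a y * b y) \<partial>M)"
 shows "ennreal (x powr p) \<le> ennreal (W powr (p - 1)) * (\<integral>\<^sup>+y. ennreal (a y powr p) \<partial>M)"
proof -
 define q where "q = p / (p - 1)"
 have q: "1 < q" "q + (1 - q) * p = 0" using p by (auto simp: q_def field_simps)
 have e: "b y powr q * (a y * b y powr (1 - q)) = a y * b y" for y
  using b0[of y] q by (cases "b y = 0") (auto simp: powr_diff)
 have "ennreal (x powr p) \<le> ennreal (W powr (p - 1)) *
   (\<integral>\<^sup>+y. ennreal (b y powr q * (a y * b y powr (1 - q)) powr p) \<partial>M)"
  using p W x a0 b0 by (intro nn_integral_weighted_Jensen) (auto simp: e q_def[symmetric])
 also have "\<dots> \<le> ennreal (W powr (p - 1)) * (\<integral>\<^sup>+y. ennreal (a y powr p) \<partial>M)"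
 proof (intro mult_left_mono nn_integral_mono ennreal_leI)
  fix y
  have "b y powr q * (b y powr (1 - q)) powr p \<le> 1"
   using b0[of y] q by (cases "b y = 0") (auto simp: powr_powr powr_add[symmetric])
  from mult_left_mono[OF this, of "a y powr p"]
  show "b y powr q * (a y * b y powr (1 - q)) powr p \<le> a y powr p"
   using a0[of y] by (simp add: powr_mult algebra_simps)
 qed auto
 finally show ?thesis .
qed

text \<open>Convexity of z^p at the points a/s and b/t with weights s and t. Keeping s and t free
  gives the crude factor 2^p with s = t = 1/2, and the sharp Minkowski inequality with s and t
  proportional to the two norm bounds.\<close>

lemma powr_sum_convex:
 fixes a b :: real
 assumes "0 \<le> a" "0 \<le> b" "1 < p" "0 < s" "0 < t" "s + t = 1"
 shows "(a + b) powr p \<le> s powr (1 - p) * a powr p + t powr (1 - p) * b powr p"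
proof -
 have conv: "convex_on {0..} (\<lambda>x::real. x powr p)"
 proof (rule convex_onI)
  fix r x y :: real assume r: "0 < r" "r < 1" and xy: "x \<in> {0..}" "y \<in> {0..}"
  have c: "convex_on {0<..} (\<lambda>x::real. x powr p)" using assms by (intro powr_convex) auto
  \<comment> \<open>The case of a segment with one endpoint at 0, where u^p \<le> u
    suffices.\<close>
  have h: "(u * z) powr p \<le> u * z powr p" if "0 \<le> z" "0 < u" "u < 1" for z u :: real
  proof -
   have "u powr p \<le> u powr 1" using that assms by (intro powr_mono') auto
   then show ?thesis using that by (simp add: powr_mult mult_right_mono)
  qed
  consider "x = 0" | "y = 0" | "0 < x" "0 < y" using xy by fastforce
  then show "((1 - r) *\<^sub>R x + r *\<^sub>R y) powr p \<le> (1 - r) * x powr p + r * y powr p"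
  proof cases
   case 3 then show ?thesis using convex_onD[OF c, of r x y] r by auto
  qed (use r xy h in auto)
 qed auto
 have "(s *\<^sub>R (a / s) + t *\<^sub>R (b / t)) powr p \<le> s * (a/s) powr p + t * (b/t) powr p"
 proof -
  have s: "s = 1 - t" using assms by simp
  show ?thesis unfolding s using assms by (intro convex_onD[OF conv]) auto
 qed
 moreover have "u * (z / u) powr p = u powr (1 - p) * z powr p" if "0 < u" "0 \<le> z" for u z
  using that by (simp add: powr_divide powr_diff)
 ultimately show ?thesis using assms by simp
qed

lemma lp_mass_cong:
 "(AE x in lborel. f x = g x) ==> lp_mass p f = lp_mass p g"
 unfolding lp_mass_def by (rule nn_integral_cong_AE) auto

lemma lp_mass_mono:
 "0 \<le> p ==> (\<And>x. norm (f x) \<le> norm (g x)) ==> lp_mass p f \<le> lp_mass p g"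
 unfolding lp_mass_def by (intro nn_integral_mono ennreal_leI powr_mono2) auto

lemma lp_mass_cmult:
 assumes [measurable]: "borel_fun f"
 shows "lp_mass p (\<lambda>x. c * f x) = ennreal (norm c powr p) * lp_mass p f"
 unfolding lp_mass_def by (subst nn_integral_cmult[symmetric]) (auto simp: norm_mult powr_mult ennreal_mult)

lemma lp_mass_0 [simp]: "lp_mass p (\<lambda>x. 0) = 0"
 by (simp add: lp_mass_def)

lemma lp_mass_uminus [simp]: "lp_mass p (\<lambda>x. - f x) = lp_mass p f"
 by (simp add: lp_mass_def)

lemma lp_mass_minus_commute: "lp_mass p (\<lambda>x. f x - g x) = lp_mass p (\<lambda>x. g x - f x)"
 by (simp add: lp_mass_def norm_minus_commute)

lemma lp_mass_add_convex:
 assumes [measurable]: "borel_fun f" "borel_fun g"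
  and "1 < p" "0 < s" "0 < t" "s + t = 1"
 shows "lp_mass p (\<lambda>x. f x + g x) \<le> ennreal (s powr (1 - p)) * lp_mass p f + ennreal (t powr (1 - p)) * lp_mass p g"
proof -
 have "norm (f x + g x) powr p \<le> s powr (1 - p) * norm (f x) powr p + t powr (1 - p) * norm (g x) powr p" for x
 proof -
  have "norm (f x + g x) powr p \<le> (norm (f x) + norm (g x)) powr p"
   using assms by (intro powr_mono2 norm_triangle_ineq) auto
  also have "\<dots> \<le> s powr (1 - p) * norm (f x) powr p + t powr (1 - p) * norm (g x) powr p"
   using assms by (intro powr_sum_convex) auto
  finally show ?thesis .
 qed
 then have "lp_mass p (\<lambda>x. f x + g x) \<le>
   (NN x. ennreal (s powr (1 - p)) * ennreal (norm (f x) powr p) + ennreal (t powr (1 - p)) * ennreal (norm (g x) powr p))"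
  unfolding lp_mass_def
  by (intro nn_integral_mono) (auto simp: ennreal_mult[symmetric] ennreal_plus[symmetric] intro!: ennreal_leI simp del: ennreal_plus)
 also have "\<dots> = ennreal (s powr (1 - p)) * lp_mass p f + ennreal (t powr (1 - p)) * lp_mass p g"
  unfolding lp_mass_def by (subst nn_integral_add) (auto simp: nn_integral_cmult)
 finally show ?thesis .
qed

lemma lp_mass_add_le:
 assumes [measurable]: "borel_fun f" "borel_fun g" and p: "1 < p"
 shows "lp_mass p (\<lambda>x. f x + g x) \<le> ennreal (2 powr p) * (lp_mass p f + lp_mass p g)"
proof -
 have "lp_mass p (\<lambda>x. f x + g x) \<le> ennreal ((1/2) powr (1 - p)) * lp_mass p f + ennreal ((1/2) powr (1 - p)) * lp_mass p g"
  using p by (intro lp_mass_add_convex) auto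
 also have "(1/2::real) powr (1 - p) \<le> 2 powr p"
  using p by (simp add: powr_divide powr_diff)
 then have "ennreal ((1/2) powr (1 - p)) * lp_mass p f + ennreal ((1/2) powr (1 - p)) * lp_mass p g
   \<le> ennreal (2 powr p) * lp_mass p f + ennreal (2 powr p) * lp_mass p g"
  by (intro add_mono mult_right_mono ennreal_leI) auto
 finally show ?thesis by (simp add: distrib_left)
qed

lemma lp_mass_diff_le:
 assumes [measurable]: "borel_fun f" "borel_fun g" "borel_fun h" and p: "1 < p"
 shows "lp_mass p (\<lambda>x. f x - h x) \<le> ennreal (2 powr p) * (lp_mass p (\<lambda>x. f x - g x) + lp_mass p (\<lambda>x. g x - h x))"
 using lp_mass_add_le[of "\<lambda>x. f x - g x" "\<lambda>x. g x - h x" p] p by simp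

text \<open>The weights a/(a+b) and b/(a+b) turn the convexity estimate into the exact triangle
  inequality. The bounds appear as p-th powers because the mass carries no root.\<close>

lemma lp_mass_Minkowski:
 assumes m: "borel_fun f" "borel_fun g" and p: "1 < p"
  and "lp_mass p f \<le> ennreal (a powr p)" "lp_mass p g \<le> ennreal (b powr p)" "0 < a" "0 < b"
 shows "lp_mass p (\<lambda>x. f x + g x) \<le> ennreal ((a + b) powr p)"
proof -
 let ?s = "a / (a + b)" and ?t = "b / (a + b)"
 have "lp_mass p (\<lambda>x. f x + g x) \<le> ennreal (?s powr (1 - p)) * lp_mass p f + ennreal (?t powr (1 - p)) * lp_mass p g"
  using assms by (intro lp_mass_add_convex) (auto simp: add_divide_distrib[symmetric])
 also have "\<dots> \<le> ennreal (?s powr (1 - p)) * ennreal (a powr p) + ennreal (?t powr (1 - p)) * ennreal (b powr p)"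
  using assms by (intro add_mono mult_left_mono) auto
 also have "\<dots> = ennreal (?s powr (1 - p) * a powr p + ?t powr (1 - p) * b powr p)"
  by (simp add: ennreal_mult[symmetric] ennreal_plus[symmetric] del: ennreal_plus)
 also have "?s powr (1 - p) * a powr p + ?t powr (1 - p) * b powr p = (a + b) powr p"
 proof -
  have "u / (a + b) * (a + b) powr p = (u / (a + b)) powr (1 - p) * u powr p" if "0 < u" for u
   using that assms by (simp add: powr_divide powr_diff)
  from this[of a] this[of b]
  have "?s powr (1 - p) * a powr p + ?t powr (1 - p) * b powr p = (?s + ?t) * (a + b) powr p"
   using assms by (simp only: distrib_right)
  moreover have "?s + ?t = 1" using assms by (simp add: add_divide_distrib[symmetric])
  ultimately show ?thesis by simp
 qed
 finally show ?thesis .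
qed

lemma lp_mass_eq_0_imp_AE:
 assumes [measurable]: "borel_fun f" and "lp_mass p f = 0"
 shows "AE x in lborel. f x = 0"
 using assms(2) unfolding lp_mass_def by (subst (asm) nn_integral_0_iff_AE) auto

section \<open>Convergence and completeness in L^p\<close>

definition lp_conv :: "real => (nat => real => complex) => (real => complex) => bool" where
 "lp_conv p F g \<longleftrightarrow> (\<lambda>n. lp_mass p (\<lambda>x. F n x - g x)) \<longlonglongrightarrow> 0"

lemma tendsto_0_le_ennreal:
 fixes f g :: "'a => ennreal"
 assumes "(g \<longlongrightarrow> 0) F" "\<forall>\<^sub>F x in F. f x \<le> g x" shows "(f \<longlongrightarrow> 0) F"
 by (rule tendsto_sandwich[OF _ assms(2) tendsto_const assms(1)]) auto

lemma tendsto_cmult_0_ennreal: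
 fixes f :: "'a => ennreal"
 assumes "(f \<longlongrightarrow> 0) F" shows "((\<lambda>x. ennreal c * f x) \<longlongrightarrow> 0) F"
 using ennreal_tendsto_cmult[OF _ assms, of "ennreal c"] by simp

lemma lp_conv_unique:
 assumes [measurable]: "\<And>n. borel_fun (F n)" "borel_fun g" "borel_fun h"
  and "1 < p" "lp_conv p F g" "lp_conv p F h"
 shows "AE x in lborel. g x = h x"
proof -
 have "(\<lambda>n. ennreal (2 powr p) * (lp_mass p (\<lambda>x. g x - F n x) + lp_mass p (\<lambda>x. F n x - h x))) \<longlonglongrightarrow> 0"
  using tendsto_add[OF assms(5,6)[unfolded lp_conv_def]]
  by (intro tendsto_cmult_0_ennreal) (simp add: lp_mass_minus_commute[of _ g])
 then have "(\<lambda>n::nat. lp_mass p (\<lambda>x. g x - h x)) \<longlonglongrightarrow> 0"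
  by (rule tendsto_0_le_ennreal) (auto intro!: always_eventually lp_mass_diff_le assms)
 then have "lp_mass p (\<lambda>x. g x - h x) = 0" by (simp add: LIMSEQ_const_iff)
 then show ?thesis using lp_mass_eq_0_imp_AE[of "\<lambda>x. g x - h x" p] by auto
qed

lemma lp_mass_Fatou:
 assumes [measurable]: "\<And>n. borel_fun (F n)"
  and lim: "AE x in lborel. (\<lambda>n. F n x) \<longlonglongrightarrow> g x" and bd: "\<And>n. lp_mass p (F n) \<le> B" and p: "0 < p"
 shows "lp_mass p g \<le> B"
proof -
 have "lp_mass p g = (NN x. liminf (\<lambda>n. ennreal (norm (F n x) powr p)))"
  unfolding lp_mass_def
 proof (rule nn_integral_cong_AE, use lim in eventually_elim)
  case (elim x)
  have "(\<lambda>n. ennreal (norm (F n x) powr p)) \<longlonglongrightarrow> ennreal (norm (g x) powr p)"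
   using p by (intro tendsto_ennrealI tendsto_powr2 tendsto_norm elim) auto
  then show ?case by (metis lim_imp_Liminf sequentially_bot)
 qed
 also have "\<dots> \<le> liminf (\<lambda>n. lp_mass p (F n))"
  unfolding lp_mass_def by (intro nn_integral_liminf) auto
 also have "\<dots> \<le> B"
  using Liminf_mono[of "\<lambda>n. lp_mass p (F n)" "\<lambda>n. B" sequentially] bd by (simp add: Liminf_const)
 finally show ?thesis .
qed

lemma ex_ennreal_between_0:
 assumes "(0::ennreal) < a" shows "\<exists>e>0. ennreal e < a"
proof (cases a)
 case (real r)
 then show ?thesis using assms by (intro exI[of _ "r / 2"]) (auto simp: ennreal_less_iff)
next
 case top then show ?thesis by (intro exI[of _ 1]) auto
qed

text \<open>Riesz-Fischer: a fast subsequence converges almost everywhere because the weighted sum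
  of the p-th powers of its increments is integrable. Fatou's lemma then carries the Cauchy estimate
  over to the almost everywhere limit.\<close>

lemma lp_complete:
 assumes m[measurable]: "\<And>n. borel_fun (F n)" and p: "1 < p"
  and cau: "\<And>e::real. 0 < e ==> \<exists>N. \<forall>j\<ge>N. \<forall>k\<ge>N. lp_mass p (\<lambda>x. F j x - F k x) < ennreal e"
 obtains g where "borel_fun g" "lp_conv p F g"
proof -
 have "\<exists>N. \<forall>j\<ge>N. \<forall>k\<ge>N. lp_mass p (\<lambda>x. F j x - F k x) < ennreal ((1/4) powr (p * real i))" for i
  by (rule cau) auto
 then obtain N where N: "\<And>i j k. N i \<le> j ==> N i \<le> k ==> lp_mass p (\<lambda>x. F j x - F k x) < ennreal ((1/4) powr (p * real i))"
  by metis
 \<comment> \<open>The sum over all l \<le> i makes r nondecreasing and at least N i; the summand i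
   makes it unbounded.\<close>
 define r where "r i = (\<Sum>l\<le>i. N l) + i" for i
 have rN: "N i \<le> r i" for i unfolding r_def by (rule trans_le_add1) (simp add: member_le_sum)
 have rS: "r i \<le> r (Suc i)" for i by (simp add: r_def)
 have ri: "i \<le> r i" for i by (simp add: r_def)
 define d where "d i x = F (r i) x - F (r (Suc i)) x" for i x
 have dm[measurable]: "borel_fun (d i)" for i unfolding d_def[abs_def] by measurable
 have dmass: "lp_mass p (d i) \<le> ennreal ((1/4) powr (p * real i))" for i
  unfolding d_def[abs_def] by (intro less_imp_le[OF N] rN order_trans[OF rN rS])
 \<comment> \<open>The increments have mass at most 4^(-p i); the weights 2^(p i) leave a convergent
   geometric series, and finiteness of the sum at a point bounds the i-th increment there by a
   multiple of 2^(-i).\<close>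
 have "(NN x. (\<Sum>i. ennreal (2 powr (p * real i)) * ennreal (norm (d i x) powr p)))
   = (\<Sum>i. ennreal (2 powr (p * real i)) * lp_mass p (d i))"
  unfolding lp_mass_def by (subst nn_integral_suminf) (auto simp: nn_integral_cmult)
 also have "\<dots> \<le> (\<Sum>i. ennreal (((1/2) powr p) ^ i))"
 proof (intro suminf_le summableI allI)
  fix i
  have "ennreal (2 powr (p * real i)) * lp_mass p (d i) \<le> ennreal (2 powr (p * real i)) * ennreal ((1/4) powr (p * real i))"
   by (intro mult_left_mono dmass) auto
  also have "\<dots> = ennreal ((2 * (1/4)) powr (p * real i))"
   by (subst powr_mult) (auto simp: ennreal_mult)
  also have "(2 * (1/4) :: real) powr (p * real i) = ((1/2) powr p) ^ i"
   by (simp add: powr_powr[symmetric] powr_realpow)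
  finally show "ennreal (2 powr (p * real i)) * lp_mass p (d i) \<le> ennreal (((1/2) powr p) ^ i)" .
 qed
 also have "\<dots> < \<infinity>"
 proof -
  have "(1/2::real) powr p < (1/2) powr 0" using p by (intro powr_less_mono') auto
  then have "summable (\<lambda>i. ((1/2::real) powr p) ^ i)" by (intro summable_geometric) auto
  then show ?thesis by (subst suminf_ennreal_eq[OF _ summable_sums]) auto
 qed
 finally have fin: "(NN x. (\<Sum>i. ennreal (2 powr (p * real i)) * ennreal (norm (d i x) powr p))) \<noteq> \<infinity>"
  by simp
 have "AE x in lborel. (\<Sum>i. ennreal (2 powr (p * real i)) * ennreal (norm (d i x) powr p)) \<noteq> \<infinity>"
  by (rule nn_integral_PInf_AE[OF _ fin]) measurable
 then have ae: "AE x in lborel. convergent (\<lambda>i. F (r i) x)"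
 proof eventually_elim
  case (elim x)
  then obtain M where M: "0 \<le> M" "(\<Sum>i. ennreal (2 powr (p * real i)) * ennreal (norm (d i x) powr p)) = ennreal M"
   by (cases "\<Sum>i. ennreal (2 powr (p * real i)) * ennreal (norm (d i x) powr p)") auto
  have bd: "norm (d i x) \<le> M powr (1/p) * (1/2) ^ i" for i
  proof -
   have "sum (\<lambda>i. ennreal (2 powr (p * real i)) * ennreal (norm (d i x) powr p)) {i} \<le> ennreal M"
    unfolding M(2)[symmetric] by (rule sum_le_suminf) auto
   then have "ennreal (2 powr (p * real i) * norm (d i x) powr p) \<le> ennreal M"
    by (simp add: ennreal_mult)
   then have "2 powr (p * real i) * norm (d i x) powr p \<le> M"
    using M by (simp add: ennreal_le_iff)
   then have "(2 powr (p * real i) * norm (d i x) powr p) powr (1/p) \<le> M powr (1/p)"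
    using p by (intro powr_mono2) auto
   then have "2 ^ i * norm (d i x) \<le> M powr (1/p)"
    using p by (simp add: powr_mult powr_powr powr_realpow)
   then show ?thesis by (simp add: field_simps)
  qed
  have "summable (\<lambda>i. M powr (1/p) * (1/2::real) ^ i)" by (intro summable_mult summable_geometric) auto
  then have "summable (\<lambda>i. d i x)" by (rule summable_comparison_test'[where N=0]) (use bd in auto)
  then have "convergent (\<lambda>n. F (r 0) x - (\<Sum>i<n. d i x))"
   by (intro convergent_diff convergent_const) (simp add: summable_iff_convergent)
  moreover have "F (r 0) x - (\<Sum>i<n. d i x) = F (r n) x" for n
   by (induction n) (auto simp: d_def algebra_simps)
  ultimately show ?case by simp
 qed
 define g where "g x = lim (\<lambda>i. F (r i) x)" for x
 have gm[measurable]: "borel_fun g" unfolding g_def[abs_def] by measurable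
 have aeg: "AE x in lborel. (\<lambda>i. F (r i) x) \<longlonglongrightarrow> g x"
  using ae by eventually_elim (simp add: g_def convergent_LIMSEQ_iff)
 have "lp_conv p F g"
  unfolding lp_conv_def
 proof (rule order_tendstoI)
  fix a :: ennreal assume "0 < a"
  then obtain e :: real where e: "0 < e" "ennreal e < a"
   using ex_ennreal_between_0[of a] by auto
  obtain N' where N': "\<And>j k. N' \<le> j ==> N' \<le> k ==> lp_mass p (\<lambda>x. F j x - F k x) < ennreal e"
   using cau[OF e(1)] by blast
  have "lp_mass p (\<lambda>x. F j x - g x) \<le> ennreal e" if "N' \<le> j" for j
  proof (rule lp_mass_Fatou)
   show "AE x in lborel. (\<lambda>i. F j x - F (r (i + N')) x) \<longlonglongrightarrow> F j x - g x"
    using aeg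
   proof eventually_elim
    case (elim x)
    show ?case by (intro tendsto_diff tendsto_const LIMSEQ_ignore_initial_segment[OF elim])
   qed
   show "lp_mass p (\<lambda>x. F j x - F (r (i + N')) x) \<le> ennreal e" for i
    using N'[OF that, of "r (i + N')"] ri[of "i + N'"] by auto
  qed (use p in auto)
  then show "\<forall>\<^sub>F n in sequentially. lp_mass p (\<lambda>x. F n x - g x) < a"
   using e by (auto simp: eventually_sequentially intro: le_less_trans)
 qed auto
 with gm show ?thesis by (rule that)
qed

lemma ennreal_add_less_mono:
 assumes "a < ennreal r" "b \<le> ennreal s" "0 \<le> s"
 shows "a + b < ennreal r + ennreal s"
proof -
 obtain a' where a: "a = ennreal a'" "0 \<le> a'" using assms(1) by (cases a) auto
 obtain b' where b: "b = ennreal b'" "0 \<le> b'" using assms(2) by (cases b) (auto simp: top_unique)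
 have "a' < r" "b' \<le> s" using assms a b by (auto simp: ennreal_less_iff)
 then show ?thesis using a b assms by (simp add: ennreal_plus[symmetric] ennreal_less_iff del: ennreal_plus)
qed

section \<open>Dense classes of functions in L^p\<close>

text \<open>Measurability in the gauge sense provides continuous functions converging off a
  negligible set; the radial retraction onto the ball of radius \<open>M\<close> makes them
  uniformly bounded and does not move the limit, whose values lie in that ball.\<close>

lemma bounded_borel_AE_limit_continuous:
 fixes h :: "real => complex"
 assumes [measurable]: "borel_fun h" and M: "\<And>x. norm (h x) \<le> M" "0 < M"
 obtains g where "\<And>n. continuous_on UNIV (g n)" "\<And>n x. norm (g n x) \<le> M"
  "AE x in lborel. (\<lambda>n. g n x :: complex) \<longlonglongrightarrow> h x"
proof -
 have "h \<in> borel_measurable lebesgue" by (simp add: measurable_completion)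
 then have "h measurable_on UNIV"
  by (intro lebesgue_measurable_imp_measurable_on) auto
 then obtain N G where N: "negligible N" and G: "\<And>n. continuous_on UNIV (G n)"
  "\<And>x. x \<notin> N ==> (\<lambda>n. G n x :: complex) \<longlonglongrightarrow> h x"
  unfolding measurable_on_def by auto
 have nz: "max 1 u \<noteq> 0" for u :: real by (simp add: max_def)
 define g where "g n x = G n x / of_real (max 1 (norm (G n x) / M))" for n x
 have ae: "AE x in lborel. x \<notin> N"
  using AE_not_in[OF N[unfolded negligible_iff_null_sets]] by (simp add: AE_completion_iff)
 show ?thesis
 proof (rule that[of g])
  show "continuous_on UNIV (g n)" for n
   unfolding g_def[abs_def] by (intro continuous_intros G ballI) (use M in simp, simp only: of_real_eq_0_iff nz not_False_eq_True)
  show "norm (g n x) \<le> M" for n x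
  proof -
   have "norm (G n x) = norm (G n x) / M * M" using M(2) by simp
   also have "\<dots> \<le> max 1 (norm (G n x) / M) * M" using M(2) by (intro mult_right_mono) auto
   finally have "norm (G n x) / max 1 (norm (G n x) / M) \<le> M"
    by (subst pos_divide_le_eq) (auto simp: mult.commute less_max_iff_disj)
   then show ?thesis by (simp add: g_def norm_divide)
  qed
  show "AE x in lborel. (\<lambda>n. g n x) \<longlonglongrightarrow> h x"
   using ae
  proof eventually_elim
   case (elim x)
   have "max 1 (norm (h x) / M) = 1" using M(1)[of x] M(2) by (auto simp: max_def field_simps)
   moreover have "(\<lambda>n. g n x) \<longlonglongrightarrow> h x / of_real (max 1 (norm (h x) / M))"
    unfolding g_def by (intro tendsto_intros G elim) (simp_all only: of_real_eq_0_iff nz not_False_eq_True, use M in simp_all)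
   ultimately show ?case by simp
  qed
 qed
qed

text \<open>Dominated convergence. The truncation also removes a neighbourhood of 0, where the
  weights used later vanish and cannot be divided out.\<close>

lemma lp_dense_bounded:
 assumes [measurable]: "borel_fun f" and p: "1 < p" and fin: "lp_mass p f < \<infinity>"
 shows "lp_conv p (\<lambda>N x. if norm (f x) \<le> real N + 1 \<and> inverse (real N + 1) \<le> \<bar>x\<bar> \<and> \<bar>x\<bar> \<le> real N + 1 then f x else 0) f"
proof -
 let ?F = "\<lambda>N x. if norm (f x) \<le> real N + 1 \<and> inverse (real N + 1) \<le> \<bar>x\<bar> \<and> \<bar>x\<bar> \<le> real N + 1 then f x else 0"
 have "(\<lambda>N. NR x. norm (?F N x - f x) powr p) \<longlonglongrightarrow> (\<integral>\<^sup>+x. 0 \<partial>(lborel :: real measure))"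
 proof (rule nn_integral_dominated_convergence[where w = "\<lambda>x. ennreal (norm (f x) powr p)"])
  show "(NR x. norm (f x) powr p) < \<infinity>" using fin by (simp add: lp_mass_def)
  show "AE x in lborel. (\<lambda>N. ennreal (norm (?F N x - f x) powr p)) \<longlonglongrightarrow> 0"
   using AE_lborel_singleton[of 0]
  proof eventually_elim
   case (elim x)
   obtain n :: nat where n: "max (max (norm (f x)) \<bar>x\<bar>) (inverse \<bar>x\<bar>) \<le> real n" using real_arch_simple by blast
   have "?F N x = f x" if "n \<le> N" for N
   proof -
    have "real n \<le> real N" using that by simp
    then have "norm (f x) \<le> real N + 1" "\<bar>x\<bar> \<le> real N + 1" "inverse \<bar>x\<bar> \<le> real N + 1" using n by linarith+
    moreover from this(3) have "inverse (real N + 1) \<le> inverse (inverse \<bar>x\<bar>)" using elim by (intro le_imp_inverse_le) auto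
    ultimately show ?thesis by simp
   qed
   then have "ennreal (norm (?F N x - f x) powr p) = 0" if "n \<le> N" for N
    using that p by (simp del: if_split)
   then have "\<forall>\<^sub>F N in sequentially. ennreal (norm (?F N x - f x) powr p) = 0"
    by (rule eventually_sequentiallyI)
   then show ?case by (rule tendsto_eventually)
  qed
 qed (use p in \<open>auto\<close>)
 then show ?thesis by (simp add: lp_conv_def lp_mass_def)
qed

text \<open>Two approximations under the weight: by continuous functions through dominated
  convergence, then by polynomials on a compact interval through Weierstrass. The bounded, compactly
  supported weight keeps both errors integrable.\<close>

lemma lp_dense_weighted_polynomial_bounded:
 fixes \<omega> :: "real => real"
 assumes h[measurable]: "borel_fun h" and M: "\<And>x. norm (h x) \<le> M" and p: "1 < p" and e: "0 < e"
  and w[measurable]: "borel_fun \<omega>" and K: "\<And>x. \<bar>\<omega> x\<bar> \<le> K" and L: "\<And>x. L < \<bar>x\<bar> ==> \<omega> x = 0"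
 shows "\<exists>q. polynomial_function q \<and> lp_mass p (\<lambda>x. of_real (\<omega> x) * (h x - q x)) < ennreal e"
proof -
 define M' where "M' = max M 1"
 have M': "\<And>x. norm (h x) \<le> M'" "0 < M'" using M by (auto simp: M'_def le_max_iff_disj)
 define L' where "L' = max L 1"
 have L': "\<And>x. L' < \<bar>x\<bar> ==> \<omega> x = 0" "1 \<le> L'" using L by (auto simp: L'_def)
 define K' where "K' = max K 1"
 have K': "\<And>x. \<bar>\<omega> x\<bar> \<le> K'" "1 \<le> K'" using K by (auto simp: K'_def le_max_iff_disj)
 obtain g where g: "\<And>n. continuous_on UNIV (g n)" "\<And>n x. norm (g n x) \<le> M'"
  "AE x in lborel. (\<lambda>n. g n x :: complex) \<longlonglongrightarrow> h x"
  using bounded_borel_AE_limit_continuous[OF h M'] by metis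
 have gm[measurable]: "borel_fun (g n)" for n
  using g(1) by (rule borel_measurable_continuous_onI)
 define e' where "e' = e / (2 * 2 powr p)"
 have e': "0 < e'" using e by (simp add: e'_def)
 have "(\<lambda>n. NR x. norm (of_real (\<omega> x) * (h x - g n x)) powr p) \<longlonglongrightarrow> (\<integral>\<^sup>+x. 0 \<partial>(lborel :: real measure))"
 proof (rule nn_integral_dominated_convergence[where w = "\<lambda>x. ennreal ((K' * (2 * M')) powr p) * indicator {-L'..L'} x"])
  show "AE x in lborel. ennreal (norm (of_real (\<omega> x) * (h x - g n x)) powr p) \<le> ennreal ((K' * (2 * M')) powr p) * indicator {-L'..L'} x" for n
  proof (rule AE_I2)
   fix x
   show "ennreal (norm (of_real (\<omega> x) * (h x - g n x)) powr p) \<le> ennreal ((K' * (2 * M')) powr p) * indicator {-L'..L'} x"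
   proof (cases "\<bar>x\<bar> \<le> L'")
    case True
    have "norm (h x - g n x) \<le> 2 * M'" using norm_triangle_ineq4[of "h x" "g n x"] M'(1)[of x] g(2)[of n x] by linarith
    then have "norm (of_real (\<omega> x) * (h x - g n x)) \<le> K' * (2 * M')"
     unfolding norm_mult using K' by (intro mult_mono) auto
    then have "norm (of_real (\<omega> x) * (h x - g n x)) powr p \<le> (K' * (2 * M')) powr p" using p by (intro powr_mono2) auto
    then show ?thesis using True by (auto simp: indicator_def intro!: ennreal_leI)
   qed (use L' p in auto)
  qed
  show "(NN x. ennreal ((K' * (2 * M')) powr p) * indicator {-L'..L'} x) < \<infinity>"
   using L' by (subst nn_integral_cmult_indicator) (auto simp: ennreal_mult_less_top)
  show "AE x in lborel. (\<lambda>n. ennreal (norm (of_real (\<omega> x) * (h x - g n x)) powr p)) \<longlonglongrightarrow> 0"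
   using g(3)
  proof eventually_elim
   case (elim x)
   have "(\<lambda>n. norm (of_real (\<omega> x) * (h x - g n x)) powr p) \<longlonglongrightarrow> norm (of_real (\<omega> x) * (h x - h x)) powr p"
    using p by (intro tendsto_powr2 tendsto_norm tendsto_intros elim) auto
   then have "(\<lambda>n. ennreal (norm (of_real (\<omega> x) * (h x - g n x)) powr p)) \<longlonglongrightarrow> ennreal (norm (of_real (\<omega> x) * (h x - h x)) powr p)"
    by (rule tendsto_ennrealI)
   then show ?case using p by simp
  qed
 qed auto
 then have "(\<lambda>n. lp_mass p (\<lambda>x. of_real (\<omega> x) * (h x - g n x))) \<longlonglongrightarrow> 0" by (simp add: lp_mass_def)
 then have "\<forall>\<^sub>F n in sequentially. lp_mass p (\<lambda>x. of_real (\<omega> x) * (h x - g n x)) < ennreal e'"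
  using e' by (intro order_tendstoD) auto
 then obtain n where n: "lp_mass p (\<lambda>x. of_real (\<omega> x) * (h x - g n x)) < ennreal e'"
  by (auto simp: eventually_sequentially)
 \<comment> \<open>Chosen so that a pointwise error K' d on an interval of length 2 L' has mass
   e'.\<close>
 define d where "d = (e' / (2 * L')) powr (1 / p) / K'"
 have d: "0 < d" using e' L' K' by (auto simp: d_def)
 obtain q where q: "polynomial_function q" "\<And>x. x \<in> {-L'..L'} ==> norm (g n x - q x) < d"
  using Stone_Weierstrass_polynomial_function[of "{-L'..L'}" "g n" d] d continuous_on_subset[OF g(1)[of n]] by auto
 have qm[measurable]: "borel_fun q"
  by (intro borel_measurable_continuous_onI continuous_on_polymonial_function q)
 have "lp_mass p (\<lambda>x. of_real (\<omega> x) * (g n x - q x)) \<le> (NN x. ennreal (e' / (2 * L')) * indicator {-L'..L'} x)"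
  unfolding lp_mass_def
 proof (intro nn_integral_mono)
  fix x
  show "ennreal (norm (of_real (\<omega> x) * (g n x - q x)) powr p) \<le> ennreal (e' / (2 * L')) * indicator {-L'..L'} x"
  proof (cases "\<bar>x\<bar> \<le> L'")
   case True
   then have "x \<in> {-L'..L'}" by auto
   then have "norm (of_real (\<omega> x) * (g n x - q x)) \<le> K' * d"
    unfolding norm_mult using K' less_imp_le[OF q(2)] by (intro mult_mono) auto
   then have "norm (of_real (\<omega> x) * (g n x - q x)) powr p \<le> (K' * d) powr p" using p by (intro powr_mono2) auto
   also have "(K' * d) powr p = e' / (2 * L')" using K' L' e' p by (simp add: d_def powr_powr)
   finally show ?thesis using True by (auto simp: indicator_def intro!: ennreal_leI)
  qed (use L' p in auto)
 qed
 also have "\<dots> = ennreal e'"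
  using L' e' by (subst nn_integral_cmult_indicator) (auto simp: ennreal_mult[symmetric])
 finally have 2: "lp_mass p (\<lambda>x. of_real (\<omega> x) * (g n x - q x)) \<le> ennreal e'" .
 have "lp_mass p (\<lambda>x. of_real (\<omega> x) * (h x - q x)) = lp_mass p (\<lambda>x. of_real (\<omega> x) * (h x - g n x) + of_real (\<omega> x) * (g n x - q x))"
  by (simp add: algebra_simps)
 also have "\<dots> \<le> ennreal (2 powr p) * (lp_mass p (\<lambda>x. of_real (\<omega> x) * (h x - g n x)) + lp_mass p (\<lambda>x. of_real (\<omega> x) * (g n x - q x)))"
  using p by (intro lp_mass_add_le) auto
 also have "\<dots> < ennreal (2 powr p) * (ennreal e' + ennreal e')"
  using n 2 e' by (intro ennreal_mult_strict_left_mono ennreal_add_less_mono) auto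
 also have "\<dots> = ennreal e"
  using e' by (simp add: ennreal_plus[symmetric] ennreal_mult[symmetric] del: ennreal_plus) (simp add: e'_def)
 finally show ?thesis using q(1) by blast
qed

text \<open>Dividing the truncated function by the weight keeps it bounded, as the weight is at
  least c where the truncation lives. Used with a continuous plateau, and with |x|^\<alpha> times a
  smooth cutoff to reach weighted derivatives of Schwartz functions.\<close>

lemma lp_dense_weighted_polynomial:
 fixes \<omega> :: "nat => real => real"
 assumes f[measurable]: "borel_fun f" and p: "1 < p" and fin: "lp_mass p f < \<infinity>" and e: "0 < e"
  and w[measurable]: "\<And>N. borel_fun (\<omega> N)" and K: "\<And>N. \<exists>K. \<forall>x. \<bar>\<omega> N x\<bar> \<le> K"
  and L: "\<And>N. \<exists>L. \<forall>x. L < \<bar>x\<bar> --> \<omega> N x = 0"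
  and c: "\<And>N. \<exists>c>0. \<forall>x. inverse (real N + 1) \<le> \<bar>x\<bar> \<and> \<bar>x\<bar> \<le> real N + 1 --> c \<le> \<omega> N x"
 shows "\<exists>N q. polynomial_function q \<and> lp_mass p (\<lambda>x. f x - of_real (\<omega> N x) * q x) < ennreal e"
proof -
 define e' where "e' = e / (2 * 2 powr p)"
 have e': "0 < e'" using e by (simp add: e'_def)
 let ?F = "\<lambda>N x. if norm (f x) \<le> real N + 1 \<and> inverse (real N + 1) \<le> \<bar>x\<bar> \<and> \<bar>x\<bar> \<le> real N + 1 then f x else 0"
 have "\<forall>\<^sub>F N in sequentially. lp_mass p (\<lambda>x. ?F N x - f x) < ennreal e'"
  using lp_dense_bounded[OF f p fin] e' unfolding lp_conv_def by (intro order_tendstoD) auto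
 then obtain N where N: "lp_mass p (\<lambda>x. ?F N x - f x) < ennreal e'"
  by (auto simp: eventually_sequentially)
 obtain c where c: "0 < c" "\<And>x. inverse (real N + 1) \<le> \<bar>x\<bar> ==> \<bar>x\<bar> \<le> real N + 1 ==> c \<le> \<omega> N x"
  using c[of N] by blast
 obtain K' L' where KL: "\<And>x. \<bar>\<omega> N x\<bar> \<le> K'" "\<And>x. L' < \<bar>x\<bar> ==> \<omega> N x = 0"
  using K[of N] L[of N] by blast
 define h where "h x = ?F N x / of_real (\<omega> N x)" for x
 have hm[measurable]: "borel_fun h" unfolding h_def[abs_def] by measurable
 have wh: "of_real (\<omega> N x) * h x = ?F N x" for x
  using c(1) c(2)[of x] by (auto simp: h_def)
 have hb: "norm (h x) \<le> (real N + 1) / c" for x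
 proof (cases "norm (f x) \<le> real N + 1 \<and> inverse (real N + 1) \<le> \<bar>x\<bar> \<and> \<bar>x\<bar> \<le> real N + 1")
  case True
  then have "norm (f x) / \<bar>\<omega> N x\<bar> \<le> (real N + 1) / c"
   using c(1) c(2)[of x] by (intro frac_le) auto
  then show ?thesis using True by (simp add: h_def norm_divide)
 next
  case False
  then show ?thesis using c(1) by (auto simp: h_def)
 qed
 obtain q where q: "polynomial_function q" "lp_mass p (\<lambda>x. of_real (\<omega> N x) * (h x - q x)) < ennreal e'"
  using lp_dense_weighted_polynomial_bounded[OF hm hb p e' w KL] by auto
 have qm[measurable]: "borel_fun q"
  by (intro borel_measurable_continuous_onI continuous_on_polymonial_function q)
 have "lp_mass p (\<lambda>x. f x - of_real (\<omega> N x) * q x) \<le> ennreal (2 powr p) * (lp_mass p (\<lambda>x. f x - ?F N x) + lp_mass p (\<lambda>x. ?F N x - of_real (\<omega> N x) * q x))"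
  using p by (intro lp_mass_diff_le) auto
 also have "(\<lambda>x. ?F N x - of_real (\<omega> N x) * q x) = (\<lambda>x. of_real (\<omega> N x) * (h x - q x))"
  by (simp only: wh[symmetric] right_diff_distrib)
 also have "ennreal (2 powr p) * (lp_mass p (\<lambda>x. f x - ?F N x) + lp_mass p (\<lambda>x. of_real (\<omega> N x) * (h x - q x))) < ennreal (2 powr p) * (ennreal e' + ennreal e')"
  using N q(2) e' by (intro ennreal_mult_strict_left_mono ennreal_add_less_mono less_imp_le) (auto simp: lp_mass_minus_commute[of _ f])
 also have "\<dots> = ennreal e"
  using e' by (simp add: ennreal_plus[symmetric] ennreal_mult[symmetric] del: ennreal_plus) (simp add: e'_def)
 finally show ?thesis using q(1) by blast
qed

lemma lp_dense_continuous:
 assumes f[measurable]: "borel_fun f" and p: "1 < p" and fin: "lp_mass p f < \<infinity>" and e: "0 < e"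
 obtains g L where "continuous_on UNIV g" "\<And>x. L < \<bar>x\<bar> ==> g x = 0" "lp_mass p (\<lambda>x. f x - g x) < ennreal e"
proof -
 define w where "w N x = max 0 (min 1 (real N + 2 - \<bar>x\<bar>))" for N and x :: real
 have wc: "continuous_on UNIV (w N)" for N unfolding w_def[abs_def] by (intro continuous_intros)
 have "\<exists>N q. polynomial_function q \<and> lp_mass p (\<lambda>x. f x - of_real (w N x) * q x) < ennreal e"
 proof (rule lp_dense_weighted_polynomial[OF f p fin e])
  show "borel_fun (w N)" for N by (intro borel_measurable_continuous_onI wc)
  show "\<exists>K. \<forall>x. \<bar>w N x\<bar> \<le> K" for N by (intro exI[of _ 1]) (auto simp: w_def)
  show "\<exists>L. \<forall>x. L < \<bar>x\<bar> --> w N x = 0" for N by (intro exI[of _ "real N + 2"]) (auto simp: w_def)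
  show "\<exists>c>0. \<forall>x. inverse (real N + 1) \<le> \<bar>x\<bar> \<and> \<bar>x\<bar> \<le> real N + 1 --> c \<le> w N x" for N
   by (intro exI[of _ 1]) (auto simp: w_def)
 qed
 then obtain N q where q: "polynomial_function q" "lp_mass p (\<lambda>x. f x - of_real (w N x) * q x) < ennreal e"
  by blast
 show ?thesis
 proof (rule that[OF _ _ q(2)])
  show "continuous_on UNIV (\<lambda>x. of_real (w N x) * q x)"
   by (intro continuous_intros wc continuous_on_polymonial_function q)
  show "of_real (w N x) * q x = 0" if "real N + 2 < \<bar>x\<bar>" for x using that by (simp add: w_def)
 qed
qed

section \<open>Dilation operators\<close>

text \<open>The dilate f(t u) has L^p norm u^(-1/p) times that of f, so the last condition is what
  Minkowski's inequality asks for; C is then a bound for the norm of the operator, taken strictly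
  positive as the Jensen estimate requires.\<close>

definition dilation_kernel :: "real => (real => real) => real => bool" where
 "dilation_kernel p k C \<longleftrightarrow> k \<in> borel_measurable borel \<and> (\<forall>u. 0 \<le> k u) \<and> (\<forall>u\<le>0. k u = 0) \<and> 0 < C \<and>
   (NR u. k u * u powr (- 1 / p)) \<le> ennreal C"

definition dilation_op :: "(real => real) => (real => complex) => real => complex" where
 "dilation_op k f t = (LBINT u. k u *\<^sub>R f (t * u))"

lemma AE_lborel_scale:
 assumes "AE t in lborel. P t" "t \<noteq> (0::real)" shows "AE u in lborel. P (t * u)"
proof -
 obtain N where N: "{t. \<not> P t} \<subseteq> N" "N \<in> null_sets lborel"
  using assms(1) by (auto elim!: AE_E simp: null_sets_def)
 have "AE u in lborel. 0 + t * u \<notin> N"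
  using AE_borel_affine[OF assms(2), of "\<lambda>x. x \<notin> N" 0] AE_not_in[OF N(2)] N(2)
  by (auto simp: null_sets_def)
 then show ?thesis by eventually_elim (use N in auto)
qed

lemma nn_integral_lborel_scale:
 assumes [measurable]: "borel_fun f" and "0 < u"
 shows "ennreal u * (NN t. f (t * u)) = (NN t. f t)"
 using nn_integral_real_affine[of f u 0] assms by (simp add: mult.commute)

context
 fixes p :: real and k :: "real => real" and C :: real
 assumes p: "1 < p" and k: "dilation_kernel p k C"
begin

lemma dilation_kernel_measurable [measurable]: "borel_fun k"
 and dilation_kernel_nonneg: "0 \<le> k u"
 and dilation_kernel_eq_0: "u \<le> 0 ==> k u = 0"
 and dilation_kernel_pos: "0 < C"
 and dilation_kernel_bound: "(NR u. k u * u powr (- 1 / p)) \<le> ennreal C"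
 using k by (auto simp: dilation_kernel_def)

text \<open>Jensen with weight k(u) u^(-1/p) and integrand u^(1/p) |g(u)|. The p-th power leaves a
  factor u, which the substitution in the dilated variable will absorb.\<close>

lemma dilation_pointwise_Jensen:
 assumes [measurable]: "borel_fun g" and x: "0 \<le> x" "ennreal x \<le> (NR u. k u * norm (g u :: complex))"
 shows "ennreal (x powr p) \<le> ennreal (C powr (p - 1)) *
  (NR u. k u * u powr (- 1 / p) * (u * norm (g u) powr p))"
proof -
 have e1: "k u * u powr (- 1 / p) * (u powr (1 / p) * norm (g u)) = k u * norm (g u)" for u
  using dilation_kernel_eq_0[of u] by (cases "0 < u") (auto simp: powr_minus field_simps)
 have e2: "k u * u powr (- 1 / p) * (u powr (1 / p) * norm (g u)) powr p = k u * u powr (- 1 / p) * (u * norm (g u) powr p)" for u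
  using dilation_kernel_eq_0[of u] p by (cases "0 < u") (auto simp: powr_mult powr_powr)
 show ?thesis
  using nn_integral_weighted_Jensen[of "\<lambda>u. k u * u powr (- 1 / p)" lborel "\<lambda>u. u powr (1 / p) * norm (g u)" p C x]
   dilation_kernel_bound dilation_kernel_pos dilation_kernel_nonneg p x
  unfolding e1 e2 by simp
qed

text \<open>Pointwise Jensen, Tonelli, and the scaling of Lebesgue measure by u. The function
  \<open>G u\<close> may vary with u because Cauchy integrals dilate to a height depending on u;
  \<open>X\<close> is any real minorant of the kernel integral, so that the estimate can be used
  before integrability is known.\<close>

lemma dilation_mass_family:
 fixes G :: "real => real => complex"
 assumes G[measurable]: "case_prod G \<in> borel_measurable (borel \<Otimes>\<^sub>M borel)"
  and X: "\<And>t. 0 \<le> X t" "\<And>t. ennreal (X t) \<le> (NR u. k u * norm (G u (t * u)))"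
 shows "(NR t. X t powr p) \<le> ennreal (C powr (p - 1)) *
  (NN u. ennreal (k u * u powr (- 1 / p)) * lp_mass p (G u))"
proof -
 have Gu[measurable]: "borel_fun (G u)" for u
  using measurable_Pair2[OF G, of u] by simp
 have [measurable]: "(\<lambda>(t, u). G u (t * u)) \<in> borel_measurable (borel \<Otimes>\<^sub>M borel)"
 proof -
  have "(\<lambda>z::real \<times> real. (snd z, fst z * snd z)) \<in> borel \<Otimes>\<^sub>M borel \<rightarrow>\<^sub>M borel \<Otimes>\<^sub>M borel" by measurable
  from measurable_compose[OF this G] show ?thesis by (simp add: split_beta')
 qed
 have Gt[measurable]: "borel_fun (\<lambda>u. G u (t * u))" for t
 proof -
  have "(\<lambda>u. (u, t * u)) \<in> borel \<rightarrow>\<^sub>M borel \<Otimes>\<^sub>M borel" by measurable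
  from measurable_compose[OF this G] show ?thesis by simp
 qed
 have "(NR t. X t powr p) \<le> (NN t. ennreal (C powr (p - 1)) *
  (NR u. k u * u powr (- 1 / p) * (u * norm (G u (t * u)) powr p)))"
  by (intro nn_integral_mono dilation_pointwise_Jensen X Gt)
 also have "\<dots> = ennreal (C powr (p - 1)) *
  (NN t. NR u. k u * u powr (- 1 / p) * (u * norm (G u (t * u)) powr p))"
  by (rule nn_integral_cmult) measurable
 also have "(NN t. NR u. k u * u powr (- 1 / p) * (u * norm (G u (t * u)) powr p))
  = (NN u. NR t. k u * u powr (- 1 / p) * (u * norm (G u (t * u)) powr p))"
  by (rule lborel_pair.Fubini'[symmetric]) measurable
 also have "\<dots> = (NN u. ennreal (k u * u powr (- 1 / p)) * lp_mass p (G u))"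
 proof (rule nn_integral_cong)
  fix u :: real
  show "(NR t. k u * u powr (- 1 / p) * (u * norm (G u (t * u)) powr p)) = ennreal (k u * u powr (- 1 / p)) * lp_mass p (G u)"
  proof (cases "0 < u")
   case True
   have "(NR t. k u * u powr (- 1 / p) * (u * norm (G u (t * u)) powr p))
    = (NN t. ennreal (k u * u powr (- 1 / p)) * (ennreal u * ennreal (norm (G u (t * u)) powr p)))"
    using True dilation_kernel_nonneg by (intro nn_integral_cong) (simp add: ennreal_mult)
   also have "\<dots> = ennreal (k u * u powr (- 1 / p)) * (ennreal u * (NR t. norm (G u (t * u)) powr p))"
    by (simp add: nn_integral_cmult)
   also have "ennreal u * (NR t. norm (G u (t * u)) powr p) = lp_mass p (G u)"
    unfolding lp_mass_def using True by (intro nn_integral_lborel_scale) auto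
   finally show ?thesis .
  qed (simp add: dilation_kernel_eq_0)
 qed
 finally show ?thesis .
qed

text \<open>The mass estimate speaks of real functions only, so it is applied to the kernel integral
  cut at level n; by monotone convergence the p-th powers of the cuts have an integrable supremum,
  hence one that is finite almost everywhere.\<close>

lemma dilation_family_AE_finite:
 fixes G :: "real => real => complex"
 assumes G[measurable]: "case_prod G \<in> borel_measurable (borel \<Otimes>\<^sub>M borel)"
  and fin: "(NN u. ennreal (k u * u powr (- 1 / p)) * lp_mass p (G u)) < \<infinity>"
 shows "AE t in lborel. (NR u. k u * norm (G u (t * u))) < \<infinity>"
proof -
 have [measurable]: "(\<lambda>(t, u). G u (t * u)) \<in> borel_measurable (borel \<Otimes>\<^sub>M borel)"
 proof -
  have "(\<lambda>z::real \<times> real. (snd z, fst z * snd z)) \<in> borel \<Otimes>\<^sub>M borel \<rightarrow>\<^sub>M borel \<Otimes>\<^sub>M borel" by measurable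
  from measurable_compose[OF this G] show ?thesis by (simp add: split_beta')
 qed
 let ?I = "\<lambda>t. NR u. k u * norm (G u (t * u))"
 define X where "X n t = enn2real (min (of_nat n) (?I t))" for n :: nat and t
 have X: "ennreal (X n t) = min (of_nat n) (?I t)" "0 \<le> X n t" for n t
  by (simp_all add: X_def ennreal_enn2real_if min_def top_unique)
 have bd: "(NR t. X n t powr p) \<le> ennreal (C powr (p - 1)) *
   (NN u. ennreal (k u * u powr (- 1 / p)) * lp_mass p (G u))" for n
  by (rule dilation_mass_family[OF G]) (auto simp: X)
 have Xm[measurable]: "borel_fun (X n)" for n unfolding X_def[abs_def] by measurable
 have "(NN t. (SUP n. ennreal (X n t powr p))) = (SUP n. NR t. X n t powr p)"
 proof (rule nn_integral_monotone_convergence_SUP)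
  show "incseq (\<lambda>n t. ennreal (X n t powr p))"
  proof (intro incseq_SucI le_funI ennreal_leI powr_mono2)
   fix n t
   have "ennreal (X n t) \<le> ennreal (X (Suc n) t)"
    unfolding X by (intro min.mono) (auto simp: of_nat_Suc[symmetric] simp del: of_nat_Suc intro!: of_nat_mono)
   then show "X n t \<le> X (Suc n) t" by (rule ennreal_le_iff[THEN iffD1, OF X(2)])
  qed (use p X in auto)
 qed measurable
 also have "\<dots> \<le> ennreal (C powr (p - 1)) *
   (NN u. ennreal (k u * u powr (- 1 / p)) * lp_mass p (G u))" by (intro SUP_least bd)
 also have "\<dots> < \<infinity>" using fin by (simp add: ennreal_mult_less_top)
 finally have "AE t in lborel. (SUP n. ennreal (X n t powr p)) \<noteq> \<infinity>"
  by (intro nn_integral_PInf_AE) auto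
 then show ?thesis
 proof eventually_elim
  case (elim t)
  show ?case
  proof (rule ccontr)
   assume "\<not> ?I t < \<infinity>"
   then have I: "?I t = \<infinity>" by (metis infinity_ennreal_def top.not_eq_extremum)
   have "X n t = real n" for n by (simp add: X_def I ennreal_of_nat_eq_real_of_nat)
   then have *: "(SUP n. ennreal (X n t powr p)) = (SUP n. ennreal (real n powr p))" by simp
   have "of_nat n \<le> (SUP n. ennreal (real n powr p))" for n
   proof (cases "n = 0")
    case False
    then have "real n powr 1 \<le> real n powr p" using p by (intro powr_mono) auto
    then have "of_nat n \<le> ennreal (real n powr p)" by (simp add: ennreal_of_nat_eq_real_of_nat ennreal_leI)
    also have "\<dots> \<le> (SUP n. ennreal (real n powr p))" by (rule SUP_upper) auto
    finally show ?thesis .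
   qed auto
   then have "(SUP n::nat. of_nat n) \<le> (SUP n. ennreal (real n powr p))" by (rule SUP_least)
   then show False using elim * by (simp add: ennreal_SUP_of_nat_eq_top top_unique)
  qed
 qed
qed

lemma dilation_AE_finite:
 assumes f[measurable]: "borel_fun f" and fin: "lp_mass p f < \<infinity>"
 shows "AE t in lborel. (NR u. k u * norm (f (t * u))) < \<infinity>"
proof (rule dilation_family_AE_finite[of "\<lambda>u. f"])
 have "(NN u. ennreal (k u * u powr (- 1 / p)) * lp_mass p f) = (NR u. k u * u powr (- 1 / p)) * lp_mass p f"
  by (rule nn_integral_multc) measurable
 also have "\<dots> \<le> ennreal C * lp_mass p f"
  by (intro mult_right_mono dilation_kernel_bound) auto
 also have "\<dots> < \<infinity>" using fin by (simp add: ennreal_mult_less_top)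
 finally show "(NN u. ennreal (k u * u powr (- 1 / p)) * lp_mass p f) < \<infinity>" .
qed measurable

lemma dilation_AE_integrable:
 assumes [measurable]: "borel_fun f" and fin: "lp_mass p f < \<infinity>"
 shows "AE t in lborel. integrable lborel (\<lambda>u. k u *\<^sub>R f (t * u))"
 using dilation_AE_finite[OF assms]
 by eventually_elim (auto simp: integrable_iff_bounded dilation_kernel_nonneg)

lemma dilation_op_measurable [measurable]:
 assumes [measurable]: "borel_fun f"
 shows "borel_fun (dilation_op k f)"
 unfolding dilation_op_def[abs_def] by measurable

lemma norm_dilation_op_le:
 "ennreal (norm (LBINT u. k u *\<^sub>R g u)) \<le> (NR u. k u * norm (g u :: complex))"
proof (cases "integrable lborel (\<lambda>u. k u *\<^sub>R g u)")
 case True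
 from integral_norm_bound_ennreal[OF this] show ?thesis by (simp add: dilation_kernel_nonneg)
qed (simp add: not_integrable_integral_eq)

lemma dilation_op_mass:
 assumes f[measurable]: "borel_fun f"
 shows "lp_mass p (dilation_op k f) \<le> ennreal (C powr p) * lp_mass p f"
proof -
 have "lp_mass p (dilation_op k f) \<le> ennreal (C powr (p - 1)) *
   (NN u. ennreal (k u * u powr (- 1 / p)) * lp_mass p f)"
  unfolding lp_mass_def[of p "dilation_op k f"]
  by (rule dilation_mass_family[of "\<lambda>u. f"]) (auto simp: dilation_op_def intro: norm_dilation_op_le)
 also have "(NN u. ennreal (k u * u powr (- 1 / p)) * lp_mass p f) = (NR u. k u * u powr (- 1 / p)) * lp_mass p f"
  by (rule nn_integral_multc) measurable
 also have "ennreal (C powr (p - 1)) * \<dots> \<le> ennreal (C powr (p - 1)) * (ennreal C * lp_mass p f)"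
  by (intro mult_left_mono mult_right_mono dilation_kernel_bound) auto
 also have "\<dots> = ennreal (C powr p) * lp_mass p f"
  using dilation_kernel_pos by (simp add: powr_diff mult.assoc[symmetric] ennreal_mult[symmetric])
 finally show ?thesis .
qed

lemma dilation_op_mass_finite:
 assumes "borel_fun f" "lp_mass p f < \<infinity>" shows "lp_mass p (dilation_op k f) < \<infinity>"
proof -
 have "ennreal (C powr p) * lp_mass p f < \<infinity>" using assms(2) by (simp add: ennreal_mult_less_top)
 then show ?thesis by (rule le_less_trans[OF dilation_op_mass[OF assms(1)]])
qed

lemma dilation_op_lincomb:
 assumes [measurable]: "borel_fun f" "borel_fun g" and "lp_mass p f < \<infinity>" "lp_mass p g < \<infinity>"
 shows "AE t in lborel. dilation_op k (\<lambda>s. a * f s + b * g s) t = a * dilation_op k f t + b * dilation_op k g t"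
 using dilation_AE_integrable[OF assms(1,3)] dilation_AE_integrable[OF assms(2,4)]
proof eventually_elim
 case (elim t)
 have "dilation_op k (\<lambda>s. a * f s + b * g s) t = (LBINT u. a * (k u *\<^sub>R f (t * u)) + b * (k u *\<^sub>R g (t * u)))"
  unfolding dilation_op_def by (intro Bochner_Integration.integral_cong) (auto simp: scaleR_add_right)
 also have "\<dots> = a * dilation_op k f t + b * dilation_op k g t"
  unfolding dilation_op_def using elim
  by (subst Bochner_Integration.integral_add) (auto simp del: mult_scaleR_right)
 finally show ?case .
qed

lemma dilation_op_conv:
 assumes [measurable]: "\<And>n. borel_fun (F n)" "borel_fun g"
  and fin: "\<And>n. lp_mass p (F n) < \<infinity>" "lp_mass p g < \<infinity>" and conv: "lp_conv p F g"
 shows "lp_conv p (\<lambda>n. dilation_op k (F n)) (dilation_op k g)"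
 unfolding lp_conv_def
proof (rule tendsto_0_le_ennreal)
 show "(\<lambda>n. ennreal (C powr p) * lp_mass p (\<lambda>x. F n x - g x)) \<longlonglongrightarrow> 0"
  by (rule tendsto_cmult_0_ennreal) (rule conv[unfolded lp_conv_def])
 show "\<forall>\<^sub>F n in sequentially. lp_mass p (\<lambda>x. dilation_op k (F n) x - dilation_op k g x) \<le> ennreal (C powr p) * lp_mass p (\<lambda>x. F n x - g x)"
 proof (rule always_eventually, rule allI)
  fix n
  have "lp_mass p (\<lambda>x. dilation_op k (F n) x - dilation_op k g x) = lp_mass p (dilation_op k (\<lambda>x. 1 * F n x + (-1) * g x))"
  proof (rule lp_mass_cong)
   have "AE x in lborel. dilation_op k (\<lambda>s. 1 * F n s + (-1) * g s) x = 1 * dilation_op k (F n) x + (-1) * dilation_op k g x"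
    by (rule dilation_op_lincomb) (use fin in auto)
   then show "AE x in lborel. dilation_op k (F n) x - dilation_op k g x = dilation_op k (\<lambda>x. 1 * F n x + (-1) * g x) x"
    by eventually_elim simp
  qed
  also have "\<dots> \<le> ennreal (C powr p) * lp_mass p (\<lambda>x. 1 * F n x + (-1) * g x)"
   by (intro dilation_op_mass) measurable
  finally show "lp_mass p (\<lambda>x. dilation_op k (F n) x - dilation_op k g x) \<le> ennreal (C powr p) * lp_mass p (\<lambda>x. F n x - g x)"
   by simp
 qed
qed

end

declare dilation_kernel_measurable [measurable del] dilation_op_measurable [measurable del]

lemma dilation_op_borel [measurable]:
 assumes [measurable]: "borel_fun k" "borel_fun f"
 shows "borel_fun (dilation_op k f)"
 unfolding dilation_op_def[abs_def] by measurable

lemma dilation_op_cong_AE: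
 assumes "AE s in lborel. f s = g s" "borel_fun f" "borel_fun g" "borel_fun k" "t \<noteq> 0"
 shows "dilation_op k f t = dilation_op k g t"
 unfolding dilation_op_def using AE_lborel_scale[OF assms(1) assms(5)] assms(2-4)
 by (intro integral_cong_AE) auto

section \<open>Composition of dilation operators\<close>

text \<open>The kernel \<open>l\<close> applied to |f| yields a function in L^p, to which the
  estimate for \<open>k\<close> applies. Fubini for the two kernels rests on this
  finiteness.\<close>

lemma dilation_double_AE_finite:
 assumes p: "1 < p" and k: "dilation_kernel p k C" and l: "dilation_kernel p l D"
  and f[measurable]: "borel_fun f" and fin: "lp_mass p f < \<infinity>"
 shows "AE t in lborel. (NN u. NR v. k u * (l v * norm (f (t * u * v)))) < \<infinity>"
proof -
 note [measurable] = dilation_kernel_measurable[OF p k] dilation_kernel_measurable[OF p l]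
 define I where "I t = (NR v. l v * norm (f (t * v)))" for t
 have Im[measurable]: "borel_fun I" unfolding I_def[abs_def] by measurable
 have Ifin: "AE t in lborel. I t < \<infinity>" unfolding I_def by (rule dilation_AE_finite[OF p l f fin])
 define g where "g t = complex_of_real (enn2real (I t))" for t
 have gm[measurable]: "borel_fun g" unfolding g_def[abs_def] by measurable
 have "lp_mass p g \<le> ennreal (D powr (p - 1)) *
   (NN u. ennreal (l u * u powr (- 1 / p)) * lp_mass p f)"
  unfolding lp_mass_def[of p g]
  by (rule dilation_mass_family[OF p l, of "\<lambda>u. f"]) (auto simp: g_def I_def ennreal_enn2real_if)
 also have "(NN u. ennreal (l u * u powr (- 1 / p)) * lp_mass p f) = (NR u. l u * u powr (- 1 / p)) * lp_mass p f"
  by (rule nn_integral_multc) measurable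
 also have "ennreal (D powr (p - 1)) * \<dots> \<le> ennreal (D powr (p - 1)) * (ennreal D * lp_mass p f)"
  by (intro mult_left_mono mult_right_mono dilation_kernel_bound[OF p l]) auto
 also have "\<dots> < \<infinity>" using fin by (simp add: ennreal_mult_less_top)
 finally have gfin: "lp_mass p g < \<infinity>" .
 show ?thesis
  using dilation_AE_finite[OF p k gm gfin] AE_lborel_singleton[of 0]
 proof eventually_elim
  case (elim t)
  have "(NN u. NR v. k u * (l v * norm (f (t * u * v))))
   = (NN u. ennreal (k u) * I (t * u))"
   unfolding I_def using dilation_kernel_nonneg[OF p k] dilation_kernel_nonneg[OF p l]
   by (intro nn_integral_cong) (simp add: nn_integral_cmult[symmetric] ennreal_mult)
  also have "\<dots> = (NR u. k u * norm (g (t * u)))"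
  proof (rule nn_integral_cong_AE)
   have "AE u in lborel. I (t * u) < \<infinity>" using AE_lborel_scale[OF Ifin] elim(2) by blast
   then show "AE u in lborel. ennreal (k u) * I (t * u) = ennreal (k u * norm (g (t * u)))"
    by eventually_elim (auto simp: g_def ennreal_mult' dilation_kernel_nonneg[OF p k] ennreal_enn2real)
  qed
  finally show ?case using elim by simp
 qed
qed

text \<open>Fubini's theorem. The double integral is symmetric in the two kernels up to exchanging u
  and v, and commutation will be read off from that.\<close>

lemma dilation_op_compose:
 assumes p: "1 < p" and k: "dilation_kernel p k C" and l: "dilation_kernel p l D"
  and f[measurable]: "borel_fun f" and fin: "lp_mass p f < \<infinity>"
 shows "AE t in lborel. integrable (lborel \<Otimes>\<^sub>M lborel) (\<lambda>(u, v). (k u * l v) *\<^sub>R f (t * u * v)) \<and>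
   dilation_op k (dilation_op l f) t = (\<integral>z. (case z of (u, v) => (k u * l v) *\<^sub>R f (t * u * v)) \<partial>(lborel \<Otimes>\<^sub>M lborel))"
 using dilation_double_AE_finite[OF assms]
proof eventually_elim
 note [measurable] = dilation_kernel_measurable[OF p k] dilation_kernel_measurable[OF p l]
 case (elim t)
 have i: "integrable (lborel \<Otimes>\<^sub>M lborel) (\<lambda>(u, v). (k u * l v) *\<^sub>R f (t * u * v))"
 proof (rule integrableI_bounded)
  show "(\<lambda>(u, v). (k u * l v) *\<^sub>R f (t * u * v)) \<in> borel_measurable (lborel \<Otimes>\<^sub>M lborel)" by measurable
  have "(\<integral>\<^sup>+z. ennreal (norm (case z of (u, v) => (k u * l v) *\<^sub>R f (t * u * v))) \<partial>(lborel \<Otimes>\<^sub>M lborel))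
   = (NN u. NR v. k u * (l v * norm (f (t * u * v))))"
   using dilation_kernel_nonneg[OF p k] dilation_kernel_nonneg[OF p l]
   by (subst lborel.nn_integral_fst[symmetric]) (auto simp: abs_mult mult.assoc)
  then show "(\<integral>\<^sup>+z. ennreal (norm (case z of (u, v) => (k u * l v) *\<^sub>R f (t * u * v))) \<partial>(lborel \<Otimes>\<^sub>M lborel)) < \<infinity>"
   using elim by simp
 qed
 have "dilation_op k (dilation_op l f) t = (LBINT u. LBINT v. (k u * l v) *\<^sub>R f (t * u * v))"
  unfolding dilation_op_def by (simp add: scaleR_scaleR[symmetric] del: scaleR_scaleR)
 also have "\<dots> = (\<integral>z. (case z of (u, v) => (k u * l v) *\<^sub>R f (t * u * v)) \<partial>(lborel \<Otimes>\<^sub>M lborel))"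
  using lborel_pair.integral_fst'[OF i] by simp
 finally show ?case using i by simp
qed

lemma dilation_op_commute:
 assumes p: "1 < p" and k: "dilation_kernel p k C" and l: "dilation_kernel p l D"
  and f: "borel_fun f" and fin: "lp_mass p f < \<infinity>"
 shows "AE t in lborel. dilation_op k (dilation_op l f) t = dilation_op l (dilation_op k f) t"
 using dilation_op_compose[OF p k l f fin] dilation_op_compose[OF p l k f fin]
proof eventually_elim
 case (elim t)
 have "(\<integral>z. (case z of (v, u) => (k u * l v) *\<^sub>R f (t * u * v)) \<partial>(lborel \<Otimes>\<^sub>M lborel)) =
   (\<integral>z. (case z of (u, v) => (k u * l v) *\<^sub>R f (t * u * v)) \<partial>(lborel \<Otimes>\<^sub>M lborel))"
  using elim lborel_pair.integral_product_swap[of "\<lambda>(u, v). (k u * l v) *\<^sub>R f (t * u * v)"]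
  by (auto intro!: borel_measurable_integrable)
 moreover have "(case z of (v, u) => (k u * l v) *\<^sub>R f (t * u * v)) = (case z of (v, u) => (l v * k u) *\<^sub>R f (t * v * u))" for z
  by (auto simp: mult_ac split: prod.split)
 ultimately show ?case using elim by simp
qed

section \<open>Cauchy and Poisson integrals\<close>

text \<open>Twice the Cauchy kernel 1 / (2 pi i (s - z)) at s = 0 and z = x + i y. With this factor
  the real part is the Poisson kernel, and the boundary value of the integral of f is f plus its
  Hilbert transform in the normalisation i / pi.\<close>

definition cker :: "real => real => complex" where
 "cker y x = \<i> / (of_real pi * (of_real x + \<i> * of_real y))"

definition pker :: "real => real => real" where
 "pker y x = y / (pi * (x\<^sup>2 + y\<^sup>2))"

definition cauchy_op :: "real => (real => complex) => real => complex" where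
 "cauchy_op y f x = (LBINT s. cker y (x - s) * f s)"

definition poisson_op :: "real => (real => complex) => real => complex" where
 "poisson_op y f x = (LBINT s. pker y (x - s) *\<^sub>R f s)"

lemma cker_measurable [measurable]:
 "(\<lambda>z. cker (fst z) (snd z)) \<in> borel_measurable (borel \<Otimes>\<^sub>M borel)"
 "borel_fun (cker y)"
 unfolding cker_def[abs_def] by measurable

lemma pker_measurable [measurable]:
 "(\<lambda>z. pker (fst z) (snd z)) \<in> borel_measurable (borel \<Otimes>\<^sub>M borel)"
 "borel_fun (pker y)"
 unfolding pker_def[abs_def] by measurable

lemma pker_nonneg: "0 < y ==> 0 \<le> pker y x"
 by (simp add: pker_def)

lemma pker_even: "pker y (- x) = pker y x"
 by (simp add: pker_def)

lemma Re_cker: "Re (cker y x) = pker y x"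
proof -
 have "cker y x = (\<i> / (of_real x + \<i> * of_real y)) / of_real pi" by (simp add: cker_def)
 then show ?thesis by (simp only: Re_divide_of_real) (simp add: pker_def Re_divide)
qed

lemma norm_cker: "norm (cker y x) = 1 / (pi * sqrt (x\<^sup>2 + y\<^sup>2))"
 by (simp add: cker_def norm_divide norm_mult Complex_eq[symmetric] complex_norm)

lemma cker_uminus: "cker y (- x) = cnj (cker y x)"
proof -
 have "- \<i> / (of_real pi * (of_real x - \<i> * of_real y)) = \<i> / (of_real pi * (- of_real x + \<i> * of_real y))"
  by (subst minus_divide_divide[symmetric]) (simp add: algebra_simps)
 then show ?thesis by (simp add: cker_def)
qed

lemma norm_cker_le:
 assumes "0 < y" shows "norm (cker y x) \<le> 1 / (\<bar>x\<bar> + y)"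
proof -
 have "((\<bar>x\<bar> + y) / 2)\<^sup>2 \<le> x\<^sup>2 + y\<^sup>2"
 proof -
  have *: "(t + y)\<^sup>2 \<le> 4 * (t\<^sup>2 + y\<^sup>2)" for t :: real
  proof -
   have "2 * (t * y) \<le> t\<^sup>2 + y\<^sup>2" using zero_le_power2[of "t - y"] by (simp add: power2_diff mult.assoc)
   then have "(t + y)\<^sup>2 \<le> 2 * (t\<^sup>2 + y\<^sup>2)" by (simp add: power2_sum mult.assoc)
   also have "\<dots> \<le> 4 * (t\<^sup>2 + y\<^sup>2)" by (intro mult_right_mono) auto
   finally show ?thesis .
  qed
  show ?thesis using *[of "\<bar>x\<bar>"] by (simp add: power_divide)
 qed
 then have "(\<bar>x\<bar> + y) / 2 \<le> sqrt (x\<^sup>2 + y\<^sup>2)" by (rule real_le_rsqrt)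
 moreover have "2 \<le> pi" by (rule pi_ge_two)
 ultimately have "2 * ((\<bar>x\<bar> + y) / 2) \<le> pi * sqrt (x\<^sup>2 + y\<^sup>2)"
  using assms by (intro mult_mono) auto
 then show ?thesis unfolding norm_cker using assms by (intro divide_left_mono) auto
qed

lemma norm_cker_le':
 assumes "0 < y" shows "norm (cker y x) \<le> 1 / y"
proof -
 have "1 / (\<bar>x\<bar> + y) \<le> 1 / y" using assms by (intro divide_left_mono) auto
 with norm_cker_le[OF assms, of x] show ?thesis by linarith
qed

lemma nn_integral_even:
 fixes f :: "real => ennreal"
 assumes [measurable]: "borel_fun f" and even: "\<And>x. f (- x) = f x"
 shows "(NN x. f x) = 2 * (NN x. f x * indicator {0..} x)"
proof -
 have "(NN x. f x) = (NN x. f x * indicator {0..} x + f x * indicator {..<0} x)"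
  by (intro nn_integral_cong) (auto simp: indicator_def)
 also have "\<dots> = (NN x. f x * indicator {0..} x) + (NN x. f x * indicator {..<0} x)"
  by (rule nn_integral_add) measurable
 also have "(NN x. f x * indicator {..<0} x) = (NN x. f (- x) * indicator {..<0} (- x))"
  using nn_integral_real_affine[of "\<lambda>x. f x * indicator {..<0} x" "-1" 0] by simp
 also have "\<dots> = (NN x. f x * indicator {0..} x)"
  by (rule nn_integral_cong_AE, use AE_lborel_singleton[of 0] in eventually_elim) (auto simp: even indicator_def)
 finally show ?thesis by (simp add: mult_2)
qed

lemma nn_integral_pker:
 assumes y: "0 < y" shows "(NR x. pker y x) = 1"
proof -
 have "LIM x at_top. inverse y * x :> at_top"
  using y by (intro filterlim_tendsto_pos_mult_at_top[OF tendsto_const _ filterlim_ident]) auto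
 then have "LIM x at_top. x / y :> at_top" by (simp add: field_simps)
 then have lim: "((\<lambda>x. arctan (x / y) / pi) \<longlongrightarrow> (pi / 2) / pi) at_top"
  by (intro tendsto_divide tendsto_const filterlim_compose[OF tendsto_arctan_at_top]) auto
 have "(NN x. ennreal (pker y x) * indicator {0..} x) = ennreal ((pi / 2) / pi - arctan (0 / y) / pi)"
 proof (rule nn_integral_FTC_atLeast[OF _ _ _ lim])
  fix x :: real
  have "((\<lambda>x. arctan (x / y) / pi) has_real_derivative (1 / y / (1 + (x / y)\<^sup>2) / pi)) (at x)"
   using y by (auto intro!: derivative_eq_intros simp: divide_inverse mult_ac)
  moreover have "1 / y / (1 + (x / y)\<^sup>2) / pi = pker y x"
   using y by (simp add: pker_def field_simps power2_eq_square)
  ultimately show "((\<lambda>x. arctan (x / y) / pi) has_real_derivative pker y x) (at x)" by simp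
 qed (use y pker_nonneg in auto)
 then have "(NR x. pker y x) = 2 * ennreal (1 / 2)"
  by (subst nn_integral_even) (auto simp: pker_even)
 also have "\<dots> = ennreal (2 * (1 / 2))" by (subst ennreal_mult) auto
 finally show ?thesis by simp
qed

lemma nn_integral_reflect_shift:
 assumes "borel_fun f"
 shows "(NN s. f (x - s)) = (\<integral>\<^sup>+s. f s \<partial>(lborel :: real measure))"
 using nn_integral_real_affine[OF assms, of "-1" x] by simp

text \<open>The bound 1/(|x| + y) decays like 1/|x|, which is integrable at infinity only to powers
  q > 1. This is why Cauchy integrals on L^p go through Hoelder's inequality with the conjugate
  exponent.\<close>

lemma nn_integral_cker_finite:
 assumes y: "0 < y" and q: "1 < q"
 shows "(NR x. norm (cker y x) powr q) < \<infinity>"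
proof -
 have "(NR x. norm (cker y x) powr q) \<le> (NR x. (\<bar>x\<bar> + y) powr (- q))"
 proof (intro nn_integral_mono ennreal_leI)
  fix x
  have "norm (cker y x) powr q \<le> (1 / (\<bar>x\<bar> + y)) powr q"
   using q y by (intro powr_mono2 norm_cker_le) auto
  then show "norm (cker y x) powr q \<le> (\<bar>x\<bar> + y) powr (- q)"
   using y by (simp add: powr_divide powr_minus_divide)
 qed
 also have "\<dots> = 2 * (NN x. ennreal ((\<bar>x\<bar> + y) powr (- q)) * indicator {0..} x)"
  by (rule nn_integral_even) auto
 also have "(NN x. ennreal ((\<bar>x\<bar> + y) powr (- q)) * indicator {0..} x) = (NN x. ennreal ((x + y) powr (- q)) * indicator {0..} x)"
  by (intro nn_integral_cong) (auto simp: indicator_def)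
 also have "(NN x. ennreal ((x + y) powr (- q)) * indicator {0..} x) = ennreal (0 - (- ((0 + y) powr (1 - q) / (q - 1))))"
 proof (rule nn_integral_FTC_atLeast)
  have "LIM x at_top. x + y :> at_top"
   using filterlim_tendsto_add_at_top[OF tendsto_const filterlim_ident, of y] by (simp add: add.commute)
  then have "((\<lambda>x. (x + y) powr (1 - q)) \<longlongrightarrow> 0) at_top"
   using q by (intro tendsto_neg_powr) auto
  then have "((\<lambda>x. - ((x + y) powr (1 - q) / (q - 1))) \<longlongrightarrow> - (0 / (q - 1))) at_top"
   using q by (intro tendsto_intros) auto
  then show "((\<lambda>x. - ((x + y) powr (1 - q) / (q - 1))) \<longlongrightarrow> 0) at_top" by simp
  fix x :: real assume x: "0 \<le> x"
  have "((\<lambda>x. - ((x + y) powr (1 - q) / (q - 1))) has_real_derivative - ((1 - q) * (x + y) powr (1 - q - 1) / (q - 1))) (at x)"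
   using x y q by (auto intro!: derivative_eq_intros)
  moreover have "- ((1 - q) * (x + y) powr (1 - q - 1) / (q - 1)) = (x + y) powr (- q)"
   using q by (simp add: field_simps)
  ultimately show "((\<lambda>x. - ((x + y) powr (1 - q) / (q - 1))) has_real_derivative (x + y) powr (- q)) (at x)"
   by simp
 qed (use y in auto)
 finally show ?thesis by (rule le_less_trans) (simp add: ennreal_mult_less_top)
qed

section \<open>Cauchy and Poisson integrals of L^p functions\<close>

text \<open>The Hoelder estimate holds for every real x below the integral of |f g|; an infinite
  integral would allow arbitrarily large x, so all three assertions follow from one
  inequality.\<close>

lemma Hoelder_finite:
 fixes f g :: "real => complex"
 assumes [measurable]: "borel_fun f" "borel_fun g" and p: "1 < p"
  and f: "lp_mass p f < \<infinity>" and g: "lp_mass (p / (p - 1)) g \<le> ennreal W" "0 < W"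
 shows "integrable lborel (\<lambda>s. g s * f s)"
  "ennreal (norm (LBINT s. g s * f s) powr p) \<le> ennreal (W powr (p - 1)) * lp_mass p f"
  "(NR s. norm (f s) * norm (g s)) < \<infinity>"
proof -
 have H: "ennreal (x powr p) \<le> ennreal (W powr (p - 1)) * lp_mass p f"
  if "0 \<le> x" "ennreal x \<le> (NR s. norm (f s) * norm (g s))" for x
  unfolding lp_mass_def using that p g by (intro nn_integral_Hoelder) (auto simp: lp_mass_def)
 obtain b where b: "0 \<le> b" "ennreal (W powr (p - 1)) * lp_mass p f = ennreal b"
 proof -
  have "ennreal (W powr (p - 1)) * lp_mass p f < \<infinity>" using f by (simp add: ennreal_mult_less_top)
  then show ?thesis using that by (cases "ennreal (W powr (p - 1)) * lp_mass p f") auto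
 qed
 show fin: "(NR s. norm (f s) * norm (g s)) < \<infinity>"
 proof (rule ccontr)
  assume "\<not> ?thesis"
  then have i: "(NR s. norm (f s) * norm (g s)) = \<infinity>"
   by (metis infinity_ennreal_def top.not_eq_extremum)
  \<comment> \<open>With an infinite integral x = b + 1 is admissible, which contradicts the bound b
    since (b+1)^p \<ge> b + 1.\<close>
  have "ennreal ((b + 1) powr p) \<le> ennreal b" unfolding b(2)[symmetric] by (rule H) (use b i in auto)
  then have "(b + 1) powr p \<le> b" using b by (simp add: ennreal_le_iff)
  moreover have "(b + 1) powr 1 \<le> (b + 1) powr p" using b p by (intro powr_mono) auto
  ultimately show False using b by simp
 qed
 show int: "integrable lborel (\<lambda>s. g s * f s)"
  using fin by (intro integrableI_bounded) (auto simp: norm_mult mult.commute)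
 show "ennreal (norm (LBINT s. g s * f s) powr p) \<le> ennreal (W powr (p - 1)) * lp_mass p f"
  using integral_norm_bound_ennreal[OF int] by (intro H) (auto simp: norm_mult mult.commute)
qed

lemma cker_mass_shift:
 "lp_mass q (\<lambda>s. cker y (x - s)) = lp_mass q (cker y)"
 unfolding lp_mass_def by (rule nn_integral_reflect_shift) measurable

text \<open>The conjugate-exponent mass of the kernel as a real number, increased by 1 to be
  strictly positive.\<close>

definition cker_const :: "real => real => real" where
 "cker_const p y = enn2real (lp_mass (p / (p - 1)) (cker y)) + 1"

lemma cker_const:
 assumes "1 < p" "0 < y"
 shows "lp_mass (p / (p - 1)) (cker y) \<le> ennreal (cker_const p y)" "0 < cker_const p y"
proof -
 have "lp_mass (p / (p - 1)) (cker y) < \<infinity>"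
  unfolding lp_mass_def using assms by (intro nn_integral_cker_finite) (auto simp: field_simps)
 then show "lp_mass (p / (p - 1)) (cker y) \<le> ennreal (cker_const p y)"
  by (cases "lp_mass (p / (p - 1)) (cker y)") (auto simp: cker_const_def intro!: ennreal_leI)
 show "0 < cker_const p y" by (simp add: cker_const_def add_nonneg_pos)
qed

lemma cauchy_op_integrable:
 assumes [measurable]: "borel_fun f" and "1 < p" "lp_mass p f < \<infinity>" "0 < y"
 shows "integrable lborel (\<lambda>s. cker y (x - s) * f s)"
 using cker_const[of p y] assms
 by (intro Hoelder_finite(1)[where p=p and W="cker_const p y"]) (auto simp: cker_mass_shift)

lemma cauchy_op_bound:
 assumes [measurable]: "borel_fun f" and "1 < p" "lp_mass p f < \<infinity>" "0 < y"
 shows "ennreal (norm (cauchy_op y f x) powr p) \<le> ennreal (cker_const p y powr (p - 1)) * lp_mass p f"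
 unfolding cauchy_op_def using cker_const[of p y] assms
 by (intro Hoelder_finite(2)) (auto simp: cker_mass_shift)

lemma cauchy_op_measurable [measurable]:
 assumes [measurable]: "borel_fun f"
 shows "(\<lambda>z. cauchy_op (fst z) f (snd z)) \<in> borel_measurable (borel \<Otimes>\<^sub>M borel)"
  "borel_fun (cauchy_op y f)"
proof -
 have "(\<lambda>(z, s). cker (fst z) (snd z - s) * f s) \<in> borel_measurable ((borel \<Otimes>\<^sub>M borel) \<Otimes>\<^sub>M lborel)"
  unfolding cker_def by measurable
 then show "(\<lambda>z. cauchy_op (fst z) f (snd z)) \<in> borel_measurable (borel \<Otimes>\<^sub>M borel)"
  unfolding cauchy_op_def by (intro lborel.borel_measurable_lebesgue_integral) (simp add: case_prod_beta')
 show "borel_fun (cauchy_op y f)"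
  unfolding cauchy_op_def[abs_def] cker_def by measurable
qed

lemma cauchy_op_lincomb:
 assumes [measurable]: "borel_fun f" "borel_fun g"
  and "1 < p" "lp_mass p f < \<infinity>" "lp_mass p g < \<infinity>" "0 < y"
 shows "cauchy_op y (\<lambda>s. a * f s + b * g s) x = a * cauchy_op y f x + b * cauchy_op y g x"
proof -
 have "cauchy_op y (\<lambda>s. a * f s + b * g s) x = (LBINT s. a * (cker y (x - s) * f s) + b * (cker y (x - s) * g s))"
  unfolding cauchy_op_def by (intro Bochner_Integration.integral_cong) (auto simp: algebra_simps)
 then show ?thesis
  unfolding cauchy_op_def using assms cauchy_op_integrable[of f p y x] cauchy_op_integrable[of g p y x]
  by (simp add: Bochner_Integration.integral_add)
qed

text \<open>Evaluation of the Cauchy integral at a fixed point of the open half plane is a bounded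
  functional on L^p, so norm convergence of the data gives convergence of the values.\<close>

lemma cauchy_op_tendsto:
 assumes [measurable]: "\<And>n. borel_fun (F n)" "borel_fun f" and p: "1 < p"
  and fin: "\<And>n. lp_mass p (F n) < \<infinity>" "lp_mass p f < \<infinity>" and y: "0 < y" and conv: "lp_conv p F f"
 shows "(\<lambda>n. cauchy_op y (F n) x) \<longlonglongrightarrow> cauchy_op y f x"
proof -
 have "(\<lambda>n. ennreal (norm (cauchy_op y (F n) x - cauchy_op y f x) powr p)) \<longlonglongrightarrow> 0"
 proof (rule tendsto_0_le_ennreal)
  show "(\<lambda>n. ennreal (cker_const p y powr (p - 1)) * lp_mass p (\<lambda>x. F n x - f x)) \<longlonglongrightarrow> 0"
   by (rule tendsto_cmult_0_ennreal) (rule conv[unfolded lp_conv_def])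
  show "\<forall>\<^sub>F n in sequentially. ennreal (norm (cauchy_op y (F n) x - cauchy_op y f x) powr p) \<le> ennreal (cker_const p y powr (p - 1)) * lp_mass p (\<lambda>x. F n x - f x)"
  proof (rule always_eventually, rule allI)
   fix n
   have "lp_mass p (\<lambda>x. F n x - f x) \<le> ennreal (2 powr p) * (lp_mass p (\<lambda>x. F n x - 0) + lp_mass p (\<lambda>x. 0 - f x))"
    by (rule lp_mass_diff_le) (use p in auto)
   also have "\<dots> < \<infinity>" using fin by (simp add: ennreal_mult_less_top)
   finally have "ennreal (norm (cauchy_op y (\<lambda>x. F n x - f x) x) powr p) \<le> ennreal (cker_const p y powr (p - 1)) * lp_mass p (\<lambda>x. F n x - f x)"
    by (intro cauchy_op_bound) (use p y in auto)
   moreover have "cauchy_op y (\<lambda>x. F n x - f x) x = cauchy_op y (F n) x - cauchy_op y f x"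
    using cauchy_op_lincomb[of "F n" f p y 1 "-1" x] p fin y by simp
   ultimately show "ennreal (norm (cauchy_op y (F n) x - cauchy_op y f x) powr p) \<le> ennreal (cker_const p y powr (p - 1)) * lp_mass p (\<lambda>x. F n x - f x)" by simp
  qed
 qed
 then have "(\<lambda>n. norm (cauchy_op y (F n) x - cauchy_op y f x) powr p) \<longlonglongrightarrow> 0"
  by (subst (asm) ennreal_0[symmetric], subst (asm) tendsto_ennreal_iff) auto
 then have "(\<lambda>n. (norm (cauchy_op y (F n) x - cauchy_op y f x) powr p) powr (1 / p)) \<longlonglongrightarrow> 0 powr (1 / p)"
  using p by (intro tendsto_powr2) auto
 then have "(\<lambda>n. norm (cauchy_op y (F n) x - cauchy_op y f x)) \<longlonglongrightarrow> 0"
  using p by (simp add: powr_powr)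
 then show ?thesis by (simp add: LIM_zero_iff tendsto_norm_zero_iff)
qed

text \<open>The Poisson kernel is a probability density, so Jensen and Tonelli show that the
  operator is a contraction, whatever the height.\<close>

lemma poisson_op_mass:
 assumes [measurable]: "borel_fun f" and p: "1 < p" and y: "0 < y"
 shows "(NR x. norm (poisson_op y f x) powr p) \<le> lp_mass p f"
proof -
 have "ennreal (norm (poisson_op y f x) powr p) \<le> (NR s. pker y (x - s) * norm (f s) powr p)" for x
 proof (cases "integrable lborel (\<lambda>s. pker y (x - s) *\<^sub>R f s)")
  case True
  have "(NR s. pker y (x - s)) = 1"
   using nn_integral_reflect_shift[of "\<lambda>s. ennreal (pker y s)" x] nn_integral_pker[OF y] by simp
  then have "ennreal (norm (poisson_op y f x) powr p) \<le> ennreal (1 powr (p - 1)) * (NR s. pker y (x - s) * norm (f s) powr p)"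
   using p pker_nonneg[OF y] integral_norm_bound_ennreal[OF True]
   by (intro nn_integral_weighted_Jensen) (auto simp: poisson_op_def)
  then show ?thesis by simp
 qed (use p in \<open>simp add: poisson_op_def not_integrable_integral_eq\<close>)
 then have "(NR x. norm (poisson_op y f x) powr p)
  \<le> (NN x. NR s. pker y (x - s) * norm (f s) powr p)"
  by (intro nn_integral_mono)
 also have "\<dots> = (NN s. NR x. pker y (x - s) * norm (f s) powr p)"
  unfolding pker_def by (rule lborel_pair.Fubini'[symmetric]) measurable
 also have "\<dots> = (NR s. norm (f s) powr p)"
 proof (rule nn_integral_cong)
  fix s
  have "(NR x. pker y (x - s) * norm (f s) powr p) = (NR x. pker y (x - s)) * ennreal (norm (f s) powr p)"
   using pker_nonneg[OF y] by (subst nn_integral_multc[symmetric]) (auto simp: ennreal_mult)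
  also have "(NR x. pker y (x - s)) = 1"
   using nn_integral_real_affine[of "\<lambda>x. ennreal (pker y x)" 1 "-s"] nn_integral_pker[OF y] by simp
  finally show "(NR x. pker y (x - s) * norm (f s) powr p) = ennreal (norm (f s) powr p)" by simp
 qed
 finally show ?thesis by (simp add: lp_mass_def)
qed

section \<open>The theorem of M. Riesz\<close>

text \<open>Cauchy's theorem on the half disc replaces the integral over the diameter by the one
  over the arc of length pi R. The half plane of holomorphy reaches below the real axis so that the
  closed half disc lies inside it.\<close>

lemma half_disc_bound:
 assumes h: "h holomorphic_on {w. - y < Im w}" and y: "0 < y" and R: "0 < R" and B: "0 \<le> B"
  and bd: "\<And>w. norm w = R ==> 0 \<le> Im w ==> norm (h w) \<le> B"
 shows "norm (integral {-R..R} (\<lambda>x. h (of_real x))) \<le> B * R * pi"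
proof -
 let ?S = "{w. - y < Im w}"
 let ?l = "linepath (of_real (- R)) (of_real R :: complex)" and ?c = "part_circlepath 0 R 0 pi"
 have S: "open ?S" "convex ?S" by (auto simp: open_halfspace_Im_gt convex_halfspace_Im_gt)
 have c: "z \<in> path_image ?c ==> norm z = R \<and> 0 \<le> Im z" for z
 proof -
  assume "z \<in> path_image ?c"
  then obtain t where t: "t \<in> {0..pi}" "z = of_real R * cis t"
   using R by (auto simp: path_image_part_circlepath' closed_segment_eq_real_ivl)
  then have "Im z = R * sin t" by simp
  moreover have "norm z = R" using t R by (simp add: norm_mult)
  moreover have "0 \<le> sin t" using t by (intro sin_ge_zero) auto
  ultimately show ?thesis using R by simp
 qed
 have cS: "path_image ?c \<subseteq> ?S" using c y by fastforce
 have lS: "path_image ?l \<subseteq> ?S" using y by (auto simp: closed_segment_def)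
 have cc: "h contour_integrable_on ?c"
  by (rule contour_integrable_holomorphic_simple[OF h S(1) _ cS]) auto
 have cl: "h contour_integrable_on ?l"
  by (rule contour_integrable_holomorphic_simple[OF h S(1) _ lS]) auto
 have "(h has_contour_integral 0) (?l +++ ?c)"
  using cS lS by (intro Cauchy_theorem_convex_simple[OF h S(2)]) (auto simp: path_image_join intro!: valid_path_join)
 moreover have "(h has_contour_integral (contour_integral ?l h + contour_integral ?c h)) (?l +++ ?c)"
  using cc cl by (intro has_contour_integral_join has_contour_integral_integral) auto
 ultimately have "contour_integral ?l h + contour_integral ?c h = 0" by (metis contour_integral_unique)
 then have "contour_integral ?l h = - contour_integral ?c h" by (simp add: eq_neg_iff_add_eq_0)
 moreover have "norm (contour_integral ?c h) \<le> B * R * (pi - 0)"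
  using c bd R B cc by (intro has_contour_integral_bound_part_circlepath[OF has_contour_integral_integral]) auto
 moreover have "((\<lambda>x. h (of_real x)) has_integral contour_integral ?l h) {-R..R}"
  using has_contour_integral_integral[OF cl] R by (subst (asm) has_contour_integral_linepath_Reals_iff) auto
 ultimately show ?thesis by (simp add: integral_unique)
qed

text \<open>For w with argument \<theta> the claim reads 1 \<le> A cos(\<theta>)^p - B cos(p
  \<theta>). Near the imaginary axis p |\<theta>| lies between pi/2 and pi, so the second term is
  positive and bounded below; elsewhere cos(\<theta>) is bounded below. The condition p \<le> 2
  keeps p |\<theta>| from exceeding pi.\<close>

lemma powr_sector_bound:
 assumes p: "1 < p" "p \<le> 2"
 obtains A B :: real where "0 \<le> A" "0 \<le> B"
  "\<And>w. 0 < Re w ==> norm w powr p \<le> A * Re w powr p - B * Re (w powr of_real p)"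
proof -
 \<comment> \<open>The midpoint of pi/(2p) and pi/2: then p t lies strictly between pi/2 and
   pi.\<close>
 define t where "t = (pi / (2 * p) + pi / 2) / 2"
 have "pi / (2 * p) < pi / 2" using p pi_gt_zero by (intro divide_strict_left_mono) auto
 then have t: "pi / (2 * p) < t" "t < pi / 2" by (simp_all add: t_def)
 have "0 < pi / (2 * p)" using p by simp
 then have t0: "0 < t" using t by linarith
 have pt: "pi / 2 < p * t" using t(1) p by (simp add: field_simps)
 have pt2: "p * t < pi"
 proof -
  have "p * t < p * (pi / 2)" using t(2) p by (intro mult_strict_left_mono) auto
  also have "\<dots> \<le> 2 * (pi / 2)" using p by (intro mult_right_mono) auto
  finally show ?thesis by simp
 qed
 define d where "d = - cos (p * t)"
 have d: "0 < d" 
  using cos_lt_zero_pi[of "p * t"] pt pt2 by (simp add: d_def)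
 define B where "B = 1 / d"
 have ct: "0 < cos t" using t0 t by (intro cos_gt_zero) auto
 \<comment> \<open>B makes the second term at least 1 beyond the angle t; A then absorbs the loss of
   at most B below it.\<close>
 define A where "A = (1 + B) / cos t powr p"
 have B: "0 \<le> B" "B * d = 1" using d by (simp_all add: B_def)
 have A: "0 \<le> A" using B ct by (simp add: A_def)
 show ?thesis
 proof (rule that[OF A B(1)])
  fix w :: complex assume w: "0 < Re w"
  then have w0: "w \<noteq> 0" by auto
  define \<theta> where "\<theta> = Im (Ln w)"
  have th: "\<bar>\<theta>\<bar> < pi / 2" unfolding \<theta>_def by (rule Re_Ln_pos_lt_imp[OF w])
  have "w = exp (Ln w)" using w0 by simp
  then have "Re w = exp (Re (Ln w)) * cos \<theta>" by (metis Re_exp \<theta>_def)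
  then have Rew: "Re w = norm w * cos \<theta>" using w0 by simp
  have "Re (w powr of_real p) = exp (p * ln (norm w)) * cos (p * \<theta>)"
   using w0 by (simp add: powr_def Re_exp \<theta>_def)
  then have Rep: "Re (w powr of_real p) = norm w powr p * cos (p * \<theta>)"
   using w0 by (simp add: powr_def)
  have ineq: "1 \<le> A * cos \<bar>\<theta>\<bar> powr p - B * cos (p * \<bar>\<theta>\<bar>)"
  proof (cases "t \<le> \<bar>\<theta>\<bar>")
   case True
   have "p * t \<le> p * \<bar>\<theta>\<bar>" using True p by (intro mult_left_mono) auto
   moreover have "p * \<bar>\<theta>\<bar> \<le> 2 * (pi / 2)" using p th by (intro mult_mono) auto
   moreover have "0 \<le> p * t" using p t0 by simp
   ultimately have "cos (p * \<bar>\<theta>\<bar>) \<le> - d" unfolding d_def minus_minus by (intro cos_monotone_0_pi_le) auto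
   then have "B * d \<le> - (B * cos (p * \<bar>\<theta>\<bar>))" using B mult_left_mono[of "cos (p * \<bar>\<theta>\<bar>)" "-d" B] by simp
   then show ?thesis using A B mult_nonneg_nonneg[OF A powr_ge_zero[of "cos \<bar>\<theta>\<bar>" p]] by linarith
  next
   case False
   then have "cos t \<le> cos \<bar>\<theta>\<bar>" using t th by (intro cos_monotone_0_pi_le) auto
   then have "cos t powr p \<le> cos \<bar>\<theta>\<bar> powr p" using ct p by (intro powr_mono2) auto
   then have "A * cos t powr p \<le> A * cos \<bar>\<theta>\<bar> powr p" using A by (intro mult_left_mono) auto
   moreover have "A * cos t powr p = 1 + B" using ct by (simp add: A_def)
   moreover have "B * cos (p * \<bar>\<theta>\<bar>) \<le> B * 1" using B by (intro mult_left_mono) auto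
   ultimately show ?thesis by linarith
  qed
  have cc: "cos \<bar>\<theta>\<bar> = cos \<theta>" "cos (p * \<bar>\<theta>\<bar>) = cos (p * \<theta>)" by (auto simp: abs_if)
  have "norm w powr p * 1 \<le> norm w powr p * (A * cos \<theta> powr p - B * cos (p * \<theta>))"
   using ineq unfolding cc by (intro mult_left_mono) auto
  also have "\<dots> = A * Re w powr p - B * Re (w powr of_real p)"
   using th by (simp add: Rew Rep powr_mult cos_ge_zero algebra_simps)
  finally show "norm w powr p \<le> A * Re w powr p - B * Re (w powr of_real p)" by simp
 qed
qed

lemma nn_integral_continuous_interval:
 fixes g :: "real => real"
 assumes g: "continuous_on {a..b} g" "\<And>x. x \<in> {a..b} ==> 0 \<le> g x"
 shows "(NN x. ennreal (g x) * indicator {a..b} x) = ennreal (integral {a..b} g)"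
proof -
 define h where "h x = (if x \<in> {a..b} then g x else 0)" for x
 have hm: "borel_fun h"
  using borel_measurable_continuous_on_indicator[OF _ g(1)] 
  by (simp add: h_def[abs_def] indicator_def of_bool_def if_distrib if_distribR cong: if_cong)
 have hi: "(h has_integral integral {a..b} g) UNIV"
  unfolding h_def using integrable_integral[OF integrable_continuous_real[OF g(1)]]
  by (subst has_integral_restrict_UNIV) 
 have "(NR x. h x) = ennreal (integral {a..b} g)"
  using g by (intro nn_integral_has_integral_lborel[OF hm _ hi]) (auto simp: h_def)
 moreover have "(NR x. h x) = (NN x. ennreal (g x) * indicator {a..b} x)"
  by (intro nn_integral_cong) (auto simp: h_def)
 ultimately show ?thesis by simp
qed

text \<open>Nonnegative data give F with positive real part, so F^p is holomorphic and the sector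
  inequality bounds |F|^p by A (Re F)^p - B Re(F^p). The integral of F^p over [-R, R] is O(R^(1-p))
  by the half disc, and Re F is the Poisson integral of f, a contraction in L^p.\<close>

lemma cauchy_op_mass_nonneg:
 fixes f :: "real => real"
 assumes p: "1 < p" "p \<le> 2" and AB: "0 \<le> A" "0 \<le> B"
  "\<And>w. 0 < Re w ==> norm w powr p \<le> A * Re w powr p - B * Re (w powr of_real p)"
  and f: "continuous_on UNIV f" "\<And>x. 0 \<le> f x" and M: "\<And>x. M < \<bar>x\<bar> ==> f x = 0" and y: "0 < y"
 shows "lp_mass p (cauchy_op y (\<lambda>x. of_real (f x))) \<le> ennreal A * lp_mass p (\<lambda>x. of_real (f x))"
proof -
 let ?f = "\<lambda>x. complex_of_real (f x)"
 define M' where "M' = max M 1"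
 have M': "M' < \<bar>x\<bar> ==> f x = 0" "0 < M'" for x using M by (auto simp: M'_def)
 have fm[measurable]: "borel_fun f" by (intro borel_measurable_continuous_onI f)
 have fI: "(\<lambda>x. \<bar>f x\<bar>) integrable_on {-M'..M'}"
  by (intro integrable_continuous_real continuous_intros continuous_on_subset[OF f(1)]) auto
 have fint: "integrable lborel f"
 proof -
  have "integrable lborel (\<lambda>x. indicator {-M'..M'} x *\<^sub>R f x)"
   by (intro borel_integrable_compact compact_Icc continuous_on_subset[OF f(1)]) auto
  moreover have "(\<lambda>x. indicator {-M'..M'} x *\<^sub>R f x) = f"
  proof
   fix x show "indicator {-M'..M'} x *\<^sub>R f x = f x"
   using M'(1)[of x] by (cases "\<bar>x\<bar> \<le> M'") (auto simp: indicator_def abs_le_iff)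
  qed
  ultimately show ?thesis by simp
 qed
 show ?thesis
 proof (cases "integral\<^sup>L lborel f = 0")
  case True
  \<comment> \<open>Data vanishing almost everywhere are set aside, since then F = 0 and the power p
    would be taken on its branch cut.\<close>
  then have "AE x in lborel. f x = 0"
   using integral_nonneg_eq_0_iff_AE[OF fint] f(2) by auto
  then have "cauchy_op y ?f x = 0" for x
   unfolding cauchy_op_def by (intro integral_eq_zero_AE) (auto elim!: eventually_mono)
  then have "cauchy_op y ?f = (\<lambda>x. 0)" by auto
  then show ?thesis by simp
 next
  case False
  then have fpos: "0 < integral\<^sup>L lborel f"
   using Bochner_Integration.integral_nonneg[of lborel f] f(2) by (simp add: less_le)
  \<comment> \<open>The Cauchy integral seen from the line at height y: \<open>F\<close> at w is its
    value at w + i y, hence holomorphic across the real axis, down to Im w = -y.\<close>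
  define F where "F w = integral (cbox (-M') M') (\<lambda>s. \<i> / (of_real pi * (w + \<i> * of_real y - of_real s)) * ?f s)" for w
  have ne: "w + \<i> * of_real y - of_real s \<noteq> 0" if "- y < Im w" for w s
  proof
   assume "w + \<i> * of_real y - of_real s = 0"
   then have "Im (w + \<i> * of_real y - of_real s) = 0" by simp
   then show False using that by simp
  qed
  have Fhol: "F holomorphic_on {w. - y < Im w}"
   unfolding F_def
  proof (rule leibniz_rule_holomorphic)
   fix w s assume w: "w \<in> {w. - y < Im w}" 
   show "((\<lambda>w. \<i> / (of_real pi * (w + \<i> * of_real y - of_real s)) * ?f s) has_field_derivative
     - (\<i> * of_real pi) / (of_real pi * (w + \<i> * of_real y - of_real s))\<^sup>2 * ?f s) (at w within {w. - y < Im w})"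
    using ne w by (auto intro!: derivative_eq_intros simp: power2_eq_square)
  next
   fix w assume w: "w \<in> {w. - y < Im w}" 
   show "(\<lambda>s. \<i> / (of_real pi * (w + \<i> * of_real y - of_real s)) * ?f s) integrable_on cbox (-M') M'"
    using ne w by (intro integrable_continuous continuous_intros continuous_on_subset[OF f(1)]) auto
  next
   have "continuous_on ({w. - y < Im w} \<times> cbox (- M') M') (\<lambda>z. f (snd z))"
    by (rule continuous_on_compose2[OF f(1)]) (auto intro: continuous_intros)
   then show "continuous_on ({w. - y < Im w} \<times> cbox (- M') M')
    (\<lambda>(w, s). - (\<i> * of_real pi) / (of_real pi * (w + \<i> * of_real y - of_real s))\<^sup>2 * ?f s)"
    using ne by (auto simp: case_prod_unfold intro!: continuous_intros)
   show "convex {w. - y < Im w}" by (simp add: convex_halfspace_Im_gt)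
  qed
  have Ci: "integrable lborel (\<lambda>s. cker (y + Im w) (Re w - s) * ?f s)" if w: "- y < Im w" for w
  proof -
   let ?g = "\<lambda>s. cker (y + Im w) (Re w - s) * ?f s"
   show ?thesis
   proof (rule Bochner_Integration.integrable_bound)
    show "integrable lborel (\<lambda>s. 1 / (y + Im w) * f s)" using fint by simp
    show "AE s in lborel. norm (?g s) \<le> norm (1 / (y + Im w) * f s)"
    proof (rule AE_I2)
     fix s
     have "norm (?g s) \<le> 1 / (y + Im w) * norm (?f s)"
      unfolding norm_mult using w by (intro mult_right_mono norm_cker_le') auto
     then show "norm (?g s) \<le> norm (1 / (y + Im w) * f s)" using w by (simp add: abs_mult)
    qed
   qed measurable
  qed
  have FC: "F w = cauchy_op (y + Im w) ?f (Re w)" if w: "- y < Im w" for w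
  proof -
   let ?g = "\<lambda>s. cker (y + Im w) (Re w - s) * ?f s"
   have e: "\<i> / (of_real pi * (w + \<i> * of_real y - of_real s)) = cker (y + Im w) (Re w - s)" for s
   proof -
    have "w + \<i> * of_real y - of_real s = of_real (Re w - s) + \<i> * of_real (y + Im w)"
     by (simp add: complex_eq_iff)
    then show ?thesis by (simp add: cker_def)
   qed
   have "integrable lborel ?g" by (rule Ci[OF w])
   then have "integral UNIV ?g = cauchy_op (y + Im w) ?f (Re w)"
    unfolding cauchy_op_def by (rule integral_lborel)
   moreover have "integral UNIV (\<lambda>s. if s \<in> cbox (- M') M' then ?g s else 0) = F w"
    unfolding F_def e by (simp only: integral_restrict_UNIV)
   moreover have "(\<lambda>s. if s \<in> cbox (- M') M' then ?g s else 0) = ?g"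
    using M'(1) by (auto simp: fun_eq_iff)
   ultimately show ?thesis by simp
  qed
  have ReF: "Re (F w) = (LBINT s. pker (y + Im w) (Re w - s) * f s)" if w: "- y < Im w" for w
  proof -
   let ?g = "\<lambda>s. cker (y + Im w) (Re w - s) * ?f s"
   have "Re (F w) = (LBINT s. Re (?g s))"
    unfolding FC[OF w] cauchy_op_def by (rule integral_Re[OF Ci[OF w], symmetric])
   also have "\<dots> = (LBINT s. pker (y + Im w) (Re w - s) * f s)"
    by (simp add: Re_cker)
   finally show ?thesis .
  qed
  have Repos: "0 < Re (F w)" if w: "- y < Im w" for w
  proof -
   let ?g = "\<lambda>s. cker (y + Im w) (Re w - s) * ?f s"
   have i: "integrable lborel ?g" by (rule Ci[OF w])
   note eq = ReF[OF w]
   have ip: "integrable lborel (\<lambda>s. pker (y + Im w) (Re w - s) * f s)"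
    using integrable_Re[OF i] by (simp add: Re_cker)
   have nn: "0 \<le> pker (y + Im w) (Re w - s) * f s" for s
    using w f(2)[of s] pker_nonneg[of "y + Im w" "Re w - s"] by simp
   have "Re (F w) \<noteq> 0"
   proof
    assume "Re (F w) = 0"
    then have "AE s in lborel. pker (y + Im w) (Re w - s) * f s = 0"
     unfolding eq using integral_nonneg_eq_0_iff_AE[OF ip] nn by auto
    moreover have "pker (y + Im w) (Re w - s) \<noteq> 0" for s
    proof -
     have "0 < (y + Im w)\<^sup>2" using w by simp
     then have "(Re w - s)\<^sup>2 + (y + Im w)\<^sup>2 > 0" using zero_le_power2[of "Re w - s"] by linarith
     then show ?thesis using w by (simp add: pker_def)
    qed
    ultimately have "AE s in lborel. f s = 0" by (auto elim!: eventually_mono)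
    then have "integral\<^sup>L lborel f = 0" by (rule integral_eq_zero_AE)
    with False show False by simp
   qed
   moreover have "0 \<le> Re (F w)" unfolding eq using nn by (rule Bochner_Integration.integral_nonneg)
   ultimately show ?thesis by simp
  qed
  \<comment> \<open>If |w| \<ge> 2 M', every s in the support satisfies |w - s| \<ge> |w| / 2, which
    produces the factor 2.\<close>
  define b where "b = integral\<^sup>L lborel f * 2"
  have b: "0 \<le> b" using fpos by (simp add: b_def)
  have Fb: "norm (F w) \<le> b / norm w" if w: "0 \<le> Im w" "2 * M' \<le> norm w" for w
  proof -
   have w': "- y < Im w" "0 < norm w" using w y M' by auto
   have "norm (F w) \<le> (LBINT s. 2 / norm w * f s)"
    unfolding FC[OF w'(1)] cauchy_op_def
   proof (rule Bochner_Integration.integral_norm_bound_integral)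
    show "integrable lborel (\<lambda>s. cker (y + Im w) (Re w - s) * ?f s)" by (rule Ci[OF w'(1)])
    show "integrable lborel (\<lambda>s. 2 / norm w * f s)" using fint by simp
    show "norm (cker (y + Im w) (Re w - s) * ?f s) \<le> 2 / norm w * f s" for s
    proof (cases "\<bar>s\<bar> \<le> M'")
     case True
     have "norm w / 2 \<le> norm (w - of_real s)"
      using norm_triangle_ineq2[of w "of_real s"] True w by simp
     also have "\<dots> = sqrt ((Re w - s)\<^sup>2 + (Im w)\<^sup>2)" by (simp add: cmod_def)
     also have "\<dots> \<le> sqrt ((Re w - s)\<^sup>2 + (y + Im w)\<^sup>2)"
      using w y by (intro real_sqrt_le_mono add_left_mono power_mono) auto
     finally have le: "1 * (norm w / 2) \<le> pi * sqrt ((Re w - s)\<^sup>2 + (y + Im w)\<^sup>2)"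
      using pi_ge_two by (intro mult_mono) auto
     have "0 < pi * sqrt ((Re w - s)\<^sup>2 + (y + Im w)\<^sup>2)"
      by (rule less_le_trans[OF _ le]) (use w' in simp)
     then have "1 / (pi * sqrt ((Re w - s)\<^sup>2 + (y + Im w)\<^sup>2)) \<le> 1 / (norm w / 2)"
      by (rule divide_left_mono[OF le[unfolded mult_1] zero_le_one mult_pos_pos[OF _ half_gt_zero[OF w'(2)]]])
     from mult_right_mono[OF this f(2)[of s]] show ?thesis
      unfolding norm_mult norm_cker using f(2)[of s] by simp
    qed (use M' in auto)
   qed
   also have "\<dots> = b / norm w" by (simp add: b_def)
   finally show ?thesis .
  qed
  define h where "h w = F w powr of_real p" for w
  have nz: "F w \<notin> \<real>\<^sub>\<le>\<^sub>0" if "- y < Im w" for w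
   using Repos[OF that] by (auto simp: complex_nonpos_Reals_iff)
  have hhol: "h holomorphic_on {w. - y < Im w}"
   unfolding h_def using nz by (intro holomorphic_on_powr Fhol holomorphic_intros) auto
  have real_in: "- y < Im (of_real x)" for x using y by simp
  have hbound: "norm (integral {-R..R} (\<lambda>x. h (of_real x))) \<le> (b / R) powr p * R * pi" if R: "2 * M' \<le> R" for R
  proof (rule half_disc_bound[OF hhol y])
   show "0 < R" using R M' by linarith
   fix w assume "norm w = R" "0 \<le> Im w"
   then have "norm (F w) powr p \<le> (b / R) powr p"
    using Fb[of w] R p by (intro powr_mono2) auto
   then show "norm (h w) \<le> (b / R) powr p" by (simp add: h_def norm_powr_real_powr')
  qed auto
  have contF: "continuous_on S (\<lambda>x. F (of_real x))" for S
   by (rule continuous_on_compose2[OF holomorphic_on_imp_continuous_on[OF Fhol]]) (auto intro!: continuous_intros simp: y)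
  have conth: "continuous_on S (\<lambda>x. h (of_real x))" for S
   by (rule continuous_on_compose2[OF holomorphic_on_imp_continuous_on[OF hhol]]) (auto intro!: continuous_intros simp: y)
  define u where "u x = Re (F (of_real x))" for x
  have upos: "0 < u x" for x unfolding u_def by (rule Repos[OF real_in])
  have contu: "continuous_on S u" for S unfolding u_def[abs_def] by (intro continuous_intros contF)
  have contup: "continuous_on S (\<lambda>x. u x powr p)" for S
   using upos by (intro continuous_on_powr contu continuous_intros) (auto simp: less_imp_neq[symmetric])
  have contFp: "continuous_on S (\<lambda>x. norm (F (of_real x)) powr p)" for S
   using Repos[OF real_in] p by (intro continuous_on_powr' continuous_intros contF) auto
  have massu: "(NR x. u x powr p) \<le> lp_mass p ?f"
  proof -
   have "u x = norm (poisson_op y ?f x)" for x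
   proof -
    have "poisson_op y ?f x = of_real (LBINT s. pker y (x - s) * f s)"
     unfolding poisson_op_def by (subst integral_complex_of_real[symmetric]) (simp add: scaleR_conv_of_real)
    moreover have "u x = (LBINT s. pker y (x - s) * f s)"
     using ReF[OF real_in, of x] by (simp add: u_def)
    ultimately show ?thesis using upos[of x] by simp
   qed
   then show ?thesis using poisson_op_mass[of ?f p y] p y by simp
  qed
  have key: "(NN x. ennreal (norm (F (of_real x)) powr p) * indicator {-R..R} x)
    \<le> ennreal A * lp_mass p ?f + ennreal (B * ((b / R) powr p * R * pi))" if R: "2 * M' \<le> R" for R
  proof -
   have "integral {-R..R} (\<lambda>x. norm (F (of_real x)) powr p)
     \<le> integral {-R..R} (\<lambda>x. A * u x powr p - B * Re (h (of_real x)))"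
    using AB(3)[OF Repos[OF real_in]]
    by (intro integral_le integrable_continuous_real continuous_intros contFp contup conth) (auto simp: u_def h_def)
   also have "\<dots> = A * integral {-R..R} (\<lambda>x. u x powr p) - B * integral {-R..R} (\<lambda>x. Re (h (of_real x)))"
    by (subst integral_diff) (auto intro!: integrable_continuous_real continuous_intros contup conth)
   also have "integral {-R..R} (\<lambda>x. Re (h (of_real x))) = Re (integral {-R..R} (\<lambda>x. h (of_real x)))"
    using integral_linear[OF integrable_continuous_real[OF conth] bounded_linear_Re] by (simp add: o_def)
   also have "A * integral {-R..R} (\<lambda>x. u x powr p) - B * Re (integral {-R..R} (\<lambda>x. h (of_real x)))
     \<le> A * integral {-R..R} (\<lambda>x. u x powr p) + B * ((b / R) powr p * R * pi)"
   proof -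
    have "- Re (integral {-R..R} (\<lambda>x. h (of_real x))) \<le> (b / R) powr p * R * pi"
     using hbound[OF R] abs_Re_le_cmod[of "integral {-R..R} (\<lambda>x. h (of_real x))"] by linarith
    from mult_left_mono[OF this AB(2)] show ?thesis by simp
   qed
   finally have le: "integral {-R..R} (\<lambda>x. norm (F (of_real x)) powr p)
     \<le> A * integral {-R..R} (\<lambda>x. u x powr p) + B * ((b / R) powr p * R * pi)" .
   have up: "0 \<le> integral {-R..R} (\<lambda>x. u x powr p)"
    by (intro integral_nonneg integrable_continuous_real contup) auto
   have "(NN x. ennreal (norm (F (of_real x)) powr p) * indicator {-R..R} x)
     = ennreal (integral {-R..R} (\<lambda>x. norm (F (of_real x)) powr p))"
    by (rule nn_integral_continuous_interval[OF contFp]) auto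
   also have "\<dots> \<le> ennreal (A * integral {-R..R} (\<lambda>x. u x powr p) + B * ((b / R) powr p * R * pi))"
    by (rule ennreal_leI[OF le])
   also have "\<dots> = ennreal A * ennreal (integral {-R..R} (\<lambda>x. u x powr p)) + ennreal (B * ((b / R) powr p * R * pi))"
    using AB up M' R by (subst ennreal_plus) (auto simp: ennreal_mult)
   also have "ennreal (integral {-R..R} (\<lambda>x. u x powr p)) = (NN x. ennreal (u x powr p) * indicator {-R..R} x)"
    by (rule nn_integral_continuous_interval[OF contup, symmetric]) auto
   also have "\<dots> \<le> (NR x. u x powr p)"
    by (intro nn_integral_mono) (auto simp: indicator_def)
   also have "\<dots> \<le> lp_mass p ?f" by (rule massu)
   finally show ?thesis by (simp add: mult_left_mono add_mono)
  qed
  define G where "G n = (NN x. ennreal (norm (F (of_real x)) powr p) * indicator {- real n..real n} x)" for n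
  \<comment> \<open>Letting the radius tend to infinity removes the contribution of the arc, as 1 -
    p < 0.\<close>
  have Gle: "G n \<le> ennreal A * lp_mass p ?f" for n
  proof (rule LIMSEQ_le_const)
   have "(\<lambda>m. B * b powr p * pi * real m powr (1 - p)) \<longlonglongrightarrow> B * b powr p * pi * 0"
    using p by (intro tendsto_intros tendsto_neg_powr filterlim_real_sequentially) auto
   then have "(\<lambda>m. ennreal (B * b powr p * pi * real m powr (1 - p))) \<longlonglongrightarrow> ennreal 0"
    by (intro tendsto_ennrealI) simp
   then have "(\<lambda>m. ennreal A * lp_mass p ?f + ennreal (B * b powr p * pi * real m powr (1 - p))) \<longlonglongrightarrow> ennreal A * lp_mass p ?f + ennreal 0"
    by (rule tendsto_add[OF tendsto_const])
   then show "(\<lambda>m. ennreal A * lp_mass p ?f + ennreal (B * b powr p * pi * real m powr (1 - p))) \<longlonglongrightarrow> ennreal A * lp_mass p ?f" by simp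
   obtain k :: nat where k: "max (2 * M') 1 \<le> real k" using real_arch_simple by blast
   show "\<exists>N. \<forall>m\<ge>N. G n \<le> ennreal A * lp_mass p ?f + ennreal (B * b powr p * pi * real m powr (1 - p))"
   proof (intro exI allI impI)
    fix m assume m: "max n k \<le> m"
    then have m': "2 * M' \<le> real m" "0 < real m" using k by (auto simp: max_def split: if_splits)
    have "G n \<le> G m" unfolding G_def using m by (intro nn_integral_mono) (auto simp: indicator_def)
    also have "\<dots> \<le> ennreal A * lp_mass p ?f + ennreal (B * ((b / real m) powr p * real m * pi))"
     unfolding G_def by (rule key[OF m'(1)])
    also have "B * ((b / real m) powr p * real m * pi) = B * b powr p * pi * real m powr (1 - p)"
     using m' b by (simp add: powr_divide powr_diff)
    finally show "G n \<le> ennreal A * lp_mass p ?f + ennreal (B * b powr p * pi * real m powr (1 - p))" .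
   qed
  qed
  show ?thesis
  proof (rule lp_mass_Fatou[where F = "\<lambda>n x. indicator {- real n..real n} x *\<^sub>R cauchy_op y ?f x"])
   show "borel_fun (\<lambda>x. indicator {- real n..real n} x *\<^sub>R cauchy_op y ?f x)" for n by measurable
   show "0 < p" using p by simp
   show "AE x in lborel. (\<lambda>n. indicator {- real n..real n} x *\<^sub>R cauchy_op y ?f x) \<longlonglongrightarrow> cauchy_op y ?f x"
   proof (rule AE_I2)
    fix x :: real
    obtain k :: nat where k: "\<bar>x\<bar> \<le> real k" using real_arch_simple by blast
    have "\<forall>\<^sub>F n in sequentially. indicator {- real n..real n} x *\<^sub>R cauchy_op y ?f x = cauchy_op y ?f x"
     by (rule eventually_sequentiallyI[of k]) (use k in \<open>auto simp: indicator_def\<close>)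
    then show "(\<lambda>n. indicator {- real n..real n} x *\<^sub>R cauchy_op y ?f x) \<longlonglongrightarrow> cauchy_op y ?f x"
     by (rule tendsto_eventually)
   qed
   have "lp_mass p (\<lambda>x. indicator {- real n..real n} x *\<^sub>R cauchy_op y ?f x) = G n" for n
    unfolding lp_mass_def G_def FC[OF real_in] by (intro nn_integral_cong) (use p in \<open>auto simp: indicator_def\<close>)
   then show "lp_mass p (\<lambda>x. indicator {- real n..real n} x *\<^sub>R cauchy_op y ?f x) \<le> ennreal A * lp_mass p ?f" for n
    using Gle by simp
  qed
 qed
qed


lemma lp_mass_continuous_finite:
 fixes f :: "real => complex"
 assumes f: "continuous_on UNIV f" and M: "\<And>x. M < \<bar>x\<bar> ==> f x = 0" and p: "0 < p"
 shows "lp_mass p f < \<infinity>"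
proof -
 have "compact (f ` {-M..M})" by (intro compact_continuous_image continuous_on_subset[OF f]) auto
 then obtain B where B: "\<And>x. x \<in> {-M..M} ==> norm (f x) \<le> B"
  by (meson bounded_iff compact_imp_bounded imageI)
 have "lp_mass p f \<le> (NN x. ennreal (B powr p) * indicator {-M..M} x)"
  unfolding lp_mass_def
 proof (intro nn_integral_mono)
  fix x show "ennreal (norm (f x) powr p) \<le> ennreal (B powr p) * indicator {-M..M} x"
  proof (cases "x \<in> {-M..M}")
   case True
   then show ?thesis using B[OF True] p by (auto intro!: ennreal_leI powr_mono2)
  next
   case False
   then have "M < \<bar>x\<bar>" by auto
   then show ?thesis using M p by simp
  qed
 qed
 also have "\<dots> < \<infinity>"
  by (subst nn_integral_cmult_indicator) (auto simp: ennreal_mult_less_top emeasure_lborel_Icc_eq)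
 finally show ?thesis .
qed

section \<open>The bound for general data and exponents up to 2\<close>

text \<open>The positive and negative parts of Re f and Im f are continuous, nonnegative and
  dominated by |f|. Four applications of the nonnegative case and three sums give the bound; hence
  the shape of the constant.\<close>

lemma cauchy_op_mass_continuous:
 assumes p: "1 < p" "p \<le> 2"
 obtains K :: real where "0 \<le> K"
  "\<And>f M y. [|continuous_on UNIV f; \<And>x. M < \<bar>x\<bar> ==> f x = 0; 0 < y|] ==> lp_mass p (cauchy_op y f) \<le> ennreal K * lp_mass p f"
proof -
 obtain A B :: real where AB: "0 \<le> A" "0 \<le> B"
  "\<And>w. 0 < Re w ==> norm w powr p \<le> A * Re w powr p - B * Re (w powr of_real p)"
  using powr_sector_bound[OF p] by metis
 show ?thesis
 proof (rule that)
  show "0 \<le> 2 powr p * (2 * (2 powr p * (2 * A)))" using AB by simp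
  fix f :: "real => complex" and M y :: real
  assume f: "continuous_on UNIV f" and M: "\<And>x. M < \<bar>x\<bar> ==> f x = 0" and y: "0 < y"
  have part: "lp_mass p (cauchy_op y (\<lambda>x. of_real (r (f x)))) \<le> ennreal A * lp_mass p f"
    "lp_mass p (\<lambda>x. of_real (r (f x))) < \<infinity>" "borel_fun (\<lambda>x. complex_of_real (r (f x)))"
   if r: "continuous_on UNIV r" "\<And>z. 0 \<le> r z" "\<And>z. r z \<le> norm z" for r :: "complex => real"
  proof -
   have c: "continuous_on UNIV (\<lambda>x. r (f x))" by (rule continuous_on_compose2[OF r(1) f]) auto
   have z: "r (f x) = 0" if "M < \<bar>x\<bar>" for x using r(2)[of 0] r(3)[of 0] M[OF that] by simp
   have "lp_mass p (cauchy_op y (\<lambda>x. of_real (r (f x)))) \<le> ennreal A * lp_mass p (\<lambda>x. of_real (r (f x)))"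
    by (rule cauchy_op_mass_nonneg[OF p AB c r(2) z y])
   also have "\<dots> \<le> ennreal A * lp_mass p f"
    using p r by (intro mult_left_mono lp_mass_mono) auto
   finally show "lp_mass p (cauchy_op y (\<lambda>x. of_real (r (f x)))) \<le> ennreal A * lp_mass p f" .
   show "lp_mass p (\<lambda>x. of_real (r (f x))) < \<infinity>"
    using p z by (intro lp_mass_continuous_finite[where M=M] continuous_intros c) auto
   show "borel_fun (\<lambda>x. complex_of_real (r (f x)))"
    by (intro borel_measurable_continuous_onI continuous_intros c)
  qed
  define r1 r2 r3 r4 :: "complex => real" where r: "r1 z = max 0 (Re z)" "r2 z = max 0 (- Re z)" "r3 z = max 0 (Im z)" "r4 z = max 0 (- Im z)" for z
  have b: "max 0 (Re z) \<le> cmod z" "max 0 (- Re z) \<le> cmod z" "max 0 (Im z) \<le> cmod z" "max 0 (- Im z) \<le> cmod z" for z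
   using abs_Re_le_cmod[of z] abs_Im_le_cmod[of z] norm_ge_zero[of z] by linarith+
  have c: "continuous_on UNIV r1" "continuous_on UNIV r2" "continuous_on UNIV r3" "continuous_on UNIV r4"
   unfolding r[abs_def] by (intro continuous_intros)+
  have nn: "0 \<le> r1 z" "0 \<le> r2 z" "0 \<le> r3 z" "0 \<le> r4 z" for z by (simp_all add: r)
  note b' = b[folded r]
  note p1 = part[OF c(1) nn(1) b'(1)] and p2 = part[OF c(2) nn(2) b'(2)] and p3 = part[OF c(3) nn(3) b'(3)] and p4 = part[OF c(4) nn(4) b'(4)]
  note [measurable] = p1(3) p2(3) p3(3) p4(3)
  have comb: "lp_mass p (cauchy_op y (\<lambda>x. a * g x + b * h x)) \<le> ennreal (2 powr p) * (X + Y)"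
    "lp_mass p (\<lambda>x. a * g x + b * h x) < \<infinity>"
   if "borel_fun g" "borel_fun h" "lp_mass p g < \<infinity>" "lp_mass p h < \<infinity>"
    "norm a = 1" "norm b = 1" "lp_mass p (cauchy_op y g) \<le> X" "lp_mass p (cauchy_op y h) \<le> Y" for a b g h X Y
  proof -
   note [measurable] = that(1,2)
   have "cauchy_op y (\<lambda>x. a * g x + b * h x) = (\<lambda>x. a * cauchy_op y g x + b * cauchy_op y h x)"
    using cauchy_op_lincomb[OF that(1,2) p(1) that(3,4) y] by auto
   then have "lp_mass p (cauchy_op y (\<lambda>x. a * g x + b * h x)) \<le> ennreal (2 powr p) * (lp_mass p (\<lambda>x. a * cauchy_op y g x) + lp_mass p (\<lambda>x. b * cauchy_op y h x))"
    using lp_mass_add_le[of "\<lambda>x. a * cauchy_op y g x" "\<lambda>x. b * cauchy_op y h x" p] p by simp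
   also have "\<dots> \<le> ennreal (2 powr p) * (X + Y)"
    using that by (intro mult_left_mono add_mono) (auto simp: lp_mass_cmult)
   finally show "lp_mass p (cauchy_op y (\<lambda>x. a * g x + b * h x)) \<le> ennreal (2 powr p) * (X + Y)" .
   have "lp_mass p (\<lambda>x. a * g x + b * h x) \<le> ennreal (2 powr p) * (lp_mass p (\<lambda>x. a * g x) + lp_mass p (\<lambda>x. b * h x))"
    using p by (intro lp_mass_add_le) auto
   also have "\<dots> < \<infinity>" using that by (simp add: lp_mass_cmult ennreal_mult_less_top)
   finally show "lp_mass p (\<lambda>x. a * g x + b * h x) < \<infinity>" .
  qed
  let ?X = "ennreal A * lp_mass p f"
  let ?u = "\<lambda>x. 1 * of_real (r1 (f x)) + (-1) * complex_of_real (r2 (f x))" and ?v = "\<lambda>x. 1 * of_real (r3 (f x)) + (-1) * complex_of_real (r4 (f x))"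
  have u: "lp_mass p (cauchy_op y ?u) \<le> ennreal (2 powr p) * (?X + ?X)" "lp_mass p ?u < \<infinity>"
   using comb[OF p1(3) p2(3) p1(2) p2(2) _ _ p1(1) p2(1), of 1 "-1"] by simp_all
  have v: "lp_mass p (cauchy_op y ?v) \<le> ennreal (2 powr p) * (?X + ?X)" "lp_mass p ?v < \<infinity>"
   using comb[OF p3(3) p4(3) p3(2) p4(2) _ _ p3(1) p4(1), of 1 "-1"] by simp_all
  have "lp_mass p (cauchy_op y (\<lambda>x. 1 * ?u x + \<i> * ?v x)) \<le> ennreal (2 powr p) * (ennreal (2 powr p) * (?X + ?X) + ennreal (2 powr p) * (?X + ?X))"
   by (rule comb(1)[OF _ _ u(2) v(2) _ _ u(1) v(1)]) auto
  moreover have "(\<lambda>x. 1 * ?u x + \<i> * ?v x) = f"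
   by (auto simp: fun_eq_iff complex_eq_iff r max_def)
  moreover have "ennreal (2 powr p) * (ennreal (2 powr p) * (?X + ?X) + ennreal (2 powr p) * (?X + ?X)) = ennreal (2 powr p * (2 * (2 powr p * (2 * A)))) * lp_mass p f"
   using AB by (simp add: ennreal_mult mult_2[symmetric] mult_ac)
  ultimately show "lp_mass p (cauchy_op y f) \<le> ennreal (2 powr p * (2 * (2 powr p * (2 * A)))) * lp_mass p f" by simp
 qed
qed

text \<open>The error is taken relative to the mass of f, so that the masses of the approximants are
  bounded by that of f times a constant depending on p only.\<close>

lemma lp_dense_continuous_sequence:
 assumes f[measurable]: "borel_fun f" and p: "1 < p" and fin: "lp_mass p f < \<infinity>"
 obtains F L where "\<And>n. continuous_on UNIV (F n)" "\<And>n x. L n < \<bar>x\<bar> ==> F n x = 0" "lp_conv p F f"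
  "\<And>n. lp_mass p (F n) \<le> ennreal (2 powr p) * (lp_mass p f + lp_mass p f)"
proof (cases "lp_mass p f = 0")
 case True
 show ?thesis
  by (rule that[of "\<lambda>n x. 0" "\<lambda>n. 0"]) (auto simp: lp_conv_def True)
next
 case False
 then obtain m where m: "lp_mass p f = ennreal m" "0 < m" using fin by (cases "lp_mass p f") auto
 have "\<exists>g L. continuous_on UNIV g \<and> (\<forall>x. L < \<bar>x\<bar> --> g x = 0) \<and> lp_mass p (\<lambda>x. f x - g x) < ennreal (m / (real n + 1))" for n
  using lp_dense_continuous[OF f p fin, of "m / (real n + 1)"] m by (metis add_nonneg_pos divide_pos_pos of_nat_0_le_iff zero_less_one)
 then obtain F L where F: "\<And>n. continuous_on UNIV (F n)" "\<And>n x. L n < \<bar>x\<bar> ==> F n x = 0"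
  "\<And>n. lp_mass p (\<lambda>x. f x - F n x) < ennreal (m / (real n + 1))" by metis
 have [measurable]: "borel_fun (F n)" for n by (intro borel_measurable_continuous_onI F)
 show ?thesis
 proof (rule that[OF F(1,2)])
  have "(\<lambda>n. m / (real n + 1)) \<longlonglongrightarrow> 0"
   using tendsto_mult[OF tendsto_const[of m] LIMSEQ_inverse_real_of_nat] by (simp add: divide_inverse add.commute)
  then have "(\<lambda>n. ennreal (m / (real n + 1))) \<longlonglongrightarrow> ennreal 0" by (rule tendsto_ennrealI)
  then show "lp_conv p F f"
   unfolding lp_conv_def ennreal_0
  proof (rule tendsto_0_le_ennreal)
   show "\<forall>\<^sub>F n in sequentially. lp_mass p (\<lambda>x. F n x - f x) \<le> ennreal (m / (real n + 1))"
    using less_imp_le[OF F(3)] by (simp add: lp_mass_minus_commute[of _ _ f])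
  qed
  fix n
  have "lp_mass p (\<lambda>x. F n x - 0) \<le> ennreal (2 powr p) * (lp_mass p (\<lambda>x. F n x - f x) + lp_mass p (\<lambda>x. f x - 0))"
   by (rule lp_mass_diff_le) (use p in auto)
  also have "\<dots> \<le> ennreal (2 powr p) * (lp_mass p f + lp_mass p f)"
  proof (intro mult_left_mono add_mono)
   have "m / (real n + 1) \<le> m" using m by (simp add: field_simps)
   then show "lp_mass p (\<lambda>x. F n x - f x) \<le> lp_mass p f"
    using F(3)[of n] m by (auto simp: lp_mass_minus_commute[of _ _ f] intro: order_trans[OF less_imp_le ennreal_leI])
  qed auto
  finally show "lp_mass p (F n) \<le> ennreal (2 powr p) * (lp_mass p f + lp_mass p f)" by simp
 qed
qed

text \<open>Compactly supported continuous data are dense, values of the Cauchy integral depend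
  continuously on the data, and Fatou's lemma passes the bound to the limit.\<close>

lemma cauchy_op_mass_le_2:
 assumes p: "1 < p" "p \<le> 2"
 obtains K :: real where "0 < K"
  "\<And>f y. [|f \<in> borel_measurable borel; lp_mass p f < \<infinity>; 0 < y|] ==> lp_mass p (cauchy_op y f) \<le> ennreal K * lp_mass p f"
proof -
 obtain K where K: "0 \<le> K"
  "\<And>f M y. [|continuous_on UNIV f; \<And>x. M < \<bar>x\<bar> ==> f x = 0; 0 < y|] ==> lp_mass p (cauchy_op y f) \<le> ennreal K * lp_mass p f"
  using cauchy_op_mass_continuous[OF p] by metis
 show ?thesis
 proof (rule that)
  show "0 < (K + 1) * (2 powr p * 2)" using K by simp
  fix f y assume f[measurable]: "borel_fun f" and fin: "lp_mass p f < \<infinity>" and y: "0 < (y::real)"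
  obtain F L where F: "\<And>n. continuous_on UNIV (F n)" "\<And>n x. L n < \<bar>x\<bar> ==> F n x = 0" "lp_conv p F f"
   "\<And>n. lp_mass p (F n) \<le> ennreal (2 powr p) * (lp_mass p f + lp_mass p f)"
   using lp_dense_continuous_sequence[OF f p(1) fin] by metis
  have Fm[measurable]: "borel_fun (F n)" for n by (intro borel_measurable_continuous_onI F)
  have Ff: "lp_mass p (F n) < \<infinity>" for n using F(1,2) p by (intro lp_mass_continuous_finite) auto
  show "lp_mass p (cauchy_op y f) \<le> ennreal ((K + 1) * (2 powr p * 2)) * lp_mass p f"
  proof (rule lp_mass_Fatou[where F="\<lambda>n. cauchy_op y (F n)"])
   show "AE x in lborel. (\<lambda>n. cauchy_op y (F n) x) \<longlonglongrightarrow> cauchy_op y f x"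
    by (intro AE_I2 cauchy_op_tendsto[OF Fm f p(1) Ff fin y F(3)])
   fix n
   have "lp_mass p (cauchy_op y (F n)) \<le> ennreal K * lp_mass p (F n)" by (rule K(2)[OF F(1,2) y])
   also have "\<dots> \<le> ennreal (K + 1) * (ennreal (2 powr p) * (lp_mass p f + lp_mass p f))"
    using K by (intro mult_mono F(4) ennreal_leI) auto
   also have "\<dots> = ennreal ((K + 1) * (2 powr p * 2)) * lp_mass p f"
    using K by (simp add: ennreal_mult mult_2[symmetric] mult_ac)
   finally show "lp_mass p (cauchy_op y (F n)) \<le> ennreal ((K + 1) * (2 powr p * 2)) * lp_mass p f" .
  qed (use p in auto)
 qed
qed


section \<open>Duality for exponents above 2\<close>

lemma borel_measurable_cnj [measurable (raw)]:
 "f \<in> borel_measurable M ==> (\<lambda>x. cnj (f x)) \<in> borel_measurable M"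
 by (rule measurable_compose[OF _ borel_measurable_continuous_onI]) (auto intro: continuous_intros)

text \<open>Pair the transform with the function that realises its norm and move the kernel to the
  other side: by \<open>cker_uminus\<close> the adjoint is again a Cauchy integral up to
  conjugation, bounded in the conjugate exponent. With X the mass of the transform this gives X^p
  \<le> (K X)^(p-1) times the mass of f, and X^(p-1) is cancelled. Truncation to a bounded interval
  makes X finite beforehand.\<close>

lemma cauchy_op_mass_dual:
 assumes p: "1 < p" and q: "q = p / (p - 1)" and K: "0 < K"
  and Kq: "\<And>g y. [|g \<in> borel_measurable borel; lp_mass q g < \<infinity>; 0 < y|] ==> lp_mass q (cauchy_op y g) \<le> ennreal K * lp_mass q g"
  and f[measurable]: "borel_fun f" and fin: "lp_mass p f < \<infinity>" and y: "0 < y"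
 shows "lp_mass p (cauchy_op y f) \<le> ennreal (K powr (p - 1)) * lp_mass p f"
proof -
 define \<Psi> where "\<Psi> = cauchy_op y f"
 have \<Psi>m[measurable]: "\<Psi> \<in> borel_measurable borel" unfolding \<Psi>_def by measurable
 have q1: "1 < q" "(p - 1) * q = p" using p by (auto simp: q field_simps)
 obtain b where b: "0 \<le> b" "ennreal (cker_const p y powr (p - 1)) * lp_mass p f = ennreal b"
 proof -
  have "ennreal (cker_const p y powr (p - 1)) * lp_mass p f < \<infinity>" using fin by (simp add: ennreal_mult_less_top)
  then show ?thesis using that by (cases "ennreal (cker_const p y powr (p - 1)) * lp_mass p f") auto
 qed
 have \<Psi>b: "norm (\<Psi> x) powr p \<le> b" for x
  using cauchy_op_bound[OF f p fin y, of x] b by (simp add: \<Psi>_def ennreal_le_iff)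
 have trunc: "lp_mass p (\<lambda>x. indicator {- real n..real n} x *\<^sub>R \<Psi> x) \<le> ennreal (K powr (p - 1)) * lp_mass p f" for n
 proof -
  let ?I = "indicator {- real n..real n} :: real => real"
  \<comment> \<open>The extremal function for the norm: on the interval both its product with \<Psi>
    and the power |g|^q equal |\<Psi>|^p, the latter since (p-1) q = p.\<close>
  define g where "g x = ?I x *\<^sub>R (of_real (norm (\<Psi> x) powr (p - 2)) * cnj (\<Psi> x))" for x
  have gm[measurable]: "borel_fun g" unfolding g_def[abs_def] by measurable
  have norm_g: "norm (g x) = ?I x * norm (\<Psi> x) powr (p - 1)" for x
  proof -
   have "norm (\<Psi> x) powr (p - 2) * norm (\<Psi> x) = norm (\<Psi> x) powr (p - 1)"
   proof (cases "\<Psi> x = 0")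
    case False
    then have "norm (\<Psi> x) powr (p - 2) * norm (\<Psi> x) powr 1 = norm (\<Psi> x) powr (p - 1)"
     by (simp only: powr_add[symmetric]) simp
    then show ?thesis using False by simp
   qed simp
   then show ?thesis by (simp add: g_def norm_mult)
  qed
  have \<Psi>g: "\<Psi> x * g x = of_real (?I x * norm (\<Psi> x) powr p)" for x
  proof (cases "\<Psi> x = 0")
   case False
   have "\<Psi> x * cnj (\<Psi> x) = of_real (norm (\<Psi> x) ^ 2)" by (simp only: complex_norm_square)
   also have "norm (\<Psi> x) ^ 2 = norm (\<Psi> x) powr 2" using False by (simp add: powr_numeral)
   finally have "\<Psi> x * g x = of_real (?I x * (norm (\<Psi> x) powr (p - 2) * norm (\<Psi> x) powr 2))"
    by (simp add: g_def scaleR_conv_of_real mult_ac)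
   then show ?thesis by (simp only: powr_add[symmetric]) simp
  qed (use p in \<open>simp add: g_def\<close>)
  define X where "X = lp_mass p (\<lambda>x. ?I x *\<^sub>R \<Psi> x)"
  have X_alt: "X = (NR x. ?I x * norm (\<Psi> x) powr p)"
   unfolding X_def lp_mass_def by (intro nn_integral_cong) (use p in \<open>auto simp: indicator_def\<close>)
  have Xg: "lp_mass q g = X"
   unfolding X_alt lp_mass_def norm_g by (intro nn_integral_cong) (use q1 in \<open>auto simp: indicator_def powr_powr\<close>)
  have bI: "(NN x. ennreal c * indicator {- real n..real n} x) < \<infinity>" for c
   by (subst nn_integral_cmult_indicator) (auto simp: ennreal_mult_less_top)
  have "X \<le> (NN x. ennreal b * indicator {- real n..real n} x)"
   unfolding X_alt by (intro nn_integral_mono) (use \<Psi>b in \<open>auto simp: indicator_def intro!: ennreal_leI\<close>)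
  then have Xfin: "X < \<infinity>" using bI by (rule le_less_trans)
  then obtain X0 where X0: "X = ennreal X0" "0 \<le> X0" by (cases X) auto
  show ?thesis
  proof (cases "X0 = 0")
   case False
   then have X0p: "0 < X0" using X0 by simp
   let ?k = "\<lambda>x s. cker y (x - s)"
   have gL1: "(NR x. norm (g x)) < \<infinity>"
   proof -
    have "(NR x. norm (g x)) \<le> (NN x. ennreal (b powr (1 / p * (p - 1))) * indicator {- real n..real n} x)"
    proof (intro nn_integral_mono)
     fix x
     have "(norm (\<Psi> x) powr p) powr (1 / p * (p - 1)) \<le> b powr (1 / p * (p - 1))"
      using p \<Psi>b by (intro powr_mono2) auto
     then have "norm (\<Psi> x) powr (p - 1) \<le> b powr (1 / p * (p - 1))" using p by (simp add: powr_powr)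
     then show "ennreal (norm (g x)) \<le> ennreal (b powr (1 / p * (p - 1))) * indicator {- real n..real n} x"
      by (auto simp: norm_g indicator_def intro!: ennreal_leI)
    qed
    then show ?thesis using bI by (rule le_less_trans)
   qed
   define c where "c = enn2real (ennreal (b powr (1/p)))"
   \<comment> \<open>Absolute convergence for Fubini: Hoelder bounds the inner integral uniformly in
     x, and g is bounded with bounded support, hence integrable.\<close>
   have int: "integrable (lborel \<Otimes>\<^sub>M lborel) (\<lambda>(x, s). ?k x s * f s * g x)"
   proof (rule integrableI_bounded)
    show "(\<lambda>(x, s). ?k x s * f s * g x) \<in> borel_measurable (lborel \<Otimes>\<^sub>M lborel)"
     unfolding cker_def by measurable
    have km: "borel_fun (\<lambda>s. ?k x s)" for x by measurable
    have H: "(NR s. norm (f s) * norm (?k x s)) \<le> ennreal (b powr (1 / p))" for x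
    proof -
     let ?J = "(NR s. norm (f s) * norm (?k x s))"
     have "?J < \<infinity>" using cker_const[OF p y] p fin
      by (intro Hoelder_finite(3)[where p=p and W="cker_const p y"]) (auto simp: cker_mass_shift)
     then obtain j where j: "?J = ennreal j" "0 \<le> j" by (cases ?J) auto
     have "ennreal (j powr p) \<le> ennreal (cker_const p y powr (p - 1)) * (NR s. norm (f s) powr p)"
      using cker_const[OF p y] p j cker_mass_shift[of "p / (p - 1)" y x]
      by (intro nn_integral_Hoelder[where b="\<lambda>s. norm (?k x s)"]) (auto simp: lp_mass_def)
     then have "j powr p \<le> b" using b by (simp add: lp_mass_def[symmetric] ennreal_le_iff)
     then have "(j powr p) powr (1 / p) \<le> b powr (1 / p)" using p by (intro powr_mono2) auto
     then show ?thesis using p j by (simp add: powr_powr ennreal_leI)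
    qed
    have "(\<integral>\<^sup>+z. ennreal (norm (case z of (x, s) => ?k x s * f s * g x)) \<partial>(lborel \<Otimes>\<^sub>M lborel))
     = (NN x. NR s. norm (?k x s * f s * g x))"
     unfolding cker_def by (subst lborel.nn_integral_fst[symmetric]) auto
    also have "\<dots> = (NN x. (NR s. norm (f s) * norm (?k x s)) * ennreal (norm (g x)))"
     by (intro nn_integral_cong, subst nn_integral_multc[symmetric]) (auto simp: norm_mult ennreal_mult mult_ac)
    also have "\<dots> \<le> (NN x. ennreal (b powr (1 / p)) * ennreal (norm (g x)))"
     by (intro nn_integral_mono mult_right_mono H) auto
    also have "\<dots> = ennreal (b powr (1 / p)) * (NR x. norm (g x))"
     by (rule nn_integral_cmult) measurable
    also have "\<dots> < \<infinity>" using gL1 by (simp add: ennreal_mult_less_top)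
    finally show "(\<integral>\<^sup>+z. ennreal (norm (case z of (x, s) => ?k x s * f s * g x)) \<partial>(lborel \<Otimes>\<^sub>M lborel)) < \<infinity>" .
   qed
   let ?h = "cauchy_op y (\<lambda>x. cnj (g x))"
   have hm[measurable]: "?h \<in> borel_measurable borel" by measurable
   \<comment> \<open>Here the kernel is reversed: conjugation turns \<open>cker\<close> at x - s
     into \<open>cker\<close> at s - x.\<close>
   have inner: "(LBINT x. ?k x s * f s * g x) = f s * cnj (?h s)" for s
   proof -
    have "(LBINT x. ?k x s * f s * g x) = (LBINT x. f s * cnj (cker y (s - x) * cnj (g x)))"
     using cker_uminus[of y "_ - s"] by (intro Bochner_Integration.integral_cong) (auto simp flip: cker_uminus)
    then show ?thesis by (simp add: cauchy_op_def del: complex_cnj_mult)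
   qed
   have "complex_of_real X0 = (LBINT x. \<Psi> x * g x)"
    unfolding \<Psi>g using X0 unfolding X_alt
    by (subst integral_complex_of_real) (auto simp: integral_eq_nn_integral)
   also have "\<dots> = (LBINT x. LBINT s. ?k x s * f s * g x)"
    unfolding \<Psi>_def cauchy_op_def by simp
   also have "\<dots> = (LBINT s. LBINT x. ?k x s * f s * g x)"
    using lborel_pair.Fubini_integral[OF int] by simp
   also have "\<dots> = (LBINT s. f s * cnj (?h s))" by (simp only: inner)
   finally have X0eq: "complex_of_real X0 = (LBINT s. f s * cnj (?h s))" .
   have "ennreal X0 \<le> (NR s. norm (f s) * norm (?h s))"
   proof (cases "integrable lborel (\<lambda>s. f s * cnj (?h s))")
    case True
    from integral_norm_bound_ennreal[OF this] show ?thesis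
     using X0 by (simp add: X0eq[symmetric] norm_mult)
   next
    case False
    then have "complex_of_real X0 = 0" unfolding X0eq by (rule not_integrable_integral_eq)
    then show ?thesis by simp
   qed
   moreover have "lp_mass q ?h \<le> ennreal (K * X0)"
   proof -
    have e: "lp_mass q (\<lambda>x. cnj (g x)) = X" using Xg by (simp add: lp_mass_def)
    have "lp_mass q ?h \<le> ennreal K * lp_mass q (\<lambda>x. cnj (g x))"
     by (rule Kq) (use y Xfin e in auto)
    then show ?thesis using e X0 K by (simp add: ennreal_mult)
   qed
   ultimately have "ennreal (X0 powr p) \<le> ennreal ((K * X0) powr (p - 1)) * (NR s. norm (f s) powr p)"
    using p K X0p by (intro nn_integral_Hoelder[where b="\<lambda>s. norm (?h s)"]) (auto simp: lp_mass_def q)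
   also have "ennreal ((K * X0) powr (p - 1)) = ennreal (X0 powr (p - 1)) * ennreal (K powr (p - 1))"
    using K X0p by (simp add: powr_mult ennreal_mult mult.commute)
   finally have *: "ennreal (X0 powr p) \<le> ennreal (X0 powr (p - 1)) * ennreal (K powr (p - 1)) * (NR s. norm (f s) powr p)" .
   have "ennreal (X0 powr (p - 1)) * ennreal X0 \<le> ennreal (X0 powr (p - 1)) * (ennreal (K powr (p - 1)) * lp_mass p f)"
   proof -
    have "ennreal (X0 powr (p - 1)) * ennreal X0 = ennreal (X0 powr p)"
     using X0p by (simp add: ennreal_mult[symmetric] powr_diff)
    then show ?thesis using * by (simp only: lp_mass_def mult.assoc)
   qed
   \<comment> \<open>Cancellation of X0^(p-1), legitimate because X0 is positive and finite.\<close>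
   then have "ennreal X0 \<le> ennreal (K powr (p - 1)) * lp_mass p f"
    using X0p by (subst (asm) ennreal_mult_le_mult_iff) auto
   then show ?thesis using X0 by (simp add: X_def[symmetric])
  qed (use X0 in \<open>simp add: X_def[symmetric]\<close>)
 qed
 show ?thesis
 proof (rule lp_mass_Fatou[where F = "\<lambda>n x. indicator {- real n..real n} x *\<^sub>R cauchy_op y f x"])
  show "AE x in lborel. (\<lambda>n. indicator {- real n..real n} x *\<^sub>R cauchy_op y f x) \<longlonglongrightarrow> cauchy_op y f x"
  proof (rule AE_I2)
   fix x :: real
   obtain k :: nat where k: "\<bar>x\<bar> \<le> real k" using real_arch_simple by blast
   have "\<forall>\<^sub>F n in sequentially. indicator {- real n..real n} x *\<^sub>R cauchy_op y f x = cauchy_op y f x"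
    by (rule eventually_sequentiallyI[of k]) (use k in \<open>auto simp: indicator_def\<close>)
   then show "(\<lambda>n. indicator {- real n..real n} x *\<^sub>R cauchy_op y f x) \<longlonglongrightarrow> cauchy_op y f x"
    by (rule tendsto_eventually)
  qed
 qed (use p trunc in \<open>auto simp: \<Psi>_def\<close>)
qed

text \<open>Exponents above 2 have a conjugate exponent below 2. The constant serves all heights y
  at once, and this uniformity is what permits the limit y to 0.\<close>

theorem cauchy_op_mass:
 assumes p: "1 < p"
 obtains K :: real where "0 < K"
  "\<And>f y. [|f \<in> borel_measurable borel; lp_mass p f < \<infinity>; 0 < y|] ==> lp_mass p (cauchy_op y f) \<le> ennreal K * lp_mass p f"
proof (cases "p \<le> 2")
 case True
 with p that show ?thesis using cauchy_op_mass_le_2 by metis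
next
 case False
 define q where "q = p / (p - 1)"
 have q: "1 < q" "q \<le> 2" using False by (auto simp: q_def field_simps)
 obtain K where K: "0 < K"
  "\<And>f y. [|f \<in> borel_measurable borel; lp_mass q f < \<infinity>; 0 < y|] ==> lp_mass q (cauchy_op y f) \<le> ennreal K * lp_mass q f"
  using cauchy_op_mass_le_2[OF q] by metis
 show ?thesis
  by (rule that[of "K powr (p - 1)"]) (use K in \<open>auto intro!: cauchy_op_mass_dual[OF p q_def K]\<close>)
qed

section \<open>Composition of Cauchy and Poisson integrals\<close>

lemma integral_interval_tendsto:
 fixes g :: "real => complex"
 assumes g: "integrable lborel g" and c: "continuous_on UNIV g"
 shows "(\<lambda>n. integral {- real n..real n} g) \<longlonglongrightarrow> integral\<^sup>L lborel g"
proof -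
 have "(\<lambda>n. LBINT x. indicator {- real n..real n} x *\<^sub>R g x) \<longlonglongrightarrow> integral\<^sup>L lborel g"
 proof (rule integral_dominated_convergence[where w="\<lambda>x. norm (g x)"])
  show "AE x in lborel. (\<lambda>n. indicator {- real n..real n} x *\<^sub>R g x) \<longlonglongrightarrow> g x"
  proof (rule AE_I2)
   fix x :: real
   obtain k :: nat where k: "\<bar>x\<bar> \<le> real k" using real_arch_simple by blast
   have "\<forall>\<^sub>F n in sequentially. indicator {- real n..real n} x *\<^sub>R g x = g x"
    by (rule eventually_sequentiallyI[of k]) (use k in \<open>auto simp: indicator_def\<close>)
   then show "(\<lambda>n. indicator {- real n..real n} x *\<^sub>R g x) \<longlonglongrightarrow> g x"
    by (rule tendsto_eventually)
  qed
 qed (use g borel_measurable_integrable[OF g] in \<open>auto simp: indicator_def\<close>)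
 moreover have "(LBINT x. indicator {a..b} x *\<^sub>R g x) = integral {a..b} g" for a b :: real
 proof -
  have "set_integrable lborel {a..b} g"
   by (rule borel_integrable_atLeastAtMost') (rule continuous_on_subset[OF c], auto)
  from set_borel_integral_eq_integral(2)[OF this] show ?thesis by (simp add: set_lebesgue_integral_def)
 qed
 ultimately show ?thesis by simp
qed

lemma pker_le_cauchy:
 assumes "0 < y" shows "pker y x \<le> norm (cker y x)"
 using complex_Re_le_cmod[of "cker y x"] by (simp add: Re_cker)

lemma integral_pker:
 assumes y: "0 < y"
 shows "integrable lborel (pker y)" "integral\<^sup>L lborel (pker y) = 1"
proof -
 show i: "integrable lborel (pker y)"
  using nn_integral_pker[OF y] pker_nonneg[OF y] by (intro integrableI_bounded) auto
 show "integral\<^sup>L lborel (pker y) = 1"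
  using nn_integral_pker[OF y] pker_nonneg[OF y] by (subst integral_eq_nn_integral) auto
qed

text \<open>In the variable t the Poisson kernel has poles at v and -v, where v = i d. Subtracting
  from the Cauchy factor its value at t = v cancels the pole in the upper half plane, leaving poles
  at -v and -w only, both in the lower half plane.\<close>

lemma half_plane_mean_value_identity:
 fixes t d x y :: real
 assumes d: "0 < d" and y: "0 < y"
 defines "w \<equiv> of_real x + \<i> * of_real y :: complex" and "v \<equiv> \<i> * of_real d :: complex"
 shows "(cker y (x + t) - cker (y + d) x) * of_real (pker d t) =
   - (\<i> * of_real d / (of_real pi * of_real pi * (v + w))) / ((of_real t + w) * (of_real t + v))"
proof -
 have n1: "of_real t + w \<noteq> 0" using y by (auto simp: w_def complex_eq_iff)
 have n2: "v + w \<noteq> 0" using y d by (auto simp: w_def v_def complex_eq_iff)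
 have n3: "of_real t + v \<noteq> 0" "of_real t - v \<noteq> 0" using d by (auto simp: v_def complex_eq_iff)
 have k1: "cker y (x + t) = \<i> / (of_real pi * (of_real t + w))"
  by (simp add: cker_def w_def add_ac)
 have k2: "cker (y + d) x = \<i> / (of_real pi * (v + w))"
  by (simp add: cker_def w_def v_def algebra_simps)
 have "of_real (t\<^sup>2 + d\<^sup>2) = (of_real t + v) * (of_real t - v)"
  by (simp add: v_def algebra_simps power2_eq_square)
 then have k3: "of_real (pker d t) = of_real d / (of_real pi * ((of_real t + v) * (of_real t - v)))"
  by (simp add: pker_def)
 have e: "cker y (x + t) - cker (y + d) x = \<i> * (v - of_real t) / (of_real pi * ((of_real t + w) * (v + w)))"
  unfolding k1 k2 using n1 n2 by (simp add: divide_simps) (simp add: algebra_simps)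
 show ?thesis unfolding e k3 using n1 n2 n3 by (simp add: divide_simps) (simp add: algebra_simps)
qed

lemma cker_nz: "0 < y ==> of_real pi * (of_real x + \<i> * of_real y) \<noteq> (0::complex)"
 by (auto simp: complex_eq_iff)

lemma continuous_cker:
 assumes "0 < y" shows "continuous_on S (\<lambda>t. cker y (x + t))"
 unfolding cker_def using cker_nz[OF assms, of "x + _"] by (intro continuous_intros) auto

lemma continuous_pker:
 assumes "0 < y" shows "continuous_on S (pker y)"
proof -
 have "continuous_on S (\<lambda>t. Re (cker y (0 + t)))" by (intro continuous_intros continuous_cker assms)
 then show ?thesis by (simp add: Re_cker)
qed

text \<open>The Poisson integral reproduces a function holomorphic and decaying in the upper half
  plane, here at the point i d. After subtraction of the value there the integrand is holomorphic
  near the closed half plane and O(|z|^(-2)), so half discs show that its integral is zero.\<close>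

lemma cauchy_poisson_convolution:
 assumes y: "0 < y" and d: "0 < d"
 shows "(LBINT t. cker y (x + t) * of_real (pker d t)) = cker (y + d) x"
proof -
 define w v :: complex where "w = of_real x + \<i> * of_real y" and "v = \<i> * of_real d"
 define c where "c = - (\<i> * of_real d / (of_real pi * of_real pi * (v + w)))"
 define h where "h z = c / ((z + w) * (z + v))" for z
 define g where "g t = (cker y (x + t) - cker (y + d) x) * of_real (pker d t)" for t
 have gh: "g t = h (of_real t)" for t
  unfolding g_def h_def c_def w_def v_def by (rule half_plane_mean_value_identity[OF d y])
 \<comment> \<open>The poles -w and -v have imaginary parts -y and -d.\<close>
 define m where "m = min y d"
 have m: "0 < m" using y d by (simp add: m_def)
 have nz: "z + w \<noteq> 0" "z + v \<noteq> 0" if "- m < Im z" for z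
 proof -
  have "Im (z + w) > 0" "Im (z + v) > 0" using that by (auto simp: w_def v_def m_def)
  then show "z + w \<noteq> 0" "z + v \<noteq> 0" by (metis less_irrefl zero_complex.simps(2))+
 qed
 have hhol: "h holomorphic_on {z. - m < Im z}"
  unfolding h_def using nz by (intro holomorphic_intros) auto
 have Pi: "integrable lborel (\<lambda>t. complex_of_real (pker d t))"
  using integral_pker(1)[OF d] by simp
 have kP: "integrable lborel (\<lambda>t. cker y (x + t) * of_real (pker d t))"
 proof (rule Bochner_Integration.integrable_bound)
  show "integrable lborel (\<lambda>t. 1 / y * pker d t)" using integral_pker(1)[OF d] by simp
  show "(\<lambda>t. cker y (x + t) * of_real (pker d t)) \<in> borel_measurable lborel" by measurable
  have "norm (cker y (x + t) * complex_of_real (pker d t)) \<le> 1 / y * norm (pker d t)" for t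
   unfolding norm_mult norm_of_real real_norm_def by (intro mult_right_mono norm_cker_le'[OF y]) auto
  then show "AE t in lborel. norm (cker y (x + t) * complex_of_real (pker d t)) \<le> norm (1 / y * pker d t)"
   using y by (auto simp: abs_mult)
 qed
 have gi: "integrable lborel g"
  unfolding g_def[abs_def] left_diff_distrib using kP Pi by auto
 have gc: "continuous_on UNIV g"
  unfolding g_def[abs_def] by (intro continuous_intros continuous_cker continuous_pker y d)
 have "(\<lambda>n. integral {- real n..real n} g) \<longlonglongrightarrow> 0"
 proof (rule Lim_null_comparison)
  have "(\<lambda>n. 4 * norm c * pi * inverse (real n)) \<longlonglongrightarrow> 4 * norm c * pi * 0"
   by (intro tendsto_intros LIMSEQ_inverse_real_of_nat[THEN LIMSEQ_imp_Suc[rotated, of "\<lambda>n. inverse (real n)"], simplified]) 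
  then show "(\<lambda>n. 4 * norm c * pi * inverse (real n)) \<longlonglongrightarrow> 0" by simp
  obtain k :: nat where k: "2 * norm w + 2 * norm v + 1 \<le> real k" using real_arch_simple by blast
  show "\<forall>\<^sub>F n in sequentially. norm (integral {- real n..real n} g) \<le> 4 * norm c * pi * inverse (real n)"
  proof (rule eventually_sequentiallyI)
   fix n assume n: "k \<le> n"
   define R where "R = real n"
   have R: "2 * norm w + 2 * norm v + 1 \<le> R" using n k by (simp add: R_def)
   then have R0: "0 < R" using norm_ge_zero[of w] norm_ge_zero[of v] by linarith
   have "norm (integral {-R..R} (\<lambda>x. h (of_real x))) \<le> norm c / (R / 2 * (R / 2)) * R * pi"
   proof (rule half_disc_bound[OF hhol m R0])
    fix z :: complex assume z: "norm z = R"
    have "R / 2 \<le> norm (z + w)" using norm_diff_ineq[of z w] z R norm_ge_zero[of v] by linarith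
    moreover have "R / 2 \<le> norm (z + v)" using norm_diff_ineq[of z v] z R norm_ge_zero[of w] by linarith
    ultimately have le: "R / 2 * (R / 2) \<le> norm (z + w) * norm (z + v)" using R0 by (intro mult_mono) auto
    have pos: "0 < R / 2 * (R / 2)" using R0 by simp
    show "norm (h z) \<le> norm c / (R / 2 * (R / 2))"
     unfolding h_def norm_divide norm_mult
     by (rule divide_left_mono[OF le norm_ge_zero mult_pos_pos[OF less_le_trans[OF pos le] pos]])
   qed (use R0 in auto)
   also have "norm c / (R / 2 * (R / 2)) * R * pi = 4 * norm c * pi * inverse R"
    using R0 by (simp add: field_simps)
   finally show "norm (integral {- real n..real n} g) \<le> 4 * norm c * pi * inverse (real n)"
    by (simp add: gh[abs_def, symmetric] R_def fun_eq_iff[symmetric] gh)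
  qed
 qed
 with integral_interval_tendsto[OF gi gc] have "integral\<^sup>L lborel g = 0" by (rule LIMSEQ_unique)
 moreover have "integral\<^sup>L lborel g = (LBINT t. cker y (x + t) * of_real (pker d t))
   - cker (y + d) x * (LBINT t. complex_of_real (pker d t))"
  unfolding g_def[abs_def] left_diff_distrib using kP Pi by simp
 moreover have "(LBINT t. complex_of_real (pker d t)) = 1"
  using integral_pker[OF d] by simp
 ultimately show ?thesis by simp
qed

lemma convolution_assoc:
 fixes a b f :: "real => complex"
 assumes [measurable]: "borel_fun a" "borel_fun b" "borel_fun f"
  and fin: "(NN t. NR s. norm (a (x - t)) * (norm (b (t - s)) * norm (f s))) < \<infinity>"
 shows "(LBINT t. a (x - t) * (LBINT s. b (t - s) * f s)) = (LBINT s. (LBINT t. a (x - t) * b (t - s)) * f s)"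
proof -
 have int: "integrable (lborel \<Otimes>\<^sub>M lborel) (\<lambda>(t, s). a (x - t) * (b (t - s) * f s))"
 proof (rule integrableI_bounded)
  have "(\<integral>\<^sup>+z. ennreal (norm (case z of (t, s) => a (x - t) * (b (t - s) * f s))) \<partial>(lborel \<Otimes>\<^sub>M lborel))
   = (NN t. NR s. norm (a (x - t)) * (norm (b (t - s)) * norm (f s)))"
   by (subst lborel.nn_integral_fst[symmetric]) (auto simp: norm_mult)
  then show "(\<integral>\<^sup>+z. ennreal (norm (case z of (t, s) => a (x - t) * (b (t - s) * f s))) \<partial>(lborel \<Otimes>\<^sub>M lborel)) < \<infinity>"
   using fin by simp
 qed measurable
 have "(LBINT t. a (x - t) * (LBINT s. b (t - s) * f s)) = (LBINT t. LBINT s. a (x - t) * (b (t - s) * f s))"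
  by simp
 also have "\<dots> = (LBINT s. LBINT t. a (x - t) * (b (t - s) * f s))"
  using lborel_pair.Fubini_integral[OF int] by simp
 also have "\<dots> = (LBINT s. (LBINT t. a (x - t) * b (t - s)) * f s)"
  by (simp add: mult.assoc[symmetric])
 finally show ?thesis .
qed

lemma poisson_op_alt: "poisson_op y f x = (LBINT s. of_real (pker y (x - s)) * f s)"
 by (simp add: poisson_op_def scaleR_conv_of_real)

lemma nn_integral_kernel_bound:
 assumes f[measurable]: "borel_fun f" and p: "1 < p" and fin: "lp_mass p f < \<infinity>" and y: "0 < y"
 obtains B :: real where "0 \<le> B" "\<And>x. (NR s. norm (cker y (x - s)) * norm (f s)) \<le> ennreal B"
proof -
 obtain b where b: "0 \<le> b" "ennreal (cker_const p y powr (p - 1)) * lp_mass p f = ennreal b"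
 proof -
  have "ennreal (cker_const p y powr (p - 1)) * lp_mass p f < \<infinity>" using fin by (simp add: ennreal_mult_less_top)
  then show ?thesis using that by (cases "ennreal (cker_const p y powr (p - 1)) * lp_mass p f") auto
 qed
 show ?thesis
 proof (rule that)
  fix x
  let ?k = "\<lambda>s. cker y (x - s)"
  let ?J = "(NR s. norm (f s) * norm (?k s))"
  have "?J < \<infinity>" using cker_const[OF p y] p fin
   by (intro Hoelder_finite(3)[where p=p and W="cker_const p y"]) (auto simp: cker_mass_shift)
  then obtain j where j: "?J = ennreal j" "0 \<le> j" by (cases ?J) auto
  have "ennreal (j powr p) \<le> ennreal (cker_const p y powr (p - 1)) * (NR s. norm (f s) powr p)"
   using cker_const[OF p y] p j cker_mass_shift[of "p / (p - 1)" y x]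
   by (intro nn_integral_Hoelder[where b="\<lambda>s. norm (?k s)"]) (auto simp: lp_mass_def)
  then have "j powr p \<le> b" using b by (simp add: lp_mass_def[symmetric] ennreal_le_iff)
  then have "(j powr p) powr (1 / p) \<le> b powr (1 / p)" using p by (intro powr_mono2) auto
  then show "(NR s. norm (?k s) * norm (f s)) \<le> ennreal (b powr (1 / p))"
   using p j by (simp add: powr_powr ennreal_leI mult.commute)
 qed auto
qed

lemma poisson_op_measurable [measurable]:
 assumes [measurable]: "borel_fun f"
 shows "borel_fun (poisson_op y f)"
 unfolding poisson_op_def[abs_def] pker_def by measurable

lemma poisson_op_integrable:
 assumes [measurable]: "borel_fun f" and "1 < p" "lp_mass p f < \<infinity>" "0 < y"
 shows "integrable lborel (\<lambda>s. of_real (pker y (x - s)) * f s)"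
proof (rule Bochner_Integration.integrable_bound[OF cauchy_op_integrable[OF assms]])
 show "AE s in lborel. norm (complex_of_real (pker y (x - s)) * f s) \<le> norm (cker y (x - s) * f s)"
  using pker_le_cauchy[OF assms(4)] pker_nonneg[OF assms(4)]
  by (auto simp: norm_mult intro!: mult_right_mono)
qed measurable

lemma poisson_mass_le:
 assumes "borel_fun f" "1 < p" "0 < y"
 shows "lp_mass p (poisson_op y f) \<le> lp_mass p f"
 using poisson_op_mass[OF assms] by (simp add: lp_mass_def)

text \<open>Associativity of convolution, reduced to the kernel identity. Absolute convergence: the
  Poisson integral of |f| is again in L^p and pairs with the Cauchy kernel by Hoelder.\<close>

lemma cauchy_op_poisson_op:
 assumes f[measurable]: "borel_fun f" and p: "1 < p" and fin: "lp_mass p f < \<infinity>" and y: "0 < y" and d: "0 < d"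
 shows "cauchy_op y (poisson_op d f) x = cauchy_op (y + d) f x"
proof -
 let ?P = "\<lambda>t. complex_of_real (pker d t)"
 have "(NN t. NR s. norm (cker y (x - t)) * (norm (?P (t - s)) * norm (f s))) < \<infinity>"
 proof -
  define F where "F = (\<lambda>s. complex_of_real (norm (f s)))"
  have Fm[measurable]: "borel_fun F" and Ff: "lp_mass p F < \<infinity>"
   using fin by (auto simp: F_def lp_mass_def)
  have Pint: "integrable lborel (\<lambda>s. norm (?P (t - s)) * norm (f s))" for t
   using integrable_norm[OF poisson_op_integrable[OF f p fin d, of t]] by (simp add: norm_mult)
  have "(NR s. norm (cker y (x - t)) * (norm (?P (t - s)) * norm (f s)))
    = ennreal (norm (poisson_op d F t) * norm (cker y (x - t)))" for t
  proof -
   have "(NR s. norm (cker y (x - t)) * (norm (?P (t - s)) * norm (f s)))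
     = ennreal (norm (cker y (x - t))) * (NR s. norm (?P (t - s)) * norm (f s))"
    by (subst nn_integral_cmult[symmetric]) (auto simp: ennreal_mult)
   also have "(NR s. norm (?P (t - s)) * norm (f s)) = ennreal (LBINT s. norm (?P (t - s)) * norm (f s))"
    by (intro nn_integral_eq_integral Pint) auto
   also have "(LBINT s. norm (?P (t - s)) * norm (f s)) = norm (poisson_op d F t)"
   proof -
    have "poisson_op d F t = (LBINT s. complex_of_real (norm (?P (t - s)) * norm (f s)))"
     unfolding poisson_op_alt F_def using pker_nonneg[OF d] by (intro Bochner_Integration.integral_cong) auto
    also have "\<dots> = of_real (LBINT s. norm (?P (t - s)) * norm (f s))" by (rule integral_complex_of_real)
    finally have e: "poisson_op d F t = of_real (LBINT s. norm (?P (t - s)) * norm (f s))" .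
    have "0 \<le> (LBINT s. norm (?P (t - s)) * norm (f s))" by (rule Bochner_Integration.integral_nonneg) auto
    then show ?thesis unfolding e by simp
   qed
   finally show ?thesis by (simp add: ennreal_mult[symmetric] mult.commute)
  qed
  moreover have "(NR t. norm (poisson_op d F t) * norm (cker y (x - t))) < \<infinity>"
   using cker_const[OF p y] p le_less_trans[OF poisson_mass_le[OF Fm p d] Ff]
   by (intro Hoelder_finite(3)[where p=p and W="cker_const p y"]) (auto simp: cker_mass_shift)
  ultimately show ?thesis by simp
 qed
 then have "cauchy_op y (poisson_op d f) x = (LBINT s. (LBINT t. cker y (x - t) * ?P (t - s)) * f s)"
  unfolding cauchy_op_def poisson_op_alt by (intro convolution_assoc) auto
 moreover have "(LBINT t. cker y (x - t) * ?P (t - s)) = cker (y + d) (x - s)" for s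
  using lborel_integral_real_affine[of "-1" "\<lambda>t. cker y (x - t) * ?P (t - s)" s]
   cauchy_poisson_convolution[OF y d, of "x - s"]
  by (simp add: pker_even algebra_simps)
 ultimately show ?thesis by (simp add: cauchy_op_def)
qed

text \<open>The other order of composition has its own absolute convergence argument: the absolute
  Cauchy integral is bounded uniformly in x, and the Poisson kernel has mass 1.\<close>

lemma poisson_op_cauchy_op:
 assumes f[measurable]: "borel_fun f" and p: "1 < p" and fin: "lp_mass p f < \<infinity>" and y: "0 < y" and d: "0 < d"
 shows "poisson_op d (cauchy_op y f) x = cauchy_op (y + d) f x"
proof -
 let ?P = "\<lambda>t. complex_of_real (pker d t)"
 obtain B where B: "0 \<le> B" "\<And>x. (NR s. norm (cker y (x - s)) * norm (f s)) \<le> ennreal B"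
  using nn_integral_kernel_bound[OF f p fin y] by metis
 have "(NN t. NR s. norm (?P (x - t)) * (norm (cker y (t - s)) * norm (f s)))
   = (NN t. ennreal (norm (?P (x - t))) * (NR s. norm (cker y (t - s)) * norm (f s)))"
  by (intro nn_integral_cong, subst nn_integral_cmult[symmetric]) (auto simp: ennreal_mult)
 also have "\<dots> \<le> (NN t. ennreal (norm (?P (x - t))) * ennreal B)"
  by (intro nn_integral_mono mult_left_mono B) auto
 also have "\<dots> = (NR t. pker d (x - t)) * ennreal B"
  using pker_nonneg[OF d] by (subst nn_integral_multc) auto
 also have "(NR t. pker d (x - t)) = 1"
  using nn_integral_reflect_shift[of "\<lambda>s. ennreal (pker d s)" x] nn_integral_pker[OF d] by simp
 also have "1 * ennreal B < \<infinity>" by simp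
 finally have "poisson_op d (cauchy_op y f) x = (LBINT s. (LBINT t. ?P (x - t) * cker y (t - s)) * f s)"
  unfolding cauchy_op_def poisson_op_alt by (intro convolution_assoc) auto
 moreover have "(LBINT t. ?P (x - t) * cker y (t - s)) = cker (y + d) (x - s)" for s
  using lborel_integral_real_affine[of "1" "\<lambda>t. ?P (x - t) * cker y (t - s)" x]
   cauchy_poisson_convolution[OF y d, of "x - s"]
  by (simp add: pker_even algebra_simps)
 ultimately show ?thesis by (simp add: cauchy_op_def)
qed

section \<open>Boundary values of Cauchy integrals\<close>

definition mass_shift_diff :: "real => (real => complex) => real => ennreal" where
 "mass_shift_diff p f h = lp_mass p (\<lambda>x. f (x - h) - f x)"

lemma lp_mass_shift:
 assumes "borel_fun f" shows "lp_mass p (\<lambda>x. f (x - h)) = lp_mass p f"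
 unfolding lp_mass_def using nn_integral_real_affine[of "\<lambda>x. ennreal (norm (f x) powr p)" 1 "-h"] assms by simp

lemma lp_mass_diff_finite:
 assumes "borel_fun f" "borel_fun g" "1 < p" "lp_mass p f < \<infinity>" "lp_mass p g < \<infinity>"
 shows "lp_mass p (\<lambda>x. f x - g x) < \<infinity>"
proof -
 have "lp_mass p (\<lambda>x. f x - g x) \<le> ennreal (2 powr p) * (lp_mass p (\<lambda>x. f x - 0) + lp_mass p (\<lambda>x. 0 - g x))"
  using assms by (intro lp_mass_diff_le) auto
 also have "\<dots> < \<infinity>" using assms by (simp add: ennreal_mult_less_top)
 finally show ?thesis .
qed

lemma pker_substitution:
 assumes [measurable]: "borel_fun \<phi>" and d: "0 < d"
 shows "(NN s. ennreal (pker d (x - s)) * \<phi> s) = (NN v. ennreal (pker 1 v) * \<phi> (x - d * v))"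
proof -
 have k: "d * pker d (d * v) = pker 1 v" for v
 proof -
  have "(d * v)\<^sup>2 + d\<^sup>2 = d * d * (v\<^sup>2 + 1)" by (simp add: power2_eq_square algebra_simps)
  then show ?thesis using d by (simp add: pker_def)
 qed
 have "(NN s. ennreal (pker d (x - s)) * \<phi> s)
  = ennreal d * (NN v. ennreal (pker d (d * v)) * \<phi> (x - d * v))"
  using nn_integral_real_affine[of "\<lambda>s. ennreal (pker d (x - s)) * \<phi> s" "-d" x] d by simp
 also have "\<dots> = (NN v. ennreal (d * pker d (d * v)) * \<phi> (x - d * v))"
  using d pker_nonneg[OF d] by (subst nn_integral_cmult[symmetric]) (auto simp: ennreal_mult mult.assoc)
 finally show ?thesis by (simp add: k)
qed

text \<open>Jensen for the probability density \<open>pker d\<close>, applied to f(s) - f(x).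
  Substituting s = x - d v makes the kernel independent of d, so that dominated convergence can act
  on the translation differences.\<close>

lemma poisson_op_diff_mass:
 assumes f[measurable]: "borel_fun f" and p: "1 < p" and fin: "lp_mass p f < \<infinity>" and d: "0 < d"
 shows "lp_mass p (\<lambda>x. poisson_op d f x - f x) \<le> (NN v. ennreal (pker 1 v) * mass_shift_diff p f (d * v))"
proof -
 have "ennreal (norm (poisson_op d f x - f x) powr p) \<le> (NR s. pker d (x - s) * norm (f s - f x) powr p)" for x
 proof -
  have P1: "(NR s. pker d (x - s)) = 1"
   using nn_integral_reflect_shift[of "\<lambda>s. ennreal (pker d s)" x] nn_integral_pker[OF d] by simp
  then have Pi: "integrable lborel (\<lambda>s. complex_of_real (pker d (x - s)))"
   using pker_nonneg[OF d] by (intro integrableI_bounded) auto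
  have Pone: "(LBINT s. complex_of_real (pker d (x - s))) = 1"
   using P1 pker_nonneg[OF d] by (simp add: integral_complex_of_real integral_eq_nn_integral)
  have i: "integrable lborel (\<lambda>s. complex_of_real (pker d (x - s)) * (f s - f x))"
   unfolding right_diff_distrib using poisson_op_integrable[OF f p fin d, of x] Pi by auto
  have "poisson_op d f x - f x = (LBINT s. complex_of_real (pker d (x - s)) * (f s - f x))"
   unfolding right_diff_distrib poisson_op_alt using poisson_op_integrable[OF f p fin d, of x] Pi Pone by simp
  then have "ennreal (norm (poisson_op d f x - f x)) \<le> (NR s. pker d (x - s) * norm (f s - f x))"
   using integral_norm_bound_ennreal[OF i] pker_nonneg[OF d] by (simp add: norm_mult)
  then have "ennreal (norm (poisson_op d f x - f x) powr p) \<le> ennreal (1 powr (p - 1)) * (NR s. pker d (x - s) * norm (f s - f x) powr p)"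
   using p pker_nonneg[OF d] P1 by (intro nn_integral_weighted_Jensen) auto
  then show ?thesis by simp
 qed
 also have "(NR s. pker d (x - s) * norm (f s - f x) powr p)
   = (NN v. ennreal (pker 1 v) * ennreal (norm (f (x - d * v) - f x) powr p))" for x
 proof -
  have "(NR s. pker d (x - s) * norm (f s - f x) powr p) = (NN s. ennreal (pker d (x - s)) * ennreal (norm (f s - f x) powr p))"
   using pker_nonneg[OF d] by (intro nn_integral_cong) (simp add: ennreal_mult)
  then show ?thesis using pker_substitution[OF _ d, of "\<lambda>s. ennreal (norm (f s - f x) powr p)" x] by simp
 qed
 finally have "lp_mass p (\<lambda>x. poisson_op d f x - f x)
  \<le> (NN x. NN v. ennreal (pker 1 v) * ennreal (norm (f (x - d * v) - f x) powr p))"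
  unfolding lp_mass_def by (intro nn_integral_mono)
 also have "\<dots> = (NN v. NN x. ennreal (pker 1 v) * ennreal (norm (f (x - d * v) - f x) powr p))"
  by (rule lborel_pair.Fubini'[symmetric]) measurable
 also have "\<dots> = (NN v. ennreal (pker 1 v) * mass_shift_diff p f (d * v))"
  unfolding mass_shift_diff_def lp_mass_def by (intro nn_integral_cong nn_integral_cmult) measurable
 finally show ?thesis .
qed

lemma mass_shift_diff_le:
 assumes f[measurable]: "borel_fun f" and p: "1 < p"
 shows "mass_shift_diff p f h \<le> ennreal (2 powr p) * (lp_mass p f + lp_mass p f)"
proof -
 have "lp_mass p (\<lambda>x. f (x - h) - f x) \<le> ennreal (2 powr p) * (lp_mass p (\<lambda>x. f (x - h) - 0) + lp_mass p (\<lambda>x. 0 - f x))"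
  by (rule lp_mass_diff_le) (use p in auto)
 then show ?thesis by (simp add: mass_shift_diff_def lp_mass_shift)
qed

text \<open>Continuity gives the pointwise limit; a bound for f and a bound H for the shifts, which
  keeps all supports in one interval, give the majorant.\<close>

lemma mass_shift_diff_tendsto_0:
 fixes f :: "real => complex"
 assumes f: "continuous_on UNIV f" and M: "\<And>x. M < \<bar>x\<bar> ==> f x = 0" and p: "1 < p" and h: "h \<longlonglongrightarrow> 0"
 shows "(\<lambda>n. mass_shift_diff p f (h n)) \<longlonglongrightarrow> 0"
proof -
 have [measurable]: "borel_fun f" by (intro borel_measurable_continuous_onI f)
 have "compact (f ` {-M..M})" by (intro compact_continuous_image continuous_on_subset[OF f]) auto
 then obtain B0 where B0: "\<And>x. x \<in> {-M..M} ==> norm (f x) \<le> B0"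
  by (meson bounded_iff compact_imp_bounded imageI)
 define B where "B = max B0 0"
 have B: "norm (f x) \<le> B" "0 \<le> B" for x using B0[of x] M[of x] by (auto simp: B_def abs_le_iff not_less) (smt (verit) norm_zero)
 obtain H where H: "\<And>n. \<bar>h n\<bar> \<le> H"
  using convergent_imp_Bseq[of h] h by (auto simp: convergent_def Bseq_def)
 let ?L = "\<bar>M\<bar> + H"
 have "(\<lambda>n. NR x. norm (f (x - h n) - f x) powr p) \<longlonglongrightarrow> (\<integral>\<^sup>+x. 0 \<partial>(lborel :: real measure))"
 proof (rule nn_integral_dominated_convergence[where w="\<lambda>x. ennreal ((2 * B) powr p) * indicator {- ?L..?L} x"])
  show "AE x in lborel. ennreal (norm (f (x - h n) - f x) powr p) \<le> ennreal ((2 * B) powr p) * indicator {- ?L..?L} x" for n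
  proof (rule AE_I2)
   fix x
   show "ennreal (norm (f (x - h n) - f x) powr p) \<le> ennreal ((2 * B) powr p) * indicator {- ?L..?L} x"
   proof (cases "x \<in> {- ?L..?L}")
    case True
    have "norm (f (x - h n) - f x) \<le> 2 * B" using norm_triangle_ineq4[of "f (x - h n)" "f x"] B(1)[of x] B(1)[of "x - h n"] by linarith
    then have "norm (f (x - h n) - f x) powr p \<le> (2 * B) powr p" using p by (intro powr_mono2) auto
    then show ?thesis using True by (simp add: ennreal_leI)
   next
    case False
    then have "M < \<bar>x\<bar>" "M < \<bar>x - h n\<bar>" using H[of n] by auto
    then show ?thesis using M p by simp
   qed
  qed
  show "(NN x. ennreal ((2 * B) powr p) * indicator {- ?L..?L} x) < \<infinity>"
   by (subst nn_integral_cmult_indicator) (auto simp: ennreal_mult_less_top emeasure_lborel_Icc_eq)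
  show "AE x in lborel. (\<lambda>n. ennreal (norm (f (x - h n) - f x) powr p)) \<longlonglongrightarrow> 0"
  proof (rule AE_I2)
   fix x
   have "(\<lambda>n. f (x - h n)) \<longlonglongrightarrow> f (x - 0)"
    using f by (intro continuous_on_tendsto_compose[OF f] tendsto_intros h) auto
   then have "(\<lambda>n. norm (f (x - h n) - f x) powr p) \<longlonglongrightarrow> norm (f (x - 0) - f x) powr p"
    using p by (intro tendsto_powr2 tendsto_norm tendsto_intros) auto
   then have "(\<lambda>n. ennreal (norm (f (x - h n) - f x) powr p)) \<longlonglongrightarrow> ennreal (norm (f (x - 0) - f x) powr p)"
    by (rule tendsto_ennrealI)
   then show "(\<lambda>n. ennreal (norm (f (x - h n) - f x) powr p)) \<longlonglongrightarrow> 0" using p by simp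
  qed
 qed auto
 then show ?thesis by (simp add: mass_shift_diff_def lp_mass_def)
qed

lemma poisson_op_conv_continuous:
 fixes f :: "real => complex"
 assumes f: "continuous_on UNIV f" and M: "\<And>x. M < \<bar>x\<bar> ==> f x = 0" and p: "1 < p" and d: "d \<longlonglongrightarrow> 0" "\<And>n. 0 < d n"
 shows "lp_conv p (\<lambda>n. poisson_op (d n) f) f"
 unfolding lp_conv_def
proof (rule tendsto_0_le_ennreal)
 have [measurable]: "borel_fun f" by (intro borel_measurable_continuous_onI f)
 have fin: "lp_mass p f < \<infinity>" using f M p by (intro lp_mass_continuous_finite) auto
 show "\<forall>\<^sub>F n in sequentially. lp_mass p (\<lambda>x. poisson_op (d n) f x - f x) \<le> (NN v. ennreal (pker 1 v) * mass_shift_diff p f (d n * v))"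
  using poisson_op_diff_mass[OF _ p fin d(2)] by simp
 define c where "c = ennreal (2 powr p) * (lp_mass p f + lp_mass p f)"
 have c: "c < \<infinity>" using fin by (simp add: c_def ennreal_mult_less_top)
 have m[measurable]: "borel_fun (\<lambda>v. mass_shift_diff p f (e * v))" for e
  unfolding mass_shift_diff_def lp_mass_def by measurable
 have "(\<lambda>n. NN v. ennreal (pker 1 v) * mass_shift_diff p f (d n * v)) \<longlonglongrightarrow> (\<integral>\<^sup>+x. 0 \<partial>(lborel :: real measure))"
 proof (rule nn_integral_dominated_convergence[where w="\<lambda>v. ennreal (pker 1 v) * c"])
  show "AE v in lborel. ennreal (pker 1 v) * mass_shift_diff p f (d n * v) \<le> ennreal (pker 1 v) * c" for n
   unfolding c_def by (intro AE_I2 mult_left_mono mass_shift_diff_le p) auto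
  show "(NN v. ennreal (pker 1 v) * c) < \<infinity>"
   using c nn_integral_pker[of 1] by (subst nn_integral_multc) auto
  show "AE v in lborel. (\<lambda>n. ennreal (pker 1 v) * mass_shift_diff p f (d n * v)) \<longlonglongrightarrow> 0"
  proof (intro AE_I2 tendsto_cmult_0_ennreal mass_shift_diff_tendsto_0[OF f M p])
   fix v
   show "(\<lambda>n. d n * v) \<longlonglongrightarrow> 0" using tendsto_mult_left_zero[OF d(1)] by simp
  qed
 qed auto
 then show "(\<lambda>n. NN v. ennreal (pker 1 v) * mass_shift_diff p f (d n * v)) \<longlonglongrightarrow> 0" by simp
qed

lemma poisson_op_lincomb:
 assumes [measurable]: "borel_fun f" "borel_fun g"
  and "1 < p" "lp_mass p f < \<infinity>" "lp_mass p g < \<infinity>" "0 < y"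
 shows "poisson_op y (\<lambda>s. a * f s + b * g s) x = a * poisson_op y f x + b * poisson_op y g x"
proof -
 have "poisson_op y (\<lambda>s. a * f s + b * g s) x = (LBINT s. a * (of_real (pker y (x - s)) * f s) + b * (of_real (pker y (x - s)) * g s))"
  unfolding poisson_op_alt by (intro Bochner_Integration.integral_cong) (auto simp: algebra_simps)
 then show ?thesis
  unfolding poisson_op_alt using assms poisson_op_integrable[of f p y x] poisson_op_integrable[of g p y x]
  by (simp add: Bochner_Integration.integral_add)
qed

lemma tendsto_0_ennrealI:
 assumes "\<And>e::real. 0 < e ==> \<forall>\<^sub>F x in F. f x \<le> ennreal e" shows "(f \<longlongrightarrow> 0) F"
proof (rule order_tendstoI)
 fix a :: ennreal assume "0 < a"
 then obtain e where e: "0 < e" "ennreal e < a" using ex_ennreal_between_0 by blast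
 show "\<forall>\<^sub>F x in F. f x < a" using assms[OF e(1)] by eventually_elim (use e in auto)
qed auto

lemma poisson_op_conv:
 assumes f[measurable]: "borel_fun f" and p: "1 < p" and fin: "lp_mass p f < \<infinity>"
  and d: "d \<longlonglongrightarrow> 0" "\<And>n. 0 < d n"
 shows "lp_conv p (\<lambda>n. poisson_op (d n) f) f"
 unfolding lp_conv_def
proof (rule tendsto_0_ennrealI)
 fix e :: real assume e: "0 < e"
 \<comment> \<open>The triangle inequality is used twice; the nested factors 2^p of the three errors
   add up to c.\<close>
 define c where "c = 2 powr p + 2 powr p * (2 powr p + 2 powr p)"
 have c: "0 < c" by (simp add: c_def add_pos_pos)
 define e' where "e' = e / c"
 have e': "0 < e'" using e c by (simp add: e'_def)
 obtain g L where g: "continuous_on UNIV g" "\<And>x. L < \<bar>x\<bar> ==> g x = 0" "lp_mass p (\<lambda>x. f x - g x) < ennreal e'"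
  using lp_dense_continuous[OF f p fin e'] by metis
 have gm[measurable]: "borel_fun g" by (intro borel_measurable_continuous_onI g)
 have gf: "lp_mass p g < \<infinity>" using g p by (intro lp_mass_continuous_finite) auto
 have "\<forall>\<^sub>F n in sequentially. lp_mass p (\<lambda>x. poisson_op (d n) g x - g x) < ennreal e'"
  using poisson_op_conv_continuous[OF g(1,2) p d] e' unfolding lp_conv_def by (intro order_tendstoD) auto
 then show "\<forall>\<^sub>F n in sequentially. lp_mass p (\<lambda>x. poisson_op (d n) f x - f x) \<le> ennreal e"
 proof eventually_elim
  case (elim n)
  have "poisson_op (d n) f x - poisson_op (d n) g x = poisson_op (d n) (\<lambda>x. f x - g x) x" for x
   using poisson_op_lincomb[OF f gm p fin gf d(2)[of n], where a=1 and b="-1" and x=x] by simp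
  then have 1: "lp_mass p (\<lambda>x. poisson_op (d n) f x - poisson_op (d n) g x) \<le> ennreal e'"
   using poisson_mass_le[of "\<lambda>x. f x - g x" p "d n"] p d(2) g(3) by simp
  have "lp_mass p (\<lambda>x. poisson_op (d n) f x - f x) \<le> ennreal (2 powr p) * (lp_mass p (\<lambda>x. poisson_op (d n) f x - poisson_op (d n) g x) + lp_mass p (\<lambda>x. poisson_op (d n) g x - f x))"
   by (rule lp_mass_diff_le) (use p in auto)
  also have "\<dots> \<le> ennreal (2 powr p) * (ennreal e' + ennreal (2 powr p) * (lp_mass p (\<lambda>x. poisson_op (d n) g x - g x) + lp_mass p (\<lambda>x. g x - f x)))"
   by (intro mult_left_mono add_mono 1 lp_mass_diff_le) (use p in auto)
  also have "\<dots> \<le> ennreal (2 powr p) * (ennreal e' + ennreal (2 powr p) * (ennreal e' + ennreal e'))"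
   using elim g(3) by (intro mult_left_mono add_mono) (auto simp: lp_mass_minus_commute[of _ g] intro: less_imp_le)
  also have "\<dots> = ennreal e"
  proof -
   have "2 powr p * (e' + 2 powr p * (e' + e')) = c * e'" by (simp add: c_def algebra_simps)
   also have "\<dots> = e" using c by (simp add: e'_def)
   finally show ?thesis
    using e' by (simp add: ennreal_plus[symmetric] ennreal_mult[symmetric] del: ennreal_plus)
  qed
  finally show ?case .
 qed
qed

lemma poisson_op_tendsto_0:
 assumes f[measurable]: "borel_fun f" and p: "1 < p" and fin: "lp_mass p f < \<infinity>"
 shows "((\<lambda>d. lp_mass p (\<lambda>x. poisson_op d f x - f x)) \<longlongrightarrow> 0) (at_right 0)"
 unfolding tendsto_at_iff_sequentially
proof (intro allI impI)
 fix X :: "nat => real" assume X: "\<forall>i. X i \<in> {0<..} - {0}" "X \<longlonglongrightarrow> 0"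
 then show "((\<lambda>d. lp_mass p (\<lambda>x. poisson_op d f x - f x)) \<circ> X) \<longlonglongrightarrow> 0"
  using poisson_op_conv[OF f p fin X(2)] by (auto simp: lp_conv_def o_def)
qed

lemma cauchy_op_finite:
 assumes "borel_fun f" "1 < p" "lp_mass p f < \<infinity>" "0 < y"
 shows "lp_mass p (cauchy_op y f) < \<infinity>"
proof -
 obtain K :: real where "0 < K"
  "\<And>f y. [|f \<in> borel_measurable borel; lp_mass p f < \<infinity>; 0 < y|] ==> lp_mass p (cauchy_op y f) \<le> ennreal K * lp_mass p f"
  using cauchy_op_mass[OF assms(2)] by metis
 then have "lp_mass p (cauchy_op y f) \<le> ennreal K * lp_mass p f" using assms by blast
 also have "\<dots> < \<infinity>" using assms by (simp add: ennreal_mult_less_top)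
 finally show ?thesis .
qed

section \<open>Boundary functions of Cauchy integrals\<close>

text \<open>The limit is taken in norm as the height decreases to 0, so the boundary function is
  determined up to null sets; it stands for f plus the Hilbert transform of f.\<close>

definition is_cauchy_boundary :: "real => (real => complex) => (real => complex) => bool" where
 "is_cauchy_boundary p f g \<longleftrightarrow> g \<in> borel_measurable borel \<and> lp_mass p g < \<infinity> \<and>
   ((\<lambda>y. lp_mass p (\<lambda>x. cauchy_op y f x - g x)) \<longlongrightarrow> 0) (at_right 0)"

text \<open>For a < b the difference of the Cauchy integrals at heights b and a is the Cauchy
  integral at height a of P f - f, with P the Poisson integral at height b - a. The uniform bound
  and the approximate identity make the family Cauchy as the height decreases to 0.\<close>

lemma cauchy_boundary_exists:
 assumes f[measurable]: "borel_fun f" and p: "1 < p" and fin: "lp_mass p f < \<infinity>"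
 shows "\<exists>g. is_cauchy_boundary p f g"
proof -
 obtain K :: real where K: "0 < K"
  "\<And>f y. [|f \<in> borel_measurable borel; lp_mass p f < \<infinity>; 0 < y|] ==> lp_mass p (cauchy_op y f) \<le> ennreal K * lp_mass p f"
  using cauchy_op_mass[OF p] by metis
 have small: "\<exists>d>0. \<forall>a b. 0 < a --> a < d --> 0 < b --> b < d --> lp_mass p (\<lambda>x. cauchy_op a f x - cauchy_op b f x) < ennreal e" if e: "0 < e" for e
 proof -
  have "\<forall>\<^sub>F h in at_right 0. lp_mass p (\<lambda>x. poisson_op h f x - f x) < ennreal (e / K)"
   using poisson_op_tendsto_0[OF f p fin] e K by (intro order_tendstoD) auto
  then obtain d where d: "0 < d" "\<And>h. 0 < h ==> h < d ==> lp_mass p (\<lambda>x. poisson_op h f x - f x) < ennreal (e / K)"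
   by (auto simp: eventually_at_right_field)
  have lt: "lp_mass p (\<lambda>x. cauchy_op b f x - cauchy_op a f x) < ennreal e" if ab: "0 < a" "a < b" "b < d" for a b
  proof -
   define h where "h = b - a"
   have h: "0 < h" "h < d" "b = a + h" using ab by (auto simp: h_def)
   have Pf: "lp_mass p (poisson_op h f) < \<infinity>" using poisson_mass_le[OF f p h(1)] fin by (rule le_less_trans)
   have "cauchy_op b f x - cauchy_op a f x = cauchy_op a (\<lambda>x. poisson_op h f x - f x) x" for x
    using cauchy_op_lincomb[OF poisson_op_measurable[OF f] f p Pf fin ab(1), where a=1 and b="-1" and x=x] cauchy_op_poisson_op[OF f p fin ab(1) h(1), of x] h(3)
    by simp
   then have "lp_mass p (\<lambda>x. cauchy_op b f x - cauchy_op a f x) = lp_mass p (cauchy_op a (\<lambda>x. poisson_op h f x - f x))" by simp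
   also have "\<dots> \<le> ennreal K * lp_mass p (\<lambda>x. poisson_op h f x - f x)"
    by (rule K(2)) (use ab lp_mass_diff_finite[OF _ f p Pf fin] in auto)
   also have "\<dots> < ennreal K * ennreal (e / K)"
    using K d(2)[OF h(1,2)] by (intro ennreal_mult_strict_left_mono) auto
   also have "\<dots> = ennreal e" using K e by (simp add: ennreal_mult[symmetric])
   finally show ?thesis .
  qed
  show ?thesis
  proof (intro exI conjI allI impI)
   show "0 < d" by (rule d)
   fix a b assume ab: "0 < a" "a < d" "0 < b" "b < d"
   consider "a < b" | "b < a" | "a = b" by linarith
   then show "lp_mass p (\<lambda>x. cauchy_op a f x - cauchy_op b f x) < ennreal e"
    by cases (use lt[of a b] lt[of b a] ab e in \<open>auto simp: lp_mass_minus_commute[of p "cauchy_op a f"]\<close>)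
  qed
 qed
 define F where "F n = cauchy_op (inverse (real (Suc n))) f" for n
 have Fm: "borel_fun (F n)" for n unfolding F_def by measurable
 have inv: "\<exists>N. \<forall>n\<ge>N. inverse (real (Suc n)) < d" if "0 < d" for d
  using order_tendstoD(2)[OF LIMSEQ_inverse_real_of_nat that] by (auto simp: eventually_sequentially)
 have "\<exists>N. \<forall>j\<ge>N. \<forall>k\<ge>N. lp_mass p (\<lambda>x. F j x - F k x) < ennreal e" if e0: "0 < e" for e :: real
 proof -
  obtain d where d: "0 < d" "\<And>a b. 0 < a ==> a < d ==> 0 < b ==> b < d ==> lp_mass p (\<lambda>x. cauchy_op a f x - cauchy_op b f x) < ennreal e"
   using small[OF e0] by blast
  from inv[OF d(1)] obtain N where "\<And>n. N \<le> n ==> inverse (real (Suc n)) < d" by blast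
  then show ?thesis unfolding F_def by (intro exI[of _ N] allI impI d(2)) auto
 qed
 from lp_complete[OF Fm p this] obtain g where g: "borel_fun g" "lp_conv p F g" by metis
 note [measurable] = g(1) Fm
 \<comment> \<open>Completeness gave a limit along the heights 1/(n+1) only; the Cauchy property in
   y extends it to all heights.\<close>
 have "((\<lambda>y. lp_mass p (\<lambda>x. cauchy_op y f x - g x)) \<longlongrightarrow> 0) (at_right 0)"
 proof (rule tendsto_0_ennrealI)
  fix e :: real assume e: "0 < e"
  define e' where "e' = e / (2 powr p * 2)"
  have e': "0 < e'" using e by (simp add: e'_def)
  obtain d where d: "0 < d" "\<And>a b. 0 < a ==> a < d ==> 0 < b ==> b < d ==> lp_mass p (\<lambda>x. cauchy_op a f x - cauchy_op b f x) < ennreal e'"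
   using small[OF e'] by blast
  have "\<forall>\<^sub>F n in sequentially. lp_mass p (\<lambda>x. F n x - g x) < ennreal e'"
   using g(2) e' unfolding lp_conv_def by (intro order_tendstoD) auto
  moreover have "\<forall>\<^sub>F n in sequentially. inverse (real (Suc n)) < d"
   using inv[OF d(1)] by (simp add: eventually_sequentially)
  ultimately have "\<forall>\<^sub>F n in sequentially. lp_mass p (\<lambda>x. F n x - g x) < ennreal e' \<and> inverse (real (Suc n)) < d"
   by (rule eventually_conj)
  then obtain n where n: "lp_mass p (\<lambda>x. F n x - g x) < ennreal e'" "inverse (real (Suc n)) < d"
   by (auto simp: eventually_sequentially)
  have "lp_mass p (\<lambda>x. cauchy_op y f x - g x) \<le> ennreal e" if y: "0 < y" "y < d" for y
  proof -
   have "lp_mass p (\<lambda>x. cauchy_op y f x - g x) \<le> ennreal (2 powr p) * (lp_mass p (\<lambda>x. cauchy_op y f x - F n x) + lp_mass p (\<lambda>x. F n x - g x))"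
    by (rule lp_mass_diff_le) (use p in auto)
   also have "\<dots> \<le> ennreal (2 powr p) * (ennreal e' + ennreal e')"
    unfolding F_def using d(2)[OF y, of "inverse (real (Suc n))"] n by (intro mult_left_mono add_mono) (auto simp: F_def less_imp_le)
   also have "\<dots> = ennreal e"
    using e' by (simp add: ennreal_plus[symmetric] ennreal_mult[symmetric] del: ennreal_plus) (simp add: e'_def)
   finally show ?thesis .
  qed
  then show "\<forall>\<^sub>F y in at_right 0. lp_mass p (\<lambda>x. cauchy_op y f x - g x) \<le> ennreal e"
   using d(1) by (auto simp: eventually_at_right_field)
 qed
 moreover have "lp_mass p g < \<infinity>"
 proof -
  have "\<forall>\<^sub>F n in sequentially. lp_mass p (\<lambda>x. F n x - g x) < ennreal 1"
   using g(2) unfolding lp_conv_def by (intro order_tendstoD) auto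
  then obtain n where n: "lp_mass p (\<lambda>x. F n x - g x) < ennreal 1" by (auto simp: eventually_sequentially)
  have "lp_mass p (F n) < \<infinity>" unfolding F_def by (intro cauchy_op_finite f p fin) auto
  moreover have "lp_mass p (\<lambda>x. F n x - g x) < \<infinity>" using n by (rule less_trans) simp
  ultimately have "lp_mass p (\<lambda>x. F n x - (F n x - g x)) < \<infinity>"
   using lp_mass_diff_finite[of "F n" "\<lambda>x. F n x - g x" p] p by simp
  then show ?thesis by simp
 qed
 ultimately show ?thesis using g(1) unfolding is_cauchy_boundary_def by blast
qed

lemma is_cauchy_boundary_conv:
 assumes "is_cauchy_boundary p f g" "d \<longlonglongrightarrow> 0" "\<And>n. 0 < d n"
 shows "lp_conv p (\<lambda>n. cauchy_op (d n) f) g"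
proof -
 have "filterlim d (at_right 0) sequentially"
  using assms(2,3) by (auto simp: filterlim_at intro!: always_eventually) (metis less_irrefl)
 then show ?thesis
  using assms(1) unfolding is_cauchy_boundary_def lp_conv_def
  by (auto intro: filterlim_compose[of "\<lambda>y. lp_mass p (\<lambda>x. cauchy_op y f x - g x)" _ "at_right 0"])
qed

text \<open>The Poisson kernel is the mean of the Cauchy kernel and its conjugate. This lets Poisson
  integrals inherit continuity in the data from Cauchy integrals.\<close>

lemma poisson_op_conv_cauchy:
 assumes f[measurable]: "borel_fun f" and p: "1 < p" and fin: "lp_mass p f < \<infinity>" and y: "0 < y"
 shows "poisson_op y f x = (cauchy_op y f x + cnj (cauchy_op y (\<lambda>s. cnj (f s)) x)) / 2"
proof -
 have cf: "lp_mass p (\<lambda>s. cnj (f s)) < \<infinity>" using fin by (simp add: lp_mass_def)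
 have P: "of_real (pker y u) = (cker y u + cnj (cker y u)) / 2" for u
  by (simp add: complex_add_cnj Re_cker)
 have i2: "integrable lborel (\<lambda>s. cnj (cker y (x - s)) * f s)"
 proof -
  have "integrable lborel (\<lambda>s. cnj (cker y (x - s) * cnj (f s)))"
   using cauchy_op_integrable[OF _ p cf y, of x] by (subst integrable_cnj) auto
  then show ?thesis by simp
 qed
 have "poisson_op y f x = (LBINT s. (cker y (x - s) * f s + cnj (cker y (x - s)) * f s) / 2)"
  unfolding poisson_op_alt P by (intro Bochner_Integration.integral_cong) (auto simp: algebra_simps add_divide_distrib)
 also have "\<dots> = (cauchy_op y f x + (LBINT s. cnj (cker y (x - s)) * f s)) / 2"
  using cauchy_op_integrable[OF f p fin y, of x] i2 by (simp add: cauchy_op_def)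
 also have "(LBINT s. cnj (cker y (x - s)) * f s) = (LBINT s. cnj (cker y (x - s) * cnj (f s)))"
  by simp
 also have "\<dots> = cnj (cauchy_op y (\<lambda>s. cnj (f s)) x)" by (simp add: cauchy_op_def del: complex_cnj_mult)
 finally show ?thesis .
qed

lemma poisson_op_tendsto:
 assumes [measurable]: "\<And>n. borel_fun (F n)" "borel_fun f" and p: "1 < p"
  and fin: "\<And>n. lp_mass p (F n) < \<infinity>" "lp_mass p f < \<infinity>" and y: "0 < y" and conv: "lp_conv p F f"
 shows "(\<lambda>n. poisson_op y (F n) x) \<longlonglongrightarrow> poisson_op y f x"
proof -
 have "(\<lambda>n. cauchy_op y (F n) x) \<longlonglongrightarrow> cauchy_op y f x"
  by (rule cauchy_op_tendsto[OF _ _ p fin y conv]) auto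
 moreover have "(\<lambda>n. cauchy_op y (\<lambda>s. cnj (F n s)) x) \<longlonglongrightarrow> cauchy_op y (\<lambda>s. cnj (f s)) x"
 proof (rule cauchy_op_tendsto[OF _ _ p _ _ y])
  have "norm (cnj a - cnj b) = norm (a - b)" for a b by (metis complex_cnj_diff complex_mod_cnj)
  then show "lp_conv p (\<lambda>n s. cnj (F n s)) (\<lambda>s. cnj (f s))" using conv by (simp add: lp_conv_def lp_mass_def)
 qed (use fin in \<open>auto simp: lp_mass_def\<close>)
 ultimately show ?thesis
  unfolding poisson_op_conv_cauchy[OF assms(2) p fin(2) y] poisson_op_conv_cauchy[OF assms(1) p fin(1) y]
  by (intro tendsto_intros) auto
qed

lemma inverse_Suc_seq: "(\<lambda>n. inverse (real (Suc n))) \<longlonglongrightarrow> 0" "0 < inverse (real (Suc n))"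
 using LIMSEQ_inverse_real_of_nat by auto

text \<open>Cauchy and Poisson integrals at two heights compose, in either order, to the Cauchy
  integral at the sum of the heights; letting the height 1/(n+1) tend to 0 in the two readings gives
  the two sides. Pointwise convergence of Cauchy integrals thereby becomes a question about Poisson
  integrals.\<close>

lemma cauchy_boundary_poisson:
 assumes f[measurable]: "borel_fun f" and p: "1 < p" and fin: "lp_mass p f < \<infinity>"
  and g: "is_cauchy_boundary p f g" and y: "0 < y"
 shows "cauchy_op y f x = poisson_op y g x"
proof -
 note [measurable] = g[unfolded is_cauchy_boundary_def, THEN conjunct1]
 have gf: "lp_mass p g < \<infinity>" using g by (simp add: is_cauchy_boundary_def)
 let ?d = "\<lambda>n. inverse (real (Suc n))"
 have 1: "(\<lambda>n. poisson_op y (cauchy_op (?d n) f) x) \<longlonglongrightarrow> poisson_op y g x"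
  by (rule poisson_op_tendsto[OF _ _ p cauchy_op_finite[OF f p fin inverse_Suc_seq(2)] gf y
     is_cauchy_boundary_conv[OF g inverse_Suc_seq(1,2)]]) auto
 have 2: "(\<lambda>n. cauchy_op y (poisson_op (?d n) f) x) \<longlonglongrightarrow> cauchy_op y f x"
  by (rule cauchy_op_tendsto[OF _ f p _ fin y poisson_op_conv[OF f p fin inverse_Suc_seq(1)]])
    (auto intro!: le_less_trans[OF poisson_mass_le[OF f p]] fin[unfolded infinity_ennreal_def])
 have "poisson_op y (cauchy_op (?d n) f) x = cauchy_op y (poisson_op (?d n) f) x" for n
  using poisson_op_cauchy_op[OF f p fin inverse_Suc_seq(2)[of n] y] cauchy_op_poisson_op[OF f p fin y inverse_Suc_seq(2)[of n]]
  by (simp add: add.commute)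
 with 1 2 show ?thesis using LIMSEQ_unique by fastforce
qed

lemma cauchy_boundary_mass:
 assumes p: "1 < p"
 obtains K :: real where "0 < K"
  "\<And>f g. [|f \<in> borel_measurable borel; lp_mass p f < \<infinity>; is_cauchy_boundary p f g|] ==> lp_mass p g \<le> ennreal K * lp_mass p f"
proof -
 obtain K :: real where K: "0 < K"
  "\<And>f y. [|f \<in> borel_measurable borel; lp_mass p f < \<infinity>; 0 < y|] ==> lp_mass p (cauchy_op y f) \<le> ennreal K * lp_mass p f"
  using cauchy_op_mass[OF p] by metis
 show ?thesis
 proof (rule that)
  show "0 < 2 powr p * K" using K by simp
  fix f g assume f[measurable]: "borel_fun f" and fin: "lp_mass p f < \<infinity>" and g: "is_cauchy_boundary p f g"
  note [measurable] = g[unfolded is_cauchy_boundary_def, THEN conjunct1]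
  let ?d = "\<lambda>n. inverse (real (Suc n))"
  have "(\<lambda>n. ennreal (2 powr p) * (lp_mass p (\<lambda>x. cauchy_op (?d n) f x - g x) + ennreal K * lp_mass p f)) \<longlonglongrightarrow> ennreal (2 powr p) * (0 + ennreal K * lp_mass p f)"
   using is_cauchy_boundary_conv[OF g inverse_Suc_seq(1,2)] unfolding lp_conv_def
   by (intro ennreal_tendsto_cmult tendsto_add tendsto_const) auto
  then have "lp_mass p g \<le> ennreal (2 powr p) * (0 + ennreal K * lp_mass p f)"
  proof (rule LIMSEQ_le_const, intro exI allI impI)
   fix n :: nat
   have "lp_mass p (\<lambda>x. g x - 0) \<le> ennreal (2 powr p) * (lp_mass p (\<lambda>x. g x - cauchy_op (?d n) f x) + lp_mass p (\<lambda>x. cauchy_op (?d n) f x - 0))"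
    by (rule lp_mass_diff_le) (use p in auto)
   also have "\<dots> \<le> ennreal (2 powr p) * (lp_mass p (\<lambda>x. cauchy_op (?d n) f x - g x) + ennreal K * lp_mass p f)"
    using K(2)[OF f fin inverse_Suc_seq(2)] by (intro mult_left_mono add_mono) (auto simp: lp_mass_minus_commute[of _ g])
   finally show "lp_mass p g \<le> ennreal (2 powr p) * (lp_mass p (\<lambda>x. cauchy_op (?d n) f x - g x) + ennreal K * lp_mass p f)" by simp
  qed
  then show "lp_mass p g \<le> ennreal (2 powr p * K) * lp_mass p f"
   using K by (simp add: ennreal_mult mult.assoc)
 qed
qed

lemma cauchy_boundary_unique:
 assumes [measurable]: "borel_fun f" and p: "1 < p" and g: "is_cauchy_boundary p f g" and h: "is_cauchy_boundary p f h"
 shows "AE x in lborel. g x = h x"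
 using is_cauchy_boundary_conv[OF g inverse_Suc_seq(1,2)] is_cauchy_boundary_conv[OF h inverse_Suc_seq(1,2)] g h p
 by (intro lp_conv_unique[of "\<lambda>n. cauchy_op (inverse (real (Suc n))) f" g h p]) (auto simp: is_cauchy_boundary_def)

section \<open>Boundary functions and dilations\<close>

text \<open>Fubini, then homogeneity: scaling height and position by u divides the kernel by u,
  which the substitution in s compensates. The height y becomes y u.\<close>

lemma cauchy_op_dilation_op:
 assumes f[measurable]: "borel_fun f" and p: "1 < p" and fin: "lp_mass p f < \<infinity>"
  and k: "dilation_kernel p k C" and y: "0 < y"
 shows "cauchy_op y (dilation_op k f) t = (LBINT u. k u *\<^sub>R cauchy_op (y * u) f (t * u))"
proof -
 note km[measurable] = dilation_kernel_measurable[OF p k]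
 note k0 = dilation_kernel_nonneg[OF p k]
 let ?c = "\<lambda>s. cker y (t - s)"
 define I where "I s = (NR u. k u * norm (f (s * u)))" for s
 have Im[measurable]: "borel_fun I" unfolding I_def[abs_def] by measurable
 have Ifin: "AE s in lborel. I s < \<infinity>" unfolding I_def by (rule dilation_AE_finite[OF p k f fin])
 define g where "g s = complex_of_real (enn2real (I s))" for s
 have gm[measurable]: "borel_fun g" unfolding g_def[abs_def] by measurable
 have "lp_mass p g \<le> ennreal (C powr (p - 1)) *
   (NN u. ennreal (k u * u powr (- 1 / p)) * lp_mass p f)"
  unfolding lp_mass_def[of p g]
  by (rule dilation_mass_family[OF p k, of "\<lambda>u. f"]) (auto simp: g_def I_def ennreal_enn2real_if)
 also have "(NN u. ennreal (k u * u powr (- 1 / p)) * lp_mass p f) = (NR u. k u * u powr (- 1 / p)) * lp_mass p f"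
  by (rule nn_integral_multc) measurable
 also have "ennreal (C powr (p - 1)) * \<dots> \<le> ennreal (C powr (p - 1)) * (ennreal C * lp_mass p f)"
  by (intro mult_left_mono mult_right_mono dilation_kernel_bound[OF p k]) auto
 also have "\<dots> < \<infinity>" using fin by (simp add: ennreal_mult_less_top)
 finally have gfin: "lp_mass p g < \<infinity>" .
 have cm: "borel_fun (\<lambda>s. ?c s)" by measurable
 have int: "integrable (lborel \<Otimes>\<^sub>M lborel) (\<lambda>(s, u). ?c s * (k u *\<^sub>R f (s * u)))"
 proof (rule integrableI_bounded)
  show "(\<lambda>(s, u). ?c s * (k u *\<^sub>R f (s * u))) \<in> borel_measurable (lborel \<Otimes>\<^sub>M lborel)"
   unfolding cker_def by measurable
  have "(\<integral>\<^sup>+z. ennreal (norm (case z of (s, u) => ?c s * (k u *\<^sub>R f (s * u)))) \<partial>(lborel \<Otimes>\<^sub>M lborel))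
   = (NN s. NN u. ennreal (norm (?c s)) * ennreal (k u * norm (f (s * u))))"
  proof -
   have "(\<integral>\<^sup>+z. ennreal (norm (case z of (s, u) => ?c s * (k u *\<^sub>R f (s * u)))) \<partial>(lborel \<Otimes>\<^sub>M lborel))
    = (NN s. NR u. norm (?c s * (k u *\<^sub>R f (s * u))))"
    unfolding cker_def by (subst lborel.nn_integral_fst[symmetric]) auto
   also have "\<dots> = (NN s. NN u. ennreal (norm (?c s)) * ennreal (k u * norm (f (s * u))))"
    using k0 by (intro nn_integral_cong) (simp add: norm_mult ennreal_mult[symmetric] mult_ac)
   finally show ?thesis .
  qed
  also have "\<dots> = (NN s. ennreal (norm (?c s)) * I s)"
   unfolding I_def by (intro nn_integral_cong nn_integral_cmult) measurable
  also have "\<dots> = (NR s. norm (g s) * norm (?c s))"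
   using Ifin by (intro nn_integral_cong_AE, elim eventually_mono) (auto simp: g_def ennreal_mult mult.commute)
  also have "\<dots> < \<infinity>"
   using cker_const[OF p y] p gfin
   by (intro Hoelder_finite(3)[where p=p and W="cker_const p y"]) (auto simp: cker_mass_shift)
  finally show "(\<integral>\<^sup>+z. ennreal (norm (case z of (s, u) => ?c s * (k u *\<^sub>R f (s * u)))) \<partial>(lborel \<Otimes>\<^sub>M lborel)) < \<infinity>" .
 qed
 have "cauchy_op y (dilation_op k f) t = (LBINT s. LBINT u. ?c s * (k u *\<^sub>R f (s * u)))"
  unfolding cauchy_op_def dilation_op_def by (simp del: mult_scaleR_right)
 also have "\<dots> = (LBINT u. LBINT s. ?c s * (k u *\<^sub>R f (s * u)))"
  using lborel_pair.Fubini_integral[OF int] by simp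
 also have "\<dots> = (LBINT u. k u *\<^sub>R cauchy_op (y * u) f (t * u))"
 proof (intro Bochner_Integration.integral_cong refl)
  fix u :: real
  show "(LBINT s. ?c s * (k u *\<^sub>R f (s * u))) = k u *\<^sub>R cauchy_op (y * u) f (t * u)"
  proof (cases "0 < u")
   case True
   have ker: "cker (y * u) (t * u - s * u) = cker y (t - s) / of_real u" for s
   proof -
    have "of_real (t * u - s * u) + \<i> * of_real (y * u) = (of_real (t - s) + \<i> * of_real y) * complex_of_real u"
     by (simp add: algebra_simps)
    then show ?thesis by (simp add: cker_def)
   qed
   have "cauchy_op (y * u) f (t * u) = (LBINT s. ?c s * f (s * u))"
    unfolding cauchy_op_def
    using lborel_integral_real_affine[of u "\<lambda>s. cker (y * u) (t * u - s) * f s" 0] True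
    by (simp add: mult.commute[of u] ker scaleR_conv_of_real)
   then show ?thesis by simp
  qed (simp add: dilation_kernel_eq_0[OF p k])
 qed
 finally show ?thesis .
qed

text \<open>At height y the two sides differ by a dilation integral of the errors at heights y u,
  and the family estimate bounds its mass by an integral over u of the masses of these errors. They
  are bounded uniformly and tend to 0 for each u > 0, so dominated convergence applies.\<close>

lemma cauchy_boundary_dilation:
 assumes f[measurable]: "borel_fun f" and p: "1 < p" and fin: "lp_mass p f < \<infinity>"
  and k: "dilation_kernel p k C" and g: "is_cauchy_boundary p f g" and h: "is_cauchy_boundary p (dilation_op k f) h"
 shows "AE t in lborel. h t = dilation_op k g t"
proof -
 note km[measurable] = dilation_kernel_measurable[OF p k]
 have gm[measurable]: "borel_fun g" and gf: "lp_mass p g < \<infinity>" using g by (auto simp: is_cauchy_boundary_def)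
 have hm[measurable]: "borel_fun h" using h by (auto simp: is_cauchy_boundary_def)
 let ?d = "\<lambda>n. inverse (real (Suc n))"
 obtain K :: real where K: "0 < K"
  "\<And>f y. [|f \<in> borel_measurable borel; lp_mass p f < \<infinity>; 0 < y|] ==> lp_mass p (cauchy_op y f) \<le> ennreal K * lp_mass p f"
  using cauchy_op_mass[OF p] by metis
 define c where "c = ennreal (2 powr p) * (ennreal K * lp_mass p f + lp_mass p g)"
 have c: "c < \<infinity>" using fin gf by (simp add: c_def ennreal_mult_less_top)
 define E where "E y = lp_mass p (\<lambda>x. cauchy_op y f x - g x)" for y
 have Em[measurable]: "borel_fun E"
  unfolding E_def[abs_def] lp_mass_def by measurable
 have Ec: "E y \<le> c" if "0 < y" for y
 proof -
  have "lp_mass p (\<lambda>x. cauchy_op y f x - g x) \<le> ennreal (2 powr p) * (lp_mass p (\<lambda>x. cauchy_op y f x - 0) + lp_mass p (\<lambda>x. 0 - g x))"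
   by (rule lp_mass_diff_le) (use p in auto)
  also have "\<dots> \<le> c" unfolding c_def using K(2)[OF f fin that] by (intro mult_left_mono add_mono) auto
  finally show ?thesis by (simp add: E_def)
 qed
 have bd: "lp_mass p (\<lambda>t. cauchy_op y (dilation_op k f) t - dilation_op k g t)
   \<le> ennreal (C powr (p - 1)) * (NN u. ennreal (k u * u powr (- 1 / p)) * E (y * u))" if y: "0 < y" for y
 proof -
  let ?G = "\<lambda>u x. cauchy_op (y * u) f x - g x"
  define X where "X t = norm (LBINT u. k u *\<^sub>R ?G u (t * u))" for t
  have "(\<lambda>(u, x). ?G u x) \<in> borel_measurable (borel \<Otimes>\<^sub>M borel)"
  proof -
   have "(\<lambda>z. (y * fst z, snd z)) \<in> borel \<Otimes>\<^sub>M borel \<rightarrow>\<^sub>M borel \<Otimes>\<^sub>M (borel :: real measure)" by measurable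
   from measurable_compose[OF this cauchy_op_measurable(1)[OF f]]
   have [measurable]: "(\<lambda>z. cauchy_op (y * fst z) f (snd z)) \<in> borel_measurable (borel \<Otimes>\<^sub>M borel)" by simp
   show ?thesis unfolding case_prod_beta' by measurable
  qed
  then have "(NR t. X t powr p) \<le> ennreal (C powr (p - 1)) *
   (NN u. ennreal (k u * u powr (- 1 / p)) * lp_mass p (?G u))"
   by (rule dilation_mass_family[OF p k, of ?G X]) (auto simp: X_def intro: norm_dilation_op_le[OF p k])
  moreover have "lp_mass p (\<lambda>t. cauchy_op y (dilation_op k f) t - dilation_op k g t) = (NR t. X t powr p)"
   unfolding lp_mass_def
  proof (rule nn_integral_cong_AE)
   \<comment> \<open>Integrability is what allows the integral of the difference to be split; the
     Bochner integral of a non-integrable function is 0 by convention.\<close>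
   have "AE t in lborel. integrable lborel (\<lambda>u. k u *\<^sub>R cauchy_op (y * u) f (t * u))"
   proof -
    let ?H = "\<lambda>u. cauchy_op (y * u) f"
    have Hm: "(\<lambda>(u, x). ?H u x) \<in> borel_measurable (borel \<Otimes>\<^sub>M borel)"
    proof -
     have "(\<lambda>z. (y * fst z, snd z)) \<in> borel \<Otimes>\<^sub>M borel \<rightarrow>\<^sub>M borel \<Otimes>\<^sub>M (borel :: real measure)" by measurable
     from measurable_compose[OF this cauchy_op_measurable(1)[OF f]] show ?thesis by (simp add: case_prod_beta')
    qed
    have "AE t in lborel. (NR u. k u * norm (?H u (t * u))) < \<infinity>"
    proof (rule dilation_family_AE_finite[OF p k Hm])
     have "lp_mass p (?H u) \<le> ennreal K * lp_mass p f" if "0 < u" for u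
      using K(2)[OF f fin, of "y * u"] y that by simp
     then have "(NN u. ennreal (k u * u powr (- 1 / p)) * lp_mass p (?H u)) \<le> (NN u. ennreal (k u * u powr (- 1 / p)) * (ennreal K * lp_mass p f))"
      using dilation_kernel_eq_0[OF p k] by (intro nn_integral_mono) (metis ennreal_0 mult_left_mono mult_zero_left not_le zero_le order_refl)
     also have "\<dots> = (NR u. k u * u powr (- 1 / p)) * (ennreal K * lp_mass p f)"
      by (rule nn_integral_multc) measurable
     also have "\<dots> \<le> ennreal C * (ennreal K * lp_mass p f)"
      by (intro mult_right_mono dilation_kernel_bound[OF p k]) auto
     also have "\<dots> < \<infinity>" using fin by (simp add: ennreal_mult_less_top)
     finally show "(NN u. ennreal (k u * u powr (- 1 / p)) * lp_mass p (?H u)) < \<infinity>" .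
    qed
    then show ?thesis
    proof eventually_elim
     case (elim t)
     have "(\<lambda>u. (u, t * u)) \<in> borel \<rightarrow>\<^sub>M borel \<Otimes>\<^sub>M (borel :: real measure)" by measurable
     from measurable_compose[OF this Hm] have [measurable]: "borel_fun (\<lambda>u. ?H u (t * u))" by simp
     show ?case using elim by (intro integrableI_bounded) (auto simp: dilation_kernel_nonneg[OF p k])
    qed
   qed
   then show "AE t in lborel. ennreal (norm (cauchy_op y (dilation_op k f) t - dilation_op k g t) powr p) = ennreal (X t powr p)"
    using dilation_AE_integrable[OF p k gm gf]
   proof eventually_elim
    case (elim t)
    have "cauchy_op y (dilation_op k f) t - dilation_op k g t = (LBINT u. k u *\<^sub>R ?G u (t * u))"
     unfolding cauchy_op_dilation_op[OF f p fin k y] dilation_op_def scaleR_diff_right using elim by simp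
    then show ?case by (simp add: X_def)
   qed
  qed
  ultimately show ?thesis by (simp add: E_def)
 qed
 have "(\<lambda>n. NN u. ennreal (k u * u powr (- 1 / p)) * E (?d n * u)) \<longlonglongrightarrow> (\<integral>\<^sup>+u. 0 \<partial>(lborel :: real measure))"
 proof (rule nn_integral_dominated_convergence[where w="\<lambda>u. ennreal (k u * u powr (- 1 / p)) * c"])
  show "AE u in lborel. ennreal (k u * u powr (- 1 / p)) * E (?d n * u) \<le> ennreal (k u * u powr (- 1 / p)) * c" for n
  proof (rule AE_I2)
   fix u :: real
   show "ennreal (k u * u powr (- 1 / p)) * E (?d n * u) \<le> ennreal (k u * u powr (- 1 / p)) * c"
    by (cases "0 < u") (auto simp: dilation_kernel_eq_0[OF p k] intro!: mult_left_mono Ec mult_pos_pos)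
  qed
  have "(NN u. ennreal (k u * u powr (- 1 / p)) * c) = (NR u. k u * u powr (- 1 / p)) * c"
   by (rule nn_integral_multc) measurable
  also have "\<dots> \<le> ennreal C * c" by (intro mult_right_mono dilation_kernel_bound[OF p k]) auto
  also have "\<dots> < \<infinity>" using c by (simp add: ennreal_mult_less_top)
  finally show "(NN u. ennreal (k u * u powr (- 1 / p)) * c) < \<infinity>" .
  show "AE u in lborel. (\<lambda>n. ennreal (k u * u powr (- 1 / p)) * E (?d n * u)) \<longlonglongrightarrow> 0"
  proof (rule AE_I2)
   fix u :: real
   show "(\<lambda>n. ennreal (k u * u powr (- 1 / p)) * E (?d n * u)) \<longlonglongrightarrow> 0"
   proof (cases "0 < u")
    case True
    have "(\<lambda>n. ?d n * u) \<longlonglongrightarrow> 0" using tendsto_mult_left_zero[OF inverse_Suc_seq(1)] by simp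
    from is_cauchy_boundary_conv[OF g this] True show ?thesis
     unfolding lp_conv_def E_def by (intro tendsto_cmult_0_ennreal) auto
   qed (simp add: dilation_kernel_eq_0[OF p k])
  qed
 qed auto
 then have "(\<lambda>n. ennreal (C powr (p - 1)) * (NN u. ennreal (k u * u powr (- 1 / p)) * E (?d n * u))) \<longlonglongrightarrow> 0"
  by (intro tendsto_cmult_0_ennreal) simp
 then have "lp_conv p (\<lambda>n. cauchy_op (?d n) (dilation_op k f)) (dilation_op k g)"
  unfolding lp_conv_def
  by (rule tendsto_0_le_ennreal) (intro always_eventually allI bd inverse_Suc_seq(2))
 from lp_conv_unique[OF _ _ _ p is_cauchy_boundary_conv[OF h inverse_Suc_seq(1,2)] this]
 show ?thesis by simp
qed

section \<open>Almost everywhere convergence of principal values\<close>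

lemma ball_measure: "0 < r ==> emeasure lborel (ball (t::real) r) = ennreal (2 * r)"
 by (simp add: ball_eq_greaterThanLessThan)

text \<open>The Hardy-Littlewood maximal inequality, by Vitali covering. In place of the level set
  itself a countable union of enlarged balls containing it is delivered, which is Borel by
  construction; outside it all averages over balls are at most l.\<close>

lemma Vitali_weak_type:
 fixes \<phi> :: "real => ennreal"
 assumes [measurable]: "borel_fun \<phi>" and A: "(NN s. \<phi> s) \<le> ennreal A" "0 \<le> A" and l: "0 < l"
 obtains W where "W \<in> sets borel" "emeasure lborel W \<le> ennreal (5 * A / l)"
  "\<And>t r. 0 < r ==> t \<notin> W ==> (NN s. \<phi> s * indicator (ball t r) s) \<le> ennreal (2 * r * l)"
proof -
 define S where "S = {t. \<exists>r>0. ennreal (2 * r * l) < (NN s. \<phi> s * indicator (ball t r) s)}"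
 have "\<forall>t\<in>S. \<exists>r. 0 < r \<and> ennreal (2 * r * l) < (NN s. \<phi> s * indicator (ball t r) s)"
  by (auto simp: S_def)
 then obtain r where r: "\<And>t. t \<in> S ==> 0 < r t" "\<And>t. t \<in> S ==> ennreal (2 * r t * l) < (NN s. \<phi> s * indicator (ball t (r t)) s)"
  by metis
 \<comment> \<open>The covering lemma asks for bounded radii; the bound comes from the total mass
   A.\<close>
 have rb: "0 < r t \<and> r t \<le> A / (2 * l)" if "t \<in> S" for t
 proof -
  have "ennreal (2 * r t * l) < (NN s. \<phi> s * indicator (ball t (r t)) s)" by (rule r(2)[OF that])
  also have "\<dots> \<le> (NN s. \<phi> s)" by (intro nn_integral_mono) (auto simp: indicator_def)
  also have "\<dots> \<le> ennreal A" by (rule A)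
  finally have "2 * r t * l \<le> A" using A(2) l r(1)[OF that] by (simp add: ennreal_less_iff)
  then show ?thesis using l r(1)[OF that] by (simp add: field_simps)
 qed
 have cov: "S \<subseteq> (\<Union>i\<in>S. ball i (r i))"
 proof
  fix t assume "t \<in> S"
  then show "t \<in> (\<Union>i\<in>S. ball i (r i))" using r(1)[of t] by (intro UN_I[of t]) auto
 qed
 obtain C where C: "countable C" "C \<subseteq> S" "pairwise (\<lambda>i j. disjnt (ball i (r i)) (ball j (r j))) C"
   "S \<subseteq> (\<Union>i\<in>C. ball i (5 * r i))"
  by (rule Vitali_covering_lemma_balls[OF cov rb])
 define W where "W = (\<Union>i\<in>C. ball i (5 * r i))"
 have disj: "disjoint_family_on (\<lambda>i. ball i (r i)) C"
  using C(3) by (auto simp: disjoint_family_on_def pairwise_def disjnt_def)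
 have Wm[measurable]: "W \<in> sets borel" unfolding W_def using C(1) by (intro sets.countable_UN') auto
 have "emeasure lborel W = (NN x. indicator W x)" by simp
 also have "\<dots> \<le> (NN x. \<integral>\<^sup>+i. indicator (ball i (5 * r i)) x \<partial>count_space C)"
 proof (intro nn_integral_mono)
  fix x
  show "indicator W x \<le> (\<integral>\<^sup>+i. indicator (ball i (5 * r i)) x \<partial>count_space C)"
  proof (cases "x \<in> W")
   case True
   then obtain i where i: "i \<in> C" "x \<in> ball i (5 * r i)" by (auto simp: W_def)
   have "indicator (ball i (5 * r i)) x \<le> (\<integral>\<^sup>+i. indicator (ball i (5 * r i)) x \<partial>count_space C)"
    by (rule nn_integral_ge_point[OF i(1)])
   then show ?thesis using i True by simp
  qed simp
 qed
 also have "\<dots> = (\<integral>\<^sup>+i. (NN x. indicator (ball i (5 * r i)) x) \<partial>count_space C)"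
  by (rule nn_integral_count_space_nn_integral[OF C(1)]) (simp add: borel_measurable_indicator)
 also have "\<dots> \<le> (\<integral>\<^sup>+i. ennreal (5 / l) * emeasure (density lborel \<phi>) (ball i (r i)) \<partial>count_space C)"
 proof (intro nn_integral_mono)
  fix i assume "i \<in> space (count_space C)"
  then have i: "i \<in> S" using C by auto
  have "(NN x. indicator (ball i (5 * r i)) x) = ennreal (2 * (5 * r i))"
   using r(1)[OF i] by (simp add: ball_measure)
  also have "\<dots> = ennreal (5 / l) * ennreal (2 * r i * l)"
   using l r(1)[OF i] by (simp add: ennreal_mult[symmetric])
  also have "\<dots> \<le> ennreal (5 / l) * (NN s. \<phi> s * indicator (ball i (r i)) s)"
   by (intro mult_left_mono less_imp_le[OF r(2)[OF i]]) auto
  also have "(NN s. \<phi> s * indicator (ball i (r i)) s) = emeasure (density lborel \<phi>) (ball i (r i))"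
   by (simp add: emeasure_density)
  finally show "(NN x. indicator (ball i (5 * r i)) x) \<le> ennreal (5 / l) * emeasure (density lborel \<phi>) (ball i (r i))" .
 qed
 also have "\<dots> = ennreal (5 / l) * (\<integral>\<^sup>+i. emeasure (density lborel \<phi>) (ball i (r i)) \<partial>count_space C)"
  by (rule nn_integral_cmult) simp
 also have "(\<integral>\<^sup>+i. emeasure (density lborel \<phi>) (ball i (r i)) \<partial>count_space C) = emeasure (density lborel \<phi>) (\<Union>i\<in>C. ball i (r i))"
  by (rule emeasure_UN_countable[symmetric, OF _ C(1) disj]) simp
 also have "\<dots> \<le> emeasure (density lborel \<phi>) UNIV"
  by (rule emeasure_mono) auto
 also have "\<dots> = (NN s. \<phi> s)" by (simp add: emeasure_density)
 also have "\<dots> \<le> ennreal A" by (rule A)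
 also have "ennreal (5 / l) * ennreal A = ennreal (5 * A / l)"
  using A l by (simp add: ennreal_mult[symmetric])
 finally have "emeasure lborel W \<le> ennreal (5 * A / l)" by (simp add: mult_left_mono)
 moreover have "(NN s. \<phi> s * indicator (ball t r') s) \<le> ennreal (2 * r' * l)" if "0 < r'" "t \<notin> W" for t r'
 proof -
  have "t \<notin> S" using that(2) C(4) unfolding W_def by blast
  show ?thesis
  proof (rule ccontr)
   assume "\<not> ?thesis"
   then have "ennreal (2 * r' * l) < (NN s. \<phi> s * indicator (ball t r') s)" by (simp only: not_le)
   then have "t \<in> S" unfolding S_def using that(1) by blast
   with \<open>t \<notin> S\<close> show False ..
  qed
 qed
 ultimately show ?thesis using that Wm by blast
qed

section \<open>Poisson means and Lebesgue points\<close>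

text \<open>The negative of the derivative of the Poisson kernel in r.\<close>

definition poisson_weight :: "real => real => real" where
 "poisson_weight y r = 2 * r * y / (pi * (r\<^sup>2 + y\<^sup>2)\<^sup>2)"

lemma poisson_weight_measurable [measurable]: "borel_fun (poisson_weight y)"
 unfolding poisson_weight_def[abs_def] by measurable

text \<open>The fundamental theorem of calculus on the half-line from |x| writes the even, radially
  decreasing kernel as a mixture of indicators of intervals with nonnegative weights.\<close>

lemma pker_layer_cake:
 assumes y: "0 < y"
 shows "ennreal (pker y x) = (NN r. ennreal (poisson_weight y r) * indicator {\<bar>x\<bar><..} r)"
proof -
 have "(NN r. ennreal (poisson_weight y r) * indicator {\<bar>x\<bar><..} r) = (NN r. ennreal (poisson_weight y r) * indicator {\<bar>x\<bar>..} r)"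
  by (rule nn_integral_cong_AE, use AE_lborel_singleton[of "\<bar>x\<bar>"] in eventually_elim) (auto simp: indicator_def)
 also have "\<dots> = ennreal (0 - - pker y \<bar>x\<bar>)"
 proof (rule nn_integral_FTC_atLeast)
  fix r :: real assume r: "\<bar>x\<bar> \<le> r"
  have pos: "0 < r\<^sup>2 + y\<^sup>2" using y by (simp add: add_nonneg_pos)
  have "((\<lambda>r. - (y / (pi * (r\<^sup>2 + y\<^sup>2)))) has_real_derivative - ((0 * (pi * (r\<^sup>2 + y\<^sup>2)) - y * (pi * (2 * r))) / ((pi * (r\<^sup>2 + y\<^sup>2)) * (pi * (r\<^sup>2 + y\<^sup>2))))) (at r)"
   using pos by (auto intro!: derivative_eq_intros)
  moreover have "- ((0 * (pi * (r\<^sup>2 + y\<^sup>2)) - y * (pi * (2 * r))) / ((pi * (r\<^sup>2 + y\<^sup>2)) * (pi * (r\<^sup>2 + y\<^sup>2)))) = poisson_weight y r"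
   by (simp add: poisson_weight_def power2_eq_square mult_ac)
  ultimately show "((\<lambda>r. - pker y r) has_real_derivative poisson_weight y r) (at r)"
   by (simp add: pker_def)
  show "0 \<le> poisson_weight y r" using y r by (simp add: poisson_weight_def)
 next
  have "((\<lambda>r. - (1 / pi * (y * inverse (r\<^sup>2 + y\<^sup>2)))) \<longlongrightarrow> - (1 / pi * (y * 0))) at_top"
   by (intro tendsto_intros tendsto_inverse_0_at_top filterlim_at_top_mono[OF filterlim_pow_at_top[of 2, OF _ filterlim_ident]]) (auto intro!: always_eventually)
  then show "((\<lambda>r. - pker y r) \<longlongrightarrow> 0) at_top" by (simp add: pker_def divide_inverse mult_ac)
 qed simp
 finally show ?thesis by (simp add: pker_def)
qed

lemma poisson_layer_cake_integral:
 assumes [measurable]: "borel_fun \<phi>" and y: "0 < y"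
 shows "(NN s. ennreal (pker y (t - s)) * \<phi> s) =
  (NN r. ennreal (poisson_weight y r) * indicator {0<..} r * (NN s. \<phi> s * indicator (ball t r) s))"
proof -
 have ind: "indicator {\<bar>t - s\<bar><..} r = (indicator {0<..} r * indicator {s. \<bar>t - s\<bar> < r} s :: ennreal)" for s r
  by (auto simp: indicator_def)
 have b: "ball t r = {s. \<bar>t - s\<bar> < r}" for r by (auto simp: ball_def dist_real_def)
 have [measurable]: "(\<lambda>(s, r). indicator {s. \<bar>t - s\<bar> < r} s :: ennreal) \<in> borel_measurable (lborel \<Otimes>\<^sub>M lborel)"
  unfolding indicator_def of_bool_def mem_Collect_eq by measurable
 have [measurable]: "(\<lambda>(r, s). indicator {s. \<bar>t - s\<bar> < r} s :: ennreal) \<in> borel_measurable (lborel \<Otimes>\<^sub>M lborel)"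
  unfolding indicator_def of_bool_def mem_Collect_eq by measurable
 have [measurable]: "{s. \<bar>t - s\<bar> < r} \<in> sets borel" for r by measurable
 have "(NN s. ennreal (pker y (t - s)) * \<phi> s)
   = (NN s. NN r. ennreal (poisson_weight y r) * indicator {0<..} r * (\<phi> s * indicator {s. \<bar>t - s\<bar> < r} s))"
 proof (rule nn_integral_cong)
  fix s
  have "(NN r. ennreal (poisson_weight y r) * indicator {\<bar>t - s\<bar><..} r) * \<phi> s = (NN r. ennreal (poisson_weight y r) * indicator {\<bar>t - s\<bar><..} r * \<phi> s)"
   by (rule nn_integral_multc[symmetric]) measurable
  then show "ennreal (pker y (t - s)) * \<phi> s = (NN r. ennreal (poisson_weight y r) * indicator {0<..} r * (\<phi> s * indicator {s. \<bar>t - s\<bar> < r} s))"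
   unfolding pker_layer_cake[OF y] ind by (simp add: mult_ac)
 qed
 also have "\<dots> = (NN r. NN s. ennreal (poisson_weight y r) * indicator {0<..} r * (\<phi> s * indicator {s. \<bar>t - s\<bar> < r} s))"
  by (rule lborel_pair.Fubini'[symmetric]) measurable
 also have "\<dots> = (NN r. ennreal (poisson_weight y r) * indicator {0<..} r * (NN s. \<phi> s * indicator (ball t r) s))"
  unfolding b by (intro nn_integral_cong nn_integral_cmult) measurable
 finally show ?thesis .
qed

text \<open>The layer-cake formula for the constant function 1, where the ball of radius r has
  measure 2 r.\<close>

lemma poisson_weight_moment:
 assumes y: "0 < y"
 shows "(NN r. ennreal (poisson_weight y r) * indicator {0<..} r * ennreal (2 * r)) = 1"
proof -
 have "(NN r. ennreal (poisson_weight y r) * indicator {0<..} r * ennreal (2 * r))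
  = (NN r. ennreal (poisson_weight y r) * indicator {0<..} r * (NN s. 1 * indicator (ball (0::real) r) s))"
 proof (rule nn_integral_cong)
  fix r :: real
  show "ennreal (poisson_weight y r) * indicator {0<..} r * ennreal (2 * r) = ennreal (poisson_weight y r) * indicator {0<..} r * (NN s. 1 * indicator (ball (0::real) r) s)"
   using ball_measure[of r 0] by (cases "0 < r") simp_all
 qed
 also have "\<dots> = (NN s. ennreal (pker y (0 - s)) * 1)"
  by (rule poisson_layer_cake_integral[symmetric, OF _ y]) simp
 also have "\<dots> = 1" using nn_integral_pker[OF y] by (simp add: pker_even)
 finally show ?thesis .
qed

text \<open>As a mixture of averages over balls with total weight 1, the Poisson mean is at most any
  common bound of these averages.\<close>

lemma poisson_maximal_bound:
 assumes [measurable]: "borel_fun \<phi>" and y: "0 < y" and l: "0 < l"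
  and avg: "\<And>r. 0 < r ==> (NN s. \<phi> s * indicator (ball t r) s) \<le> ennreal (2 * r * l)"
 shows "(NN s. ennreal (pker y (t - s)) * \<phi> s) \<le> ennreal l"
proof -
 have "(NN s. ennreal (pker y (t - s)) * \<phi> s) \<le> (NN r. ennreal (poisson_weight y r) * indicator {0<..} r * ennreal (2 * r) * ennreal l)"
  unfolding poisson_layer_cake_integral[OF assms(1) y]
 proof (intro nn_integral_mono)
  fix r
  show "ennreal (poisson_weight y r) * indicator {0<..} r * (NN s. \<phi> s * indicator (ball t r) s) \<le> ennreal (poisson_weight y r) * indicator {0<..} r * ennreal (2 * r) * ennreal l"
  proof (cases "0 < r")
   case True
   then show ?thesis using avg[OF True] l by (simp add: ennreal_mult mult.assoc mult_left_mono)
  qed simp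
 qed
 also have "\<dots> = 1 * ennreal l"
  unfolding poisson_weight_moment[OF y, symmetric] by (rule nn_integral_multc) measurable
 finally show ?thesis by simp
qed

text \<open>The p-th power of the oscillation is averaged since |f|^p is what is integrable for f in
  L^p, so that the maximal inequality applies to it.\<close>

definition poisson_osc :: "real => (real => complex) => real => real => ennreal" where
 "poisson_osc p f t y = (NN s. ennreal (pker y (t - s)) * ennreal (norm (f s - f t) powr p))"

lemma powr_norm_add_le:
 fixes a b :: complex
 assumes "1 < p" shows "norm (a + b) powr p \<le> 2 powr p * (norm a powr p + norm b powr p)"
proof -
 have "norm (a + b) powr p \<le> (norm a + norm b) powr p" using assms by (intro powr_mono2 norm_triangle_ineq) auto
 also have "\<dots> \<le> (1/2) powr (1 - p) * norm a powr p + (1/2) powr (1 - p) * norm b powr p"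
  using assms by (intro powr_sum_convex) auto
 also have "(1/2::real) powr (1 - p) \<le> 2 powr p" using assms by (simp add: powr_divide powr_diff)
 then have "(1/2) powr (1 - p) * norm a powr p + (1/2) powr (1 - p) * norm b powr p \<le> 2 powr p * norm a powr p + 2 powr p * norm b powr p"
  by (intro add_mono mult_right_mono) auto
 finally show ?thesis by (simp add: distrib_left)
qed

lemma nn_integral_poisson_shift: "0 < y ==> (NR s. pker y (t - s)) = 1"
 using nn_integral_reflect_shift[of "\<lambda>s. ennreal (pker y s)" t] nn_integral_pker[of y] by simp

lemma poisson_osc_add:
 assumes [measurable]: "borel_fun g" "borel_fun b" and p: "1 < p" and y: "0 < y"
 shows "poisson_osc p (\<lambda>s. g s + b s) t y \<le> ennreal (2 powr p) * poisson_osc p g t y + ennreal (2 powr p * 2 powr p) *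
  ((NN s. ennreal (pker y (t - s)) * ennreal (norm (b s) powr p)) + ennreal (norm (b t) powr p))"
proof -
 let ?P = "\<lambda>s. ennreal (pker y (t - s))"
 have pw: "ennreal (norm (g s + b s - (g t + b t)) powr p) \<le> ennreal (2 powr p) * ennreal (norm (g s - g t) powr p)
   + ennreal (2 powr p * 2 powr p) * (ennreal (norm (b s) powr p) + ennreal (norm (b t) powr p))" for s
 proof -
  have "norm (g s + b s - (g t + b t)) powr p = norm ((g s - g t) + (b s - b t)) powr p" by (simp add: algebra_simps)
  also have "\<dots> \<le> 2 powr p * (norm (g s - g t) powr p + norm (b s - b t) powr p)" by (rule powr_norm_add_le[OF p])
  also have "norm (b s - b t) powr p \<le> 2 powr p * (norm (b s) powr p + norm (- b t) powr p)"
   using powr_norm_add_le[OF p, of "b s" "- b t"] by simp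
  finally have "norm (g s + b s - (g t + b t)) powr p \<le> 2 powr p * norm (g s - g t) powr p + 2 powr p * 2 powr p * (norm (b s) powr p + norm (b t) powr p)"
   by (simp add: distrib_left mult.assoc)
  then have "ennreal (norm (g s + b s - (g t + b t)) powr p) \<le> ennreal (2 powr p * norm (g s - g t) powr p + 2 powr p * 2 powr p * (norm (b s) powr p + norm (b t) powr p))"
   by (rule ennreal_leI)
  then show ?thesis by (simp add: ennreal_mult[symmetric] ennreal_plus[symmetric] del: ennreal_plus)
 qed
 have "poisson_osc p (\<lambda>s. g s + b s) t y \<le> (NN s. ennreal (2 powr p) * (?P s * ennreal (norm (g s - g t) powr p))
  + ennreal (2 powr p * 2 powr p) * (?P s * ennreal (norm (b s) powr p) + ?P s * ennreal (norm (b t) powr p)))"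
  unfolding poisson_osc_def
 proof (intro nn_integral_mono)
  fix s
  show "?P s * ennreal (norm (g s + b s - (g t + b t)) powr p) \<le> ennreal (2 powr p) * (?P s * ennreal (norm (g s - g t) powr p))
   + ennreal (2 powr p * 2 powr p) * (?P s * ennreal (norm (b s) powr p) + ?P s * ennreal (norm (b t) powr p))"
   using mult_left_mono[OF pw[of s], of "?P s"] by (simp add: distrib_left mult_ac)
 qed
 also have "\<dots> = ennreal (2 powr p) * (NN s. ?P s * ennreal (norm (g s - g t) powr p))
  + ennreal (2 powr p * 2 powr p) * ((NN s. ?P s * ennreal (norm (b s) powr p)) + (NN s. ?P s * ennreal (norm (b t) powr p)))"
  by (simp add: nn_integral_add nn_integral_cmult)
 also have "(NN s. ?P s * ennreal (norm (b t) powr p)) = ennreal (norm (b t) powr p)"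
  using nn_integral_poisson_shift[OF y, of t] by (subst nn_integral_multc) auto
 finally show ?thesis by (simp add: poisson_osc_def)
qed

lemma poisson_osc_continuous:
 fixes g :: "real => complex"
 assumes g: "continuous_on UNIV g" and M: "\<And>x. M < \<bar>x\<bar> ==> g x = 0" and p: "1 < p"
 shows "(poisson_osc p g t \<longlongrightarrow> 0) (at_right 0)"
 unfolding tendsto_at_iff_sequentially
proof (intro allI impI)
 fix X :: "nat => real" assume X: "\<forall>i. X i \<in> {0<..} - {0}" "X \<longlonglongrightarrow> 0"
 have [measurable]: "borel_fun g" by (intro borel_measurable_continuous_onI g)
 have "compact (g ` {-M..M})" by (intro compact_continuous_image continuous_on_subset[OF g]) auto
 then obtain B0 where B0: "\<And>x. x \<in> {-M..M} ==> norm (g x) \<le> B0"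
  by (meson bounded_iff compact_imp_bounded imageI)
 define B where "B = max B0 0"
 have B: "norm (g x) \<le> B" "0 \<le> B" for x using B0[of x] M[of x] by (auto simp: B_def abs_le_iff not_less) (smt (verit) norm_zero)
 have "poisson_osc p g t (X n) = (NN v. ennreal (pker 1 v) * ennreal (norm (g (t - X n * v) - g t) powr p))" for n
  unfolding poisson_osc_def using X(1) by (intro pker_substitution) auto
 moreover have "(\<lambda>n. NN v. ennreal (pker 1 v) * ennreal (norm (g (t - X n * v) - g t) powr p)) \<longlonglongrightarrow> (\<integral>\<^sup>+v. 0 \<partial>(lborel :: real measure))"
 proof (rule nn_integral_dominated_convergence[where w="\<lambda>v. ennreal (pker 1 v) * ennreal ((2 * B) powr p)"])
  show "AE v in lborel. ennreal (pker 1 v) * ennreal (norm (g (t - X n * v) - g t) powr p) \<le> ennreal (pker 1 v) * ennreal ((2 * B) powr p)" for n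
  proof (intro AE_I2 mult_left_mono ennreal_leI powr_mono2)
   fix v
   show "norm (g (t - X n * v) - g t) \<le> 2 * B"
    using norm_triangle_ineq4[of "g (t - X n * v)" "g t"] B(1)[of t] B(1)[of "t - X n * v"] by linarith
  qed (use p in auto)
  show "(NN v. ennreal (pker 1 v) * ennreal ((2 * B) powr p)) < \<infinity>"
   using nn_integral_pker[of 1] by (subst nn_integral_multc) auto
  show "AE v in lborel. (\<lambda>n. ennreal (pker 1 v) * ennreal (norm (g (t - X n * v) - g t) powr p)) \<longlonglongrightarrow> 0"
  proof (intro AE_I2 tendsto_cmult_0_ennreal)
   fix v
   have "(\<lambda>n. X n * v) \<longlonglongrightarrow> 0" using tendsto_mult_left_zero[OF X(2)] by simp
   then have "(\<lambda>n. g (t - X n * v)) \<longlonglongrightarrow> g (t - 0)"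
    by (intro continuous_on_tendsto_compose[OF g] tendsto_diff tendsto_const) auto
   then have "(\<lambda>n. norm (g (t - X n * v) - g t) powr p) \<longlonglongrightarrow> norm (g (t - 0) - g t) powr p"
    using p by (intro tendsto_powr2 tendsto_norm tendsto_diff tendsto_const) auto
   then have "(\<lambda>n. ennreal (norm (g (t - X n * v) - g t) powr p)) \<longlonglongrightarrow> ennreal (norm (g (t - 0) - g t) powr p)"
    by (rule tendsto_ennrealI)
   then show "(\<lambda>n. ennreal (norm (g (t - X n * v) - g t) powr p)) \<longlonglongrightarrow> 0" using p by simp
  qed
 qed auto
 ultimately show "(poisson_osc p g t \<circ> X) \<longlonglongrightarrow> 0" by (simp add: o_def)
qed

text \<open>Covers of measure at most 1/(n+1) intersect in a null set. Phrased through Borel covers,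
  because the exceptional set itself is not known to be measurable.\<close>

lemma AE_small_covers:
 assumes "\<And>e::real. 0 < e ==> \<exists>W\<in>sets borel. emeasure lborel W \<le> ennreal e \<and> (\<forall>t. t \<notin> W --> P t)"
 shows "AE t in (lborel :: real measure). P t"
proof -
 have "\<forall>n. \<exists>W. W \<in> sets borel \<and> emeasure lborel W \<le> ennreal (inverse (real (Suc n))) \<and> (\<forall>t. t \<notin> W --> P t)"
  using assms inverse_Suc_seq(2) by blast
 then obtain W where W: "\<And>n. W n \<in> sets borel" "\<And>n. emeasure lborel (W n) \<le> ennreal (inverse (real (Suc n)))" "\<And>n t. t \<notin> W n ==> P t"
  by metis
 have "emeasure lborel (\<Inter>n. W n) = 0"
 proof -
  have "emeasure lborel (\<Inter>n. W n) \<le> ennreal (inverse (real (Suc n)))" for n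
   using W(1) by (intro order_trans[OF emeasure_mono W(2)[of n]]) auto
  moreover have "(\<lambda>n. ennreal (inverse (real (Suc n)))) \<longlonglongrightarrow> ennreal 0" by (intro tendsto_ennrealI inverse_Suc_seq)
  ultimately have "emeasure lborel (\<Inter>n. W n) \<le> ennreal 0" by (intro LIMSEQ_le_const) auto
  then show ?thesis by simp
 qed
 then have "(\<Inter>n. W n) \<in> null_sets lborel" using W(1) by (intro null_setsI) auto
 from AE_not_in[OF this] show ?thesis by eventually_elim (use W(3) in auto)
qed

text \<open>Split f into a continuous part g, whose oscillation tends to 0 everywhere, and a part b
  of small mass. Off a set of small measure the maximal inequality bounds the Poisson mean of |b|^p,
  and Chebyshev's inequality bounds |b(t)|^p itself.\<close>

lemma poisson_osc_AE:
 assumes f[measurable]: "borel_fun f" and p: "1 < p" and fin: "lp_mass p f < \<infinity>"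
 shows "AE t in lborel. (poisson_osc p f t \<longlongrightarrow> 0) (at_right 0)"
proof -
 have each: "AE t in lborel. \<forall>\<^sub>F y in at_right 0. poisson_osc p f t y \<le> ennreal e" if e: "0 < e" for e
 proof (rule AE_small_covers)
  fix \<eta> :: real assume \<eta>: "0 < \<eta>"
  define c where "c = 2 powr p + 2 powr p * 2 powr p * 2"
  have c: "0 < c" by (simp add: c_def add_pos_pos)
  define l where "l = e / c"
  have l: "0 < l" "c * l = e" using e c by (auto simp: l_def)
  \<comment> \<open>The factor 6 pays for 5 A / l from the covering and A / l from Chebyshev's
    inequality.\<close>
  define A where "A = \<eta> * l / 6"
  have A: "0 < A" using \<eta> l by (simp add: A_def)
  obtain g L where g: "continuous_on UNIV g" "\<And>x. L < \<bar>x\<bar> ==> g x = 0" "lp_mass p (\<lambda>x. f x - g x) < ennreal A"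
   using lp_dense_continuous[OF f p fin A] by metis
  have gm[measurable]: "borel_fun g" by (intro borel_measurable_continuous_onI g)
  define b where "b s = f s - g s" for s
  have bm[measurable]: "borel_fun b" unfolding b_def[abs_def] by measurable
  have bA: "(NR s. norm (b s) powr p) \<le> ennreal A"
   using g(3) by (simp add: lp_mass_def b_def)
  have \<phi>m: "borel_fun (\<lambda>s. ennreal (norm (b s) powr p))" by measurable
  obtain W where W: "W \<in> sets borel" "emeasure lborel W \<le> ennreal (5 * A / l)"
   "\<And>t r. 0 < r ==> t \<notin> W ==> (NN s. ennreal (norm (b s) powr p) * indicator (ball t r) s) \<le> ennreal (2 * r * l)"
   using Vitali_weak_type[OF \<phi>m bA less_imp_le[OF A] l(1)] by metis
  define V where "V = {t. ennreal l \<le> ennreal (norm (b t) powr p)}"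
  have Vm[measurable]: "V \<in> sets borel" unfolding V_def by measurable
  have "ennreal l * emeasure lborel V \<le> (NR s. norm (b s) powr p)"
  proof -
   have "ennreal l * emeasure lborel V = (NN s. ennreal l * indicator V s)" by (subst nn_integral_cmult_indicator) auto
   also have "\<dots> \<le> (NR s. norm (b s) powr p)"
    by (intro nn_integral_mono) (auto simp: V_def indicator_def)
   finally show ?thesis .
  qed
  also have "\<dots> \<le> ennreal l * ennreal (A / l)" using bA l A by (simp add: ennreal_mult[symmetric])
  finally have V: "emeasure lborel V \<le> ennreal (A / l)"
   using l by (subst (asm) ennreal_mult_le_mult_iff) auto
  have "emeasure lborel (W \<union> V) \<le> emeasure lborel W + emeasure lborel V" by (intro emeasure_subadditive) (use W in auto)
  also have "\<dots> \<le> ennreal (5 * A / l) + ennreal (A / l)" by (intro add_mono W V)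
  also have "\<dots> = ennreal \<eta>" using A l by (simp add: ennreal_plus[symmetric] del: ennreal_plus) (simp add: A_def field_simps)
  finally have m: "emeasure lborel (W \<union> V) \<le> ennreal \<eta>" .
  have "\<forall>\<^sub>F y in at_right 0. poisson_osc p f t y \<le> ennreal e" if t: "t \<notin> W \<union> V" for t
  proof -
   have "\<forall>\<^sub>F y in at_right 0. poisson_osc p g t y < ennreal l"
    using poisson_osc_continuous[OF g(1,2) p] l by (intro order_tendstoD) auto
   moreover have "\<forall>\<^sub>F y in at_right 0. (0::real) < y" by (simp add: eventually_at_right_less)
   ultimately show ?thesis
   proof eventually_elim
    case (elim y)
    have "(NN s. ennreal (pker y (t - s)) * ennreal (norm (b s) powr p)) \<le> ennreal l"
     using t by (intro poisson_maximal_bound W(3) elim l) auto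
    moreover have "ennreal (norm (b t) powr p) \<le> ennreal l"
     using t linear[of "ennreal l" "ennreal (norm (b t) powr p)"] unfolding V_def by blast
    ultimately have "poisson_osc p (\<lambda>s. g s + b s) t y \<le> ennreal (2 powr p) * ennreal l + ennreal (2 powr p * 2 powr p) * (ennreal l + ennreal l)"
     using elim by (intro order_trans[OF poisson_osc_add[OF gm bm p]] add_mono mult_left_mono) auto
    also have "\<dots> = ennreal (c * l)"
     using l by (simp add: ennreal_plus[symmetric] ennreal_mult[symmetric] del: ennreal_plus) (simp add: c_def algebra_simps)
    finally show ?case by (simp add: l b_def)
   qed
  qed
  then show "\<exists>W\<in>sets borel. emeasure lborel W \<le> ennreal \<eta> \<and> (\<forall>t. t \<notin> W --> (\<forall>\<^sub>F y in at_right 0. poisson_osc p f t y \<le> ennreal e))"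
   using m W(1) Vm by (intro bexI[of _ "W \<union> V"]) auto
 qed
 have "AE t in lborel. \<forall>n. \<forall>\<^sub>F y in at_right 0. poisson_osc p f t y \<le> ennreal (inverse (real (Suc n)))"
  unfolding AE_all_countable by (intro allI each) simp
 then show ?thesis
 proof eventually_elim
  case (elim t)
  show ?case
  proof (rule tendsto_0_ennrealI)
   fix e :: real assume "0 < e"
   then obtain n where n: "inverse (real (Suc n)) < e" using reals_Archimedean by blast
   have "\<forall>\<^sub>F y in at_right 0. poisson_osc p f t y \<le> ennreal (inverse (real (Suc n)))" using elim by blast
   then show "\<forall>\<^sub>F y in at_right 0. poisson_osc p f t y \<le> ennreal e"
    by eventually_elim (erule order_trans, rule ennreal_leI, use n in simp)
  qed
 qed
qed

section \<open>Truncated Hilbert kernel and conjugate Poisson kernel\<close>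

definition hker :: "real => real => complex" where
 "hker e x = (if e < \<bar>x\<bar> then \<i> / (of_real pi * of_real x) else 0)"

lemma hker_measurable [measurable]: "borel_fun (hker e)"
 unfolding hker_def[abs_def] by measurable

definition pv_op :: "real => (real => complex) => real => complex" where
 "pv_op e f t = (LBINT s. hker e (t - s) * f s)"

text \<open>The defect between the conjugate Poisson kernel, which is the Cauchy kernel minus the
  Poisson kernel, and the Hilbert kernel truncated at the same scale y.\<close>

definition dker :: "real => real => complex" where
 "dker y x = cker y x - of_real (pker y x) - hker y x"

lemma dker_measurable [measurable]: "borel_fun (dker y)"
 unfolding dker_def[abs_def] by measurable

lemma Im_cker: "Im (cker y x) = x / (pi * (x\<^sup>2 + y\<^sup>2))"
proof -
 have "cker y x = (\<i> / (of_real x + \<i> * of_real y)) / of_real pi" by (simp add: cker_def)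
 then show ?thesis by (simp only: Im_divide_of_real) (simp add: Im_divide)
qed

lemma dker_alt:
 assumes y: "0 < y"
 shows "dker y x = \<i> * of_real (if y < \<bar>x\<bar> then - (y\<^sup>2 / (pi * x * (x\<^sup>2 + y\<^sup>2))) else x / (pi * (x\<^sup>2 + y\<^sup>2)))"
proof -
 have ck: "cker y x - of_real (pker y x) = \<i> * of_real (x / (pi * (x\<^sup>2 + y\<^sup>2)))"
  by (simp add: complex_eq_iff Re_cker Im_cker)
 show ?thesis
 proof (cases "y < \<bar>x\<bar>")
  case True
  then have x0: "x \<noteq> 0" using y by auto
  have "0 < x\<^sup>2 + y\<^sup>2" using y by (simp add: add_nonneg_pos)
  then have "x / (pi * (x\<^sup>2 + y\<^sup>2)) - 1 / (pi * x) = - (y\<^sup>2 / (pi * x * (x\<^sup>2 + y\<^sup>2)))"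
   using x0 by (simp add: divide_simps) (simp add: power2_eq_square algebra_simps)
  moreover have "hker y x = \<i> * of_real (1 / (pi * x))" using True by (simp add: hker_def)
  ultimately show ?thesis unfolding dker_def ck using True
   by (simp only: if_True right_diff_distrib[symmetric] of_real_diff[symmetric])
 next
  case False
  then show ?thesis unfolding dker_def ck by (simp add: hker_def)
 qed
qed

lemma dker_odd: "0 < y ==> dker y (- x) = - dker y x"
 by (simp add: dker_alt)

text \<open>For |x| > y the defect has the size of the Poisson kernel times y / |x|, otherwise times
  |x| / y; both factors are at most 1. Being odd and dominated by an approximate identity, the
  defect disappears in the limit at Lebesgue points.\<close>

lemma norm_dker_le:
 assumes y: "0 < y" shows "norm (dker y x) \<le> pker y x"
proof -
 have pos: "0 < pi * (x\<^sup>2 + y\<^sup>2)" using y by (simp add: add_nonneg_pos)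
 show ?thesis
 proof (cases "y < \<bar>x\<bar>")
  case True
  have "norm (dker y x) = (y / \<bar>x\<bar>) * (y / (pi * (x\<^sup>2 + y\<^sup>2)))"
  proof -
   have "norm (dker y x) = \<bar>y\<^sup>2 / (pi * x * (x\<^sup>2 + y\<^sup>2))\<bar>"
    using True by (simp only: dker_alt[OF y] norm_mult norm_ii norm_of_real if_True abs_minus_cancel mult_1)
   also have "\<dots> = (y / \<bar>x\<bar>) * (y / (pi * (x\<^sup>2 + y\<^sup>2)))"
    using y by (simp add: abs_mult power2_eq_square)
   finally show ?thesis .
  qed
  also have "\<dots> \<le> 1 * (y / (pi * (x\<^sup>2 + y\<^sup>2)))"
   using True y pos by (intro mult_right_mono) auto
  finally show ?thesis by (simp add: pker_def)
 next
  case False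
  then have "norm (dker y x) = \<bar>x\<bar> / (pi * (x\<^sup>2 + y\<^sup>2))"
  proof -
   have "norm (dker y x) = \<bar>x / (pi * (x\<^sup>2 + y\<^sup>2))\<bar>"
    using False by (simp only: dker_alt[OF y] norm_mult norm_ii norm_of_real if_False mult_1)
   then show ?thesis by (simp add: abs_mult)
  qed
  also have "\<dots> \<le> y / (pi * (x\<^sup>2 + y\<^sup>2))" using False pos by (intro divide_right_mono) auto
  finally show ?thesis by (simp add: pker_def)
 qed
qed

text \<open>Jensen against the probability density \<open>pker y\<close>, which dominates the
  kernel. A non-integrable integrand has integral 0, so the bound holds in that case too.\<close>

lemma kernel_osc_bound:
 assumes [measurable]: "borel_fun f" "borel_fun \<kappa>" and p: "1 < p" and y: "0 < y"
  and le: "\<And>x. norm (\<kappa> x) \<le> pker y x"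
 shows "ennreal (norm (LBINT s. \<kappa> (t - s) * (f s - f t)) powr p) \<le> poisson_osc p f t y"
proof -
 let ?i = "\<lambda>s. \<kappa> (t - s) * (f s - f t)"
 have "ennreal (norm (integral\<^sup>L lborel ?i)) \<le> (NR s. pker y (t - s) * norm (f s - f t))"
 proof (cases "integrable lborel ?i")
  case True
  have "ennreal (norm (integral\<^sup>L lborel ?i)) \<le> (NR s. norm (?i s))"
   by (rule integral_norm_bound_ennreal[OF True])
  also have "\<dots> \<le> (NR s. pker y (t - s) * norm (f s - f t))"
   unfolding norm_mult by (intro nn_integral_mono ennreal_leI mult_right_mono le) auto
  finally show ?thesis .
 qed (simp add: not_integrable_integral_eq)
 then have "ennreal (norm (integral\<^sup>L lborel ?i) powr p) \<le> ennreal (1 powr (p - 1)) * (NR s. pker y (t - s) * norm (f s - f t) powr p)"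
  using p pker_nonneg[OF y] nn_integral_poisson_shift[OF y, of t]
  by (intro nn_integral_weighted_Jensen) auto
 also have "\<dots> = poisson_osc p f t y"
  unfolding poisson_osc_def using pker_nonneg[OF y] by (simp add: ennreal_mult)
 finally show ?thesis .
qed

lemma poisson_shift_integrable:
 assumes y: "0 < y"
 shows "integrable lborel (\<lambda>s. complex_of_real (pker y (t - s)))" "(LBINT s. complex_of_real (pker y (t - s))) = 1"
proof -
 show "integrable lborel (\<lambda>s. complex_of_real (pker y (t - s)))"
  using nn_integral_poisson_shift[OF y, of t] pker_nonneg[OF y] by (intro integrableI_bounded) auto
 show "(LBINT s. complex_of_real (pker y (t - s))) = 1"
  using nn_integral_poisson_shift[OF y, of t] pker_nonneg[OF y] by (simp add: integral_complex_of_real integral_eq_nn_integral)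
qed

lemma tendsto_of_osc:
 fixes X :: "real => complex"
 assumes p: "1 < p" and osc: "(poisson_osc p f t \<longlongrightarrow> 0) (at_right 0)"
  and le: "\<And>y. 0 < y ==> ennreal (norm (X y) powr p) \<le> poisson_osc p f t y"
 shows "(X \<longlongrightarrow> 0) (at_right 0)"
proof -
 have pos: "\<forall>\<^sub>F y in at_right 0. (0::real) < y" by (simp add: eventually_at_right_less)
 have "((\<lambda>y. ennreal (norm (X y) powr p)) \<longlongrightarrow> 0) (at_right 0)"
  by (rule tendsto_0_le_ennreal[OF osc]) (use pos in eventually_elim, rule le)
 then have "((\<lambda>y. norm (X y) powr p) \<longlongrightarrow> 0) (at_right 0)"
  by (subst (asm) ennreal_0[symmetric], subst (asm) tendsto_ennreal_iff) auto
 then have "((\<lambda>y. (norm (X y) powr p) powr (1 / p)) \<longlongrightarrow> 0 powr (1 / p)) (at_right 0)"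
  using p by (intro tendsto_powr2) auto
 then have "((\<lambda>y. norm (X y)) \<longlongrightarrow> 0) (at_right 0)" using p by (simp add: powr_powr)
 then show ?thesis by (simp add: tendsto_norm_zero_iff)
qed

lemma poisson_op_tendsto_osc:
 assumes f[measurable]: "borel_fun f" and p: "1 < p" and fin: "lp_mass p f < \<infinity>"
  and osc: "(poisson_osc p f t \<longlongrightarrow> 0) (at_right 0)"
 shows "((\<lambda>y. poisson_op y f t) \<longlongrightarrow> f t) (at_right 0)"
proof -
 have "((\<lambda>y. poisson_op y f t - f t) \<longlongrightarrow> 0) (at_right 0)"
 proof (rule tendsto_of_osc[OF p osc])
  fix y :: real assume y: "0 < y"
  have "poisson_op y f t - f t = (LBINT s. complex_of_real (pker y (t - s)) * (f s - f t))"
   unfolding right_diff_distrib poisson_op_alt using poisson_op_integrable[OF f p fin y, of t] poisson_shift_integrable[OF y, of t] by simp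
  then show "ennreal (norm (poisson_op y f t - f t) powr p) \<le> poisson_osc p f t y"
   using kernel_osc_bound[of f "\<lambda>x. complex_of_real (pker y x)" p y t] p y pker_nonneg[OF y] by simp
 qed
 then show ?thesis by (simp add: LIM_zero_iff)
qed

text \<open>The kernel is odd, so its integral equals its own negative. This permits subtracting the
  constant f(t) under the integral.\<close>

lemma defect_integrable:
 assumes y: "0 < y"
 shows "integrable lborel (\<lambda>s. dker y (t - s))" "(LBINT s. dker y (t - s)) = 0"
proof -
 have i: "integrable lborel (\<lambda>s. dker y (t - s))" for t
  by (rule Bochner_Integration.integrable_bound[OF poisson_shift_integrable(1)[OF y, of t]])
    (use norm_dker_le[OF y] pker_nonneg[OF y] in auto)
 then show "integrable lborel (\<lambda>s. dker y (t - s))" .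
 have "(LBINT s. dker y (t - s)) = (LBINT s. dker y s)"
  using lborel_integral_real_affine[of "-1" "\<lambda>s. dker y s" t] by simp
 moreover have "(LBINT s. dker y s) = 0"
 proof -
  have "(LBINT s. dker y s) = (LBINT s. dker y (- s))"
   using lborel_integral_real_affine[of "-1" "\<lambda>s. dker y s" 0] by simp
  also have "\<dots> = - (LBINT s. dker y s)" by (simp only: dker_odd[OF y] integral_minus)
  finally show ?thesis by simp
 qed
 ultimately show "(LBINT s. dker y (t - s)) = 0"
  by simp
qed

lemma pv_integrable:
 assumes f[measurable]: "borel_fun f" and p: "1 < p" and fin: "lp_mass p f < \<infinity>" and y: "0 < y"
 shows "integrable lborel (\<lambda>s. dker y (t - s) * f s)" "integrable lborel (\<lambda>s. hker y (t - s) * f s)"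
proof -
 show i: "integrable lborel (\<lambda>s. dker y (t - s) * f s)"
  by (rule Bochner_Integration.integrable_bound[OF poisson_op_integrable[OF f p fin y, of t]])
    (use norm_dker_le[OF y] pker_nonneg[OF y] in \<open>auto simp: norm_mult intro!: mult_right_mono\<close>)
 have "hker y (t - s) * f s = cker y (t - s) * f s - of_real (pker y (t - s)) * f s - dker y (t - s) * f s" for s
  by (simp add: dker_def algebra_simps)
 then show "integrable lborel (\<lambda>s. hker y (t - s) * f s)"
  using i cauchy_op_integrable[OF f p fin y, of t] poisson_op_integrable[OF f p fin y, of t] by simp
qed

text \<open>The truncated integral is Cauchy minus Poisson minus defect. The Cauchy integral of f is
  the Poisson integral of g, so wherever the oscillations of f and g both tend to 0 the three terms
  tend to g(t), f(t) and 0.\<close>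

theorem pv_op_tendsto_AE:
 assumes f[measurable]: "borel_fun f" and p: "1 < p" and fin: "lp_mass p f < \<infinity>"
  and g: "is_cauchy_boundary p f g"
 shows "AE t in lborel. ((\<lambda>y. pv_op y f t) \<longlongrightarrow> g t - f t) (at_right 0)"
proof -
 have gm[measurable]: "borel_fun g" and gf: "lp_mass p g < \<infinity>" using g by (auto simp: is_cauchy_boundary_def)
 show ?thesis
  using poisson_osc_AE[OF f p fin] poisson_osc_AE[OF gm p gf]
 proof eventually_elim
  case (elim t)
  have "((\<lambda>y. LBINT s. dker y (t - s) * f s) \<longlongrightarrow> 0) (at_right 0)"
  proof (rule tendsto_of_osc[OF p elim(1)])
   fix y :: real assume y: "0 < y"
   have "(LBINT s. dker y (t - s) * (f s - f t)) = (LBINT s. dker y (t - s) * f s)"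
    unfolding right_diff_distrib using pv_integrable(1)[OF f p fin y, of t] defect_integrable[OF y, of t] by simp
   then show "ennreal (norm (LBINT s. dker y (t - s) * f s) powr p) \<le> poisson_osc p f t y"
    using kernel_osc_bound[of f "dker y" p y t] p y norm_dker_le[OF y] by simp
  qed
  then have lim: "((\<lambda>y. poisson_op y g t - poisson_op y f t - (LBINT s. dker y (t - s) * f s)) \<longlongrightarrow> g t - f t - 0) (at_right 0)"
   by (intro tendsto_diff poisson_op_tendsto_osc[OF gm p gf elim(2)] poisson_op_tendsto_osc[OF f p fin elim(1)])
  have ev: "\<forall>\<^sub>F y in at_right 0. poisson_op y g t - poisson_op y f t - (LBINT s. dker y (t - s) * f s) = pv_op y f t"
  proof -
   have "\<forall>\<^sub>F y in at_right 0. (0::real) < y" by (simp add: eventually_at_right_less)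
   then show ?thesis
   proof eventually_elim
    case (elim y)
    have "pv_op y f t = (LBINT s. cker y (t - s) * f s - of_real (pker y (t - s)) * f s - dker y (t - s) * f s)"
     unfolding pv_op_def by (intro Bochner_Integration.integral_cong) (auto simp: dker_def algebra_simps)
    also have "\<dots> = cauchy_op y f t - poisson_op y f t - (LBINT s. dker y (t - s) * f s)"
     unfolding cauchy_op_def poisson_op_alt
     using pv_integrable(1)[OF f p fin elim, of t] cauchy_op_integrable[OF f p fin elim, of t] poisson_op_integrable[OF f p fin elim, of t] by simp
    finally show ?case by (simp add: cauchy_boundary_poisson[OF f p fin g elim])
   qed
  qed
  show ?case using Lim_transform_eventually[OF lim ev] by simp
 qed
qed

section \<open>Smooth functions\<close>

abbreviation vd :: "(real => complex) => real => complex" where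
 "vd f \<equiv> \<lambda>x. vector_derivative f (at x)"

lemma nth_vderiv_0 [simp]: "nth_vderiv 0 f = f"
 by (simp add: nth_vderiv_def)

lemma nth_vderiv_Suc: "nth_vderiv (Suc m) f = vd (nth_vderiv m f)"
 by (simp add: nth_vderiv_def)

lemma nth_vderiv_Suc': "nth_vderiv (Suc m) f = nth_vderiv m (vd f)"
 by (simp only: nth_vderiv_def funpow_Suc_right o_apply)

definition smooth :: "(real => complex) => bool" where
 "smooth f \<longleftrightarrow> (\<forall>m x. nth_vderiv m f differentiable (at x))"

lemma smooth_has_vderiv: "smooth f ==> (f has_vector_derivative vd f x) (at x)"
 unfolding smooth_def using vector_derivative_works by (metis nth_vderiv_0)

lemma smooth_vd: "smooth f ==> smooth (vd f)"
 unfolding smooth_def by (metis nth_vderiv_Suc')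

lemma smooth_nth_vderiv: "smooth f ==> smooth (nth_vderiv m f)"
 by (induction m arbitrary: f) (auto simp: nth_vderiv_Suc' smooth_vd)

text \<open>A property closed under passing to some derivative forces differentiability of every
  order. Exhibiting a class closed under differentiation replaces explicit formulas for higher
  derivatives.\<close>

lemma smooth_coinduct:
 assumes P: "P f" and step: "\<And>f. P f ==> \<exists>f'. P f' \<and> (\<forall>x. (f has_vector_derivative f' x) (at x))"
 shows "smooth f"
proof -
 have "nth_vderiv m f differentiable (at x)" if "P f" for m f x
  using that
 proof (induction m arbitrary: f)
  case 0 then show ?case using step by (metis differentiableI_vector nth_vderiv_0)
 next
  case (Suc m)
  obtain f' where f': "P f'" "\<And>x. (f has_vector_derivative f' x) (at x)" using step[OF Suc.prems] by blast
  have "vd f = f'" using f'(2) by (auto simp: fun_eq_iff intro: vector_derivative_at)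
  then show ?case unfolding nth_vderiv_Suc' using Suc.IH f' by simp
 qed
 then show ?thesis using P by (auto simp: smooth_def)
qed

lemma smooth_continuous: "smooth f ==> continuous_on S f"
 by (intro continuous_at_imp_continuous_on ballI has_vector_derivative_continuous[OF smooth_has_vderiv])

lemma smooth_borel: "smooth f ==> f \<in> borel_measurable borel"
 by (rule borel_measurable_continuous_onI[OF smooth_continuous])

lemma smooth_const [simp]: "smooth (\<lambda>x. c)"
 by (rule smooth_coinduct[of "\<lambda>f. \<exists>c. f = (\<lambda>x. c)"]) (auto intro!: exI[of _ "\<lambda>x. 0"])

lemma smooth_add:
 assumes "smooth f" "smooth g" shows "smooth (\<lambda>x. f x + g x)"
proof (rule smooth_coinduct[of "\<lambda>h. \<exists>f g. smooth f \<and> smooth g \<and> h = (\<lambda>x. f x + g x)"])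
 fix h assume "\<exists>f g. smooth f \<and> smooth g \<and> h = (\<lambda>x. f x + g x)"
 then obtain f g where fg: "smooth f" "smooth g" "h = (\<lambda>x. f x + g x)" by blast
 then show "\<exists>f'. (\<exists>f g. smooth f \<and> smooth g \<and> f' = (\<lambda>x. f x + g x)) \<and> (\<forall>x. (h has_vector_derivative f' x) (at x))"
  by (intro exI[of _ "\<lambda>x. vd f x + vd g x"]) (auto intro!: smooth_vd has_vector_derivative_add smooth_has_vderiv)
qed (use assms in blast)

lemma smooth_affine:
 assumes "smooth f" shows "smooth (\<lambda>x. c * f (a * x + b))"
proof (rule smooth_coinduct[of "\<lambda>h. \<exists>f c. smooth f \<and> h = (\<lambda>x. c * f (a * x + b))"])
 fix h assume "\<exists>f c. smooth f \<and> h = (\<lambda>x. c * f (a * x + b))"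
 then obtain f c where f: "smooth f" "h = (\<lambda>x. c * f (a * x + b))" by blast
 have "((\<lambda>x. c * f (a * x + b)) has_vector_derivative c * of_real a * vd f (a * x + b)) (at x)" for x
 proof -
  have "((\<lambda>x. a * x + b) has_vector_derivative a) (at x)"
   by (auto intro!: derivative_eq_intros simp: has_real_derivative_iff_has_vector_derivative[symmetric])
  from vector_diff_chain_at[OF this smooth_has_vderiv[OF f(1)]]
  have "((\<lambda>x. f (a * x + b)) has_vector_derivative a *\<^sub>R vd f (a * x + b)) (at x)" by (simp add: o_def)
  from has_vector_derivative_mult_right[OF this, of c] show ?thesis by (simp add: scaleR_conv_of_real mult.assoc)
 qed
 then show "\<exists>f'. (\<exists>f c. smooth f \<and> f' = (\<lambda>x. c * f (a * x + b))) \<and> (\<forall>x. (h has_vector_derivative f' x) (at x))"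
  unfolding f(2) using f(1)
  by (intro exI[of _ "\<lambda>x. c * of_real a * vd f (a * x + b)"] conjI allI exI[of _ "vd f"] exI[of _ "c * of_real a"] refl smooth_vd)
qed (intro exI[of _ f] exI[of _ c] conjI assms refl)

lemma smooth_cmult: "smooth f ==> smooth (\<lambda>x. c * f x)"
 using smooth_affine[of f c 1 0] by simp

lemma smooth_reflect: "smooth f ==> smooth (\<lambda>x. f (- x))"
 using smooth_affine[of f 1 "-1" 0] by simp

lemma smooth_diff: "smooth f ==> smooth g ==> smooth (\<lambda>x. f x - g x)"
 using smooth_add[of f "\<lambda>x. (-1) * g x"] smooth_cmult[of g "-1"] by simp

text \<open>Leibniz's rule leads out of the class of single products but not out of that of their
  sums, which is therefore the class used for coinduction.\<close>

inductive sum_of_products :: "(real => complex) => bool" where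
 prod: "smooth f ==> smooth g ==> sum_of_products (\<lambda>x. f x * g x)"
| add: "sum_of_products f ==> sum_of_products g ==> sum_of_products (\<lambda>x. f x + g x)"

lemma smooth_mult:
 assumes "smooth f" "smooth g" shows "smooth (\<lambda>x. f x * g x)"
proof (rule smooth_coinduct[of sum_of_products])
 show "sum_of_products (\<lambda>x. f x * g x)" using assms by (rule sum_of_products.prod)
 fix h assume "sum_of_products h"
 then show "\<exists>f'. sum_of_products f' \<and> (\<forall>x. (h has_vector_derivative f' x) (at x))"
 proof induction
  case (prod f g)
  show ?case
   by (intro exI[of _ "\<lambda>x. f x * vd g x + vd f x * g x"] conjI allI has_vector_derivative_mult smooth_has_vderiv prod
    sum_of_products.intros smooth_vd)
 next
  case (add f g)
  then obtain f' g' where "sum_of_products f'" "\<And>x. (f has_vector_derivative f' x) (at x)"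
   "sum_of_products g'" "\<And>x. (g has_vector_derivative g' x) (at x)" by blast
  then show ?case
   by (intro exI[of _ "\<lambda>x. f' x + g' x"] conjI allI has_vector_derivative_add sum_of_products.intros)
 qed
qed

lemma smooth_polynomial_function:
 assumes "polynomial_function (q :: real => complex)" shows "smooth q"
proof (rule smooth_coinduct[of polynomial_function])
 fix f :: "real => complex" assume "polynomial_function f"
 then show "\<exists>f'. polynomial_function f' \<and> (\<forall>x. (f has_vector_derivative f' x) (at x))"
  using has_vector_derivative_polynomial_function by blast
qed fact

lemma nth_vderiv_add:
 assumes "smooth f" "smooth g"
 shows "nth_vderiv m (\<lambda>x. f x + g x) x = nth_vderiv m f x + nth_vderiv m g x"
proof -
 have "nth_vderiv m (\<lambda>x. f x + g x) = (\<lambda>x. nth_vderiv m f x + nth_vderiv m g x)"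
 proof (induction m)
  case (Suc m)
  show ?case
   unfolding nth_vderiv_Suc Suc.IH
   using smooth_has_vderiv[OF smooth_nth_vderiv[OF assms(1)]] smooth_has_vderiv[OF smooth_nth_vderiv[OF assms(2)]]
   by (intro ext vector_derivative_at has_vector_derivative_add)
 qed simp
 then show ?thesis by simp
qed

lemma nth_vderiv_cmult:
 assumes "smooth f"
 shows "nth_vderiv m (\<lambda>x. c * f x) x = c * nth_vderiv m f x"
proof -
 have "nth_vderiv m (\<lambda>x. c * f x) = (\<lambda>x. c * nth_vderiv m f x)"
 proof (induction m)
  case (Suc m)
  show ?case
   unfolding nth_vderiv_Suc Suc.IH
   using smooth_has_vderiv[OF smooth_nth_vderiv[OF assms]]
   by (intro ext vector_derivative_at has_vector_derivative_mult_right)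
 qed simp
 then show ?thesis by simp
qed

lemma nth_vderiv_affine:
 assumes "smooth f"
 shows "nth_vderiv m (\<lambda>x. f (a * x + b)) x = of_real (a ^ m) * nth_vderiv m f (a * x + b)"
proof -
 have "nth_vderiv m (\<lambda>x. f (a * x + b)) = (\<lambda>x. of_real (a ^ m) * nth_vderiv m f (a * x + b))"
 proof (induction m)
  case (Suc m)
  have "((\<lambda>x. of_real (a ^ m) * nth_vderiv m f (a * x + b)) has_vector_derivative of_real (a ^ Suc m) * vd (nth_vderiv m f) (a * x + b)) (at x)" for x
  proof -
   have "((\<lambda>x. a * x + b) has_vector_derivative a) (at x)"
    by (auto intro!: derivative_eq_intros simp: has_real_derivative_iff_has_vector_derivative[symmetric])
   from vector_diff_chain_at[OF this smooth_has_vderiv[OF smooth_nth_vderiv[OF assms]]]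
   have "((\<lambda>x. nth_vderiv m f (a * x + b)) has_vector_derivative a *\<^sub>R vd (nth_vderiv m f) (a * x + b)) (at x)" by (simp add: o_def)
   from has_vector_derivative_mult_right[OF this, of "of_real (a ^ m)"] show ?thesis by (simp add: scaleR_conv_of_real mult_ac)
  qed
  then show ?case unfolding nth_vderiv_Suc Suc.IH by (intro ext vector_derivative_at)
 qed simp
 then show ?thesis by simp
qed

lemma nth_vderiv_reflect:
 "smooth f ==> nth_vderiv m (\<lambda>x. f (- x)) x = (-1) ^ m * nth_vderiv m f (- x)"
 using nth_vderiv_affine[of f m "-1" 0 x] by simp

text \<open>Each differentiation of a product yields two terms, in which one factor gains a power of
  r; after n steps the count is 2^n. In the application r is the inverse of the cutoff
  scale.\<close>

lemma nth_vderiv_mult_bound: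
 assumes "smooth f" "smooth g" "\<And>j. j \<le> n ==> norm (nth_vderiv j f x) \<le> A * r ^ j" "\<And>j. j \<le> n ==> norm (nth_vderiv j g x) \<le> B * r ^ j"
  and "0 \<le> r" "0 \<le> A" "0 \<le> B"
 shows "norm (nth_vderiv n (\<lambda>x. f x * g x) x) \<le> A * B * (2 * r) ^ n"
 using assms
proof (induction n arbitrary: f g A B)
 case 0
 then show ?case using mult_mono[OF 0(3)[of 0] 0(4)[of 0]] by (simp add: norm_mult)
next
 case (Suc n)
 have d: "vd (\<lambda>x. f x * g x) = (\<lambda>x. vd f x * g x + f x * vd g x)"
  using has_vector_derivative_mult[OF smooth_has_vderiv[OF Suc.prems(1)] smooth_has_vderiv[OF Suc.prems(2)]]
  by (intro ext vector_derivative_at) (simp add: add.commute)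
 have "nth_vderiv (Suc n) (\<lambda>x. f x * g x) x = nth_vderiv n (\<lambda>x. vd f x * g x) x + nth_vderiv n (\<lambda>x. f x * vd g x) x"
  unfolding nth_vderiv_Suc' d by (intro nth_vderiv_add smooth_mult smooth_vd Suc.prems)
 moreover have "norm (nth_vderiv n (\<lambda>x. vd f x * g x) x) \<le> (A * r) * B * (2 * r) ^ n"
 proof (rule Suc.IH)
  show "norm (nth_vderiv j (vd f) x) \<le> A * r * r ^ j" if "j \<le> n" for j
   using Suc.prems(3)[of "Suc j"] that by (simp add: nth_vderiv_Suc' mult.assoc)
 qed (use Suc.prems smooth_vd in auto)
 moreover have "norm (nth_vderiv n (\<lambda>x. f x * vd g x) x) \<le> A * (B * r) * (2 * r) ^ n"
 proof (rule Suc.IH)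
  show "norm (nth_vderiv j (vd g) x) \<le> B * r * r ^ j" if "j \<le> n" for j
   using Suc.prems(4)[of "Suc j"] that by (simp add: nth_vderiv_Suc' mult.assoc)
 qed (use Suc.prems smooth_vd in auto)
 ultimately have "norm (nth_vderiv (Suc n) (\<lambda>x. f x * g x) x) \<le> (A * r) * B * (2 * r) ^ n + A * (B * r) * (2 * r) ^ n"
  by (simp only:) (rule order_trans[OF norm_triangle_ineq add_mono])
 then show ?case by (simp add: algebra_simps)
qed

lemma vector_derivative_cong_open:
 fixes f g :: "real => complex"
 assumes "open S" "x \<in> S" "\<And>y. y \<in> S ==> f y = g y"
 shows "vector_derivative f (at x) = vector_derivative g (at x)"
proof -
 have "(f has_vector_derivative D) (at x) \<longleftrightarrow> (g has_vector_derivative D) (at x)" for D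
 proof
  assume "(f has_vector_derivative D) (at x)"
  then show "(g has_vector_derivative D) (at x)" by (rule has_vector_derivative_transform_within_open[OF _ assms])
 next
  assume "(g has_vector_derivative D) (at x)"
  then show "(f has_vector_derivative D) (at x)" by (rule has_vector_derivative_transform_within_open[OF _ assms(1,2)]) (simp add: assms(3))
 qed
 then show ?thesis by (simp add: vector_derivative_def)
qed

lemma nth_vderiv_cong_open:
 assumes "open S" "\<And>y. y \<in> S ==> f y = g y" "x \<in> S"
 shows "nth_vderiv m f x = nth_vderiv m g x"
proof -
 have "\<forall>x\<in>S. nth_vderiv m f x = nth_vderiv m g x"
 proof (induction m)
  case (Suc m)
  then show ?case unfolding nth_vderiv_Suc by (intro ballI vector_derivative_cong_open[OF assms(1)]) auto
 qed (simp add: assms)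
 then show ?thesis using assms by blast
qed

lemma nth_vderiv_zero [simp]: "nth_vderiv m (\<lambda>x. 0) = (\<lambda>x. 0)"
 by (induction m) (auto simp: nth_vderiv_Suc)

lemma nth_vderiv_eq_0_open:
 assumes "open S" "\<And>y. y \<in> S ==> f y = 0" "x \<in> S" shows "nth_vderiv m f x = 0"
 using nth_vderiv_cong_open[of S f "\<lambda>x. 0" x m] assms by simp

text \<open>Functions of the form \<open>r(1/x) exp(-1/x)\<close> on the positive half-line, extended by zero, are closed
 under differentiation.\<close>

definition flat :: "real poly => real => real" where
 "flat r x = (if 0 < x then poly r (1 / x) * exp (- (1 / x)) else 0)"

lemma poly_exp_tendsto_0: "((\<lambda>x::real. poly r x * exp (- x)) \<longlongrightarrow> 0) at_top"
proof -
 have "((\<lambda>x::real. \<Sum>i\<le>degree r. coeff r i * (x ^ i / exp x)) \<longlongrightarrow> (\<Sum>i\<le>degree r. coeff r i * 0)) at_top"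
  by (intro tendsto_sum tendsto_mult tendsto_const tendsto_power_div_exp_0)
 then show ?thesis by (simp add: poly_altdef exp_minus field_simps sum_distrib_left sum_divide_distrib)
qed

text \<open>On the positive side the chain rule maps the polynomial r to z^2 (r - r') in z = 1/x. At
  0 the difference quotient from the right is again a polynomial in 1/h times exp(-1/h), which tends
  to 0.\<close>

lemma flat_has_derivative:
 "(flat r has_real_derivative flat ([:0, 0, 1:] * (r - pderiv r)) x) (at x)"
proof -
 consider "x < 0" | "0 < x" | "x = 0" by linarith
 then show ?thesis
 proof cases
  case 1
  have "((\<lambda>x. 0) has_real_derivative 0) (at x)" by simp
  then have "(flat r has_real_derivative 0) (at x)"
   by (rule has_field_derivative_transform_within_open[where S="{..<0}"]) (use 1 in \<open>auto simp: flat_def\<close>)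
  then show ?thesis using 1 by (simp add: flat_def)
 next
  case 2
  have "((\<lambda>x. poly r (1 / x) * exp (- (1 / x))) has_real_derivative
    (poly (pderiv r) (1 / x) * (- 1 / x\<^sup>2) * exp (- (1 / x)) + poly r (1 / x) * (exp (- (1 / x)) * (1 / x\<^sup>2)))) (at x)"
   using 2 by (auto intro!: derivative_eq_intros DERIV_chain2[OF poly_DERIV] simp: power2_eq_square divide_inverse)
  moreover have "(poly (pderiv r) (1 / x) * (- 1 / x\<^sup>2) * exp (- (1 / x)) + poly r (1 / x) * (exp (- (1 / x)) * (1 / x\<^sup>2)))
    = flat ([:0, 0, 1:] * (r - pderiv r)) x"
   using 2 by (simp add: flat_def power2_eq_square field_simps)
  ultimately have "((\<lambda>x. poly r (1 / x) * exp (- (1 / x))) has_real_derivative flat ([:0, 0, 1:] * (r - pderiv r)) x) (at x)" by simp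
  then show ?thesis
   by (rule has_field_derivative_transform_within_open[where S="{0<..}"]) (use 2 in \<open>auto simp: flat_def\<close>)
 next
  case 3
  have "((\<lambda>h. flat r h / h) \<longlongrightarrow> 0) (at 0)"
  proof (rule filterlim_split_at)
   have "\<forall>\<^sub>F h in at_left 0. 0 = flat r h / h"
    by (auto simp: eventually_at_left_field flat_def intro!: exI[of _ "-1"])
   then show "((\<lambda>h. flat r h / h) \<longlongrightarrow> 0) (at_left 0)" by (rule Lim_transform_eventually[OF tendsto_const])
   have "((\<lambda>h. poly (pCons 0 r) (inverse h) * exp (- inverse h)) \<longlongrightarrow> 0) (at_right 0)"
    by (rule filterlim_compose[OF poly_exp_tendsto_0 filterlim_inverse_at_top_right])
   moreover have "\<forall>\<^sub>F h in at_right 0. poly (pCons 0 r) (inverse h) * exp (- inverse h) = flat r h / h"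
    by (auto simp: eventually_at_right_field flat_def divide_inverse intro!: exI[of _ 1])
   ultimately show "((\<lambda>h. flat r h / h) \<longlongrightarrow> 0) (at_right 0)" by (rule Lim_transform_eventually)
  qed
  then show ?thesis using 3 by (simp add: DERIV_def flat_def)
 qed
qed

lemma of_real_has_vderiv:
 "(f has_real_derivative d) (at x) ==> ((\<lambda>x. complex_of_real (f x)) has_vector_derivative of_real d) (at x)"
 using has_vector_derivative_of_real[of f d "at x"] by (simp add: has_real_derivative_iff_has_vector_derivative)

lemma smooth_flat: "smooth (\<lambda>x. of_real (flat r x))"
proof (rule smooth_coinduct[of "\<lambda>f. \<exists>r. f = (\<lambda>x. of_real (flat r x))"])
 fix f :: "real => complex" assume "\<exists>r. f = (\<lambda>x. of_real (flat r x))"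
 then obtain r where f: "f = (\<lambda>x. of_real (flat r x))" by blast
 show "\<exists>f'. (\<exists>r. f' = (\<lambda>x. of_real (flat r x))) \<and> (\<forall>x. (f has_vector_derivative f' x) (at x))"
  unfolding f by (intro exI[of _ "\<lambda>x. of_real (flat ([:0, 0, 1:] * (r - pderiv r)) x)"] conjI allI
   exI[of _ "[:0, 0, 1:] * (r - pderiv r)"] refl of_real_has_vderiv flat_has_derivative)
qed (intro exI[of _ r] refl)

text \<open>The normalised antiderivative of a bump: \<open>flat 1 t * flat 1 (1 - t)\<close> is
  smooth, positive on (0, 1) and zero elsewhere.\<close>

lemma smooth_step_exists:
 obtains \<sigma> :: "real => real" where "smooth (\<lambda>x. of_real (\<sigma> x))" "\<And>x. x \<le> 0 ==> \<sigma> x = 0" "\<And>x. 1 \<le> x ==> \<sigma> x = 1"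
  "\<And>x. 0 \<le> \<sigma> x" "\<And>x. \<sigma> x \<le> 1"
proof -
 define \<psi> where "\<psi> t = flat 1 t * flat 1 (1 - t)" for t :: real
 have flat1: "0 < x ==> 0 < flat 1 x" "x \<le> 0 ==> flat 1 x = 0" for x by (auto simp: flat_def)
 have \<psi>0: "0 \<le> \<psi> t" for t by (cases "0 < t"; cases "0 < 1 - t") (auto simp: \<psi>_def flat1 less_imp_le)
 have sm: "smooth (\<lambda>x. of_real (\<psi> x))"
  using smooth_mult[OF smooth_flat[of 1] smooth_affine[OF smooth_flat[of 1], of 1 "-1" 1]] by (simp add: \<psi>_def)
 have c1: "continuous_on UNIV (flat 1)"
  by (intro continuous_at_imp_continuous_on ballI DERIV_isCont[OF flat_has_derivative])
 have \<psi>c: "continuous_on UNIV \<psi>"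
  unfolding \<psi>_def[abs_def] by (intro continuous_intros c1 continuous_on_compose2[OF c1]) auto
 have "isCont \<psi> x" for x using \<psi>c by (simp add: continuous_on_eq_continuous_at)
 then have "\<exists>F. \<forall>x. -\<infinity> < ereal x --> ereal x < \<infinity> --> (F has_vector_derivative \<psi> x) (at x)"
  by (intro einterval_antiderivative) auto
 then obtain F where "\<forall>x. -\<infinity> < ereal x --> ereal x < \<infinity> --> (F has_vector_derivative \<psi> x) (at x)" by (rule exE)
 then have F: "(F has_vector_derivative \<psi> x) (at x)" for x by simp
 have FD: "(F has_real_derivative \<psi> x) (at x)" for x
  using F by (simp add: has_real_derivative_iff_has_vector_derivative)
 have mono: "F x \<le> F y" if "x \<le> y" for x y
 proof (rule DERIV_nonneg_imp_nondecreasing[OF that])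
  show "\<exists>d. (F has_real_derivative d) (at z) \<and> 0 \<le> d" for z by (intro exI[of _ "\<psi> z"] conjI FD \<psi>0)
 qed
 have F0: "F x = F 0" if "x \<le> 0" for x
 proof (cases "x = 0")
  case False
  have "\<exists>D. (F has_real_derivative D) (at y) \<and> D \<le> 0" if "x \<le> y" "y \<le> 0" for y
   using FD[of y] that flat1(2)[of y] by (intro exI[of _ "\<psi> y"]) (simp add: \<psi>_def)
  then have "F 0 \<le> F x" using that by (intro DERIV_nonpos_imp_nonincreasing[of x 0 F]) auto
  then show ?thesis using mono[OF that] by simp
 qed simp
 have F1: "F x = F 1" if "1 \<le> x" for x
 proof -
  have "\<exists>D. (F has_real_derivative D) (at y) \<and> D \<le> 0" if "1 \<le> y" "y \<le> x" for y
   using FD[of y] that flat1(2)[of "1 - y"] by (intro exI[of _ "\<psi> y"]) (simp add: \<psi>_def)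
  then have "F x \<le> F 1" using that by (intro DERIV_nonpos_imp_nonincreasing[of 1 x F]) auto
  then show ?thesis using mono[OF that] by simp
 qed
 have pos: "F 0 < F 1"
 proof (rule DERIV_pos_imp_increasing_open[of 0 1 F])
  show "\<exists>D. (F has_real_derivative D) (at x) \<and> 0 < D" if "0 < x" "x < 1" for x
   using FD[of x] that flat1(1)[of x] flat1(1)[of "1 - x"] by (intro exI[of _ "\<psi> x"]) (simp add: \<psi>_def)
  show "continuous_on {0..1} F" by (intro continuous_at_imp_continuous_on ballI DERIV_isCont[OF FD])
 qed simp
 define c where "c = F 1 - F 0"
 have c: "0 < c" using pos by (simp add: c_def)
 define \<sigma> where "\<sigma> x = (F x - F 0) / c" for x
 show ?thesis
 proof (rule that[of \<sigma>])
  have hd: "((\<lambda>x. complex_of_real (\<sigma> x)) has_vector_derivative of_real (1 / c) * of_real (\<psi> x)) (at x)" for x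
  proof -
   have "(\<sigma> has_real_derivative (\<psi> x - 0) / c) (at x)"
    unfolding \<sigma>_def[abs_def] by (intro DERIV_cdivide DERIV_diff FD DERIV_const)
   from of_real_has_vderiv[OF this] show ?thesis by (simp add: divide_inverse mult.commute)
  qed
  show "smooth (\<lambda>x. complex_of_real (\<sigma> x))"
  proof (rule smooth_coinduct[of "\<lambda>f. smooth f \<or> f = (\<lambda>x. of_real (\<sigma> x))"])
   fix f assume "smooth f \<or> f = (\<lambda>x. of_real (\<sigma> x))"
   then show "\<exists>f'. (smooth f' \<or> f' = (\<lambda>x. of_real (\<sigma> x))) \<and> (\<forall>x. (f has_vector_derivative f' x) (at x))"
   proof
    assume "smooth f"
    then show ?thesis by (intro exI[of _ "vd f"] conjI disjI1 allI smooth_vd smooth_has_vderiv)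
   next
    assume f: "f = (\<lambda>x. of_real (\<sigma> x))"
    show ?thesis
     unfolding f by (intro exI[of _ "\<lambda>x. of_real (1 / c) * of_real (\<psi> x)"] conjI disjI1 allI hd smooth_cmult[OF sm])
   qed
  qed (rule disjI2, rule refl)
  show "\<sigma> x = 0" if "x \<le> 0" for x using F0[OF that] by (simp add: \<sigma>_def)
  show "\<sigma> x = 1" if "1 \<le> x" for x using F1[OF that] c by (simp add: \<sigma>_def c_def)
  show "0 \<le> \<sigma> x" for x
  proof (cases "x \<le> 0")
   case True then show ?thesis using F0[OF True] by (simp add: \<sigma>_def)
  next
   case False then show ?thesis using mono[of 0 x] c by (simp add: \<sigma>_def)
  qed
  show "\<sigma> x \<le> 1" for x
  proof (cases "x \<le> 1")
   case True then show ?thesis using mono[OF True] c by (simp add: \<sigma>_def c_def)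
  next
   case False then show ?thesis using F1[of x] c by (simp add: \<sigma>_def c_def)
  qed
 qed
qed

section \<open>Fractional integrals\<close>

text \<open>Decay is demanded towards plus infinity only, on every half-line separately. The
  fractional integral looks to the right and preserves this class, but not the Schwartz class, since
  its values may decay slowly at minus infinity.\<close>

definition rapid :: "(real => complex) => bool" where
 "rapid f \<longleftrightarrow> smooth f \<and> (\<forall>m A. \<forall>k::nat. \<exists>C. \<forall>x\<ge>A. norm (nth_vderiv m f x) * (1 + (x - A)) ^ k \<le> C)"

lemma rapid_smooth: "rapid f ==> smooth f"
 by (simp add: rapid_def)

lemma rapid_bound:
 assumes "rapid f"
 obtains C where "0 \<le> C" "\<And>x. A \<le> x ==> norm (nth_vderiv m f x) \<le> C / (1 + (x - A)) ^ k"
proof -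
 obtain C where C: "\<And>x. A \<le> x ==> norm (nth_vderiv m f x) * (1 + (x - A)) ^ k \<le> C"
  using assms unfolding rapid_def by blast
 have "0 \<le> C" using order_trans[OF _ C[of A]] by simp
 then show ?thesis using C by (intro that[of C]) (simp_all add: pos_le_divide_eq)
qed

lemma rapid_vd: "rapid f ==> rapid (vd f)"
 unfolding rapid_def by (metis nth_vderiv_Suc' smooth_vd)

lemma rapid_nth_vderiv: "rapid f ==> rapid (nth_vderiv m f)"
 by (induction m arbitrary: f) (auto simp: nth_vderiv_Suc' rapid_vd)

lemma rapid_cmult: assumes "rapid f" shows "rapid (\<lambda>x. c * f x)"
 unfolding rapid_def
proof (intro conjI allI)
 show "smooth (\<lambda>x. c * f x)" using assms by (simp add: rapid_smooth smooth_cmult)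
 fix m A and k :: nat
 obtain C where C: "0 \<le> C" "\<And>x. A \<le> x ==> norm (nth_vderiv m f x) \<le> C / (1 + (x - A)) ^ k"
  using rapid_bound[OF assms] by metis
 show "\<exists>C. \<forall>x\<ge>A. norm (nth_vderiv m (\<lambda>x. c * f x) x) * (1 + (x - A)) ^ k \<le> C"
 proof (intro exI allI impI)
  fix x assume x: "A \<le> x"
  then have "norm (nth_vderiv m f x) * (1 + (x - A)) ^ k \<le> C" using C(2)[OF x] by (simp add: pos_le_divide_eq)
  then show "norm (nth_vderiv m (\<lambda>x. c * f x) x) * (1 + (x - A)) ^ k \<le> norm c * C"
   using mult_left_mono[of _ _ "norm c"] by (simp add: nth_vderiv_cmult[OF rapid_smooth[OF assms]] norm_mult mult.assoc)
 qed
qed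

lemma rapid_zero_right:
 assumes f: "smooth f" and b: "\<And>x. b < x ==> f x = 0" shows "rapid f"
 unfolding rapid_def
proof (intro conjI allI)
 fix m A and k :: nat
 let ?h = "\<lambda>x. norm (nth_vderiv m f x) * (1 + (x - A)) ^ k"
 have "continuous_on {A..max A b} ?h"
  by (intro continuous_intros smooth_continuous smooth_nth_vderiv f)
 then have "compact (?h ` {A..max A b})" by (intro compact_continuous_image) auto
 then obtain C where C: "\<And>x. x \<in> {A..max A b} ==> norm (?h x) \<le> C"
  by (meson bounded_iff compact_imp_bounded imageI)
 show "\<exists>C. \<forall>x\<ge>A. ?h x \<le> C"
 proof (intro exI allI impI)
  fix x assume x: "A \<le> x"
  show "?h x \<le> max C 0"
  proof (cases "x \<le> max A b")
   case True
   then have "norm (?h x) \<le> C" using x by (intro C) auto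
   then show ?thesis by (simp only: real_norm_def)
  next
   case False
   then have "nth_vderiv m f x = 0" by (intro nth_vderiv_eq_0_open[of "{b<..}"] b) auto
   then show ?thesis by simp
  qed
 qed
qed fact

text \<open>Comparison with s^(a-1) on (0, 1], integrable as a > 0, and with s^(a-b-1) beyond 1,
  integrable as a < b. It serves the Weyl, the Erdelyi-Kober and the Stieltjes kernels.\<close>

lemma power_integral_finite:
 assumes a: "0 < a" and b: "a < b"
 shows "(NR s. indicator {0<..} s * s powr (a - 1) * (1 + s) powr (- b)) < \<infinity>"
proof -
 have "(NR s. indicator {0<..} s * s powr (a - 1) * (1 + s) powr (- b))
  \<le> (NN s. ennreal (if s \<in> {0..1} then s powr (a - 1) else 0) + ennreal (s powr (a - b - 1)) * indicator {1..} s)"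
 proof (rule nn_integral_mono)
  fix s :: real
  consider "s \<le> 0" | "0 < s" "s \<le> 1" | "1 < s" by linarith
  then show "ennreal (indicator {0<..} s * s powr (a - 1) * (1 + s) powr (- b)) \<le> ennreal (if s \<in> {0..1} then s powr (a - 1) else 0) + ennreal (s powr (a - b - 1)) * indicator {1..} s"
  proof cases
   case 2
   have "(1 + s) powr (- b) \<le> (1 + s) powr 0" using 2 a b by (intro powr_mono) auto
   then have "s powr (a - 1) * (1 + s) powr (- b) \<le> s powr (a - 1)" using 2 by (intro mult_left_le) auto
   then have "ennreal (indicator {0<..} s * s powr (a - 1) * (1 + s) powr (- b)) \<le> ennreal (s powr (a - 1))"
    using 2 by (intro ennreal_leI) auto
   also have "\<dots> \<le> ennreal (if s \<in> {0..1} then s powr (a - 1) else 0) + ennreal (s powr (a - b - 1)) * indicator {1..} s"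
    using 2 by (intro order_trans[OF _ add_increasing2[OF _ order_refl]]) auto
   finally show ?thesis .
  next
   case 3
   have "(1 + s) powr (- b) \<le> s powr (- b)" using 3 a b by (intro powr_mono2') auto
   then have "s powr (a - 1) * (1 + s) powr (- b) \<le> s powr (a - 1) * s powr (- b)" by (intro mult_left_mono) auto
   also have "\<dots> = s powr (a - b - 1)" using 3 by (simp add: powr_add[symmetric] algebra_simps)
   finally show ?thesis using 3 by (auto intro!: ennreal_leI)
  qed simp
 qed
 also have "\<dots> = (NR s. if s \<in> {0..1} then s powr (a - 1) else 0) + (NN s. ennreal (s powr (a - b - 1)) * indicator {1..} s)"
  by (rule nn_integral_add) measurable
 also have "(NR s. if s \<in> {0..1} then s powr (a - 1) else 0) = ennreal (1 powr (a - 1 + 1) / (a - 1 + 1))"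
 proof (rule nn_integral_has_integral_lborel)
  show "((\<lambda>s. if s \<in> {0..1} then s powr (a - 1) else 0) has_integral 1 powr (a - 1 + 1) / (a - 1 + 1)) UNIV"
   unfolding has_integral_restrict_UNIV using a by (intro has_integral_powr_from_0) auto
 qed auto
 also have "(NN s. ennreal (s powr (a - b - 1)) * indicator {1..} s) = ennreal (0 - (- (1 powr (a - b) / (b - a))))"
 proof (rule nn_integral_FTC_atLeast)
  have "((\<lambda>x::real. x powr (a - b)) \<longlongrightarrow> 0) at_top"
   using b by (intro tendsto_neg_powr filterlim_ident) auto
  then have "((\<lambda>x::real. - (x powr (a - b) / (b - a))) \<longlongrightarrow> - (0 / (b - a))) at_top"
   using b by (intro tendsto_intros) auto
  then show "((\<lambda>x::real. - (x powr (a - b) / (b - a))) \<longlongrightarrow> 0) at_top" by simp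
  fix x :: real assume x: "1 \<le> x"
  have "((\<lambda>x. - (x powr (a - b) / (b - a))) has_real_derivative - ((a - b) * x powr (a - b - 1) / (b - a))) (at x)"
   using x b by (auto intro!: derivative_eq_intros)
  moreover have "- ((a - b) * x powr (a - b - 1) / (b - a)) = x powr (a - b - 1)" using b by (simp add: field_simps)
  ultimately show "((\<lambda>x. - (x powr (a - b) / (b - a))) has_real_derivative x powr (a - b - 1)) (at x)" by simp
 qed auto
 finally show ?thesis by (rule le_less_trans) simp
qed

definition fker :: "real => real => real" where
 "fker \<gamma> s = indicator {0<..} s * s powr (\<gamma> - 1)"

lemma fker_measurable [measurable]: "borel_fun (fker \<gamma>)"
 unfolding fker_def[abs_def] by measurable

lemma fker_nonneg [simp]: "0 \<le> fker \<gamma> s"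
 by (simp add: fker_def)

text \<open>The Weyl fractional integral of order \<gamma>, written over the fixed half-line s > 0
  so that differentiation in x passes to f.\<close>

definition frac_int :: "real => (real => complex) => real => complex" where
 "frac_int \<gamma> f x = (1 / Gamma \<gamma>) *\<^sub>R (LBINT s. fker \<gamma> s *\<^sub>R f (x + s))"

lemma frac_majorant_integrable:
 assumes g: "0 < \<gamma>" "\<gamma> < real k"
 shows "integrable lborel (\<lambda>s. fker \<gamma> s * (C / (1 + s) ^ k))"
proof -
 have e: "fker \<gamma> s * (1 / (1 + s) ^ k) = indicator {0<..} s * s powr (\<gamma> - 1) * (1 + s) powr (- real k)" for s
  by (auto simp: fker_def indicator_def powr_minus_divide powr_realpow)
 have "integrable lborel (\<lambda>s. fker \<gamma> s * (1 / (1 + s) ^ k))"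
  unfolding e using power_integral_finite[OF g] by (intro integrableI_bounded) (auto simp: abs_mult)
 then have "integrable lborel (\<lambda>s. C * (fker \<gamma> s * (1 / (1 + s) ^ k)))" by (rule integrable_mult_right)
 then show ?thesis by (simp add: mult_ac)
qed

lemma frac_integrable:
 fixes f :: "real => complex"
 assumes g: "0 < \<gamma>" "\<gamma> < real k" and [measurable]: "borel_fun f"
  and C: "\<And>s. 0 < s ==> norm (f s) \<le> C / (1 + s) ^ k"
 shows "integrable lborel (\<lambda>s. fker \<gamma> s *\<^sub>R f s)"
proof (rule Bochner_Integration.integrable_bound[OF frac_majorant_integrable[OF g, of C]])
 show "AE s in lborel. norm (fker \<gamma> s *\<^sub>R f s) \<le> norm (fker \<gamma> s * (C / (1 + s) ^ k))"
 proof (rule AE_I2)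
  fix s :: real
  show "norm (fker \<gamma> s *\<^sub>R f s) \<le> norm (fker \<gamma> s * (C / (1 + s) ^ k))"
  proof (cases "0 < s")
   case True
   have "fker \<gamma> s * norm (f s) \<le> fker \<gamma> s * (C / (1 + s) ^ k)" by (intro mult_left_mono C True) simp
   also have "\<dots> \<le> norm (fker \<gamma> s * (C / (1 + s) ^ k))" by (simp only: real_norm_def abs_ge_self)
   finally show ?thesis by simp
  qed (simp add: fker_def)
 qed
qed measurable

lemma ex_nat_gt: "\<exists>k::nat. (\<gamma>::real) < real k" by (rule reals_Archimedean2)

lemma rapid_frac_integrable:
 assumes "rapid f" "0 < \<gamma>"
 shows "integrable lborel (\<lambda>s. fker \<gamma> s *\<^sub>R f (x + s))"
proof -
 obtain k :: nat where k: "\<gamma> < real k" using ex_nat_gt by blast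
 obtain C where C: "0 \<le> C" "\<And>z. x \<le> z ==> norm (nth_vderiv 0 f z) \<le> C / (1 + (z - x)) ^ k"
  using rapid_bound[OF assms(1)] by metis
 have [measurable]: "borel_fun f" by (rule smooth_borel[OF rapid_smooth[OF assms(1)]])
 show ?thesis
  using C(2)[of "x + _"] by (intro frac_integrable[OF assms(2) k, where C=C]) auto
qed

lemma has_vector_derivativeI_tendsto:
 fixes F :: "real => complex"
 assumes "((\<lambda>h. (1 / h) *\<^sub>R (F (x + h) - F x)) \<longlongrightarrow> D) (at 0)"
 shows "(F has_vector_derivative D) (at x)"
 unfolding has_vector_derivative_def has_derivative_at
proof (intro conjI)
 have "((\<lambda>h. norm ((1 / h) *\<^sub>R (F (x + h) - F x) - D)) \<longlongrightarrow> 0) (at 0)"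
  using assms by (simp add: LIM_zero_iff tendsto_norm_zero_iff)
 moreover have "\<forall>\<^sub>F h in at 0. norm ((1 / h) *\<^sub>R (F (x + h) - F x) - D) = norm (F (x + h) - F x - h *\<^sub>R D) / norm h"
 proof (rule eventually_at_filter[THEN iffD2], rule always_eventually, intro allI impI)
  fix h :: real assume h: "h \<noteq> 0"
  have e: "(1 / h) *\<^sub>R (F (x + h) - F x) - D = (1 / h) *\<^sub>R (F (x + h) - F x - h *\<^sub>R D)"
   using h by (simp add: scaleR_diff_right)
  show "norm ((1 / h) *\<^sub>R (F (x + h) - F x) - D) = norm (F (x + h) - F x - h *\<^sub>R D) / norm h"
   unfolding e by simp
 qed
 ultimately show "((\<lambda>h. norm (F (x + h) - F x - h *\<^sub>R D) / norm h) \<longlongrightarrow> 0) (at 0)"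
  by (rule Lim_transform_eventually)
qed (rule bounded_linear_scaleR_left)

lemma smooth_mean_value:
 assumes f: "smooth f" and B: "\<And>z. min a b \<le> z ==> norm (vd f z) \<le> B"
 shows "norm (f b - f a) \<le> B * \<bar>b - a\<bar>"
proof -
 have "norm (f b - f a) \<le> B * norm (b - a)"
 proof (rule differentiable_bound[where S="{min a b..}" and f'="\<lambda>z h. h *\<^sub>R vd f z"])
  fix z assume z: "z \<in> {min a b..}"
  show "(f has_derivative (\<lambda>h. h *\<^sub>R vd f z)) (at z within {min a b..})"
   using smooth_has_vderiv[OF f, of z] has_derivative_at_withinI unfolding has_vector_derivative_def by blast
  have "0 \<le> B" using B[of z] z norm_ge_zero[of "vd f z"] by (auto simp del: norm_ge_zero)
  then show "onorm (\<lambda>h. h *\<^sub>R vd f z) \<le> B"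
   using B[of z] z by (intro onorm_bound) (auto simp: mult.commute[of B] intro!: mult_left_mono)
 qed (auto simp: convex_real_interval)
 then show ?thesis by simp
qed

text \<open>Differentiation under the integral: the mean value bound on the difference quotients,
  together with the decay of the derivative, gives an integrable majorant.\<close>

lemma frac_int_has_vderiv:
 assumes f: "rapid f" and g: "0 < \<gamma>"
 shows "(frac_int \<gamma> f has_vector_derivative frac_int \<gamma> (vd f) x) (at x)"
proof (rule has_vector_derivativeI_tendsto)
 have fm[measurable]: "borel_fun f" by (rule smooth_borel[OF rapid_smooth[OF f]])
 have f'm[measurable]: "borel_fun (vd f)" by (rule smooth_borel[OF smooth_vd[OF rapid_smooth[OF f]]])
 obtain k :: nat where k: "\<gamma> < real k" using ex_nat_gt by blast
 show "((\<lambda>h. (1 / h) *\<^sub>R (frac_int \<gamma> f (x + h) - frac_int \<gamma> f x)) \<longlongrightarrow> frac_int \<gamma> (vd f) x) (at 0)"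
  unfolding tendsto_at_iff_sequentially
 proof (intro allI impI)
  fix X :: "nat => real" assume X: "\<forall>i. X i \<in> UNIV - {0}" "X \<longlonglongrightarrow> 0"
  \<comment> \<open>All increments are at most H in modulus, so a decay bound starting at x - H
    controls every difference quotient.\<close>
  obtain H where H: "\<And>n. \<bar>X n\<bar> \<le> H"
   using convergent_imp_Bseq[of X] X by (auto simp: convergent_def Bseq_def)
  obtain C where C: "0 \<le> C" "\<And>z. x - H \<le> z ==> norm (nth_vderiv 1 f z) \<le> C / (1 + (z - (x - H))) ^ k"
   using rapid_bound[OF f] by metis
  have n1: "nth_vderiv 1 f = vd f" by (simp add: nth_vderiv_Suc')
  let ?q = "\<lambda>n s. (1 / X n) *\<^sub>R (f (x + X n + s) - f (x + s))"
  have qb: "norm (?q n s) \<le> C / (1 + s) ^ k" if s: "0 < s" for n s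
  proof -
   have "norm (f (x + X n + s) - f (x + s)) \<le> C / (1 + s) ^ k * \<bar>x + X n + s - (x + s)\<bar>"
   proof (rule smooth_mean_value[OF rapid_smooth[OF f]])
    fix z assume "min (x + s) (x + X n + s) \<le> z"
    then have z: "x - H + s \<le> z" using H[of n] by auto
    then have "norm (vd f z) \<le> C / (1 + (z - (x - H))) ^ k" using C(2)[of z, unfolded n1] s by simp
    also have "\<dots> \<le> C / (1 + s) ^ k"
     using z s C by (intro divide_left_mono power_mono mult_pos_pos zero_less_power) auto
    finally show "norm (vd f z) \<le> C / (1 + s) ^ k" .
   qed
   then show ?thesis using X(1) by (simp add: divide_le_eq)
  qed
  have "(\<lambda>n. LBINT s. fker \<gamma> s *\<^sub>R ?q n s) \<longlonglongrightarrow> (LBINT s. fker \<gamma> s *\<^sub>R vd f (x + s))"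
  proof (rule integral_dominated_convergence[OF _ _ frac_majorant_integrable[OF g k, of C]])
   show "AE s in lborel. (\<lambda>n. fker \<gamma> s *\<^sub>R ?q n s) \<longlonglongrightarrow> fker \<gamma> s *\<^sub>R vd f (x + s)"
   proof (intro AE_I2 tendsto_scaleR tendsto_const)
    fix s
    have "((\<lambda>y. norm (f y - f (x + s) - (y - (x + s)) *\<^sub>R vd f (x + s)) / norm (y - (x + s))) \<longlongrightarrow> 0) (at (x + s))"
     using smooth_has_vderiv[OF rapid_smooth[OF f], of "x + s"] by (simp add: has_vector_derivative_def has_derivative_iff_norm)
    moreover have "filterlim (\<lambda>n. x + X n + s) (at (x + s)) sequentially"
     using X by (auto simp: filterlim_at add.commute add.left_commute intro!: always_eventually tendsto_eq_intros)
    ultimately have "(\<lambda>n. norm (f (x + X n + s) - f (x + s) - (x + X n + s - (x + s)) *\<^sub>R vd f (x + s)) / norm (x + X n + s - (x + s))) \<longlonglongrightarrow> 0"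
     by (rule filterlim_compose)
    moreover have "norm (f (x + X n + s) - f (x + s) - (x + X n + s - (x + s)) *\<^sub>R vd f (x + s)) / norm (x + X n + s - (x + s)) = norm (?q n s - vd f (x + s))" for n
    proof -
     have "X n \<noteq> 0" using X(1) by auto
     then have e: "?q n s - vd f (x + s) = (1 / X n) *\<^sub>R (f (x + X n + s) - f (x + s) - X n *\<^sub>R vd f (x + s))"
      by (simp add: scaleR_diff_right)
     show ?thesis unfolding e by simp
    qed
    ultimately show "(\<lambda>n. ?q n s) \<longlonglongrightarrow> vd f (x + s)" by (simp add: LIM_zero_iff tendsto_norm_zero_iff)
   qed
   show "AE s in lborel. norm (fker \<gamma> s *\<^sub>R ?q n s) \<le> fker \<gamma> s * (C / (1 + s) ^ k)" for n
   proof (rule AE_I2)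
    fix s :: real
    show "norm (fker \<gamma> s *\<^sub>R ?q n s) \<le> fker \<gamma> s * (C / (1 + s) ^ k)"
    proof (cases "0 < s")
     case True
     have "norm (fker \<gamma> s *\<^sub>R ?q n s) = fker \<gamma> s * norm (?q n s)" by (simp only: norm_scaleR abs_of_nonneg fker_nonneg)
     also have "\<dots> \<le> fker \<gamma> s * (C / (1 + s) ^ k)" by (intro mult_left_mono qb True) simp
     finally show ?thesis .
    qed (simp add: fker_def)
   qed
  qed measurable
  moreover have "(1 / X n) *\<^sub>R (frac_int \<gamma> f (x + X n) - frac_int \<gamma> f x) = (1 / Gamma \<gamma>) *\<^sub>R (LBINT s. fker \<gamma> s *\<^sub>R ?q n s)" for n
  proof -
   have "(LBINT s. fker \<gamma> s *\<^sub>R ?q n s) = (LBINT s. (1 / X n) *\<^sub>R (fker \<gamma> s *\<^sub>R f (x + X n + s) - fker \<gamma> s *\<^sub>R f (x + s)))"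
    by (intro Bochner_Integration.integral_cong) (auto simp: scaleR_diff_right mult.commute)
   also have "\<dots> = (1 / X n) *\<^sub>R ((LBINT s. fker \<gamma> s *\<^sub>R f (x + X n + s)) - (LBINT s. fker \<gamma> s *\<^sub>R f (x + s)))"
    using rapid_frac_integrable[OF f g, of "x + X n"] rapid_frac_integrable[OF f g, of x]
    by (simp only: integral_scaleR_right Bochner_Integration.integral_diff)
   finally show ?thesis by (simp add: frac_int_def scaleR_diff_right mult.commute)
  qed
  ultimately show "((\<lambda>h. (1 / h) *\<^sub>R (frac_int \<gamma> f (x + h) - frac_int \<gamma> f x)) \<circ> X) \<longlonglongrightarrow> frac_int \<gamma> (vd f) x"
   unfolding o_def frac_int_def[of \<gamma> "vd f"] by (simp only:) (intro tendsto_scaleR tendsto_const)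
 qed
qed

lemma smooth_frac_int:
 assumes "rapid f" "0 < \<gamma>" shows "smooth (frac_int \<gamma> f)"
proof (rule smooth_coinduct[of "\<lambda>h. \<exists>f. rapid f \<and> h = frac_int \<gamma> f"])
 fix h assume "\<exists>f. rapid f \<and> h = frac_int \<gamma> f"
 then obtain f where f: "rapid f" and h: "h = frac_int \<gamma> f" by blast
 show "\<exists>h'. (\<exists>f. rapid f \<and> h' = frac_int \<gamma> f) \<and> (\<forall>x. (h has_vector_derivative h' x) (at x))"
  unfolding h by (intro exI[of _ "frac_int \<gamma> (vd f)"] conjI allI exI[of _ "vd f"] refl rapid_vd f frac_int_has_vderiv assms(2))
qed (intro exI[of _ f] conjI refl assms(1))

lemma nth_vderiv_frac_int:
 assumes "rapid f" "0 < \<gamma>" shows "nth_vderiv m (frac_int \<gamma> f) = frac_int \<gamma> (nth_vderiv m f)"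
proof (induction m)
 case (Suc m)
 show ?case
  unfolding nth_vderiv_Suc Suc.IH
  by (intro ext vector_derivative_at frac_int_has_vderiv rapid_nth_vderiv assms)
qed simp

lemma rapid_frac_int:
 assumes f: "rapid f" and g: "0 < \<gamma>" shows "rapid (frac_int \<gamma> f)"
 unfolding rapid_def
proof (intro conjI allI)
 show "smooth (frac_int \<gamma> f)" by (rule smooth_frac_int[OF assms])
 fix m A and k :: nat
 obtain K :: nat where K: "\<gamma> < real K" using ex_nat_gt by blast
 \<comment> \<open>Of the k + K powers, k give the decay claimed for the integral and K the
   convergence in s.\<close>
 obtain C where C: "0 \<le> C" "\<And>x. A \<le> x ==> norm (nth_vderiv m f x) \<le> C / (1 + (x - A)) ^ (k + K)"
  using rapid_bound[OF f] by metis
 let ?f = "nth_vderiv m f"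
 let ?I = "LBINT s. fker \<gamma> s * (C / (1 + s) ^ K)"
 show "\<exists>C. \<forall>x\<ge>A. norm (nth_vderiv m (frac_int \<gamma> f) x) * (1 + (x - A)) ^ k \<le> C"
 proof (intro exI allI impI)
  fix x assume x: "A \<le> x"
  have "norm (LBINT s. fker \<gamma> s *\<^sub>R ?f (x + s)) \<le> (LBINT s. 1 / (1 + (x - A)) ^ k * (fker \<gamma> s * (C / (1 + s) ^ K)))"
  proof (rule Bochner_Integration.integral_norm_bound_integral)
   show "integrable lborel (\<lambda>s. fker \<gamma> s *\<^sub>R ?f (x + s))" by (rule rapid_frac_integrable[OF rapid_nth_vderiv[OF f] g])
   show "integrable lborel (\<lambda>s. 1 / (1 + (x - A)) ^ k * (fker \<gamma> s * (C / (1 + s) ^ K)))"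
    by (intro integrable_mult_right frac_majorant_integrable[OF g K])
   fix s :: real
   show "norm (fker \<gamma> s *\<^sub>R ?f (x + s)) \<le> 1 / (1 + (x - A)) ^ k * (fker \<gamma> s * (C / (1 + s) ^ K))"
   proof (cases "0 < s")
    case True
    have "norm (?f (x + s)) \<le> C / (1 + (x + s - A)) ^ (k + K)" using C(2)[of "x + s"] x True by simp
    also have "\<dots> \<le> C / ((1 + (x - A)) ^ k * (1 + s) ^ K)"
     unfolding power_add using True x C by (intro divide_left_mono mult_mono power_mono mult_pos_pos zero_less_power) auto
    finally have "norm (?f (x + s)) \<le> 1 / (1 + (x - A)) ^ k * (C / (1 + s) ^ K)" by simp
    from mult_left_mono[OF this fker_nonneg[of \<gamma> s]] show ?thesis by (simp add: mult_ac)
   qed (simp add: fker_def)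
  qed
  also have "\<dots> = ?I / (1 + (x - A)) ^ k" unfolding integral_mult_right_zero by simp
  finally have "norm (LBINT s. fker \<gamma> s *\<^sub>R ?f (x + s)) * (1 + (x - A)) ^ k \<le> ?I"
   using x by (simp add: pos_le_divide_eq)
  then have "\<bar>1 / Gamma \<gamma>\<bar> * (norm (LBINT s. fker \<gamma> s *\<^sub>R ?f (x + s)) * (1 + (x - A)) ^ k) \<le> \<bar>1 / Gamma \<gamma>\<bar> * ?I"
   by (intro mult_left_mono) auto
  then show "norm (nth_vderiv m (frac_int \<gamma> f) x) * (1 + (x - A)) ^ k \<le> \<bar>1 / Gamma \<gamma>\<bar> * ?I"
   unfolding nth_vderiv_frac_int[OF f g] frac_int_def norm_scaleR by (simp only: mult.assoc)
 qed
qed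

text \<open>Substituting s = v r scales the integrand to Euler's Beta integral on (0, 1); the
  exponents of v combine to a + b - 1.\<close>

lemma fker_beta:
 assumes ab: "0 < a" "0 < b"
 shows "(NR s. fker a s * fker b (v - s)) = ennreal (Beta a b * fker (a + b) v)"
proof (cases "0 < v")
 case True
 let ?h = "\<lambda>r. if r \<in> {0..1} then r powr (a - 1) * (1 - r) powr (b - 1) else (0::real)"
 have B: "(NR r. ?h r) = ennreal (Beta a b)"
 proof (rule nn_integral_has_integral_lborel)
  show "(?h has_integral Beta a b) UNIV"
   unfolding has_integral_restrict_UNIV by (rule has_integral_Beta_real[OF ab])
 qed auto
 have pw: "fker a (v * r) * fker b (v - v * r) = v powr (a + b - 2) * ?h r" for r
 proof -
  consider "r \<le> 0" | "1 \<le> r" | "0 < r" "r < 1" by linarith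
  then show ?thesis
  proof cases
   case 3
   have "v - v * r = v * (1 - r)" by (simp add: algebra_simps)
   then have "fker a (v * r) * fker b (v - v * r) = (v powr (a - 1) * v powr (b - 1)) * (r powr (a - 1) * (1 - r) powr (b - 1))"
    using 3 True by (simp add: fker_def powr_mult)
   also have "v powr (a - 1) * v powr (b - 1) = v powr (a + b - 2)" by (simp add: powr_add[symmetric])
   finally show ?thesis using 3 by simp
  next
   case 1
   then have "v * r \<le> 0" using True by (simp add: mult_nonneg_nonpos)
   then show ?thesis using 1 by (auto simp: fker_def)
  next
   case 2
   then have "v * 1 \<le> v * r" using True by (intro mult_left_mono) auto
   then show ?thesis using 2 by (auto simp: fker_def)
  qed
 qed
 have "(NR s. fker a s * fker b (v - s))
   = ennreal v * (NR r. fker a (v * r) * fker b (v - v * r))"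
  using nn_integral_real_affine[of "\<lambda>s. ennreal (fker a s * fker b (v - s))" v 0] True by simp
 also have "\<dots> = ennreal v * (ennreal (v powr (a + b - 2)) * ennreal (Beta a b))"
  unfolding pw B[symmetric] by (subst nn_integral_cmult[symmetric]) (auto simp: ennreal_mult)
 also have "\<dots> = ennreal (v * v powr (a + b - 2) * Beta a b)"
  using True ab by (simp add: ennreal_mult[symmetric] Beta_def mult.assoc)
 also have "v * v powr (a + b - 2) = v powr (a + b - 1)" using True by (simp add: powr_mult_base)
 finally show ?thesis using True by (simp add: fker_def mult.commute)
next
 case False
 then have "ennreal (fker a s * fker b (v - s)) = 0" for s by (auto simp: fker_def indicator_def)
 moreover have "fker (a + b) v = 0" using False by (auto simp: fker_def)
 ultimately show ?thesis by (simp only: nn_integral_const) simp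
qed

text \<open>Fubini and the convolution rule of the power kernels; Beta(a, b) cancels the Gamma
  factors. The hypothesis is absolute convergence at the point x, because the injectivity argument
  applies the law to functions without smoothness.\<close>

lemma frac_int_semigroup:
 assumes ab: "0 < a" "0 < b" and G[measurable]: "borel_fun G"
  and fin: "(NR s. fker (a + b) s * norm (G (x + s))) < \<infinity>"
 shows "frac_int a (frac_int b G) x = frac_int (a + b) G x"
proof -
 have Bpos: "0 < Beta a b" using ab by (simp add: Beta_def)
 have int: "integrable (lborel \<Otimes>\<^sub>M lborel) (\<lambda>(v, s). (fker a s * fker b (v - s)) *\<^sub>R G (x + v))"
 proof (rule integrableI_bounded)
  have "(\<integral>\<^sup>+z. ennreal (norm (case z of (v, s) => (fker a s * fker b (v - s)) *\<^sub>R G (x + v))) \<partial>(lborel \<Otimes>\<^sub>M lborel))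
   = (NN v. NR s. norm ((fker a s * fker b (v - s)) *\<^sub>R G (x + v)))"
   by (subst lborel.nn_integral_fst[symmetric]) auto
  also have "\<dots> = (NN v. (NR s. fker a s * fker b (v - s)) * ennreal (norm (G (x + v))))"
   by (intro nn_integral_cong, subst nn_integral_multc[symmetric]) (auto simp: ennreal_mult)
  also have "\<dots> = (NN v. ennreal (Beta a b) * ennreal (fker (a + b) v * norm (G (x + v))))"
   unfolding fker_beta[OF ab] using Bpos by (simp add: ennreal_mult mult.assoc)
  also have "\<dots> = ennreal (Beta a b) * (NR v. fker (a + b) v * norm (G (x + v)))"
   by (rule nn_integral_cmult) measurable
  also have "\<dots> < \<infinity>" using fin by (simp add: ennreal_mult_less_top)
  finally show "(\<integral>\<^sup>+z. ennreal (norm (case z of (v, s) => (fker a s * fker b (v - s)) *\<^sub>R G (x + v))) \<partial>(lborel \<Otimes>\<^sub>M lborel)) < \<infinity>" .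
 qed measurable
 have inner: "(LBINT s. (fker a s * fker b (v - s)) *\<^sub>R G (x + v)) = (Beta a b * fker (a + b) v) *\<^sub>R G (x + v)" for v
 proof -
  have "(LBINT s. fker a s * fker b (v - s)) = Beta a b * fker (a + b) v"
   using fker_beta[OF ab, of v] Bpos by (subst integral_eq_nn_integral) auto
  moreover have "integrable lborel (\<lambda>s. fker a s * fker b (v - s))"
   using fker_beta[OF ab, of v] by (intro integrableI_bounded) auto
  ultimately show ?thesis by simp
 qed
 have "(LBINT s. fker a s *\<^sub>R frac_int b G (x + s)) = (LBINT s. (1 / Gamma b) *\<^sub>R (LBINT v. (fker a s * fker b (v - s)) *\<^sub>R G (x + v)))"
 proof (intro Bochner_Integration.integral_cong refl)
  fix s
  have "(LBINT r. fker b r *\<^sub>R G (x + s + r)) = (LBINT v. fker b (v - s) *\<^sub>R G (x + v))"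
   using lborel_integral_real_affine[of 1 "\<lambda>r. fker b r *\<^sub>R G (x + s + r)" "-s"] by (simp add: add.assoc)
  then show "fker a s *\<^sub>R frac_int b G (x + s) = (1 / Gamma b) *\<^sub>R (LBINT v. (fker a s * fker b (v - s)) *\<^sub>R G (x + v))"
   by (simp add: frac_int_def scaleR_scaleR[symmetric] mult.commute del: scaleR_scaleR) (simp add: mult.commute)
 qed
 also have "\<dots> = (1 / Gamma b) *\<^sub>R (LBINT s. LBINT v. (fker a s * fker b (v - s)) *\<^sub>R G (x + v))"
  by (rule integral_scaleR_right)
 also have "(LBINT s. LBINT v. (fker a s * fker b (v - s)) *\<^sub>R G (x + v)) = (LBINT v. LBINT s. (fker a s * fker b (v - s)) *\<^sub>R G (x + v))"
  using lborel_pair.Fubini_integral[OF int] by simp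
 also have "\<dots> = (LBINT v. Beta a b *\<^sub>R (fker (a + b) v *\<^sub>R G (x + v)))"
  unfolding inner by simp
 also have "\<dots> = Beta a b *\<^sub>R (LBINT v. fker (a + b) v *\<^sub>R G (x + v))"
  by (rule integral_scaleR_right)
 finally show ?thesis
  using Gamma_real_pos[OF ab(1)] Gamma_real_pos[OF ab(2)] by (simp add: frac_int_def Beta_def)
qed

lemma rapid_frac_int_semigroup:
 assumes "0 < a" "0 < b" "rapid f" shows "frac_int a (frac_int b f) = frac_int (a + b) f"
proof
 fix x
 have "integrable lborel (\<lambda>s. fker (a + b) s *\<^sub>R f (x + s))"
  using assms by (intro rapid_frac_integrable) auto
 then have "(NR s. fker (a + b) s * norm (f (x + s))) < \<infinity>"
  by (simp add: integrable_iff_bounded)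
 then show "frac_int a (frac_int b f) x = frac_int (a + b) f x"
  using assms by (intro frac_int_semigroup smooth_borel rapid_smooth)
qed

text \<open>The fundamental theorem of calculus on [x, x + n], with f(x + n) tending to 0.\<close>

lemma frac_int_1_vd:
 assumes f: "rapid f" shows "frac_int 1 (vd f) x = - f x"
proof -
 let ?g = "\<lambda>s. fker 1 s *\<^sub>R vd f (x + s)"
 have gi: "integrable lborel ?g" by (rule rapid_frac_integrable[OF rapid_vd[OF f]]) simp
 have "(\<lambda>n. LBINT s. indicator {- real n..real n} s *\<^sub>R ?g s) \<longlonglongrightarrow> integral\<^sup>L lborel ?g"
 proof (rule integral_dominated_convergence[where w="\<lambda>s. norm (?g s)"])
  show "AE s in lborel. (\<lambda>n. indicator {- real n..real n} s *\<^sub>R ?g s) \<longlonglongrightarrow> ?g s"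
  proof (rule AE_I2)
   fix s :: real
   obtain k :: nat where k: "\<bar>s\<bar> \<le> real k" using real_arch_simple by blast
   have "\<forall>\<^sub>F n in sequentially. indicator {- real n..real n} s *\<^sub>R ?g s = ?g s"
    by (rule eventually_sequentiallyI[of k]) (use k in \<open>auto simp: indicator_def\<close>)
   then show "(\<lambda>n. indicator {- real n..real n} s *\<^sub>R ?g s) \<longlonglongrightarrow> ?g s" by (rule tendsto_eventually)
  qed
  show "?g \<in> borel_measurable lborel" by (rule borel_measurable_integrable[OF gi])
  show "(\<lambda>s. indicator {- real n..real n} s *\<^sub>R ?g s) \<in> borel_measurable lborel" for n
   by (intro borel_measurable_scaleR borel_measurable_integrable[OF gi] borel_measurable_indicator) simp
  show "integrable lborel (\<lambda>s. norm (?g s))" by (rule integrable_norm[OF gi])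
  show "AE s in lborel. norm (indicator {- real n..real n} s *\<^sub>R ?g s) \<le> norm (?g s)" for n
   by (auto simp: indicator_def)
 qed
 moreover have "(LBINT s. indicator {- real n..real n} s *\<^sub>R ?g s) = f (x + real n) - f x" for n
 proof -
  have "(LBINT s. indicator {- real n..real n} s *\<^sub>R ?g s) = (LBINT s. indicator {0..real n} s *\<^sub>R vd f (x + s))"
  proof (rule integral_cong_AE)
   show "AE s in lborel. indicator {- real n..real n} s *\<^sub>R ?g s = indicator {0..real n} s *\<^sub>R vd f (x + s)"
    using AE_lborel_singleton[of 0] by eventually_elim (auto simp: fker_def indicator_def)
   show "(\<lambda>s. indicator {0..real n} s *\<^sub>R vd f (x + s)) \<in> borel_measurable lborel"
    using smooth_borel[OF smooth_vd[OF rapid_smooth[OF f]]] by measurable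
  qed (use borel_measurable_integrable[OF gi] in measurable)
  also have "\<dots> = f (x + real n) - f (x + 0)"
  proof (rule integral_FTC_Icc)
   fix s :: real
   have "((\<lambda>s. 1 * f (1 * s + x)) has_vector_derivative vd f (x + s)) (at s)"
   proof -
    have "((\<lambda>s. 1 * s + x) has_vector_derivative 1) (at s)"
     by (auto intro!: derivative_eq_intros simp: has_real_derivative_iff_has_vector_derivative[symmetric])
    from vector_diff_chain_at[OF this smooth_has_vderiv[OF rapid_smooth[OF f]]]
    show ?thesis by (simp add: o_def add.commute)
   qed
   then show "((\<lambda>s. f (x + s)) has_vector_derivative vd f (x + s)) (at s within {0..real n})"
    by (simp add: add.commute has_vector_derivative_at_within)
  next
   show "continuous_on {0..real n} (\<lambda>s. vd f (x + s))"
    by (rule continuous_on_compose2[OF smooth_continuous[OF smooth_vd[OF rapid_smooth[OF f]], of UNIV]]) (auto intro!: continuous_intros)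
  qed simp
  finally show ?thesis by simp
 qed
 ultimately have 1: "(\<lambda>n. f (x + real n) - f x) \<longlonglongrightarrow> integral\<^sup>L lborel ?g" by simp
 obtain C where C: "0 \<le> C" "\<And>z. x \<le> z ==> norm (nth_vderiv 0 f z) \<le> C / (1 + (z - x)) ^ 1"
  using rapid_bound[OF f] by metis
 have "(\<lambda>n. f (x + real n)) \<longlonglongrightarrow> 0"
 proof (rule Lim_null_comparison)
  show "\<forall>\<^sub>F n in sequentially. norm (f (x + real n)) \<le> C * inverse (real (Suc n))"
   using C(2)[of "x + real _"] by (auto intro!: always_eventually simp: divide_inverse)
  show "(\<lambda>n. C * inverse (real (Suc n))) \<longlonglongrightarrow> 0"
   using tendsto_mult_right_zero[OF inverse_Suc_seq(1), of C] by simp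
 qed
 then have "(\<lambda>n. f (x + real n) - f x) \<longlonglongrightarrow> 0 - f x" by (intro tendsto_diff tendsto_const)
 with 1 have "integral\<^sup>L lborel ?g = - f x" using LIMSEQ_unique by fastforce
 then show ?thesis by (simp add: frac_int_def)
qed

text \<open>Order n + 1 splits into n and 1 by the semigroup law; each unit of order undoes one
  derivative at the cost of a sign.\<close>

lemma frac_int_nth_vderiv:
 assumes f: "rapid f" and n: "0 < n" shows "frac_int (real n) (nth_vderiv n f) x = (-1) ^ n * f x"
 using n
proof (induction n arbitrary: x)
 case (Suc n)
 have e: "frac_int 1 (nth_vderiv (Suc n) f) = (\<lambda>x. - nth_vderiv n f x)"
  unfolding nth_vderiv_Suc by (rule ext) (rule frac_int_1_vd[OF rapid_nth_vderiv[OF f]])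
 show ?case
 proof (cases "n = 0")
  case True
  then show ?thesis using fun_cong[OF e, of x] by simp
 next
  case False
  have "frac_int (real n) (frac_int 1 (nth_vderiv (Suc n) f)) x = frac_int (real n + 1) (nth_vderiv (Suc n) f) x"
   using False by (subst rapid_frac_int_semigroup) (auto intro: rapid_nth_vderiv f)
  moreover have "frac_int (real n) (\<lambda>x. - nth_vderiv n f x) x = - frac_int (real n) (nth_vderiv n f) x"
   by (simp add: frac_int_def)
  ultimately show ?thesis using Suc.IH[of x] False by (simp add: e add.commute)
 qed
qed simp

text \<open>The right-sided Weyl derivative with the n-fold derivative moved inside the fractional
  integral; on rapidly decaying functions the two agree, and this form fits the semigroup law
  directly.\<close>

definition frac_deriv :: "nat => real => (real => complex) => real => complex" where
 "frac_deriv n \<alpha> f x = (-1) ^ n * frac_int (real n - \<alpha>) (nth_vderiv n f) x"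

text \<open>The orders \<alpha> and n - \<alpha> add up to n, where the integer case applies and the
  two signs cancel.\<close>

lemma frac_int_frac_deriv:
 assumes f: "rapid f" and a: "0 < \<alpha>" "\<alpha> < real n"
 shows "frac_int \<alpha> (frac_deriv n \<alpha> f) x = f x"
proof -
 have "frac_int \<alpha> (frac_deriv n \<alpha> f) x = (-1) ^ n * frac_int \<alpha> (frac_int (real n - \<alpha>) (nth_vderiv n f)) x"
  by (simp add: frac_int_def[of \<alpha>] frac_deriv_def del: mult_scaleR_right mult_scaleR_left flip: mult_scaleR_right)
 also have "frac_int \<alpha> (frac_int (real n - \<alpha>) (nth_vderiv n f)) = frac_int (\<alpha> + (real n - \<alpha>)) (nth_vderiv n f)"
  using a by (intro rapid_frac_int_semigroup rapid_nth_vderiv f) auto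
 also have "(-1) ^ n * \<dots> x = (-1) ^ n * ((-1) ^ n * f x)"
  using frac_int_nth_vderiv[OF f, of n x] a by (cases "n = 0") auto
 finally show ?thesis by (simp add: power_mult_distrib[symmetric] mult.assoc[symmetric])
qed

lemma frac_deriv_frac_int:
 assumes f: "rapid f" and a: "0 < \<alpha>" "\<alpha> < real n"
 shows "frac_deriv n \<alpha> (frac_int \<alpha> f) x = f x"
proof -
 have "frac_deriv n \<alpha> (frac_int \<alpha> f) x = (-1) ^ n * frac_int (real n - \<alpha>) (frac_int \<alpha> (nth_vderiv n f)) x"
  unfolding frac_deriv_def nth_vderiv_frac_int[OF f a(1)] ..
 also have "frac_int (real n - \<alpha>) (frac_int \<alpha> (nth_vderiv n f)) = frac_int (real n - \<alpha> + \<alpha>) (nth_vderiv n f)"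
  using a by (intro rapid_frac_int_semigroup rapid_nth_vderiv f) auto
 also have "(-1) ^ n * \<dots> x = (-1) ^ n * ((-1) ^ n * f x)"
  using frac_int_nth_vderiv[OF f, of n x] a by (cases "n = 0") auto
 finally show ?thesis by (simp add: power_mult_distrib[symmetric] mult.assoc[symmetric])
qed

section \<open>Weyl derivatives of Schwartz functions\<close>

lemma nth_vderiv_diff:
 assumes "smooth f" "smooth g"
 shows "nth_vderiv m (\<lambda>x. f x - g x) x = nth_vderiv m f x - nth_vderiv m g x"
 using nth_vderiv_add[OF assms(1) smooth_cmult[OF assms(2), of "-1"], of m x] nth_vderiv_cmult[OF assms(2), of m "-1" x] by simp

lemma schwartz_iff:
 "f \<in> schwartz \<longleftrightarrow> smooth f \<and> (\<forall>k m. \<exists>B. \<forall>x. \<bar>x\<bar> ^ k * norm (nth_vderiv m f x) \<le> B)"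
 by (auto simp: schwartz_def smooth_def bounded_iff power_abs)

lemma schwartz_smooth: "f \<in> schwartz ==> smooth f"
 by (simp add: schwartz_iff)

lemma schwartz_rapid:
 assumes f: "f \<in> schwartz" shows "rapid f"
 unfolding rapid_def
proof (intro conjI allI)
 show "smooth f" by (rule schwartz_smooth[OF f])
 fix m A and k :: nat
 obtain B0 where B0: "\<And>x. \<bar>x\<bar> ^ 0 * norm (nth_vderiv m f x) \<le> B0" using f unfolding schwartz_iff by blast
 obtain B where B: "\<And>x. \<bar>x\<bar> ^ k * norm (nth_vderiv m f x) \<le> B" using f unfolding schwartz_iff by blast
 let ?c = "2 ^ k :: real"
 show "\<exists>C. \<forall>x\<ge>A. norm (nth_vderiv m f x) * (1 + (x - A)) ^ k \<le> C"
 proof (intro exI allI impI)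
  fix x assume x: "A \<le> x"
  have "(1 + (x - A)) ^ k \<le> (2 * max (1 + \<bar>A\<bar>) \<bar>x\<bar>) ^ k"
   using x by (intro power_mono) (auto simp: max_def abs_if)
  also have "\<dots> \<le> 2 ^ k * ((1 + \<bar>A\<bar>) ^ k + \<bar>x\<bar> ^ k)"
   by (auto simp: power_mult_distrib max_def)
  finally have "norm (nth_vderiv m f x) * (1 + (x - A)) ^ k \<le> norm (nth_vderiv m f x) * (?c * ((1 + \<bar>A\<bar>) ^ k + \<bar>x\<bar> ^ k))"
   by (intro mult_left_mono) auto
  also have "\<dots> = ?c * ((1 + \<bar>A\<bar>) ^ k * (\<bar>x\<bar> ^ 0 * norm (nth_vderiv m f x)) + \<bar>x\<bar> ^ k * norm (nth_vderiv m f x))"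
   by (simp add: algebra_simps)
  also have "\<dots> \<le> ?c * ((1 + \<bar>A\<bar>) ^ k * B0 + B)"
   by (intro mult_left_mono add_mono B B0) auto
  finally show "norm (nth_vderiv m f x) * (1 + (x - A)) ^ k \<le> ?c * ((1 + \<bar>A\<bar>) ^ k * B0 + B)" .
 qed
qed

lemma schwartz_reflect:
 assumes f: "f \<in> schwartz" shows "(\<lambda>x. f (- x)) \<in> schwartz"
 unfolding schwartz_iff
proof (intro conjI allI)
 show "smooth (\<lambda>x. f (- x))" by (rule smooth_reflect[OF schwartz_smooth[OF f]])
 fix k m
 obtain B where B: "\<And>x. \<bar>x\<bar> ^ k * norm (nth_vderiv m f x) \<le> B" using f unfolding schwartz_iff by blast
 then show "\<exists>B. \<forall>x. \<bar>x\<bar> ^ k * norm (nth_vderiv m (\<lambda>x. f (- x)) x) \<le> B"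
  using B[of "- _"] by (intro exI[of _ B]) (auto simp: nth_vderiv_reflect[OF schwartz_smooth[OF f]] norm_mult norm_power)
qed

lemma schwartz_add:
 assumes f: "f \<in> schwartz" and g: "g \<in> schwartz" shows "(\<lambda>x. f x + g x) \<in> schwartz"
 unfolding schwartz_iff
proof (intro conjI allI)
 show "smooth (\<lambda>x. f x + g x)" by (intro smooth_add schwartz_smooth f g)
 fix k m
 obtain B where B: "\<And>x. \<bar>x\<bar> ^ k * norm (nth_vderiv m f x) \<le> B" using f unfolding schwartz_iff by blast
 obtain D where D: "\<And>x. \<bar>x\<bar> ^ k * norm (nth_vderiv m g x) \<le> D" using g unfolding schwartz_iff by blast
 show "\<exists>B. \<forall>x. \<bar>x\<bar> ^ k * norm (nth_vderiv m (\<lambda>x. f x + g x) x) \<le> B"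
 proof (intro exI allI)
  fix x
  have "\<bar>x\<bar> ^ k * norm (nth_vderiv m (\<lambda>x. f x + g x) x) \<le> \<bar>x\<bar> ^ k * (norm (nth_vderiv m f x) + norm (nth_vderiv m g x))"
   unfolding nth_vderiv_add[OF f[THEN schwartz_smooth] g[THEN schwartz_smooth]] by (intro mult_left_mono norm_triangle_ineq) auto
  also have "\<dots> \<le> B + D" unfolding distrib_left by (intro add_mono B D)
  finally show "\<bar>x\<bar> ^ k * norm (nth_vderiv m (\<lambda>x. f x + g x) x) \<le> B + D" .
 qed
qed

lemma schwartz_cmult:
 assumes f: "f \<in> schwartz" shows "(\<lambda>x. c * f x) \<in> schwartz"
 unfolding schwartz_iff
proof (intro conjI allI)
 show "smooth (\<lambda>x. c * f x)" by (intro smooth_cmult schwartz_smooth f)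
 fix k m
 obtain B where B: "\<And>x. \<bar>x\<bar> ^ k * norm (nth_vderiv m f x) \<le> B" using f unfolding schwartz_iff by blast
 have "\<bar>x\<bar> ^ k * norm (nth_vderiv m (\<lambda>x. c * f x) x) \<le> norm c * B" for x
  using mult_left_mono[OF B[of x], of "norm c"] by (simp add: nth_vderiv_cmult[OF schwartz_smooth[OF f]] norm_mult mult_ac)
 then show "\<exists>B. \<forall>x. \<bar>x\<bar> ^ k * norm (nth_vderiv m (\<lambda>x. c * f x) x) \<le> B" by blast
qed

lemma schwartz_diff: "f \<in> schwartz ==> g \<in> schwartz ==> (\<lambda>x. f x - g x) \<in> schwartz"
 using schwartz_add[of f "\<lambda>x. (-1) * g x"] schwartz_cmult[of g "-1"] by simp

lemma schwartz_compact:
 assumes f: "smooth f" and M: "\<And>x. M < \<bar>x\<bar> ==> f x = 0" shows "f \<in> schwartz"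
 unfolding schwartz_iff
proof (intro conjI allI)
 fix k m
 let ?h = "\<lambda>x. \<bar>x\<bar> ^ k * norm (nth_vderiv m f x)"
 have "continuous_on {-M..M} ?h" by (intro continuous_intros smooth_continuous smooth_nth_vderiv f)
 then have "compact (?h ` {-M..M})" by (intro compact_continuous_image) auto
 then obtain C where C: "\<And>x. x \<in> {-M..M} ==> norm (?h x) \<le> C"
  by (meson bounded_iff compact_imp_bounded imageI)
 show "\<exists>B. \<forall>x. ?h x \<le> B"
 proof (intro exI allI)
  fix x show "?h x \<le> max C 0"
  proof (cases "\<bar>x\<bar> \<le> M")
   case True
   then have "norm (?h x) \<le> C" by (intro C) auto
   then show ?thesis by (simp only: real_norm_def)
  next
   case False
   have "open {x. M < \<bar>x\<bar>}" by (intro open_Collect_less continuous_intros)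
   then have "nth_vderiv m f x = 0" using False M by (intro nth_vderiv_eq_0_open[of "{x. M < \<bar>x\<bar>}"]) auto
   then show ?thesis by simp
  qed
 qed
qed fact

lemma weyl_inner_plus:
 fixes f :: "real => complex"
 assumes [measurable]: "borel_fun f"
 shows "(LINT t:{y<..}|lebesgue. (t - y) powr (\<gamma> - 1) *\<^sub>R f t) = (LBINT s. fker \<gamma> s *\<^sub>R f (y + s))"
proof -
 have "(LINT t:{y<..}|lebesgue. (t - y) powr (\<gamma> - 1) *\<^sub>R f t) = (LBINT t. indicator {y<..} t *\<^sub>R ((t - y) powr (\<gamma> - 1) *\<^sub>R f t))"
  unfolding set_lebesgue_integral_def by (rule integral_completion) measurable
 also have "\<dots> = (LBINT s. indicator {y<..} (y + s) *\<^sub>R ((y + s - y) powr (\<gamma> - 1) *\<^sub>R f (y + s)))"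
  using lborel_integral_real_affine[of 1 "\<lambda>t. indicator {y<..} t *\<^sub>R ((t - y) powr (\<gamma> - 1) *\<^sub>R f t)" y] by simp
 also have "\<dots> = (LBINT s. fker \<gamma> s *\<^sub>R f (y + s))"
  by (intro Bochner_Integration.integral_cong) (auto simp: fker_def indicator_def)
 finally show ?thesis .
qed

lemma weyl_inner_minus:
 fixes f :: "real => complex"
 assumes [measurable]: "borel_fun f"
 shows "(LINT t:{..<y}|lebesgue. (y - t) powr (\<gamma> - 1) *\<^sub>R f t) = (LBINT s. fker \<gamma> s *\<^sub>R f (- (- y + s)))"
proof -
 have "(LINT t:{..<y}|lebesgue. (y - t) powr (\<gamma> - 1) *\<^sub>R f t) = (LBINT t. indicator {..<y} t *\<^sub>R ((y - t) powr (\<gamma> - 1) *\<^sub>R f t))"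
  unfolding set_lebesgue_integral_def by (rule integral_completion) measurable
 also have "\<dots> = (LBINT s. indicator {..<y} (y - s) *\<^sub>R ((y - (y - s)) powr (\<gamma> - 1) *\<^sub>R f (y - s)))"
  using lborel_integral_real_affine[of "-1" "\<lambda>t. indicator {..<y} t *\<^sub>R ((y - t) powr (\<gamma> - 1) *\<^sub>R f t)" y] by simp
 also have "\<dots> = (LBINT s. fker \<gamma> s *\<^sub>R f (- (- y + s)))"
  by (intro Bochner_Integration.integral_cong) (auto simp: fker_def indicator_def)
 finally show ?thesis .
qed

lemma frac_int_unscaled:
 assumes "0 < \<gamma>" shows "(LBINT s. fker \<gamma> s *\<^sub>R f (y + s)) = of_real (Gamma \<gamma>) * frac_int \<gamma> f y"
 using Gamma_real_pos[OF assms] by (simp add: frac_int_def scaleR_conv_of_real)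

lemma weyl_plus_eq:
 assumes f: "rapid f" and a: "0 < \<alpha>" "\<alpha> < real n"
 shows "weyl_plus n \<alpha> f x = frac_deriv n \<alpha> f x"
proof -
 let ?g = "real n - \<alpha>"
 have g: "0 < ?g" using a by simp
 have "(\<lambda>y. LINT t:{y<..}|lebesgue. (t - y) powr (?g - 1) *\<^sub>R f t) = (\<lambda>y. of_real (Gamma ?g) * frac_int ?g f y)"
  unfolding weyl_inner_plus[OF smooth_borel[OF rapid_smooth[OF f]]] frac_int_unscaled[OF g] ..
 then have "weyl_plus n \<alpha> f x = ((-1) ^ n / Gamma ?g) *\<^sub>R (of_real (Gamma ?g) * frac_int ?g (nth_vderiv n f) x)"
  using a by (simp add: weyl_plus_def nth_vderiv_cmult[OF smooth_frac_int[OF f g]] nth_vderiv_frac_int[OF f g])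
 then show ?thesis using Gamma_real_pos[OF g] by (simp add: frac_deriv_def scaleR_conv_of_real)
qed

text \<open>Reflection exchanges left-sided and right-sided integrals. The sign (-1)^n, which the
  left-sided derivative does not carry, arises from differentiating n times in a reflected
  variable.\<close>

lemma weyl_minus_eq:
 assumes f: "rapid (\<lambda>x. f (- x))" and fm: "borel_fun f" and a: "0 < \<alpha>" "\<alpha> < real n"
 shows "weyl_minus n \<alpha> f x = frac_deriv n \<alpha> (\<lambda>x. f (- x)) (- x)"
proof -
 let ?g = "real n - \<alpha>"
 let ?f = "\<lambda>x. f (- x)"
 have g: "0 < ?g" using a by simp
 have "(\<lambda>y. LINT t:{..<y}|lebesgue. (y - t) powr (?g - 1) *\<^sub>R f t) = (\<lambda>y. of_real (Gamma ?g) * frac_int ?g ?f (- y))"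
  unfolding weyl_inner_minus[OF fm] frac_int_unscaled[OF g, of ?f, symmetric] ..
 then have "weyl_minus n \<alpha> f x = (1 / Gamma ?g) *\<^sub>R (of_real (Gamma ?g) * ((-1) ^ n * frac_int ?g (nth_vderiv n ?f) (- x)))"
  using a by (simp add: weyl_minus_def nth_vderiv_cmult[OF smooth_reflect[OF smooth_frac_int[OF f g]]]
    nth_vderiv_reflect[OF smooth_frac_int[OF f g]] nth_vderiv_frac_int[OF f g])
 then show ?thesis using Gamma_real_pos[OF g] by (simp add: frac_deriv_def scaleR_conv_of_real)
qed

section \<open>The weighted derivative and its inverse\<close>

text \<open>The function |t|^\<alpha> W_0^\<alpha> f inside the norm. The left derivative is
  expressed by reflection so that only right-sided operators occur; \<alpha> = 0 is separated by the
  convention that order 0 is the identity.\<close>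

definition tD :: "nat => real => (real => complex) => real => complex" where
 "tD n \<alpha> f t = (if \<alpha> = 0 then f t else of_real (\<bar>t\<bar> powr \<alpha>) *
   (if t < 0 then frac_deriv n \<alpha> (\<lambda>s. f (- s)) (- t) else frac_deriv n \<alpha> f t))"

lemma norm_tD:
 assumes f: "f \<in> schwartz" and a: "0 \<le> \<alpha>" "\<alpha> < real n" and t: "t \<noteq> 0"
 shows "norm (weyl_zero n \<alpha> f t) * \<bar>t\<bar> powr \<alpha> = norm (tD n \<alpha> f t)"
proof (cases "\<alpha> = 0")
 case True
 then show ?thesis using t by (simp add: tD_def weyl_zero_def weyl_plus_def weyl_minus_def)
next
 case False
 then have a': "0 < \<alpha>" using a by simp
 show ?thesis
  unfolding weyl_zero_def tD_def
   weyl_plus_eq[OF schwartz_rapid[OF f] a' a(2)] weyl_minus_eq[OF schwartz_rapid[OF schwartz_reflect[OF f]] smooth_borel[OF schwartz_smooth[OF f]] a' a(2)]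
  using False by (simp add: norm_mult)
qed

lemma rapid_frac_deriv:
 assumes "rapid f" "\<alpha> < real n" shows "rapid (frac_deriv n \<alpha> f)"
 unfolding frac_deriv_def[abs_def] using assms by (intro rapid_cmult rapid_frac_int rapid_nth_vderiv) auto

lemma tD_measurable:
 assumes f: "f \<in> schwartz" and a: "\<alpha> < real n" shows "borel_fun (tD n \<alpha> f)"
proof -
 have [measurable]: "borel_fun f" "borel_fun (frac_deriv n \<alpha> f)" "frac_deriv n \<alpha> (\<lambda>s. f (- s)) \<in> borel_measurable borel"
  by (rule smooth_borel[OF schwartz_smooth[OF f]] smooth_borel[OF rapid_smooth[OF rapid_frac_deriv[OF schwartz_rapid[OF f] a]]]
   smooth_borel[OF rapid_smooth[OF rapid_frac_deriv[OF schwartz_rapid[OF schwartz_reflect[OF f]] a]]])+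
 show ?thesis unfolding tD_def[abs_def] by measurable
qed

text \<open>Comparison with a multiple of the Cauchy kernel at height 1, whose mass is already known
  to be finite.\<close>

lemma lp_mass_finite_decay:
 assumes p: "1 < p" and C: "\<And>t. norm (f t) \<le> C / (1 + \<bar>t\<bar>)"
 shows "lp_mass p f < \<infinity>"
proof -
 have C0: "0 \<le> C" using C[of 0] norm_ge_zero[of "f 0"] by (auto simp del: norm_ge_zero)
 have "lp_mass p f \<le> lp_mass p (\<lambda>t. of_real (C * pi) * cker 1 t)"
 proof (rule lp_mass_mono)
  fix t
  have "sqrt (t\<^sup>2 + 1\<^sup>2) \<le> \<bar>t\<bar> + 1" using sqrt_sum_squares_le_sum_abs[of t 1] by simp
  moreover have "0 < sqrt (t\<^sup>2 + 1\<^sup>2)" by (simp add: add_nonneg_pos)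
  ultimately have "C / (1 + \<bar>t\<bar>) \<le> C / sqrt (t\<^sup>2 + 1\<^sup>2)" using C0 by (intro divide_left_mono mult_pos_pos) auto
  then show "norm (f t) \<le> norm (of_real (C * pi) * cker 1 t)"
   using C[of t] C0 by (simp add: norm_mult norm_cker)
 qed (use p in auto)
 also have "\<dots> < \<infinity>"
  using nn_integral_cker_finite[of 1 p] p lp_mass_cmult[of "cker 1" p "of_real (C * pi)"] by (simp add: ennreal_mult_less_top lp_mass_def del: of_real_mult)
 finally show ?thesis .
qed

lemma rapid_weighted_decay:
 assumes h: "rapid h" and a: "0 \<le> \<alpha>"
 obtains C where "0 \<le> C" "\<And>t. 0 \<le> t ==> t powr \<alpha> * norm (h t) \<le> C / (1 + t)"
proof -
 obtain k :: nat where k: "\<alpha> < real k" using ex_nat_gt by blast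
 obtain C where C: "0 \<le> C" "\<And>x. 0 \<le> x ==> norm (nth_vderiv 0 h x) \<le> C / (1 + (x - 0)) ^ Suc k"
  using rapid_bound[OF h] by metis
 show ?thesis
 proof (rule that[OF C(1)])
  fix t :: real assume t: "0 \<le> t"
  have "t powr \<alpha> \<le> (1 + t) powr \<alpha>" using t a by (intro powr_mono2) auto
  also have "\<dots> \<le> (1 + t) powr real k" using t k by (intro powr_mono) auto
  also have "\<dots> = (1 + t) ^ k" using t by (simp add: powr_realpow)
  finally have "t powr \<alpha> * norm (h t) \<le> (1 + t) ^ k * (C / (1 + t) ^ Suc k)"
   using C(2)[OF t] t by (intro mult_mono) auto
  also have "\<dots> = C / (1 + t)" using t by (simp add: add_nonneg_eq_0_iff)
  finally show "t powr \<alpha> * norm (h t) \<le> C / (1 + t)" .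
 qed
qed

lemma tD_mass_finite:
 assumes f: "f \<in> schwartz" and a: "0 \<le> \<alpha>" "\<alpha> < real n" and p: "1 < p"
 shows "lp_mass p (tD n \<alpha> f) < \<infinity>"
proof -
 have f': "(\<lambda>s. f (- s)) \<in> schwartz" by (rule schwartz_reflect[OF f])
 define h1 h2 where "h1 = (if \<alpha> = 0 then f else frac_deriv n \<alpha> f)" and "h2 = (if \<alpha> = 0 then (\<lambda>s. f (- s)) else frac_deriv n \<alpha> (\<lambda>s. f (- s)))"
 have h: "rapid h1" "rapid h2" using f f' a by (auto simp: h1_def h2_def intro: rapid_frac_deriv schwartz_rapid)
 obtain C where C: "0 \<le> C" "\<And>t. 0 \<le> t ==> t powr \<alpha> * norm (h1 t) \<le> C / (1 + t)" using rapid_weighted_decay[OF h(1) a(1)] by metis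
 obtain D where D: "0 \<le> D" "\<And>t. 0 \<le> t ==> t powr \<alpha> * norm (h2 t) \<le> D / (1 + t)" using rapid_weighted_decay[OF h(2) a(1)] by metis
 have "lp_mass p (tD n \<alpha> f) = lp_mass p (\<lambda>t. if t = 0 then 0 else tD n \<alpha> f t)"
  by (rule lp_mass_cong, use AE_lborel_singleton[of 0] in eventually_elim) auto
 also have "\<dots> < \<infinity>"
 proof (rule lp_mass_finite_decay[OF p, where C="C + D"])
  fix t :: real
  show "norm (if t = 0 then 0 else tD n \<alpha> f t) \<le> (C + D) / (1 + \<bar>t\<bar>)"
  proof -
   consider "t = 0" | "0 < t" | "t < 0" by linarith
   then show ?thesis
   proof cases
    case 2
    then have "norm (tD n \<alpha> f t) = t powr \<alpha> * norm (h1 t)" by (simp add: tD_def h1_def norm_mult)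
    also have "\<dots> \<le> C / (1 + t)" using C(2)[of t] 2 by simp
    also have "\<dots> \<le> (C + D) / (1 + t)" using D(1) 2 by (intro divide_right_mono) auto
    finally show ?thesis using 2 by simp
   next
    case 3
    then have "norm (tD n \<alpha> f t) = (- t) powr \<alpha> * norm (h2 (- t))" by (simp add: tD_def h2_def norm_mult)
    also have "\<dots> \<le> D / (1 + - t)" using D(2)[of "- t"] 3 by simp
    also have "\<dots> \<le> (C + D) / (1 + - t)" using C(1) 3 by (intro divide_right_mono) auto
    finally show ?thesis using 3 by simp
   qed (use C D in simp)
  qed
 qed
 finally show ?thesis .
qed

lemma frac_int_diff:
 assumes "rapid f" "rapid g" "0 < \<gamma>"
 shows "frac_int \<gamma> (\<lambda>x. f x - g x) x = frac_int \<gamma> f x - frac_int \<gamma> g x"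
proof -
 have "(LBINT s. fker \<gamma> s *\<^sub>R (f (x + s) - g (x + s))) = (LBINT s. fker \<gamma> s *\<^sub>R f (x + s)) - (LBINT s. fker \<gamma> s *\<^sub>R g (x + s))"
  unfolding scaleR_diff_right using assms by (intro Bochner_Integration.integral_diff rapid_frac_integrable)
 then show ?thesis by (simp add: frac_int_def scaleR_diff_right)
qed

lemma frac_deriv_diff:
 assumes "rapid f" "rapid g" "\<alpha> < real n"
 shows "frac_deriv n \<alpha> (\<lambda>x. f x - g x) x = frac_deriv n \<alpha> f x - frac_deriv n \<alpha> g x"
proof -
 have "nth_vderiv n (\<lambda>x. f x - g x) = (\<lambda>x. nth_vderiv n f x - nth_vderiv n g x)"
  using assms by (intro ext nth_vderiv_diff rapid_smooth)
 then show ?thesis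
  using assms by (simp add: frac_deriv_def frac_int_diff rapid_nth_vderiv right_diff_distrib)
qed

lemma tD_diff:
 assumes "f \<in> schwartz" "g \<in> schwartz" "\<alpha> < real n"
 shows "tD n \<alpha> (\<lambda>x. f x - g x) t = tD n \<alpha> f t - tD n \<alpha> g t"
 using assms by (simp add: tD_def frac_deriv_diff schwartz_rapid schwartz_reflect right_diff_distrib)

lemma tD_reflect: "tD n \<alpha> (\<lambda>s. f (- s)) t = tD n \<alpha> f (- t)"
 by (cases "t = 0") (auto simp: tD_def)

text \<open>The kernel of an Erdelyi-Kober fractional integral. The case a = 0, b = \<alpha> is the
  operator R; general a serves to compose up to integer order.\<close>

definition ek :: "real => real => real => real" where
 "ek a b u = fker b (u - 1) * u powr (- a - b) / Gamma b"

lemma ek_measurable [measurable]: "borel_fun (ek a b)"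
 unfolding ek_def[abs_def] by measurable

text \<open>Substituting u = 1 + s gives a power integral with parameters b and a + b + 1/p; the
  excess a + 1/p is positive.\<close>

lemma dilation_kernel_ek:
 assumes "0 \<le> a" "0 < b" "1 < p" shows "\<exists>C. dilation_kernel p (ek a b) C"
proof -
 have G: "0 < Gamma b" by (rule Gamma_real_pos[OF assms(2)])
 have nn: "0 \<le> ek a b u" for u using G by (simp add: ek_def)
 have z: "ek a b u = 0" if "u \<le> 0" for u using that by (simp add: ek_def fker_def)
 have "(NR u. ek a b u * u powr (- 1 / p)) = (NR s. ek a b (1 + s) * (1 + s) powr (- 1 / p))"
  using nn_integral_real_affine[of "\<lambda>u. ennreal (ek a b u * u powr (- 1 / p))" 1 1] by simp
 also have "\<dots> = (NN s. ennreal (1 / Gamma b) * ennreal (indicator {0<..} s * s powr (b - 1) * (1 + s) powr (- (a + b + 1 / p))))"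
 proof (rule nn_integral_cong)
  fix s :: real
  have "(1 + s) powr (- a - b) * (1 + s) powr (- 1 / p) = (1 + s) powr (- (a + b + 1 / p))"
   by (simp add: powr_add[symmetric])
  then have "ek a b (1 + s) * (1 + s) powr (- 1 / p) = 1 / Gamma b * (indicator {0<..} s * s powr (b - 1) * (1 + s) powr (- (a + b + 1 / p)))"
   by (simp add: ek_def fker_def)
  then show "ennreal (ek a b (1 + s) * (1 + s) powr (- 1 / p)) = ennreal (1 / Gamma b) * ennreal (indicator {0<..} s * s powr (b - 1) * (1 + s) powr (- (a + b + 1 / p)))"
   using G by (subst ennreal_mult[symmetric]) auto
 qed
 also have "\<dots> = ennreal (1 / Gamma b) * (NR s. indicator {0<..} s * s powr (b - 1) * (1 + s) powr (- (a + b + 1 / p)))"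
  by (rule nn_integral_cmult) measurable
 also have "\<dots> < \<infinity>"
  using power_integral_finite[of b "a + b + 1 / p"] assms by (simp add: ennreal_mult_less_top add_nonneg_pos)
 finally obtain c where c: "0 \<le> c" "(NR u. ek a b u * u powr (- 1 / p)) = ennreal c"
  by (cases "NR u. ek a b u * u powr (- 1 / p)") auto
 then have "dilation_kernel p (ek a b) (c + 1)"
  using nn z by (auto simp: dilation_kernel_def intro!: ennreal_leI)
 then show ?thesis ..
qed

text \<open>The substitution u = 1 + s/t turns the dilation integral into a Weyl integral with
  powers of t before and after it.\<close>

lemma dilation_op_ek:
 assumes t: "0 < t" and b: "0 < b"
 shows "dilation_op (ek a b) g t = of_real (t powr a) * frac_int b (\<lambda>s. of_real (s powr (- a - b)) * g s) t"
proof -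
 have "dilation_op (ek a b) g t = (1 / t) *\<^sub>R (LBINT s. ek a b (1 + 1 / t * s) *\<^sub>R g (t * (1 + 1 / t * s)))"
  unfolding dilation_op_def using t by (subst lborel_integral_real_affine[of "1 / t" _ 1]) auto
 also have "\<dots> = (1 / t) *\<^sub>R (LBINT s. (t * t powr a / Gamma b) *\<^sub>R (fker b s *\<^sub>R (of_real ((t + s) powr (- a - b)) * g (t + s))))"
 proof (intro arg_cong[where f="scaleR (1 / t)"] Bochner_Integration.integral_cong refl)
  fix s
  have ts: "t * (1 + 1 / t * s) = t + s" using t by (simp add: field_simps)
  show "ek a b (1 + 1 / t * s) *\<^sub>R g (t * (1 + 1 / t * s)) = (t * t powr a / Gamma b) *\<^sub>R (fker b s *\<^sub>R (of_real ((t + s) powr (- a - b)) * g (t + s)))"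
  proof (cases "0 < s")
   case True
   have "1 + 1 / t * s = (t + s) / t" using t by (simp add: field_simps)
   then have "(1 + 1 / t * s) powr (- a - b) = (t + s) powr (- a - b) * t powr (a + b)"
    using t True powr_minus_divide[of t "a + b"] by (simp add: powr_divide)
   moreover have "fker b (1 + 1 / t * s - 1) = s powr (b - 1) * t powr (1 - b)"
    using t True by (simp add: fker_def powr_divide) (simp add: powr_diff)
   moreover have "t powr (1 - b) * t powr (a + b) = t * t powr a" using t by (simp add: powr_add[symmetric] powr_mult_base)
   ultimately have "ek a b (1 + 1 / t * s) = t * t powr a / Gamma b * (s powr (b - 1) * (t + s) powr (- a - b))"
    unfolding ek_def by (simp add: mult_ac)
   then show ?thesis unfolding ts using True by (simp add: fker_def scaleR_conv_of_real mult_ac)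
  next
   case False
   then have "1 / t * s \<le> 0" using t by (simp add: divide_nonpos_pos)
   then show ?thesis using False by (simp add: ek_def fker_def)
  qed
 qed
 also have "\<dots> = (t powr a / Gamma b) *\<^sub>R (LBINT s. fker b s *\<^sub>R (of_real ((t + s) powr (- a - b)) * g (t + s)))"
  using t by (subst integral_scaleR_right) simp
 finally show ?thesis by (simp add: frac_int_def scaleR_conv_of_real)
qed

lemma dilation_op_reflect: "dilation_op k g (- t) = dilation_op k (\<lambda>s. g (- s)) t"
 by (simp add: dilation_op_def)

definition tR :: "real => (real => complex) => real => complex" where
 "tR \<alpha> g = (if \<alpha> = 0 then g else dilation_op (ek 0 \<alpha>) g)"

lemma tR_measurable [measurable]: "g \<in> borel_measurable borel ==> tR \<alpha> g \<in> borel_measurable borel"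
 by (simp add: tR_def dilation_op_borel)

text \<open>On t > 0 the powers of t cancel and the fractional integral inverts the derivative; t <
  0 follows by reflection, with which dilations commute.\<close>

lemma tR_tD:
 assumes f: "f \<in> schwartz" and a: "0 \<le> \<alpha>" "\<alpha> < real n" and t: "t \<noteq> 0"
 shows "tR \<alpha> (tD n \<alpha> f) t = f t"
proof (cases "\<alpha> = 0")
 case False
 then have a': "0 < \<alpha>" using a by simp
 have pos: "dilation_op (ek 0 \<alpha>) (tD n \<alpha> f) t = f t" if f: "f \<in> schwartz" and t: "0 < t" for f t
 proof -
  have "frac_int \<alpha> (\<lambda>s. of_real (s powr (- 0 - \<alpha>)) * tD n \<alpha> f s) t = frac_int \<alpha> (frac_deriv n \<alpha> f) t"
   unfolding frac_int_def
  proof (intro arg_cong[where f="scaleR (1 / Gamma \<alpha>)"] Bochner_Integration.integral_cong refl)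
   fix s
   show "fker \<alpha> s *\<^sub>R (of_real ((t + s) powr (- 0 - \<alpha>)) * tD n \<alpha> f (t + s)) = fker \<alpha> s *\<^sub>R frac_deriv n \<alpha> f (t + s)"
   proof (cases "0 < s")
    case True
    then have "(t + s) powr (- \<alpha>) * (t + s) powr \<alpha> = 1" using t by (simp add: powr_add[symmetric])
    then have "of_real ((t + s) powr (- 0 - \<alpha>)) * tD n \<alpha> f (t + s) = frac_deriv n \<alpha> f (t + s)"
     using True t a' by (simp add: tD_def mult.assoc[symmetric] of_real_mult[symmetric] del: of_real_mult)
    then show ?thesis by simp
   qed (simp add: fker_def)
  qed
  then show ?thesis
   using dilation_op_ek[OF t a', of 0 "tD n \<alpha> f"] frac_int_frac_deriv[OF schwartz_rapid[OF f] a' a(2), of t] t by simp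
 qed
 show ?thesis
 proof (cases "0 < t")
  case True
  then show ?thesis using pos[OF f True] False by (simp add: tR_def)
 next
  case neg: False
  then have "dilation_op (ek 0 \<alpha>) (tD n \<alpha> (\<lambda>s. f (- s))) (- t) = f (- (- t))"
   using pos[OF schwartz_reflect[OF f], of "- t"] t by simp
  then show ?thesis using False by (simp add: tR_def dilation_op_reflect tD_reflect)
 qed
qed (simp add: tR_def tD_def)

section \<open>Density of the weighted Weyl derivatives\<close>

lemma lp_mass_reflect:
 assumes [measurable]: "borel_fun h"
 shows "lp_mass p (\<lambda>t. h (- t)) = lp_mass p h"
 unfolding lp_mass_def using nn_integral_real_affine[of "\<lambda>x. ennreal (norm (h x) powr p)" "-1" 0] by simp

lemma tD_add:
 assumes "f \<in> schwartz" "g \<in> schwartz" "\<alpha> < real n"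
 shows "tD n \<alpha> (\<lambda>x. f x + g x) t = tD n \<alpha> f t + tD n \<alpha> g t"
 using tD_diff[OF schwartz_add[OF assms(1,2)] assms(2,3), of t] by simp

lemma rapid_bound_upto:
 assumes f: "rapid f"
 shows "\<exists>C\<ge>0. \<forall>j\<le>n. \<forall>x\<ge>A. norm (nth_vderiv j f x) \<le> C"
proof (induction n)
 case 0
 obtain C where C: "0 \<le> C" "\<And>x. A \<le> x ==> norm (nth_vderiv 0 f x) \<le> C / (1 + (x - A)) ^ 0"
  using rapid_bound[OF f, of A 0 0] by blast
 then show ?case by auto
next
 case (Suc n)
 then obtain D where D: "0 \<le> D" "\<And>j x. j \<le> n ==> A \<le> x ==> norm (nth_vderiv j f x) \<le> D" by blast
 obtain C where C: "0 \<le> C" "\<And>x. A \<le> x ==> norm (nth_vderiv (Suc n) f x) \<le> C / (1 + (x - A)) ^ 0"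
  using rapid_bound[OF f, of A "Suc n" 0] by blast
 show ?case
 proof (intro exI[of _ "C + D"] conjI allI impI)
  fix j x assume j: "j \<le> Suc n" and x: "A \<le> x"
  show "norm (nth_vderiv j f x) \<le> C + D"
  proof (cases "j = Suc n")
   case True
   then show ?thesis using C(2)[OF x] D(1) by simp
  next
   case False
   then show ?thesis using D(2)[of j x] j x C(1) by simp
  qed
 qed (use C D in simp)
qed

lemma fker_integral_Icc:
 assumes g: "0 < \<gamma>" and b: "0 \<le> b"
 shows "integrable lborel (\<lambda>s. fker \<gamma> s * indicator {..b} s)" "(LBINT s. fker \<gamma> s * indicator {..b} s) = b powr \<gamma> / \<gamma>"
proof -
 have "((\<lambda>s. s powr (\<gamma> - 1)) has_integral b powr (\<gamma> - 1 + 1) / (\<gamma> - 1 + 1)) {0..b}"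
  using g b by (intro has_integral_powr_from_0) auto
 then have "((\<lambda>s. if s \<in> {0..b} then s powr (\<gamma> - 1) else 0) has_integral b powr \<gamma> / \<gamma>) UNIV"
  unfolding has_integral_restrict_UNIV by simp
 moreover have "(\<lambda>s. if s \<in> {0..b} then s powr (\<gamma> - 1) else 0) = (\<lambda>s. fker \<gamma> s * indicator {..b} s)"
  by (auto simp: fker_def indicator_def fun_eq_iff)
 ultimately have h: "((\<lambda>s. fker \<gamma> s * indicator {..b} s) has_integral b powr \<gamma> / \<gamma>) UNIV" by simp
 have "(NR s. fker \<gamma> s * indicator {..b} s) = ennreal (b powr \<gamma> / \<gamma>)"
  by (rule nn_integral_has_integral_lborel[OF _ _ h]) auto
 then have "has_bochner_integral lborel (\<lambda>s. fker \<gamma> s * indicator {..b} s) (b powr \<gamma> / \<gamma>)"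
  using g by (intro has_bochner_integral_nn_integral) auto
 then show "integrable lborel (\<lambda>s. fker \<gamma> s * indicator {..b} s)" "(LBINT s. fker \<gamma> s * indicator {..b} s) = b powr \<gamma> / \<gamma>"
  by (auto simp: has_bochner_integral_iff)
qed

text \<open>For t \<le> b the integrand lives on 0 < s \<le> b, where the kernel has integral
  b^\<gamma> / \<gamma>; for t > b it vanishes.\<close>

lemma frac_int_bound_left:
 assumes g: "0 < \<gamma>" and h: "rapid h" and b: "0 < b" and z: "\<And>x. b < x ==> h x = 0"
  and D: "\<And>x. 0 < x ==> norm (h x) \<le> D" and t: "0 < t"
 shows "norm (frac_int \<gamma> h t) \<le> b powr \<gamma> / \<gamma> * D / Gamma \<gamma> * indicator {..b} t"
proof -
 have D0: "0 \<le> D" using D[of 1] norm_ge_zero[of "h 1"] by linarith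
 have G: "0 < Gamma \<gamma>" by (rule Gamma_real_pos[OF g])
 have pw: "norm (fker \<gamma> s *\<^sub>R h (t + s)) \<le> (D * indicator {..b} t) * (fker \<gamma> s * indicator {..b} s)" for s
 proof (cases "0 < s \<and> t + s \<le> b")
  case True
  then have "fker \<gamma> s * norm (h (t + s)) \<le> fker \<gamma> s * D" using t by (intro mult_left_mono D) auto
  then show ?thesis using True t by (simp add: mult.commute)
 next
  case False
  then have "fker \<gamma> s *\<^sub>R h (t + s) = 0" using z[of "t + s"] by (auto simp: fker_def)
  then have "norm (fker \<gamma> s *\<^sub>R h (t + s)) = 0" by (simp only: norm_zero)
  then show ?thesis using D0 by (simp only:) simp
 qed
 have "norm (LBINT s. fker \<gamma> s *\<^sub>R h (t + s)) \<le> (LBINT s. (D * indicator {..b} t) * (fker \<gamma> s * indicator {..b} s))"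
  by (rule Bochner_Integration.integral_norm_bound_integral[OF rapid_frac_integrable[OF h g] integrable_mult_right[OF fker_integral_Icc(1)[OF g]] pw])
    (use b in simp)
 also have "\<dots> = (D * indicator {..b} t) * (b powr \<gamma> / \<gamma>)"
  unfolding integral_mult_right_zero fker_integral_Icc(2)[OF g less_imp_le[OF b]] ..
 finally have "norm (LBINT s. fker \<gamma> s *\<^sub>R h (t + s)) \<le> (D * indicator {..b} t) * (b powr \<gamma> / \<gamma>)" .
 from divide_right_mono[OF this less_imp_le[OF G]] show ?thesis
  using G by (simp add: frac_int_def mult_ac)
qed

lemma frac_int_eq_0:
 assumes "\<And>x. t < x ==> h x = 0" shows "frac_int \<gamma> h t = 0"
proof -
 have "(\<lambda>s. fker \<gamma> s *\<^sub>R h (t + s)) = (\<lambda>s. 0)"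
 proof
  fix s show "fker \<gamma> s *\<^sub>R h (t + s) = 0" using assms[of "t + s"] by (cases "0 < s") (auto simp: fker_def)
 qed
 then show ?thesis unfolding frac_int_def by (simp only:) simp
qed

text \<open>The fractional integral f of \<psi> solves the equation on t > 0 but need not vanish to
  the left of the support of \<psi>, so its left half would contribute. Cutting it off between
  \<epsilon> and 2 \<epsilon> changes the derivative on (0, 2 \<epsilon>] only. There the factors
  t^\<alpha>, \<epsilon>^(n-\<alpha>) from the integral and \<epsilon>^(-n) from the cutoff multiply
  to a bound independent of \<epsilon>, and the interval is short.\<close>

lemma tD_dense_one_sided:
 assumes psi: "smooth \<psi>" and a: "0 < a" and z: "\<And>x. x \<le> a ==> \<psi> x = 0" "\<And>x. c \<le> x ==> \<psi> x = 0"
  and al: "0 < \<alpha>" "\<alpha> < real n" and p: "1 < p" and e: "0 < e"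
 shows "\<exists>\<phi>\<in>schwartz. lp_mass p (\<lambda>t. of_real (\<bar>t\<bar> powr \<alpha>) * \<psi> t - tD n \<alpha> \<phi> t) < ennreal e"
proof -
 define \<gamma> where "\<gamma> = real n - \<alpha>"
 have g: "0 < \<gamma>" using al by (simp add: \<gamma>_def)
 have G: "0 < Gamma \<gamma>" by (rule Gamma_real_pos[OF g])
 have rpsi: "rapid \<psi>" by (rule rapid_zero_right[OF psi, of c]) (simp add: z)
 define f where "f = frac_int \<alpha> \<psi>"
 have rf: "rapid f" unfolding f_def by (rule rapid_frac_int[OF rpsi al(1)])
 have sf: "smooth f" by (rule rapid_smooth[OF rf])
 have fz: "f x = 0" if "c < x" for x
  unfolding f_def using that by (intro frac_int_eq_0) (simp add: z)
 obtain \<sigma> :: "real => real" where s: "smooth (\<lambda>x. of_real (\<sigma> x))" "\<And>x. x \<le> 0 ==> \<sigma> x = 0" "\<And>x. 1 \<le> x ==> \<sigma> x = 1"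
  by (rule smooth_step_exists) (rule that, assumption+)
 define \<tau> :: "real => complex" where "\<tau> x = 1 - of_real (\<sigma> x)" for x
 have st: "smooth \<tau>" unfolding \<tau>_def[abs_def] by (intro smooth_diff smooth_const s(1))
 have rt: "rapid \<tau>" by (rule rapid_zero_right[OF st, of 1]) (simp add: \<tau>_def s(3))
 obtain A where A: "0 \<le> A" "\<And>j x. j \<le> n ==> -1 \<le> x ==> norm (nth_vderiv j \<tau> x) \<le> A"
  using rapid_bound_upto[OF rt, of n "-1"] by blast
 obtain B where B: "0 \<le> B" "\<And>j x. j \<le> n ==> 0 \<le> x ==> norm (nth_vderiv j f x) \<le> B"
  using rapid_bound_upto[OF rf, of n 0] by blast
 \<comment> \<open>One factor 2^n comes from the support of length 2 \<epsilon>, the other from the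
   product rule; the powers of \<epsilon> cancel.\<close>
 define K where "K = 2 ^ n * 2 ^ n * A * B / (\<gamma> * Gamma \<gamma>)"
 have K: "0 \<le> K" using A B g G by (simp add: K_def)
 \<comment> \<open>Makes 2 \<epsilon> K^p at most half of e; the summand 1 guards against K =
   0.\<close>
 define \<epsilon> where "\<epsilon> = min 1 (e / (4 * (K powr p + 1)))"
 have eps: "0 < \<epsilon>" "\<epsilon> \<le> 1" using e by (auto simp: \<epsilon>_def add_nonneg_pos intro!: divide_pos_pos)
 \<comment> \<open>Equal to 1 up to \<epsilon> and to 0 from 2 \<epsilon> on; the product of \<eta>
   and f is the part to be removed.\<close>
 define \<eta> where "\<eta> x = \<tau> (1 / \<epsilon> * x + (-1))" for x
 have se: "smooth \<eta>" using smooth_affine[OF st, of 1 "1 / \<epsilon>" "-1"] by (simp add: \<eta>_def[abs_def])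
 have \<eta>1: "\<eta> x = 1" if "x \<le> \<epsilon>" for x
  using that eps s(2)[of "1 / \<epsilon> * x + (-1)"] by (simp add: \<eta>_def \<tau>_def)
 have \<eta>0: "\<eta> x = 0" if "2 * \<epsilon> \<le> x" for x
  using that eps s(3)[of "1 / \<epsilon> * x + (-1)"] by (simp add: \<eta>_def \<tau>_def field_simps)
 define h where "h x = \<eta> x * f x" for x
 have sh: "smooth h" unfolding h_def[abs_def] by (rule smooth_mult[OF se sf])
 have rh: "rapid h" by (rule rapid_zero_right[OF sh, of "2 * \<epsilon>"]) (simp add: h_def \<eta>0)
 have hb: "norm (nth_vderiv n h x) \<le> A * B * (2 * (1 / \<epsilon>)) ^ n" if x: "0 < x" for x
  unfolding h_def[abs_def]
 proof (rule nth_vderiv_mult_bound[OF se sf])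
  fix j assume j: "j \<le> n"
  have "nth_vderiv j \<eta> x = of_real ((1 / \<epsilon>) ^ j) * nth_vderiv j \<tau> (1 / \<epsilon> * x + (-1))"
   unfolding \<eta>_def[abs_def] by (rule nth_vderiv_affine[OF st])
  then have "norm (nth_vderiv j \<eta> x) = (1 / \<epsilon>) ^ j * norm (nth_vderiv j \<tau> (1 / \<epsilon> * x + (-1)))"
   using eps by (simp add: norm_mult norm_divide norm_power)
  also have "\<dots> \<le> (1 / \<epsilon>) ^ j * A" using x eps by (intro mult_left_mono A(2) j) auto
  finally show "norm (nth_vderiv j \<eta> x) \<le> A * (1 / \<epsilon>) ^ j" by (simp add: mult.commute)
  have "1 \<le> (1 / \<epsilon>) ^ j" using eps by (intro one_le_power) simp
  then have "B * 1 \<le> B * (1 / \<epsilon>) ^ j" using B(1) by (rule mult_left_mono)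
  then show "norm (nth_vderiv j f x) \<le> B * (1 / \<epsilon>) ^ j" using B(2)[OF j, of x] x by simp
 qed (use A B eps in auto)
 define \<phi> where "\<phi> x = f x - h x" for x
 have sphi: "smooth \<phi>" unfolding \<phi>_def[abs_def] by (rule smooth_diff[OF sf sh])
 have phi0: "\<phi> x = 0" if "x < \<epsilon>" for x using \<eta>1[of x] that by (simp add: \<phi>_def h_def)
 have phi: "\<phi> \<in> schwartz"
 proof (rule schwartz_compact[OF sphi])
  fix x assume "\<bar>c\<bar> < \<bar>x\<bar>"
  then have "c < x \<or> x < \<epsilon>" using eps by linarith
  then show "\<phi> x = 0" using phi0[of x] fz[of x] by (auto simp: \<phi>_def h_def)
 qed
 have bd: "norm (of_real (\<bar>t\<bar> powr \<alpha>) * \<psi> t - tD n \<alpha> \<phi> t) \<le> K * indicator {0..2 * \<epsilon>} t" for t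
 proof -
  consider "t < 0" | "t = 0" | "0 < t" by linarith
  then show ?thesis
  proof cases
   case 1
   have "nth_vderiv n (\<lambda>s. \<phi> (- s)) x = 0" if "- t < x" for x
    using that 1 eps by (intro nth_vderiv_eq_0_open[of "{0<..}"] phi0) auto
   then have "frac_deriv n \<alpha> (\<lambda>s. \<phi> (- s)) (- t) = 0" by (simp add: frac_deriv_def frac_int_eq_0)
   then have "tD n \<alpha> \<phi> t = 0" using 1 al by (simp add: tD_def)
   moreover have "\<psi> t = 0" using 1 a by (intro z(1)) simp
   ultimately show ?thesis using K by simp
  next
   case 2
   then show ?thesis using K al by (simp add: tD_def)
  next
   case 3
   have "frac_deriv n \<alpha> \<phi> t = frac_deriv n \<alpha> f t - frac_deriv n \<alpha> h t"
    unfolding \<phi>_def[abs_def] by (rule frac_deriv_diff[OF rf rh al(2)])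
   also have "frac_deriv n \<alpha> f t = \<psi> t"
    unfolding f_def by (rule frac_deriv_frac_int[OF rpsi al])
   finally have "of_real (\<bar>t\<bar> powr \<alpha>) * \<psi> t - tD n \<alpha> \<phi> t = of_real (t powr \<alpha>) * frac_deriv n \<alpha> h t"
    using 3 al by (simp add: tD_def right_diff_distrib)
   then have "norm (of_real (\<bar>t\<bar> powr \<alpha>) * \<psi> t - tD n \<alpha> \<phi> t) = t powr \<alpha> * norm (frac_int \<gamma> (nth_vderiv n h) t)"
    by (simp add: norm_mult frac_deriv_def \<gamma>_def norm_power)
   also have "\<dots> \<le> t powr \<alpha> * ((2 * \<epsilon>) powr \<gamma> / \<gamma> * (A * B * (2 * (1 / \<epsilon>)) ^ n) / Gamma \<gamma> * indicator {..2 * \<epsilon>} t)"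
   proof (intro mult_left_mono frac_int_bound_left[OF g rapid_nth_vderiv[OF rh] _ _ hb 3])
    fix x assume "2 * \<epsilon> < x"
    then show "nth_vderiv n h x = 0" by (intro nth_vderiv_eq_0_open[of "{2 * \<epsilon><..}"]) (auto simp: h_def \<eta>0)
   qed (use eps in auto)
   also have "\<dots> \<le> K * indicator {0..2 * \<epsilon>} t"
   proof (cases "t \<le> 2 * \<epsilon>")
    case True
    have "t powr \<alpha> \<le> (2 * \<epsilon>) powr \<alpha>" using 3 True al by (intro powr_mono2) auto
    then have "t powr \<alpha> * (2 * \<epsilon>) powr \<gamma> \<le> (2 * \<epsilon>) powr \<alpha> * (2 * \<epsilon>) powr \<gamma>" by (rule mult_right_mono) simp
    also have "\<dots> = (2 * \<epsilon>) ^ n" using eps by (simp add: powr_add[symmetric] \<gamma>_def powr_realpow)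
    finally have "(t powr \<alpha> * (2 * \<epsilon>) powr \<gamma>) * (A * B * (2 * (1 / \<epsilon>)) ^ n / (\<gamma> * Gamma \<gamma>)) \<le> (2 * \<epsilon>) ^ n * (A * B * (2 * (1 / \<epsilon>)) ^ n / (\<gamma> * Gamma \<gamma>))"
     using A B g G eps by (intro mult_right_mono) auto
    also have "\<dots> = K" using eps by (simp add: K_def power_mult_distrib power_divide)
    finally show ?thesis using True 3 by (simp add: mult_ac)
   qed simp
   finally show ?thesis .
  qed
 qed
 have "lp_mass p (\<lambda>t. of_real (\<bar>t\<bar> powr \<alpha>) * \<psi> t - tD n \<alpha> \<phi> t) \<le> lp_mass p (\<lambda>t. of_real (K * indicator {0..2 * \<epsilon>} t))"
 proof (rule lp_mass_mono)
  fix t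
  have "norm (complex_of_real (K * indicator {0..2 * \<epsilon>} t)) = K * indicator {0..2 * \<epsilon>} t"
   using K by (simp add: indicator_def)
  then show "norm (of_real (\<bar>t\<bar> powr \<alpha>) * \<psi> t - tD n \<alpha> \<phi> t) \<le> norm (complex_of_real (K * indicator {0..2 * \<epsilon>} t))"
   using bd[of t] by (simp only:)
 qed (use p in simp)
 also have "\<dots> = (NN t. ennreal (K powr p) * indicator {0..2 * \<epsilon>} t)"
  unfolding lp_mass_def using K by (intro nn_integral_cong) (auto simp: indicator_def)
 also have "\<dots> = ennreal (K powr p) * ennreal (2 * \<epsilon>)"
  using eps by (subst nn_integral_cmult_indicator) auto
 also have "\<dots> = ennreal (K powr p * (2 * \<epsilon>))" using eps by (simp add: ennreal_mult)
 also have "\<dots> < ennreal e"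
 proof (rule ennreal_lessI[OF e])
  have "(K powr p + 1) * (2 * \<epsilon>) \<le> (K powr p + 1) * (2 * (e / (4 * (K powr p + 1))))"
   by (intro mult_left_mono) (auto simp: \<epsilon>_def)
  also have "\<dots> = e / 2"
  proof -
   have "K powr p + 1 \<noteq> 0" using powr_ge_zero[of K p] by linarith
   then show ?thesis by (simp add: field_simps)
  qed
  finally show "K powr p * (2 * \<epsilon>) < e" using eps e by (simp add: algebra_simps)
 qed
 finally show ?thesis using phi by blast
qed

text \<open>Polynomials times a weight are dense, and the weight |x|^\<alpha> times smooth cutoffs
  away from 0 brings them into the form of the one-sided lemma, one piece on each half-line. For
  \<alpha> = 0 the weighted polynomial is itself a Schwartz function.\<close>

lemma tD_dense:
 assumes gm[measurable]: "borel_fun g" and gf: "lp_mass p g < \<infinity>" and al: "0 \<le> \<alpha>" "\<alpha> < real n" and p: "1 < p" and e: "0 < e"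
 shows "\<exists>\<phi>\<in>schwartz. lp_mass p (\<lambda>t. g t - tD n \<alpha> \<phi> t) < ennreal e"
proof -
 obtain \<sigma> :: "real => real" where s: "smooth (\<lambda>x. of_real (\<sigma> x))" "\<And>x. x \<le> 0 ==> \<sigma> x = 0" "\<And>x. 1 \<le> x ==> \<sigma> x = 1"
  "\<And>x. 0 \<le> \<sigma> x" "\<And>x. \<sigma> x \<le> 1"
  by (rule smooth_step_exists) (rule that, assumption+)
 have sm[measurable]: "borel_fun \<sigma>"
  using smooth_borel[OF s(1)] by (simp add: borel_measurable_complex_iff)
 \<comment> \<open>A smooth plateau on the positive half-line: 1 between 1/(N+1) and N + 1,
   supported between 1/(2(N+1)) and N + 2.\<close>
 define \<beta> where "\<beta> N x = \<sigma> (2 * (real N + 1) * x + (-1)) * \<sigma> (-1 * x + (real N + 2))" for N :: nat and x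
 have sb: "smooth (\<lambda>x. of_real (\<beta> N x))" for N
  using smooth_mult[OF smooth_affine[OF s(1), of 1 "2 * (real N + 1)" "-1"] smooth_affine[OF s(1), of 1 "-1" "real N + 2"]]
  by (simp add: \<beta>_def)
 have b0: "\<beta> N x = 0" if "x \<le> 1 / (2 * (real N + 1))" for N x
 proof -
  have "2 * (real N + 1) * x \<le> 1" using that by (simp add: pos_le_divide_eq add_nonneg_pos mult.commute)
  then show ?thesis using s(2)[of "2 * (real N + 1) * x + (-1)"] by (simp add: \<beta>_def)
 qed
 have bneg: "\<beta> N x = 0" if "x \<le> 0" for N x
  by (rule b0) (rule order_trans[OF that], simp)
 have b1: "\<beta> N x = 0" if "real N + 2 \<le> x" for N x
  using s(2)[of "-1 * x + (real N + 2)"] that by (simp add: \<beta>_def)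
 have b2: "\<beta> N x = 1" if "inverse (real N + 1) \<le> x" "x \<le> real N + 1" for N x
 proof -
  have "(real N + 1) * inverse (real N + 1) \<le> (real N + 1) * x" using that by (intro mult_left_mono) auto
  moreover have "(real N + 1) * inverse (real N + 1) = 1" by (rule right_inverse) (simp add: add_nonneg_eq_0_iff)
  ultimately have "1 \<le> 2 * (real N + 1) * x + (-1)" by linarith
  then show ?thesis using s(3)[of "2 * (real N + 1) * x + (-1)"] s(3)[of "-1 * x + (real N + 2)"] that by (simp add: \<beta>_def)
 qed
 have b01: "0 \<le> \<beta> N x" "\<beta> N x \<le> 1" for N x using s(4,5) by (auto simp: \<beta>_def intro!: mult_le_one)
 have [measurable]: "borel_fun (\<beta> N)" for N unfolding \<beta>_def[abs_def] by measurable
 define \<omega> where "\<omega> N x = \<bar>x\<bar> powr \<alpha> * (\<beta> N x + \<beta> N (- x))" for N x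
 \<comment> \<open>The three errors enter with the factors 2^p, 4^p and 4^p; their total is at most
   3/4 of e.\<close>
 define e' where "e' = e / (4 * (2 powr p * 2 powr p))"
 have e': "0 < e'" using e by (simp add: e'_def)
 have "\<exists>N q. polynomial_function q \<and> lp_mass p (\<lambda>x. g x - of_real (\<omega> N x) * q x) < ennreal e'"
 proof (rule lp_dense_weighted_polynomial[OF gm p gf e'])
  fix N :: nat
  show "borel_fun (\<omega> N)" unfolding \<omega>_def[abs_def] by measurable
  show "\<exists>L. \<forall>x. L < \<bar>x\<bar> --> \<omega> N x = 0"
  proof (intro exI allI impI)
   fix x assume "real N + 2 < \<bar>x\<bar>"
   then have "\<beta> N x = 0 \<and> \<beta> N (- x) = 0" using b1[of N x] b1[of N "- x"] bneg[of x N] bneg[of "- x" N] by (cases "0 \<le> x") auto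
   then show "\<omega> N x = 0" by (simp add: \<omega>_def)
  qed
  show "\<exists>K. \<forall>x. \<bar>\<omega> N x\<bar> \<le> K"
  proof (intro exI allI)
   fix x
   show "\<bar>\<omega> N x\<bar> \<le> (real N + 2) powr \<alpha> * (1 + 1)"
   proof (cases "\<bar>x\<bar> \<le> real N + 2")
    case True
    have "\<bar>x\<bar> powr \<alpha> * \<bar>\<beta> N x + \<beta> N (- x)\<bar> \<le> (real N + 2) powr \<alpha> * (1 + 1)"
     using True al b01[of N x] b01[of N "- x"] by (intro mult_mono powr_mono2) auto
    then show ?thesis by (simp add: \<omega>_def abs_mult)
   next
    case False
    then have "\<beta> N x = 0 \<and> \<beta> N (- x) = 0" using b1[of N x] b1[of N "- x"] bneg[of x N] bneg[of "- x" N] by (cases "0 \<le> x") auto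
    then show ?thesis by (simp add: \<omega>_def)
   qed
  qed
  show "\<exists>c>0. \<forall>x. inverse (real N + 1) \<le> \<bar>x\<bar> \<and> \<bar>x\<bar> \<le> real N + 1 --> c \<le> \<omega> N x"
  proof (intro exI[of _ "inverse (real N + 1) powr \<alpha> * 1"] conjI allI impI)
   fix x assume x: "inverse (real N + 1) \<le> \<bar>x\<bar> \<and> \<bar>x\<bar> \<le> real N + 1"
   then have "\<beta> N \<bar>x\<bar> = 1" using b2[of N "\<bar>x\<bar>"] by simp
   then have "1 \<le> \<beta> N x + \<beta> N (- x)" using b01[of N x] b01[of N "- x"] by (cases "0 \<le> x") auto
   then show "inverse (real N + 1) powr \<alpha> * 1 \<le> \<omega> N x"
    unfolding \<omega>_def using x al by (intro mult_mono powr_mono2) auto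
  qed (simp add: add_nonneg_pos add_nonneg_eq_0_iff)
 qed
 then obtain N q where q: "polynomial_function q" and m1: "lp_mass p (\<lambda>x. g x - of_real (\<omega> N x) * q x) < ennreal e'" by blast
 have sq: "smooth q" by (rule smooth_polynomial_function[OF q])
 have [measurable]: "borel_fun q" by (rule smooth_borel[OF sq])
 define \<psi>1 \<psi>2 where "\<psi>1 x = of_real (\<beta> N x) * q x" and "\<psi>2 x = of_real (\<beta> N x) * q (- x)" for x
 have spsi: "smooth \<psi>1" "smooth \<psi>2"
  unfolding \<psi>1_def[abs_def] \<psi>2_def[abs_def] by (intro smooth_mult sb sq smooth_reflect)+
 have \<omega>_eq: "of_real (\<omega> N x) * q x = of_real (\<bar>x\<bar> powr \<alpha>) * \<psi>1 x + of_real (\<bar>- x\<bar> powr \<alpha>) * \<psi>2 (- x)" for x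
  by (simp add: \<omega>_def \<psi>1_def \<psi>2_def algebra_simps)
 have [measurable]: "borel_fun (\<omega> N)" unfolding \<omega>_def[abs_def] by measurable
 show ?thesis
 proof (cases "\<alpha> = 0")
  case True
  define \<phi> where "\<phi> x = \<psi>1 x + \<psi>2 (- x)" for x
  have "\<phi> \<in> schwartz"
  proof (rule schwartz_compact)
   show "smooth \<phi>" unfolding \<phi>_def[abs_def] by (intro smooth_add spsi smooth_reflect)
   fix x assume "real N + 2 < \<bar>x\<bar>"
   then have "\<beta> N x = 0 \<and> \<beta> N (- x) = 0" using b1[of N x] b1[of N "- x"] bneg[of x N] bneg[of "- x" N] by (cases "0 \<le> x") auto
   then show "\<phi> x = 0" by (simp add: \<phi>_def \<psi>1_def \<psi>2_def)
  qed
  moreover have "of_real (\<omega> N x) * q x = tD n \<alpha> \<phi> x" for x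
   unfolding \<omega>_eq using True bneg[of 0 N] by (cases "x = 0") (auto simp: tD_def \<phi>_def \<psi>1_def \<psi>2_def)
  moreover have "ennreal e' \<le> ennreal e"
  proof (rule ennreal_leI)
   have "1 \<le> 2 powr p" using p by (intro ge_one_powr_ge_zero) auto
   then have "1 * 1 \<le> 2 powr p * 2 powr p" by (intro mult_mono) auto
   then show "e' \<le> e" using e by (simp add: e'_def divide_le_eq)
  qed
  ultimately show ?thesis using m1 by (intro bexI[of _ \<phi>]) auto
 next
  case False
  then have al': "0 < \<alpha>" using al by simp
  have a0: "0 < 1 / (2 * (real N + 1))" by simp
  have "\<exists>\<phi>\<in>schwartz. lp_mass p (\<lambda>t. of_real (\<bar>t\<bar> powr \<alpha>) * \<psi>1 t - tD n \<alpha> \<phi> t) < ennreal e'"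
   by (rule tD_dense_one_sided[OF spsi(1) a0 _ _ al' al(2) p e', where c="real N + 2"]) (auto simp: \<psi>1_def b0 b1 simp del: mult_le_cancel_left)
  then obtain \<phi>1 where phi1: "\<phi>1 \<in> schwartz" "lp_mass p (\<lambda>t. of_real (\<bar>t\<bar> powr \<alpha>) * \<psi>1 t - tD n \<alpha> \<phi>1 t) < ennreal e'" by blast
  have "\<exists>\<phi>\<in>schwartz. lp_mass p (\<lambda>t. of_real (\<bar>t\<bar> powr \<alpha>) * \<psi>2 t - tD n \<alpha> \<phi> t) < ennreal e'"
   by (rule tD_dense_one_sided[OF spsi(2) a0 _ _ al' al(2) p e', where c="real N + 2"]) (auto simp: \<psi>2_def b0 b1)
  then obtain \<phi>2 where phi2: "\<phi>2 \<in> schwartz" "lp_mass p (\<lambda>t. of_real (\<bar>t\<bar> powr \<alpha>) * \<psi>2 t - tD n \<alpha> \<phi>2 t) < ennreal e'" by blast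
  have [measurable]: "borel_fun (tD n \<alpha> \<phi>1)" "borel_fun (tD n \<alpha> \<phi>2)" "borel_fun \<psi>1" "borel_fun \<psi>2"
   using phi1 phi2 al spsi by (auto intro: tD_measurable smooth_borel)
  define h1 h2 where "h1 t = of_real (\<bar>t\<bar> powr \<alpha>) * \<psi>1 t - tD n \<alpha> \<phi>1 t" and "h2 t = of_real (\<bar>t\<bar> powr \<alpha>) * \<psi>2 t - tD n \<alpha> \<phi>2 t" for t
  have [measurable]: "borel_fun h1" "borel_fun h2"
   unfolding h1_def[abs_def] h2_def[abs_def] by measurable
  define \<phi> where "\<phi> x = \<phi>1 x + \<phi>2 (- x)" for x
  have phi: "\<phi> \<in> schwartz" unfolding \<phi>_def[abs_def] by (intro schwartz_add schwartz_reflect phi1 phi2)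
  have "tD n \<alpha> \<phi> t = tD n \<alpha> \<phi>1 t + tD n \<alpha> \<phi>2 (- t)" for t
   unfolding \<phi>_def[abs_def] by (subst tD_add) (auto simp: phi1 schwartz_reflect[OF phi2(1)] al tD_reflect)
  then have eq: "(\<lambda>t. g t - tD n \<alpha> \<phi> t) = (\<lambda>t. (g t - of_real (\<omega> N t) * q t) + (h1 t + h2 (- t)))"
   unfolding \<omega>_eq h1_def h2_def by (simp add: algebra_simps)
  have "lp_mass p (\<lambda>t. g t - tD n \<alpha> \<phi> t) \<le> ennreal (2 powr p) * (lp_mass p (\<lambda>t. g t - of_real (\<omega> N t) * q t) + lp_mass p (\<lambda>t. h1 t + h2 (- t)))"
   unfolding eq by (rule lp_mass_add_le[OF _ _ p]) measurable
  also have "\<dots> \<le> ennreal (2 powr p) * (ennreal e' + ennreal (2 powr p) * (ennreal e' + ennreal e'))"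
  proof (intro mult_left_mono add_mono)
   have "lp_mass p (\<lambda>t. h1 t + h2 (- t)) \<le> ennreal (2 powr p) * (lp_mass p h1 + lp_mass p (\<lambda>t. h2 (- t)))"
    by (rule lp_mass_add_le[OF _ _ p]) measurable
   also have "lp_mass p (\<lambda>t. h2 (- t)) = lp_mass p h2" by (rule lp_mass_reflect) measurable
   also have "ennreal (2 powr p) * (lp_mass p h1 + lp_mass p h2) \<le> ennreal (2 powr p) * (ennreal e' + ennreal e')"
    using phi1(2) phi2(2) by (intro mult_left_mono add_mono) (auto simp: h1_def[abs_def] h2_def[abs_def])
   finally show "lp_mass p (\<lambda>t. h1 t + h2 (- t)) \<le> ennreal (2 powr p) * (ennreal e' + ennreal e')" .
  qed (use m1 in auto)
  also have "\<dots> = ennreal (2 powr p * (e' + 2 powr p * (e' + e')))"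
   using e' by (simp add: ennreal_mult[symmetric] ennreal_plus[symmetric] del: ennreal_plus)
  also have "\<dots> < ennreal e"
  proof (rule ennreal_lessI[OF e])
   have 1: "1 \<le> 2 powr p" using p by (intro ge_one_powr_ge_zero) auto
   have "2 powr p * e' * 1 \<le> 2 powr p * e' * 2 powr p" using e' 1 by (intro mult_left_mono) auto
   moreover have "2 powr p * e' * 2 powr p = e / 4" by (simp add: e'_def)
   ultimately show "2 powr p * (e' + 2 powr p * (e' + e')) < e" using e by (simp add: algebra_simps)
  qed
  finally show ?thesis using phi by blast
 qed
qed

section \<open>Injectivity of the weighted fractional integral\<close>

lemma AE_ex_in_interval:
 assumes P: "AE t in lborel. P t" and ab: "a < (b::real)"
 obtains t where "a < t" "t < b" "P t"
proof -
 have "\<exists>t. a < t \<and> t < b \<and> P t"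
 proof (rule ccontr)
  assume n: "\<not> ?thesis"
  have "AE t in lborel. t \<notin> {a<..<b}" using P by eventually_elim (use n in auto)
  then have "{a<..<b} \<in> null_sets lborel" by (subst AE_iff_null_sets) auto
  then have "emeasure lborel {a<..<b} = 0" by (rule null_setsD1)
  then show False using ab by simp
 qed
 then show ?thesis using that by blast
qed

text \<open>The semigroup law for nonnegative functions, infinite values included; it transports
  finiteness from order a + b to the iterated integral.\<close>

lemma fker_double:
 assumes ab: "0 < a" "0 < b" and [measurable]: "borel_fun \<phi>" and nn: "\<And>x. 0 \<le> \<phi> x"
 shows "(NN s. ennreal (fker a s) * (NR r. fker b r * \<phi> (x + s + r)))
  = ennreal (Beta a b) * (NR v. fker (a + b) v * \<phi> (x + v))"
proof -
 have Bpos: "0 < Beta a b" using ab by (simp add: Beta_def)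
 have "(NR r. fker b r * \<phi> (x + s + r)) = (NR v. fker b (v - s) * \<phi> (x + v))" for s
  using nn_integral_real_affine[of "\<lambda>r. ennreal (fker b r * \<phi> (x + s + r))" 1 "-s"] by (simp add: add.assoc)
 then have "(NN s. ennreal (fker a s) * (NR r. fker b r * \<phi> (x + s + r)))
  = (NN s. NN v. ennreal (fker a s) * ennreal (fker b (v - s) * \<phi> (x + v)))"
  by (simp add: nn_integral_cmult)
 also have "\<dots> = (NN v. NN s. ennreal (fker a s) * ennreal (fker b (v - s) * \<phi> (x + v)))"
  by (rule lborel_pair.Fubini') measurable
 also have "\<dots> = (NN v. (NR s. fker a s * fker b (v - s)) * ennreal (\<phi> (x + v)))"
  by (intro nn_integral_cong, subst nn_integral_multc[symmetric]) (auto simp: ennreal_mult nn mult.assoc)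
 also have "\<dots> = (NN v. ennreal (Beta a b) * ennreal (fker (a + b) v * \<phi> (x + v)))"
  unfolding fker_beta[OF ab] using Bpos by (simp add: ennreal_mult nn mult.assoc)
 also have "\<dots> = ennreal (Beta a b) * (NR v. fker (a + b) v * \<phi> (x + v))"
  by (rule nn_integral_cmult) measurable
 finally show ?thesis .
qed

lemma frac_int_measurable [measurable]:
 assumes [measurable]: "borel_fun h" shows "borel_fun (frac_int \<gamma> h)"
 unfolding frac_int_def[abs_def] by measurable

lemma norm_frac_int_le:
 assumes "0 < \<gamma>"
 shows "ennreal (norm (frac_int \<gamma> h x)) \<le> ennreal (1 / Gamma \<gamma>) * (NR s. fker \<gamma> s * norm (h (x + s)))"
proof (cases "integrable lborel (\<lambda>s. fker \<gamma> s *\<^sub>R h (x + s))")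
 case True
 have G: "0 < Gamma \<gamma>" by (rule Gamma_real_pos[OF assms])
 have "ennreal (norm (LBINT s. fker \<gamma> s *\<^sub>R h (x + s))) \<le> (NR s. fker \<gamma> s * norm (h (x + s)))"
  using integral_norm_bound_ennreal[OF True] by simp
 from mult_left_mono[OF this, of "ennreal (1 / Gamma \<gamma>)"] show ?thesis
  using G by (simp add: frac_int_def ennreal_mult[symmetric])
qed (simp add: frac_int_def not_integrable_integral_eq)

lemma frac_int_1_eq:
 "frac_int 1 h t = (LBINT r. indicator {t<..} r *\<^sub>R h r)"
proof -
 have "(LBINT r. indicator {t<..} r *\<^sub>R h r) = (LBINT s. indicator {t<..} (t + s) *\<^sub>R h (t + s))"
  using lborel_integral_real_affine[of 1 "\<lambda>r. indicator {t<..} r *\<^sub>R h r" t] by simp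
 also have "\<dots> = (LBINT s. fker 1 s *\<^sub>R h (t + s))"
  by (intro Bochner_Integration.integral_cong) (auto simp: fker_def indicator_def)
 finally show ?thesis by (simp add: frac_int_def)
qed

lemma tail_integrable:
 fixes h :: "real => complex"
 assumes [measurable]: "borel_fun h"
  and fin: "(NR s. fker 1 s * norm (h (t + s))) < \<infinity>"
 shows "integrable lborel (\<lambda>r. indicator {t<..} r *\<^sub>R h r)"
proof (rule integrableI_bounded)
 have "(NR r. norm (indicator {t<..} r *\<^sub>R h r)) = (NR s. norm (indicator {t<..} (t + s) *\<^sub>R h (t + s)))"
  using nn_integral_real_affine[of "\<lambda>r. ennreal (norm (indicator {t<..} r *\<^sub>R h r))" 1 t] by simp
 also have "\<dots> = (NR s. fker 1 s * norm (h (t + s)))"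
  by (intro nn_integral_cong) (auto simp: fker_def indicator_def)
 finally show "(NR r. norm (indicator {t<..} r *\<^sub>R h r)) < \<infinity>" using fin by simp
qed measurable

text \<open>Open right half-lines form an intersection-stable generator of the Borel sets. The sets
  over which f integrates to 0 are closed under complements, thanks to the vanishing total, and
  under countable disjoint unions, so they are all Borel sets.\<close>

lemma AE_eq_0_if_tails_eq_0:
 fixes f :: "real => complex"
 assumes f: "integrable lborel f" and z: "\<And>t. (LBINT r. indicator {t<..} r *\<^sub>R f r) = 0" and total: "(LBINT r. f r) = 0"
 shows "AE r in lborel. f r = 0"
proof (rule sigma_finite_measure.density_zero[OF lborel.sigma_finite_measure_axioms f])
 have st: "Int_stable (range greaterThan :: real set set)"
 proof (rule Int_stableI)
  fix X Y :: "real set" assume "X \<in> range greaterThan" "Y \<in> range greaterThan"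
  then obtain a b where "X = {a<..}" "Y = {b<..}" by blast
  then have "X \<inter> Y = {max a b<..}" by auto
  then show "X \<inter> Y \<in> range greaterThan" by blast
 qed
 have pw: "range greaterThan \<subseteq> Pow (UNIV :: real set)" by simp
 have ss: "sets lborel = sigma_sets UNIV (range greaterThan :: real set set)"
  unfolding sets_lborel by (subst borel_Ioi) (rule sets_measure_of[OF pw])
 note sets = ss[THEN equalityD2, THEN subsetD]
 fix A :: "real set" assume "A \<in> sets lborel"
 then have A: "A \<in> sigma_sets UNIV (range greaterThan)" unfolding ss .
 show "(LINT r:A|lborel. f r) = 0"
  using st pw A
 proof (induction rule: sigma_sets_induct_disjoint)
  case (basic A)
  then show ?case using z by (auto simp: set_lebesgue_integral_def)
 next
  case empty
  then show ?case by (simp add: set_lebesgue_integral_def)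
 next
  case (compl A)
  note [measurable] = sets[OF compl(1)]
  have i: "integrable lborel (\<lambda>r. indicator A r *\<^sub>R f r)" by (rule integrable_mult_indicator[OF _ f]) measurable
  have "(LINT r:UNIV - A|lborel. f r) = (LBINT r. f r - indicator A r *\<^sub>R f r)"
   unfolding set_lebesgue_integral_def by (intro Bochner_Integration.integral_cong) (auto simp: indicator_def)
  also have "\<dots> = (LBINT r. f r) - (LBINT r. indicator A r *\<^sub>R f r)"
   by (rule Bochner_Integration.integral_diff[OF f i])
  finally show ?case using total compl(2) by (simp add: set_lebesgue_integral_def)
 next
  case (union A)
  then have s: "A i \<in> sets lborel" for i using sets by blast
  have "set_integrable lborel (\<Union>i. A i) f"
   unfolding set_integrable_def by (rule integrable_mult_indicator[OF _ f]) (use s in blast)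
  then have "(LINT r:(\<Union>i. A i)|lborel. f r) = (\<Sum>i. (LINT r:A i|lborel. f r))"
   using union(1) s by (intro lebesgue_integral_countable_add) (auto simp: disjoint_family_on_def)
  then show ?case using union(3) by simp
 qed
qed

text \<open>The tail integral is right-continuous in its endpoint, so vanishing for almost every t >
  0 becomes vanishing for all t > 0. Tails then determine h beyond each point 1/(n+1), and these
  half-lines exhaust t > 0.\<close>

lemma frac_int_1_eq_0_imp:
 assumes [measurable]: "borel_fun h"
  and fin: "\<And>t. 0 < t ==> (NR s. fker 1 s * norm (h (t + s))) < \<infinity>"
  and z: "AE t in lborel. 0 < t --> frac_int 1 h t = 0"
 shows "AE t in lborel. 0 < t --> h t = 0"
proof -
 note int = tail_integrable[OF assms(1) fin]
 have zt: "(LBINT r. indicator {t<..} r *\<^sub>R h r) = 0" if t: "0 < t" for t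
 proof -
  \<comment> \<open>A set of full measure is dense, so t is a limit from the right of points where
    the tail vanishes.\<close>
  have "\<exists>u. t < u \<and> u < t + inverse (real (Suc n)) \<and> frac_int 1 h u = 0" for n
  proof -
   obtain u where "t < u" "u < t + inverse (real (Suc n))" "0 < u --> frac_int 1 h u = 0"
    by (rule AE_ex_in_interval[OF z, of t "t + inverse (real (Suc n))"]) simp
   then show ?thesis using t by (intro exI[of _ u]) auto
  qed
  then obtain u where u: "\<And>n. t < u n" "\<And>n. u n < t + inverse (real (Suc n))" "\<And>n. frac_int 1 h (u n) = 0" by metis
  have "(\<lambda>n. t + inverse (real (Suc n))) \<longlonglongrightarrow> t + 0" by (intro tendsto_add tendsto_const inverse_Suc_seq(1))
  then have "(\<lambda>n. t + inverse (real (Suc n))) \<longlonglongrightarrow> t" by simp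
  then have ul: "u \<longlonglongrightarrow> t"
   by (rule tendsto_sandwich[rotated 3]) (use u in \<open>auto intro!: always_eventually less_imp_le\<close>)
  have "(\<lambda>n. LBINT r. indicator {u n<..} r *\<^sub>R h r) \<longlonglongrightarrow> (LBINT r. indicator {t<..} r *\<^sub>R h r)"
  proof (rule integral_dominated_convergence)
   show "integrable lborel (\<lambda>r. norm (indicator {t<..} r *\<^sub>R h r))" by (rule integrable_norm[OF int[OF t]])
   show "AE r in lborel. norm (indicator {u n<..} r *\<^sub>R h r) \<le> norm (indicator {t<..} r *\<^sub>R h r)" for n
    using u(1)[of n] by (auto simp: indicator_def)
   show "AE r in lborel. (\<lambda>n. indicator {u n<..} r *\<^sub>R h r) \<longlonglongrightarrow> indicator {t<..} r *\<^sub>R h r"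
   proof (rule AE_I2, rule tendsto_eventually)
    fix r
    show "\<forall>\<^sub>F n in sequentially. indicator {u n<..} r *\<^sub>R h r = indicator {t<..} r *\<^sub>R h r"
    proof (cases "t < r")
     case True
     then have "\<forall>\<^sub>F n in sequentially. u n < r" using ul by (simp add: order_tendstoD)
     then show ?thesis by eventually_elim (use True in simp)
    next
     case False
     then have "\<not> u n < r" for n using u(1)[of n] by linarith
     then show ?thesis using False by simp
    qed
   qed
  qed measurable
  moreover have "(LBINT r. indicator {u n<..} r *\<^sub>R h r) = 0" for n
   using u(3)[of n] by (simp only: frac_int_1_eq)
  ultimately show ?thesis by (simp add: LIMSEQ_const_iff)
 qed
 have "AE r in lborel. indicator {inverse (real (Suc n))<..} r *\<^sub>R h r = 0" for n
 proof (rule AE_eq_0_if_tails_eq_0)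
  show "integrable lborel (\<lambda>r. indicator {inverse (real (Suc n))<..} r *\<^sub>R h r)" by (rule int) simp
  show "(LBINT r. indicator {inverse (real (Suc n))<..} r *\<^sub>R h r) = 0" by (rule zt) simp
  fix t
  have "indicator {t<..} r *\<^sub>R indicator {inverse (real (Suc n))<..} r *\<^sub>R h r = indicator {max t (inverse (real (Suc n)))<..} r *\<^sub>R h r" for r
   by (auto simp: indicator_def)
  then show "(LBINT r. indicator {t<..} r *\<^sub>R indicator {inverse (real (Suc n))<..} r *\<^sub>R h r) = 0"
   using zt[of "max t (inverse (real (Suc n)))"] by (simp only:) (simp add: less_max_iff_disj)
 qed
 then have "AE r in lborel. \<forall>n. indicator {inverse (real (Suc n))<..} r *\<^sub>R h r = 0" by (simp only: AE_all_countable) simp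
 then show ?thesis
 proof eventually_elim
  case (elim r)
  show ?case
  proof
   assume "0 < r"
   then obtain n where "inverse (real (Suc n)) < r" using reals_Archimedean by blast
   then show "h r = 0" using elim[rule_format, of n] by simp
  qed
 qed
qed

text \<open>Orders are peeled off one at a time: order n + 1 is order 1 applied to order n, and the
  unit case shows that the integral of order n vanishes. Finiteness is assumed for every order up to
  n because the induction descends through them.\<close>

lemma frac_int_nat_eq_0_imp:
 assumes n: "0 < n" and [measurable]: "borel_fun h"
  and fin: "\<And>t m. 0 < t ==> 0 < m ==> m \<le> n ==> (NR s. fker (real m) s * norm (h (t + s))) < \<infinity>"
  and z: "AE t in lborel. 0 < t --> frac_int (real n) h t = 0"
 shows "AE t in lborel. 0 < t --> h t = 0"
 using n fin z
proof (induction n)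
 case (Suc n)
 show ?case
 proof (cases "n = 0")
  case True
  then show ?thesis using frac_int_1_eq_0_imp[OF assms(2)] Suc.prems(2)[of _ 1] Suc.prems(3) by simp
 next
  case False
  then have n: "0 < real n" by simp
  have "AE t in lborel. 0 < t --> frac_int (real n) h t = 0"
  proof (rule frac_int_1_eq_0_imp)
   show "AE t in lborel. 0 < t --> frac_int 1 (frac_int (real n) h) t = 0"
    using Suc.prems(3)
   proof eventually_elim
    case (elim t)
    show ?case
    proof
     assume t: "0 < t"
     have "frac_int 1 (frac_int (real n) h) t = frac_int (1 + real n) h t"
      using Suc.prems(2)[OF t, of "Suc n"] by (intro frac_int_semigroup n) auto
     then show "frac_int 1 (frac_int (real n) h) t = 0" using elim t by simp
    qed
   qed
   fix t :: real assume t: "0 < t"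
   have "(NR s. fker 1 s * norm (frac_int (real n) h (t + s)))
    \<le> (NN s. ennreal (1 / Gamma (real n)) * (ennreal (fker 1 s) * (NR r. fker (real n) r * norm (h (t + s + r)))))"
   proof (rule nn_integral_mono)
    fix s
    from mult_left_mono[OF norm_frac_int_le[OF n, of h "t + s"] zero_le, of "ennreal (fker 1 s)"]
    show "ennreal (fker 1 s * norm (frac_int (real n) h (t + s))) \<le> ennreal (1 / Gamma (real n)) * (ennreal (fker 1 s) * (NR r. fker (real n) r * norm (h (t + s + r))))"
     by (simp only: ennreal_mult[OF fker_nonneg norm_ge_zero] mult.left_commute)
   qed
   also have "\<dots> = ennreal (1 / Gamma (real n)) * (ennreal (Beta 1 (real n)) * (NR v. fker (1 + real n) v * norm (h (t + v))))"
    by (subst nn_integral_cmult, measurable) (subst fker_double[OF _ n], auto)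
   also have "\<dots> < \<infinity>" using Suc.prems(2)[OF t, of "Suc n"] by (simp add: ennreal_mult_less_top)
   finally show "(NR s. fker 1 s * norm (frac_int (real n) h (t + s))) < \<infinity>" .
  qed measurable
  then show ?thesis using Suc.IH Suc.prems(2) False by simp
 qed
qed simp

text \<open>For s > 0 the weight s^(m-1) (t+s)^(-n) is at most t^(m-n) / (t+s), and 1/(t+s) is pi
  times the modulus of the truncated Hilbert kernel, whose pairing with g converges by
  Hoelder.\<close>

lemma weighted_tail_finite:
 assumes g[measurable]: "borel_fun g" and p: "1 < p" and fin: "lp_mass p g < \<infinity>" and t: "0 < t" and m: "0 < m" "m \<le> n"
 shows "(NR s. fker (real m) s * norm (of_real ((t + s) powr (- real n)) * g (t + s))) < \<infinity>"
proof -
 \<comment> \<open>The truncation level t / 2 lies below t + s, so it never acts on the points that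
   occur.\<close>
 let ?H = "\<lambda>r. ennreal (norm (hker (t / 2) (0 - r) * g r))"
 let ?c = "pi * t powr (real m - real n)"
 have "(NR s. fker (real m) s * norm (of_real ((t + s) powr (- real n)) * g (t + s)))
  \<le> (NN s. ennreal ?c * ?H (t + s))"
 proof (rule nn_integral_mono)
  fix s
  show "ennreal (fker (real m) s * norm (of_real ((t + s) powr (- real n)) * g (t + s))) \<le> ennreal ?c * ?H (t + s)"
  proof (cases "0 < s")
   case True
   have "s powr (real m - 1) * (t + s) powr (- real n) \<le> (t + s) powr (real m - 1) * (t + s) powr (- real n)"
    using True t m by (intro mult_right_mono powr_mono2) auto
   also have "\<dots> = (t + s) powr (real m - real n) * (t + s) powr (- 1)" by (simp only: powr_add[symmetric]) (simp add: algebra_simps)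
   also have "\<dots> \<le> t powr (real m - real n) * (t + s) powr (- 1)"
    using True t m by (intro mult_right_mono powr_mono2') auto
   also have "(t + s) powr (- 1) = pi * norm (hker (t / 2) (0 - (t + s)))"
    using True t by (simp add: hker_def norm_divide norm_mult powr_minus_divide abs_if del: of_real_diff of_real_add of_real_minus)
   finally have "s powr (real m - 1) * (t + s) powr (- real n) \<le> ?c * norm (hker (t / 2) (0 - (t + s)))" by (simp only: mult_ac)
   from mult_right_mono[OF this norm_ge_zero[of "g (t + s)"]]
   have "fker (real m) s * norm (of_real ((t + s) powr (- real n)) * g (t + s)) \<le> ?c * norm (hker (t / 2) (0 - (t + s)) * g (t + s))"
    using True by (simp add: fker_def norm_mult mult.assoc)
   from ennreal_leI[OF this] show ?thesis by (simp only: ennreal_mult[OF _ norm_ge_zero] mult_nonneg_nonneg pi_ge_zero powr_ge_zero)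
  qed (simp add: fker_def)
 qed
 also have "\<dots> = ennreal ?c * (NN s. ?H (t + s))" by (rule nn_integral_cmult) measurable
 also have "(NN s. ?H (t + s)) = (NN r. ?H r)"
  using nn_integral_real_affine[of ?H 1 t] by simp
 also have "ennreal ?c * \<dots> < \<infinity>"
  using pv_integrable(2)[OF g p fin, of "t / 2" 0] t by (simp add: integrable_iff_bounded ennreal_mult_less_top)
 finally show ?thesis .
qed

lemma dilation_op_zero: "dilation_op k (\<lambda>s. 0) t = 0"
 by (simp add: dilation_op_def)

text \<open>Apply the operator of complementary order n - \<alpha> with kernel
  \<open>ek \<alpha> \<gamma>\<close> to the vanishing function and commute. With
  \<open>ek 0 \<alpha>\<close> outermost the inner powers of t cancel, leaving the integral of order
  n of s^(-n) g, and the integer case applies.\<close>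

lemma dilation_op_ek_eq_0_imp:
 assumes g[measurable]: "borel_fun g" and p: "1 < p" and fin: "lp_mass p g < \<infinity>" and al: "0 < \<alpha>"
  and z: "AE t in lborel. dilation_op (ek 0 \<alpha>) g t = 0"
 shows "AE t in lborel. 0 < t --> g t = 0"
proof -
 obtain n :: nat where n: "\<alpha> < real n" using ex_nat_gt by blast
 define \<gamma> where "\<gamma> = real n - \<alpha>"
 have g0: "0 < \<gamma>" using n by (simp add: \<gamma>_def)
 obtain C where C: "dilation_kernel p (ek 0 \<alpha>) C" using dilation_kernel_ek[of 0 \<alpha> p] al p by auto
 obtain D where D: "dilation_kernel p (ek \<alpha> \<gamma>) D" using dilation_kernel_ek[of \<alpha> \<gamma> p] al g0 p by auto
 let ?G = "\<lambda>s. of_real (s powr (- real n)) * g s"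
 have n0: "0 < n" using n al by (cases n) auto
 have finG: "(NR s. fker (real m) s * norm (?G (t + s))) < \<infinity>" if "0 < t" "0 < m" "m \<le> n" for t m
  by (rule weighted_tail_finite[OF g p fin that])
 have "AE t in lborel. 0 < t --> frac_int (real n) ?G t = 0"
  using dilation_op_commute[OF p C D g fin]
 proof eventually_elim
  case (elim t)
  show ?case
  proof
   assume t: "0 < t"
   have "dilation_op (ek \<alpha> \<gamma>) (dilation_op (ek 0 \<alpha>) g) t = dilation_op (ek \<alpha> \<gamma>) (\<lambda>s. 0) t"
    using t by (intro dilation_op_cong_AE z) auto
   then have "dilation_op (ek 0 \<alpha>) (dilation_op (ek \<alpha> \<gamma>) g) t = 0" using elim by (simp add: dilation_op_zero)
   then have "frac_int \<alpha> (\<lambda>s. of_real (s powr (- 0 - \<alpha>)) * dilation_op (ek \<alpha> \<gamma>) g s) t = 0"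
    using t by (simp add: dilation_op_ek[OF t al])
   moreover have "frac_int \<alpha> (\<lambda>s. of_real (s powr (- 0 - \<alpha>)) * dilation_op (ek \<alpha> \<gamma>) g s) t = frac_int \<alpha> (frac_int \<gamma> ?G) t"
    unfolding frac_int_def[of \<alpha>]
   proof (intro arg_cong[where f="scaleR (1 / Gamma \<alpha>)"] Bochner_Integration.integral_cong refl)
    fix s
    show "fker \<alpha> s *\<^sub>R (of_real ((t + s) powr (- 0 - \<alpha>)) * dilation_op (ek \<alpha> \<gamma>) g (t + s)) = fker \<alpha> s *\<^sub>R frac_int \<gamma> ?G (t + s)"
    proof (cases "0 < s")
     case True
     then have ts: "0 < t + s" using t by simp
     have "- \<alpha> - \<gamma> = - real n" by (simp add: \<gamma>_def)
     then have "dilation_op (ek \<alpha> \<gamma>) g (t + s) = of_real ((t + s) powr \<alpha>) * frac_int \<gamma> ?G (t + s)"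
      using dilation_op_ek[OF ts g0, of \<alpha> g] by simp
     moreover have "(t + s) powr (- 0 - \<alpha>) * (t + s) powr \<alpha> = 1" using ts by (simp add: powr_add[symmetric])
     ultimately show ?thesis by (simp add: mult.assoc[symmetric] of_real_mult[symmetric] del: of_real_mult)
    qed (simp add: fker_def)
   qed
   moreover have "frac_int \<alpha> (frac_int \<gamma> ?G) t = frac_int (\<alpha> + \<gamma>) ?G t"
    using finG[OF t n0 order_refl] by (intro frac_int_semigroup al g0) (auto simp: \<gamma>_def)
   ultimately show "frac_int (real n) ?G t = 0" by (simp add: \<gamma>_def)
  qed
 qed
 then have "AE t in lborel. 0 < t --> ?G t = 0"
  by (intro frac_int_nat_eq_0_imp[OF n0 _ finG]) auto
 then show ?thesis by eventually_elim auto
qed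

lemma tR_inj:
 assumes g[measurable]: "borel_fun g" and p: "1 < p" and fin: "lp_mass p g < \<infinity>" and al: "0 \<le> \<alpha>"
  and z: "AE t in lborel. tR \<alpha> g t = 0"
 shows "AE t in lborel. g t = 0"
proof (cases "\<alpha> = 0")
 case True
 then show ?thesis using z by (simp add: tR_def)
next
 case False
 then have al': "0 < \<alpha>" using al by simp
 have z1: "AE t in lborel. dilation_op (ek 0 \<alpha>) g t = 0" using z False by (simp add: tR_def)
 then have "AE t in lborel. dilation_op (ek 0 \<alpha>) g (-1 * t) = 0" by (rule AE_lborel_scale) simp
 then have z2: "AE t in lborel. dilation_op (ek 0 \<alpha>) (\<lambda>s. g (- s)) t = 0" by (simp add: dilation_op_reflect)
 have pos: "AE t in lborel. 0 < t --> g t = 0" by (rule dilation_op_ek_eq_0_imp[OF g p fin al' z1])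
 have "AE t in lborel. 0 < t --> g (- t) = 0"
  by (rule dilation_op_ek_eq_0_imp[OF _ p _ al' z2]) (use fin lp_mass_reflect[OF g, of p] in auto)
 then have "AE t in lborel. 0 < -1 * t --> g (- (-1 * t)) = 0" by (rule AE_lborel_scale) simp
 with pos AE_lborel_singleton[of 0] show ?thesis
 proof eventually_elim
  case (elim t)
  then show ?case by (cases "0 < t") auto
 qed
qed

section \<open>The completed space and its operators\<close>

text \<open>The norm proper, as a real number. An infinite mass is sent to 0, so estimates for it
  assume finite mass.\<close>

definition lp_mag :: "real => (real => complex) => real" where
 "lp_mag p h = enn2real (lp_mass p h) powr (1 / p)"

lemma lp_mag_nonneg [simp]: "0 \<le> lp_mag p h"
 by (simp add: lp_mag_def)

lemma lp_mag_less_iff: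
 assumes p: "1 < p" and fin: "lp_mass p h < \<infinity>" and e: "0 < e"
 shows "lp_mag p h < e \<longleftrightarrow> lp_mass p h < ennreal (e powr p)"
proof -
 obtain m where m: "0 \<le> m" "lp_mass p h = ennreal m" using fin by (cases "lp_mass p h") auto
 have "m powr (1 / p) < e \<longleftrightarrow> m < e powr p"
 proof
  assume "m powr (1 / p) < e"
  then have "(m powr (1 / p)) powr p < e powr p" using p by (intro powr_less_mono2) auto
  then show "m < e powr p" using p m by (simp add: powr_powr)
 next
  assume "m < e powr p"
  then have "m powr (1 / p) < (e powr p) powr (1 / p)" using p m by (intro powr_less_mono2) auto
  then show "m powr (1 / p) < e" using p e by (simp add: powr_powr)
 qed
 then show ?thesis using m by (simp add: lp_mag_def ennreal_less_iff)
qed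

lemma lp_mag_minus_commute: "lp_mag p (\<lambda>x. f x - g x) = lp_mag p (\<lambda>x. g x - f x)"
 unfolding lp_mag_def by (subst lp_mass_minus_commute) (rule refl)

lemma lp_mag_cong: "(AE x in lborel. f x = g x) ==> lp_mag p f = lp_mag p g"
 unfolding lp_mag_def by (simp only: lp_mass_cong)

lemma lp_mass_add_finite:
 assumes "borel_fun f" "borel_fun g" "1 < p" "lp_mass p f < \<infinity>" "lp_mass p g < \<infinity>"
 shows "lp_mass p (\<lambda>x. f x + g x) < \<infinity>"
proof -
 have "ennreal (2 powr p) * (lp_mass p f + lp_mass p g) < \<infinity>" using assms by (simp add: ennreal_mult_less_top)
 then show ?thesis by (rule le_less_trans[OF lp_mass_add_le[OF assms(1-3)]])
qed

lemma lp_mass_cmult_finite: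
 "f \<in> borel_measurable borel ==> lp_mass p f < \<infinity> ==> lp_mass p (\<lambda>x. c * f x) < \<infinity>"
 by (simp add: lp_mass_cmult ennreal_mult_less_top)

text \<open>The power form of Minkowski's inequality asks for strictly positive bounds, so it is
  applied to norms increased by a third of the allowed slack; another third makes the final
  comparison strict.\<close>

lemma lp_mag_add:
 assumes m: "borel_fun f" "borel_fun g" and p: "1 < p" and fin: "lp_mass p f < \<infinity>" "lp_mass p g < \<infinity>"
 shows "lp_mag p (\<lambda>x. f x + g x) \<le> lp_mag p f + lp_mag p g"
proof (rule field_le_epsilon)
 fix e :: real assume e: "0 < e"
 define a b where "a = lp_mag p f + e / 3" and "b = lp_mag p g + e / 3"
 have ab: "0 < a" "0 < b" using e lp_mag_nonneg[of p f] lp_mag_nonneg[of p g] by (auto simp: a_def b_def simp del: lp_mag_nonneg)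
 have "lp_mag p f < a" "lp_mag p g < b" using e by (auto simp: a_def b_def)
 then have "lp_mass p f \<le> ennreal (a powr p)" "lp_mass p g \<le> ennreal (b powr p)"
  using lp_mag_less_iff[OF p fin(1) ab(1)] lp_mag_less_iff[OF p fin(2) ab(2)] by auto
 then have "lp_mass p (\<lambda>x. f x + g x) \<le> ennreal ((a + b) powr p)" by (intro lp_mass_Minkowski m p ab)
 also have "\<dots> < ennreal ((a + b + e / 3) powr p)"
  using ab e p by (intro ennreal_lessI powr_less_mono2) auto
 finally have "lp_mag p (\<lambda>x. f x + g x) < a + b + e / 3"
  using lp_mag_less_iff[OF p lp_mass_add_finite[OF m p fin], of "a + b + e / 3"] ab e by simp
 then show "lp_mag p (\<lambda>x. f x + g x) \<le> lp_mag p f + lp_mag p g + e" by (simp add: a_def b_def)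
qed

lemma lp_mag_scale:
 assumes le: "lp_mass p f \<le> ennreal c * lp_mass p g" and c: "0 \<le> c" and fin: "lp_mass p g < \<infinity>" and p: "1 < p"
 shows "lp_mag p f \<le> c powr (1 / p) * lp_mag p g"
proof -
 have "enn2real (lp_mass p f) \<le> enn2real (ennreal c * lp_mass p g)"
  using le fin by (intro enn2real_mono) (auto simp: ennreal_mult_less_top)
 also have "\<dots> = c * enn2real (lp_mass p g)" using c by (simp add: enn2real_mult)
 finally have "enn2real (lp_mass p f) powr (1 / p) \<le> (c * enn2real (lp_mass p g)) powr (1 / p)"
  using p by (intro powr_mono2) auto
 then show ?thesis using c by (simp add: lp_mag_def powr_mult)
qed

lemma lp_mag_tendsto_0_iff:
 assumes p: "1 < p" and fin: "\<And>k. lp_mass p (F k) < \<infinity>"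
 shows "(\<lambda>k. lp_mag p (F k)) \<longlonglongrightarrow> 0 \<longleftrightarrow> (\<lambda>k. lp_mass p (F k)) \<longlonglongrightarrow> 0"
proof
 assume l: "(\<lambda>k. lp_mag p (F k)) \<longlonglongrightarrow> 0"
 show "(\<lambda>k. lp_mass p (F k)) \<longlonglongrightarrow> 0"
 proof (rule tendsto_0_ennrealI)
  fix e :: real assume e: "0 < e"
  have "\<forall>\<^sub>F k in sequentially. lp_mag p (F k) < e powr (1 / p)"
   using l e by (intro order_tendstoD) auto
  then show "\<forall>\<^sub>F k in sequentially. lp_mass p (F k) \<le> ennreal e"
  proof eventually_elim
   case (elim k)
   then show ?case using lp_mag_less_iff[OF p fin, of "e powr (1 / p)" k] e p by (simp add: powr_powr less_imp_le)
  qed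
 qed
next
 assume l: "(\<lambda>k. lp_mass p (F k)) \<longlonglongrightarrow> 0"
 show "(\<lambda>k. lp_mag p (F k)) \<longlonglongrightarrow> 0"
 proof (rule tendstoI)
  fix e :: real assume e: "0 < e"
  have "\<forall>\<^sub>F k in sequentially. lp_mass p (F k) < ennreal (e powr p)"
   using l e by (intro order_tendstoD) auto
  then show "\<forall>\<^sub>F k in sequentially. dist (lp_mag p (F k)) 0 < e"
   by eventually_elim (simp add: lp_mag_less_iff[OF p fin e])
 qed
qed

lemma lp_conv_finite:
 assumes [measurable]: "\<And>k. borel_fun (F k)" "borel_fun g"
  and fin: "\<And>k. lp_mass p (F k) < \<infinity>" and p: "1 < p" and c: "lp_conv p F g"
 shows "lp_mass p g < \<infinity>"
proof -
 have "\<forall>\<^sub>F k in sequentially. lp_mass p (\<lambda>x. F k x - g x) < 1"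
  using c unfolding lp_conv_def by (intro order_tendstoD) auto
 then obtain k where k: "lp_mass p (\<lambda>x. F k x - g x) < 1" by (auto simp: eventually_sequentially)
 have d: "lp_mass p (\<lambda>x. F k x - g x) < \<infinity>" using less_trans[OF k ennreal_one_less_top] by simp
 have "lp_mass p (\<lambda>x. F k x - (F k x - g x)) < \<infinity>"
  by (rule lp_mass_diff_finite[OF _ _ p fin d]) measurable
 then show ?thesis by simp
qed

lemma lp_mag_tendsto:
 assumes m[measurable]: "\<And>k. borel_fun (F k)" "borel_fun g"
  and fin: "\<And>k. lp_mass p (F k) < \<infinity>" "lp_mass p g < \<infinity>" and p: "1 < p" and c: "lp_conv p F g"
 shows "(\<lambda>k. lp_mag p (F k)) \<longlonglongrightarrow> lp_mag p g"
proof (rule LIM_zero_cancel, rule Lim_null_comparison)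
 have d: "lp_mass p (\<lambda>x. F k x - g x) < \<infinity>" "lp_mass p (\<lambda>x. g x - F k x) < \<infinity>" for k
  by (intro lp_mass_diff_finite m p fin)+
 show "(\<lambda>k. lp_mag p (\<lambda>x. F k x - g x)) \<longlonglongrightarrow> 0"
  using c unfolding lp_mag_tendsto_0_iff[OF p d(1)] lp_conv_def .
 show "\<forall>\<^sub>F k in sequentially. norm (lp_mag p (F k) - lp_mag p g) \<le> lp_mag p (\<lambda>x. F k x - g x)"
 proof (rule always_eventually, rule allI)
  fix k
  have "lp_mag p (\<lambda>x. (F k x - g x) + g x) \<le> lp_mag p (\<lambda>x. F k x - g x) + lp_mag p g"
   by (intro lp_mag_add p d fin) measurable
  moreover have "lp_mag p (\<lambda>x. (g x - F k x) + F k x) \<le> lp_mag p (\<lambda>x. g x - F k x) + lp_mag p (F k)"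
   by (intro lp_mag_add p d fin) measurable
  ultimately show "norm (lp_mag p (F k) - lp_mag p g) \<le> lp_mag p (\<lambda>x. F k x - g x)"
   by (simp add: lp_mag_minus_commute[of p g "F k"] abs_le_iff)
 qed
qed

section \<open>Borel representatives\<close>

text \<open>Elements of the space are Lebesgue measurable, while the Fubini arguments live on Borel
  functions; this is the passage between the two.\<close>

lemma lebesgue_AE_borel:
 fixes h :: "real => 'a::euclidean_space"
 assumes h: "borel_fun h" and ae: "AE x in lborel. f x = h x"
 shows "f \<in> borel_measurable lebesgue" "integral\<^sup>L lebesgue f = integral\<^sup>L lborel h"
  "integrable lebesgue f \<longleftrightarrow> integrable lborel h"
proof -
 have hl: "h \<in> borel_measurable lborel" using h by simp
 have hm: "h \<in> borel_measurable lebesgue" using measurable_completion[OF hl] .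
 have ae': "AE x in lebesgue. h x = f x" using ae by (simp add: AE_completion_iff eq_commute)
 then have ae'': "AE x in lebesgue. f x = h x" by (simp add: eq_commute)
 show fm: "f \<in> borel_measurable lebesgue" by (rule borel_measurable_AE[OF hm ae'])
 show "integral\<^sup>L lebesgue f = integral\<^sup>L lborel h"
  using integral_cong_AE[OF fm hm ae''] integral_completion[OF hl] by simp
 show "integrable lebesgue f \<longleftrightarrow> integrable lborel h"
  using integrable_cong_AE[OF fm hm ae''] integrable_completion[OF hl] by simp
qed

lemma ex_borel_representative:
 fixes f :: "real => complex"
 assumes f: "f \<in> borel_measurable lebesgue"
 shows "\<exists>f'\<in>borel_measurable borel. AE x in lborel. f x = f' x"
proof -
 have "(\<lambda>x. Re (f x)) \<in> borel_measurable lebesgue" "(\<lambda>x. Im (f x)) \<in> borel_measurable lebesgue" using f by (simp_all add: borel_measurable_complex_iff)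
 then obtain r i where r: "r \<in> borel_measurable lborel" "AE x in lborel. Re (f x) = r x" and i: "i \<in> borel_measurable lborel" "AE x in lborel. Im (f x) = i x"
  using completion_ex_borel_measurable_real by metis
 have "borel_fun (\<lambda>x. Complex (r x) (i x))" using r(1) i(1) by (simp add: borel_measurable_complex_iff)
 then show ?thesis
 proof (rule bexI[rotated])
  show "AE x in lborel. f x = Complex (r x) (i x)"
   using r(2) i(2) by eventually_elim (simp add: complex_eq_iff)
 qed
qed

lemma lp_norm_eq:
 assumes [measurable]: "borel_fun h" and ae: "AE x in lborel. f x = h x"
 shows "lp_norm p f = lp_mag p h"
proof -
 have "AE x in lborel. norm (f x) powr p = norm (h x) powr p" using ae by eventually_elim simp
 then have "(LINT x|lebesgue. norm (f x) powr p) = (LBINT x. norm (h x) powr p)"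
  by (intro lebesgue_AE_borel) measurable
 also have "\<dots> = enn2real (lp_mass p h)" unfolding lp_mass_def by (rule integral_eq_nn_integral) auto
 finally show ?thesis by (simp add: lp_norm_def lp_mag_def)
qed

lemma lp_spaceI:
 assumes [measurable]: "borel_fun h" and fin: "lp_mass p h < \<infinity>" and ae: "AE x in lborel. f x = h x"
 shows "f \<in> lp_space p"
proof -
 have "AE x in lborel. norm (f x) powr p = norm (h x) powr p" using ae by eventually_elim simp
 then have "integrable lebesgue (\<lambda>x. norm (f x) powr p) \<longleftrightarrow> integrable lborel (\<lambda>x. norm (h x) powr p)"
  by (intro lebesgue_AE_borel) measurable
 moreover have "integrable lborel (\<lambda>x. norm (h x) powr p)"
  using fin by (intro integrableI_bounded) (auto simp: lp_mass_def)
 ultimately show ?thesis using lebesgue_AE_borel(1)[OF assms(1) ae] by (simp add: lp_space_def)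
qed

lemma lp_spaceE:
 assumes f: "f \<in> lp_space p"
 obtains h where "borel_fun h" "lp_mass p h < \<infinity>" "AE x in lborel. f x = h x"
proof -
 have fm: "f \<in> borel_measurable lebesgue" and fi: "integrable lebesgue (\<lambda>x. norm (f x) powr p)"
  using f by (auto simp: lp_space_def)
 obtain h where h[measurable]: "borel_fun h" and ae: "AE x in lborel. f x = h x"
  using ex_borel_representative[OF fm] by blast
 have "AE x in lborel. norm (f x) powr p = norm (h x) powr p" using ae by eventually_elim simp
 then have "integrable lborel (\<lambda>x. norm (h x) powr p)"
  using fi by (subst (asm) lebesgue_AE_borel(3)) auto
 then have hf: "lp_mass p h < \<infinity>" by (simp add: integrable_iff_bounded lp_mass_def)
 show ?thesis by (rule that[OF h hf ae])
qed

lemma tp_prenorm_eq: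
 assumes f: "f \<in> schwartz" and a: "0 \<le> \<alpha>" "\<alpha> < real n"
 shows "tp_prenorm n \<alpha> p f = 1 / Gamma (\<alpha> + 1) * lp_mag p (tD n \<alpha> f)"
proof -
 have [measurable]: "borel_fun (tD n \<alpha> f)" by (rule tD_measurable[OF f a(2)])
 have "AE t in lborel. (norm (weyl_zero n \<alpha> f t) * \<bar>t\<bar> powr \<alpha>) powr p = norm (tD n \<alpha> f t) powr p"
  using AE_lborel_singleton[of 0] by eventually_elim (simp add: norm_tD[OF f a])
 then have "(LINT t|lebesgue. (norm (weyl_zero n \<alpha> f t) * \<bar>t\<bar> powr \<alpha>) powr p) = (LBINT t. norm (tD n \<alpha> f t) powr p)"
  by (intro lebesgue_AE_borel) measurable
 also have "\<dots> = enn2real (lp_mass p (tD n \<alpha> f))" unfolding lp_mass_def by (rule integral_eq_nn_integral) auto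
 finally show ?thesis by (simp add: tp_prenorm_def lp_mag_def)
qed

lemma tR_cases:
 assumes "0 \<le> \<alpha>" "1 < p"
 obtains "\<alpha> = 0" | C where "0 < \<alpha>" "dilation_kernel p (ek 0 \<alpha>) C"
 using dilation_kernel_ek[of 0 \<alpha> p] assms by (cases "\<alpha> = 0") auto

lemma tR_mass_finite:
 assumes "borel_fun g" "lp_mass p g < \<infinity>" "0 \<le> \<alpha>" "1 < p"
 shows "lp_mass p (tR \<alpha> g) < \<infinity>"
 using tR_cases[OF assms(3,4)]
proof cases
 case (2 C)
 then show ?thesis using dilation_op_mass_finite[OF assms(4) 2(2) assms(1,2)] by (simp add: tR_def)
qed (use assms in \<open>simp add: tR_def\<close>)

lemma tR_lincomb:
 assumes "borel_fun f" "borel_fun g" "lp_mass p f < \<infinity>" "lp_mass p g < \<infinity>" "0 \<le> \<alpha>" "1 < p"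
 shows "AE t in lborel. tR \<alpha> (\<lambda>s. a * f s + b * g s) t = a * tR \<alpha> f t + b * tR \<alpha> g t"
 using tR_cases[OF assms(5,6)]
proof cases
 case (2 C)
 then show ?thesis using dilation_op_lincomb[OF assms(6) 2(2) assms(1-4)] by (simp add: tR_def)
qed (use assms in \<open>simp add: tR_def\<close>)

lemma tR_conv:
 assumes "\<And>n. borel_fun (F n)" "borel_fun g" "\<And>n. lp_mass p (F n) < \<infinity>" "lp_mass p g < \<infinity>"
  "0 \<le> \<alpha>" "1 < p" "lp_conv p F g"
 shows "lp_conv p (\<lambda>n. tR \<alpha> (F n)) (tR \<alpha> g)"
 using tR_cases[OF assms(5,6)]
proof cases
 case (2 C)
 then show ?thesis using dilation_op_conv[OF assms(6) 2(2) assms(1-4,7)] by (simp add: tR_def)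
qed (use assms in \<open>simp add: tR_def\<close>)

lemma tR_cong:
 assumes "borel_fun f" "borel_fun g" "AE t in lborel. f t = g t"
 shows "AE t in lborel. tR \<alpha> f t = tR \<alpha> g t"
proof (cases "\<alpha> = 0")
 case False
 show ?thesis using AE_lborel_singleton[of 0]
 proof eventually_elim
  case (elim t)
  then show ?case using False dilation_op_cong_AE[OF assms(3,1,2) ek_measurable[of 0 \<alpha>], of t] by (simp add: tR_def)
 qed
qed (use assms in \<open>simp add: tR_def\<close>)

section \<open>The completion as the range of the fractional integral\<close>

text \<open>The function g is the generalised weighted derivative of f, determined almost everywhere
  by injectivity of \<open>tR\<close>. Membership, norm and operators are all expressed through it,
  and the auxiliary integer \<open>n\<close> does not occur.\<close>

definition tp_deriv :: "real => real => (real => complex) => (real => complex) => bool" where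
 "tp_deriv \<alpha> p f g \<longleftrightarrow> g \<in> borel_measurable borel \<and> lp_mass p g < \<infinity> \<and> (AE t in lborel. f t = tR \<alpha> g t)"

lemma tp_deriv_unique:
 assumes "tp_deriv \<alpha> p f g" "tp_deriv \<alpha> p f h" "0 \<le> \<alpha>" "1 < p"
 shows "AE t in lborel. g t = h t"
proof -
 have m[measurable]: "borel_fun g" "borel_fun h" and fin: "lp_mass p g < \<infinity>" "lp_mass p h < \<infinity>"
  and ae: "AE t in lborel. f t = tR \<alpha> g t" "AE t in lborel. f t = tR \<alpha> h t"
  using assms by (auto simp: tp_deriv_def)
 have "AE t in lborel. tR \<alpha> (\<lambda>s. 1 * g s + (-1) * h s) t = 0"
  using tR_lincomb[OF m fin assms(3,4), of 1 "-1"] ae by eventually_elim simp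
 then have "AE t in lborel. tR \<alpha> (\<lambda>s. g s - h s) t = 0" by simp
 then have "AE t in lborel. g t - h t = 0"
  using assms fin by (intro tR_inj[OF _ assms(4) lp_mass_diff_finite]) auto
 then show ?thesis by eventually_elim simp
qed

lemma lp_norm_tendsto_0_iff:
 assumes [measurable]: "\<And>k. borel_fun (\<phi> k)" "borel_fun h"
  and fin: "\<And>k. lp_mass p (\<phi> k) < \<infinity>" "lp_mass p h < \<infinity>" and p: "1 < p" and ae: "AE t in lborel. f t = h t"
 shows "(\<lambda>k. lp_norm p (\<lambda>t. \<phi> k t - f t)) \<longlonglongrightarrow> 0 \<longleftrightarrow> lp_conv p \<phi> h"
proof -
 have "lp_norm p (\<lambda>t. \<phi> k t - f t) = lp_mag p (\<lambda>t. \<phi> k t - h t)" for k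
 proof (rule lp_norm_eq)
  show "AE t in lborel. \<phi> k t - f t = \<phi> k t - h t" using ae by eventually_elim simp
 qed measurable
 moreover have "lp_mass p (\<lambda>t. \<phi> k t - h t) < \<infinity>" for k
  by (rule lp_mass_diff_finite[OF _ _ p fin]) measurable
 ultimately show ?thesis
  unfolding lp_conv_def by (simp only: lp_mag_tendsto_0_iff[OF p])
qed

lemma tD_represents:
 assumes a: "0 \<le> \<alpha>" "\<alpha> < real n" and p: "1 < p" and s: "\<And>k. \<phi> k \<in> schwartz"
 shows "AE t in lborel. \<phi> k t = tR \<alpha> (tD n \<alpha> (\<phi> k)) t"
 using AE_lborel_singleton[of 0] by eventually_elim (simp add: tR_tD[OF s a])

text \<open>The prenorm of a difference is a multiple of the L^p norm of the difference of the
  functions \<open>tD\<close>, so a Cauchy sequence yields a limit g in L^p; continuity of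
  \<open>tR\<close> identifies the limit of the sequence itself as \<open>tR\<close> of g.\<close>

lemma tp_represents_iff:
 assumes a: "0 \<le> \<alpha>" "\<alpha> < real n" and p: "1 < p" and f: "f \<in> lp_space p"
 shows "tp_represents n \<alpha> p \<phi> f \<longleftrightarrow>
  (\<forall>k. \<phi> k \<in> schwartz) \<and> (\<exists>g. tp_deriv \<alpha> p f g \<and> lp_conv p (\<lambda>k. tD n \<alpha> (\<phi> k)) g)"
proof (cases "\<forall>k. \<phi> k \<in> schwartz")
 case True
 then have s: "\<phi> k \<in> schwartz" for k by simp
 have G: "0 < Gamma (\<alpha> + 1)" using a by (intro Gamma_real_pos) simp
 obtain h where h[measurable]: "borel_fun h" and hf: "lp_mass p h < \<infinity>" and ae: "AE t in lborel. f t = h t"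
  using lp_spaceE[OF f] by metis
 have [measurable]: "borel_fun (\<phi> k)" for k by (rule smooth_borel[OF schwartz_smooth[OF s]])
 note dm[measurable] = tD_measurable[OF s a(2)]
 note df = tD_mass_finite[OF s a p]
 have tr: "AE t in lborel. \<phi> k t = tR \<alpha> (tD n \<alpha> (\<phi> k)) t" for k
  by (rule tD_represents[where \<phi>=\<phi>, OF a p s])
 have \<phi>f: "lp_mass p (\<phi> k) < \<infinity>" for k
  unfolding lp_mass_cong[OF tr[of k], of p] by (rule tR_mass_finite[OF dm df a(1) p])
 have pre: "tp_prenorm n \<alpha> p (\<lambda>t. \<phi> j t - \<phi> k t) = 1 / Gamma (\<alpha> + 1) * lp_mag p (\<lambda>t. tD n \<alpha> (\<phi> j) t - tD n \<alpha> (\<phi> k) t)" for j k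
 proof -
  have "tD n \<alpha> (\<lambda>t. \<phi> j t - \<phi> k t) = (\<lambda>t. tD n \<alpha> (\<phi> j) t - tD n \<alpha> (\<phi> k) t)"
   by (rule ext) (rule tD_diff[OF s s a(2)])
  then show ?thesis by (simp only: tp_prenorm_eq[OF schwartz_diff[OF s s] a])
 qed
 have convh: "lp_conv p \<phi> (tR \<alpha> g)" if "borel_fun g" "lp_mass p g < \<infinity>" "lp_conv p (\<lambda>k. tD n \<alpha> (\<phi> k)) g" for g
 proof -
  have "lp_conv p (\<lambda>k. tR \<alpha> (tD n \<alpha> (\<phi> k))) (tR \<alpha> g)" by (rule tR_conv[OF dm that(1) df that(2) a(1) p that(3)])
  moreover have "lp_mass p (\<lambda>t. tR \<alpha> (tD n \<alpha> (\<phi> k)) t - tR \<alpha> g t) = lp_mass p (\<lambda>t. \<phi> k t - tR \<alpha> g t)" for k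
   by (rule lp_mass_cong, use tr[of k] in eventually_elim) simp
  ultimately show ?thesis by (simp add: lp_conv_def)
 qed
 have "tp_represents n \<alpha> p \<phi> f \<longleftrightarrow> (\<exists>g. tp_deriv \<alpha> p f g \<and> lp_conv p (\<lambda>k. tD n \<alpha> (\<phi> k)) g)"
 proof
  assume r: "tp_represents n \<alpha> p \<phi> f"
  obtain g where g[measurable]: "borel_fun g" and gc: "lp_conv p (\<lambda>k. tD n \<alpha> (\<phi> k)) g"
  proof (rule lp_complete[OF dm p])
   fix e :: real assume e: "0 < e"
   have "0 < 1 / Gamma (\<alpha> + 1) * e powr (1 / p)" using G e by simp
   then obtain N where N: "\<And>j k. N \<le> j ==> N \<le> k ==> tp_prenorm n \<alpha> p (\<lambda>t. \<phi> j t - \<phi> k t) < 1 / Gamma (\<alpha> + 1) * e powr (1 / p)"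
    using r unfolding tp_represents_def by blast
   have "lp_mass p (\<lambda>t. tD n \<alpha> (\<phi> j) t - tD n \<alpha> (\<phi> k) t) < ennreal e" if "N \<le> j" "N \<le> k" for j k
   proof -
    have "lp_mag p (\<lambda>t. tD n \<alpha> (\<phi> j) t - tD n \<alpha> (\<phi> k) t) < e powr (1 / p)"
     using N[OF that] G by (simp add: pre divide_less_cancel)
    then show ?thesis
     using lp_mag_less_iff[OF p lp_mass_diff_finite[OF dm dm p df df], of "e powr (1 / p)" j k] e p by (simp add: powr_powr)
   qed
   then show "\<exists>N. \<forall>j\<ge>N. \<forall>k\<ge>N. lp_mass p (\<lambda>t. tD n \<alpha> (\<phi> j) t - tD n \<alpha> (\<phi> k) t) < ennreal e" by blast
  qed (rule that, assumption+)
  have gf: "lp_mass p g < \<infinity>" by (rule lp_conv_finite[OF dm g df p gc])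
  have "lp_conv p \<phi> h" using r lp_norm_tendsto_0_iff[OF _ h \<phi>f hf p ae] by (simp add: tp_represents_def)
  then have "AE t in lborel. h t = tR \<alpha> g t" by (intro lp_conv_unique[OF _ _ _ p _ convh[OF g gf gc]]) auto
  with ae have "AE t in lborel. f t = tR \<alpha> g t" by eventually_elim simp
  then show "\<exists>g. tp_deriv \<alpha> p f g \<and> lp_conv p (\<lambda>k. tD n \<alpha> (\<phi> k)) g"
   using g gf gc unfolding tp_deriv_def by (intro exI[of _ g] conjI)
 next
  assume "\<exists>g. tp_deriv \<alpha> p f g \<and> lp_conv p (\<lambda>k. tD n \<alpha> (\<phi> k)) g"
  then obtain g where g[measurable]: "borel_fun g" and gf: "lp_mass p g < \<infinity>" and ga: "AE t in lborel. f t = tR \<alpha> g t"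
   and gc: "lp_conv p (\<lambda>k. tD n \<alpha> (\<phi> k)) g"
   by (auto simp: tp_deriv_def)
  have "lp_conv p \<phi> h"
  proof -
   have "lp_mass p (\<lambda>t. \<phi> k t - h t) = lp_mass p (\<lambda>t. \<phi> k t - tR \<alpha> g t)" for k
    by (rule lp_mass_cong, use ga ae in eventually_elim) simp
   then show ?thesis using convh[OF g gf gc] by (simp add: lp_conv_def)
  qed
  then have l: "(\<lambda>k. lp_norm p (\<lambda>t. \<phi> k t - f t)) \<longlonglongrightarrow> 0" using lp_norm_tendsto_0_iff[OF _ h \<phi>f hf p ae] by simp
  have dg: "lp_mass p (\<lambda>t. tD n \<alpha> (\<phi> k) t - g t) < \<infinity>" for k by (rule lp_mass_diff_finite[OF dm g p df gf])
  have z: "(\<lambda>k. lp_mag p (\<lambda>t. tD n \<alpha> (\<phi> k) t - g t)) \<longlonglongrightarrow> 0"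
   using gc unfolding lp_mag_tendsto_0_iff[OF p dg] lp_conv_def .
  have "\<exists>N. \<forall>j\<ge>N. \<forall>k\<ge>N. tp_prenorm n \<alpha> p (\<lambda>t. \<phi> j t - \<phi> k t) < e" if e: "0 < e" for e
  proof -
   have "\<forall>\<^sub>F k in sequentially. lp_mag p (\<lambda>t. tD n \<alpha> (\<phi> k) t - g t) < Gamma (\<alpha> + 1) * e / 2"
    using z G e by (intro order_tendstoD) auto
   then obtain N where N: "\<And>k. N \<le> k ==> lp_mag p (\<lambda>t. tD n \<alpha> (\<phi> k) t - g t) < Gamma (\<alpha> + 1) * e / 2"
    by (auto simp: eventually_sequentially)
   have "tp_prenorm n \<alpha> p (\<lambda>t. \<phi> j t - \<phi> k t) < e" if "N \<le> j" "N \<le> k" for j k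
   proof -
    have "lp_mag p (\<lambda>t. (tD n \<alpha> (\<phi> j) t - g t) + (g t - tD n \<alpha> (\<phi> k) t)) \<le> lp_mag p (\<lambda>t. tD n \<alpha> (\<phi> j) t - g t) + lp_mag p (\<lambda>t. g t - tD n \<alpha> (\<phi> k) t)"
     using dg by (intro lp_mag_add p) (auto simp: lp_mass_minus_commute[of p g])
    also have "\<dots> < Gamma (\<alpha> + 1) * e / 2 + Gamma (\<alpha> + 1) * e / 2"
     unfolding lp_mag_minus_commute[of p g] by (intro add_strict_mono N that)
    finally have "lp_mag p (\<lambda>t. tD n \<alpha> (\<phi> j) t - tD n \<alpha> (\<phi> k) t) < Gamma (\<alpha> + 1) * e" by (simp add: mult.commute)
    then show ?thesis using G by (simp add: pre divide_less_eq mult.commute)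
   qed
   then show ?thesis by blast
  qed
  then show "tp_represents n \<alpha> p \<phi> f" unfolding tp_represents_def using s l by blast
 qed
 then show ?thesis using True by simp
next
 case False
 then have "\<not> tp_represents n \<alpha> p \<phi> f" unfolding tp_represents_def by (rule contrapos_nn) (rule conjunct1)
 with False show ?thesis by (simp only: simp_thms)
qed

lemma tp_deriv_lp_space:
 assumes "tp_deriv \<alpha> p f g" "0 \<le> \<alpha>" "1 < p" shows "f \<in> lp_space p"
 using assms by (intro lp_spaceI[of "tR \<alpha> g"] tR_mass_finite tR_measurable) (auto simp: tp_deriv_def)

lemma ex_tD_sequence:
 assumes g: "borel_fun g" "lp_mass p g < \<infinity>" and a: "0 \<le> \<alpha>" "\<alpha> < real n" and p: "1 < p"
 obtains \<phi> where "\<And>k. \<phi> k \<in> schwartz" "lp_conv p (\<lambda>k. tD n \<alpha> (\<phi> k)) g"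
proof -
 have "\<forall>k. \<exists>\<phi>. \<phi> \<in> schwartz \<and> lp_mass p (\<lambda>t. g t - tD n \<alpha> \<phi> t) < ennreal (inverse (real (Suc k)))"
  using tD_dense[OF g a p] unfolding Bex_def by simp
 from choice[OF this] obtain \<phi> where "\<forall>k. \<phi> k \<in> schwartz \<and> lp_mass p (\<lambda>t. g t - tD n \<alpha> (\<phi> k) t) < ennreal (inverse (real (Suc k)))"
  by (rule exE)
 then have \<phi>: "\<phi> k \<in> schwartz" "lp_mass p (\<lambda>t. g t - tD n \<alpha> (\<phi> k) t) < ennreal (inverse (real (Suc k)))" for k by simp_all
 have "(\<lambda>k. ennreal (inverse (real (Suc k)))) \<longlonglongrightarrow> ennreal 0" by (intro tendsto_ennrealI inverse_Suc_seq(1))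
 then have "(\<lambda>k. ennreal (inverse (real (Suc k)))) \<longlonglongrightarrow> 0" by simp
 then have "lp_conv p (\<lambda>k. tD n \<alpha> (\<phi> k)) g"
  unfolding lp_conv_def
  by (rule tendsto_0_le_ennreal) (use \<phi>(2) in \<open>auto simp: lp_mass_minus_commute[of p _ g] intro!: always_eventually less_imp_le\<close>)
 then show ?thesis by (rule that[OF \<phi>(1)])
qed

text \<open>Completeness of L^p gives one direction; density of the functions \<open>tD\<close>
  supplies a representing sequence for the other.\<close>

lemma tp_space_iff:
 assumes a: "0 \<le> \<alpha>" "\<alpha> < real n" and p: "1 < p"
 shows "f \<in> tp_space n \<alpha> p \<longleftrightarrow> (\<exists>g. tp_deriv \<alpha> p f g)"
proof
 assume "f \<in> tp_space n \<alpha> p"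
 then obtain \<phi> where "f \<in> lp_space p" "tp_represents n \<alpha> p \<phi> f" by (auto simp: tp_space_def)
 then show "\<exists>g. tp_deriv \<alpha> p f g" using tp_represents_iff[OF a p] by blast
next
 assume "\<exists>g. tp_deriv \<alpha> p f g"
 then obtain g where g: "tp_deriv \<alpha> p f g" by (rule exE)
 then have gm: "borel_fun g" and gf: "lp_mass p g < \<infinity>" by (auto simp: tp_deriv_def)
 obtain \<phi> where s: "\<And>k. \<phi> k \<in> schwartz" and c: "lp_conv p (\<lambda>k. tD n \<alpha> (\<phi> k)) g"
  by (rule ex_tD_sequence[OF gm gf a p]) (rule that, assumption+)
 have "tp_represents n \<alpha> p \<phi> f"
  unfolding tp_represents_iff[OF a p tp_deriv_lp_space[OF g a(1) p]] by (intro conjI allI s exI[of _ g] g c)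
 then show "f \<in> tp_space n \<alpha> p" using tp_deriv_lp_space[OF g a(1) p] by (auto simp: tp_space_def)
qed

text \<open>Along every representing sequence the prenorms converge to the norm of the generalised
  derivative. Uniqueness in the definite description rests on the existence of at least one such
  sequence, which is where density enters.\<close>

lemma tp_norm_eq:
 assumes a: "0 \<le> \<alpha>" "\<alpha> < real n" and p: "1 < p" and g: "tp_deriv \<alpha> p f g"
 shows "tp_norm n \<alpha> p f = 1 / Gamma (\<alpha> + 1) * lp_mag p g"
 unfolding tp_norm_def
proof (rule the_equality)
 have gm: "borel_fun g" and gf: "lp_mass p g < \<infinity>" using g by (auto simp: tp_deriv_def)
 have f: "f \<in> lp_space p" by (rule tp_deriv_lp_space[OF g a(1) p])
 have lim: "(\<lambda>k. tp_prenorm n \<alpha> p (\<phi> k)) \<longlonglongrightarrow> 1 / Gamma (\<alpha> + 1) * lp_mag p g" if r: "tp_represents n \<alpha> p \<phi> f" for \<phi>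
 proof -
  obtain h where s: "\<And>k. \<phi> k \<in> schwartz" and h: "tp_deriv \<alpha> p f h" and c: "lp_conv p (\<lambda>k. tD n \<alpha> (\<phi> k)) h"
   using r tp_represents_iff[OF a p f] by blast
  have "lp_mag p h = lp_mag p g" by (rule lp_mag_cong[OF tp_deriv_unique[OF h g a(1) p]])
  moreover have "(\<lambda>k. lp_mag p (tD n \<alpha> (\<phi> k))) \<longlonglongrightarrow> lp_mag p h"
   using h by (intro lp_mag_tendsto[OF tD_measurable[OF s a(2)] _ tD_mass_finite[OF s a p] _ p c]) (auto simp: tp_deriv_def)
  ultimately have "(\<lambda>k. 1 / Gamma (\<alpha> + 1) * lp_mag p (tD n \<alpha> (\<phi> k))) \<longlonglongrightarrow> 1 / Gamma (\<alpha> + 1) * lp_mag p g"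
   by (intro tendsto_mult tendsto_const) simp
  then show ?thesis by (simp only: tp_prenorm_eq[OF s a])
 qed
 then show "\<forall>\<phi>. tp_represents n \<alpha> p \<phi> f --> (\<lambda>k. tp_prenorm n \<alpha> p (\<phi> k)) \<longlonglongrightarrow> 1 / Gamma (\<alpha> + 1) * lp_mag p g" by blast
 fix N assume N: "\<forall>\<phi>. tp_represents n \<alpha> p \<phi> f --> (\<lambda>k. tp_prenorm n \<alpha> p (\<phi> k)) \<longlonglongrightarrow> N"
 obtain \<phi> where s: "\<And>k. \<phi> k \<in> schwartz" and c: "lp_conv p (\<lambda>k. tD n \<alpha> (\<phi> k)) g"
  by (rule ex_tD_sequence[OF gm gf a p]) (rule that, assumption+)
 have r: "tp_represents n \<alpha> p \<phi> f" unfolding tp_represents_iff[OF a p f] by (intro conjI allI s exI[of _ g] g c)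
 show "N = 1 / Gamma (\<alpha> + 1) * lp_mag p g" by (rule LIMSEQ_unique[OF N[rule_format, OF r] lim[OF r]])
qed

text \<open>The operator A on the space corresponds to T on generalised derivatives.
  Well-definedness, linearity up to null sets and the bound are inherited from T on L^p, since the
  norm of the space is a constant times the L^p norm of the derivative.\<close>

lemma tp_bounded_operatorI:
 assumes a: "0 \<le> \<alpha>" "\<alpha> < real n" and p: "1 < p"
  and T: "\<And>g. g \<in> borel_measurable borel ==> lp_mass p g < \<infinity> ==> T g \<in> borel_measurable borel \<and> lp_mass p (T g) \<le> ennreal c * lp_mass p g"
  and c: "0 \<le> c"
  and lin: "\<And>g h a b. g \<in> borel_measurable borel ==> lp_mass p g < \<infinity> ==> h \<in> borel_measurable borel ==> lp_mass p h < \<infinity> ==>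
   AE t in lborel. T (\<lambda>s. a * g s + b * h s) t = a * T g t + b * T h t"
  and A: "\<And>f g. tp_deriv \<alpha> p f g ==> tp_deriv \<alpha> p (A f) (T g)"
 shows "tp_bounded_operator n \<alpha> p A"
 unfolding tp_bounded_operator_def
proof (intro conjI ballI allI impI)
 fix f assume "f \<in> tp_space n \<alpha> p"
 then show "A f \<in> tp_space n \<alpha> p" using A by (auto simp: tp_space_iff[OF a p])
next
 fix f g assume "f \<in> tp_space n \<alpha> p" and ae: "AE t in lebesgue. f t = g t"
 then obtain d where d: "tp_deriv \<alpha> p f d" by (auto simp: tp_space_iff[OF a p])
 have "AE t in lborel. f t = g t" using ae by (simp add: AE_completion_iff)
 then have "AE t in lborel. g t = tR \<alpha> d t"
  using d[unfolded tp_deriv_def, THEN conjunct2, THEN conjunct2] by eventually_elim simp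
 then have d': "tp_deriv \<alpha> p g d" using d by (simp add: tp_deriv_def)
 have "AE t in lborel. A f t = A g t"
  using A[OF d, unfolded tp_deriv_def, THEN conjunct2, THEN conjunct2] A[OF d', unfolded tp_deriv_def, THEN conjunct2, THEN conjunct2]
  by eventually_elim simp
 then show "AE t in lebesgue. A f t = A g t" by (simp add: AE_completion_iff)
next
 fix f g x y assume "f \<in> tp_space n \<alpha> p" "g \<in> tp_space n \<alpha> p"
 then obtain d e where d: "tp_deriv \<alpha> p f d" and e: "tp_deriv \<alpha> p g e" by (auto simp: tp_space_iff[OF a p])
 note [measurable] = d[unfolded tp_deriv_def, THEN conjunct1] e[unfolded tp_deriv_def, THEN conjunct1]
 have fin: "lp_mass p d < \<infinity>" "lp_mass p e < \<infinity>" using d e by (auto simp: tp_deriv_def)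
 have Td: "tp_deriv \<alpha> p (A f) (T d)" "tp_deriv \<alpha> p (A g) (T e)" by (intro A d e)+
 have s: "tp_deriv \<alpha> p (\<lambda>s. x * f s + y * g s) (\<lambda>s. x * d s + y * e s)"
  unfolding tp_deriv_def
 proof (intro conjI)
  show "lp_mass p (\<lambda>s. x * d s + y * e s) < \<infinity>" by (intro lp_mass_add_finite lp_mass_cmult_finite fin p) measurable
  have "AE t in lborel. tR \<alpha> (\<lambda>s. x * d s + y * e s) t = x * tR \<alpha> d t + y * tR \<alpha> e t"
   by (rule tR_lincomb[OF _ _ fin a(1) p]) measurable
  then show "AE t in lborel. x * f t + y * g t = tR \<alpha> (\<lambda>s. x * d s + y * e s) t"
   using d[unfolded tp_deriv_def, THEN conjunct2, THEN conjunct2] e[unfolded tp_deriv_def, THEN conjunct2, THEN conjunct2] by eventually_elim simp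
 qed measurable
 note TS = A[OF s]
 have "AE t in lborel. tR \<alpha> (T (\<lambda>s. x * d s + y * e s)) t = tR \<alpha> (\<lambda>s. x * T d s + y * T e s) t"
  using Td TS fin by (intro tR_cong lin) (auto simp: tp_deriv_def)
 moreover have "AE t in lborel. tR \<alpha> (\<lambda>s. x * T d s + y * T e s) t = x * tR \<alpha> (T d) t + y * tR \<alpha> (T e) t"
  using Td by (intro tR_lincomb[OF _ _ _ _ a(1) p]) (auto simp: tp_deriv_def)
 ultimately have "AE t in lborel. A (\<lambda>s. x * f s + y * g s) t = x * A f t + y * A g t"
  using Td[unfolded tp_deriv_def, THEN conjunct2, THEN conjunct2] TS[unfolded tp_deriv_def, THEN conjunct2, THEN conjunct2]
  by eventually_elim simp
 then show "AE t in lebesgue. A (\<lambda>s. x * f s + y * g s) t = x * A f t + y * A g t" by (simp add: AE_completion_iff)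
next
 have G: "0 < Gamma (\<alpha> + 1)" using a by (intro Gamma_real_pos) simp
 show "\<exists>C. \<forall>f\<in>tp_space n \<alpha> p. tp_norm n \<alpha> p (A f) \<le> C * tp_norm n \<alpha> p f"
 proof (intro exI ballI)
  fix f assume "f \<in> tp_space n \<alpha> p"
  then obtain d where d: "tp_deriv \<alpha> p f d" by (auto simp: tp_space_iff[OF a p])
  have "lp_mag p (T d) \<le> c powr (1 / p) * lp_mag p d"
   using T[of d] d c p by (intro lp_mag_scale) (auto simp: tp_deriv_def)
  then have "1 / Gamma (\<alpha> + 1) * lp_mag p (T d) \<le> 1 / Gamma (\<alpha> + 1) * (c powr (1 / p) * lp_mag p d)"
   using G by (intro mult_left_mono) auto
  then show "tp_norm n \<alpha> p (A f) \<le> c powr (1 / p) * tp_norm n \<alpha> p f"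
   by (simp add: tp_norm_eq[OF a p d] tp_norm_eq[OF a p A[OF d]])
 qed
qed

section \<open>The Stieltjes operator and the Hilbert transform on the completed space\<close>

definition sker :: "real => real => real => real" where
 "sker \<beta> \<mu> u = indicator {0<..} u * (u powr (\<beta> - 1) / (1 + u) powr \<mu>)"

lemma sker_measurable [measurable]: "borel_fun (sker \<beta> \<mu>)"
 unfolding sker_def[abs_def] by measurable

text \<open>Multiplied by u^(-1/p) the kernel is u^(\<beta> - 1/p - 1) (1+u)^(-\<mu>), a power
  integral that converges under the stated inequalities.\<close>

lemma dilation_kernel_stieltjes:
 assumes "0 < \<beta> - 1 / p" "\<beta> - 1 / p < \<mu>" shows "\<exists>C. dilation_kernel p (sker \<beta> \<mu>) C"
proof -
 have "sker \<beta> \<mu> u * u powr (- 1 / p) = indicator {0<..} u * u powr ((\<beta> - 1 / p) - 1) * (1 + u) powr (- \<mu>)" for u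
 proof (cases "0 < u")
  case True
  have "sker \<beta> \<mu> u * u powr (- 1 / p) = (u powr (\<beta> - 1) * u powr (- 1 / p)) * (1 + u) powr (- \<mu>)"
   using True by (simp add: sker_def powr_minus_divide)
  also have "u powr (\<beta> - 1) * u powr (- 1 / p) = u powr ((\<beta> - 1 / p) - 1)"
   by (simp only: powr_add[symmetric]) (simp add: algebra_simps)
  finally show ?thesis using True by simp
 qed (simp add: sker_def)
 then have "(NR u. sker \<beta> \<mu> u * u powr (- 1 / p)) < \<infinity>"
  using power_integral_finite[OF assms] by simp
 then obtain c where c: "0 \<le> c" "(NR u. sker \<beta> \<mu> u * u powr (- 1 / p)) = ennreal c"
  by (cases "NR u. sker \<beta> \<mu> u * u powr (- 1 / p)") auto
 then have "dilation_kernel p (sker \<beta> \<mu>) (c + 1)"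
  by (auto simp: dilation_kernel_def sker_def[of _ _ "_ :: real"] intro!: ennreal_leI)
 then show ?thesis ..
qed

text \<open>For t \<noteq> 0 the map u to t u preserves null sets, so f may be replaced by a Borel
  representative; at t = 0 the integral sees the single value f(0), hence the exclusion.\<close>

lemma stieltjes_eq:
 assumes [measurable]: "borel_fun h" and ae: "AE s in lborel. f s = h s" and t: "t \<noteq> 0"
 shows "stieltjes \<beta> \<mu> f t = dilation_op (sker \<beta> \<mu>) h t"
  "stieltjes_defined_at \<beta> \<mu> f t \<longleftrightarrow> integrable lborel (\<lambda>u. sker \<beta> \<mu> u *\<^sub>R h (t * u))"
proof -
 have "AE u in lborel. indicator {0<..} u *\<^sub>R (u powr (\<beta> - 1) / (1 + u) powr \<mu>) *\<^sub>R f (t * u) = sker \<beta> \<mu> u *\<^sub>R h (t * u)"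
  using AE_lborel_scale[OF ae t] by eventually_elim (simp add: sker_def)
 note * = lebesgue_AE_borel[OF _ this]
 show "stieltjes \<beta> \<mu> f t = dilation_op (sker \<beta> \<mu>) h t"
  unfolding stieltjes_def set_lebesgue_integral_def dilation_op_def by (rule *(2)) measurable
 show "stieltjes_defined_at \<beta> \<mu> f t \<longleftrightarrow> integrable lborel (\<lambda>u. sker \<beta> \<mu> u *\<^sub>R h (t * u))"
  unfolding stieltjes_defined_at_def set_integrable_def by (rule *(3)) measurable
qed

lemma truncated_hilbert_eq:
 assumes [measurable]: "borel_fun h" and ae: "AE s in lborel. f s = h s"
 shows "truncated_hilbert \<epsilon> f t = pv_op \<epsilon> h t"
  "set_integrable lebesgue {s. \<epsilon> < \<bar>t - s\<bar>} (\<lambda>s. f s / of_real (t - s)) \<longleftrightarrow> integrable lborel (\<lambda>s. hker \<epsilon> (t - s) * h s)"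
proof -
 let ?k = "\<lambda>s. indicator {s. \<epsilon> < \<bar>t - s\<bar>} s *\<^sub>R (h s / of_real (t - s))"
 have "AE s in lborel. indicator {s. \<epsilon> < \<bar>t - s\<bar>} s *\<^sub>R (f s / of_real (t - s)) = ?k s"
  using ae by eventually_elim simp
 note * = lebesgue_AE_borel[OF _ this]
 have e: "(\<lambda>s. hker \<epsilon> (t - s) * h s) = (\<lambda>s. \<i> / of_real pi * ?k s)"
  by (rule ext) (simp add: hker_def)
 have "(LINT s:{s. \<epsilon> < \<bar>t - s\<bar>}|lebesgue. f s / of_real (t - s)) = integral\<^sup>L lborel ?k"
  unfolding set_lebesgue_integral_def by (rule *(2)) measurable
 then show "truncated_hilbert \<epsilon> f t = pv_op \<epsilon> h t"
  unfolding truncated_hilbert_def pv_op_def e integral_mult_right_zero by simp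
 have "set_integrable lebesgue {s. \<epsilon> < \<bar>t - s\<bar>} (\<lambda>s. f s / of_real (t - s)) \<longleftrightarrow> integrable lborel ?k"
  unfolding set_integrable_def by (rule *(3)) measurable
 also have "\<dots> \<longleftrightarrow> integrable lborel (\<lambda>s. hker \<epsilon> (t - s) * h s)"
  unfolding e using integrable_mult_right[of "\<i> / of_real pi" lborel ?k] integrable_mult_right[of "of_real pi / \<i>" lborel "\<lambda>s. \<i> / of_real pi * ?k s"]
  by (auto simp: mult.assoc[symmetric])
 finally show "set_integrable lebesgue {s. \<epsilon> < \<bar>t - s\<bar>} (\<lambda>s. f s / of_real (t - s)) \<longleftrightarrow> integrable lborel (\<lambda>s. hker \<epsilon> (t - s) * h s)" .
qed

text \<open>Almost everywhere convergence of the truncated integrals identifies the value of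
  \<open>Lim\<close>, and Hoelder's inequality gives integrability of each truncation.\<close>

lemma hilbert_AE:
 assumes h: "borel_fun h" and fin: "lp_mass p h < \<infinity>" and p: "1 < p" and ae: "AE s in lborel. f s = h s"
  and g: "is_cauchy_boundary p h g"
 shows "AE t in lborel. hilbert f t = g t - h t \<and> hilbert_defined_at f t"
 using pv_op_tendsto_AE[OF h p fin g]
proof eventually_elim
 case (elim t)
 then have l: "((\<lambda>\<epsilon>. truncated_hilbert \<epsilon> f t) \<longlongrightarrow> g t - h t) (at_right 0)"
  by (simp only: truncated_hilbert_eq(1)[OF h ae])
 have "hilbert f t = g t - h t" unfolding hilbert_def by (rule tendsto_Lim[OF _ l]) simp
 moreover have "hilbert_defined_at f t"
  unfolding hilbert_defined_at_def truncated_hilbert_eq(2)[OF h ae] using l pv_integrable(2)[OF h p fin] by blast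
 ultimately show ?case by blast
qed

lemma is_cauchy_boundary_lincomb:
 assumes f[measurable]: "borel_fun f" "borel_fun g" and fin: "lp_mass p f < \<infinity>" "lp_mass p g < \<infinity>" and p: "1 < p"
  and h: "is_cauchy_boundary p f h" and k: "is_cauchy_boundary p g k"
 shows "is_cauchy_boundary p (\<lambda>s. a * f s + b * g s) (\<lambda>s. a * h s + b * k s)"
proof -
 have [measurable]: "borel_fun h" "borel_fun k" using h k by (auto simp: is_cauchy_boundary_def)
 have hk: "lp_mass p h < \<infinity>" "lp_mass p k < \<infinity>"
  "((\<lambda>y. lp_mass p (\<lambda>x. cauchy_op y f x - h x)) \<longlongrightarrow> 0) (at_right 0)" "((\<lambda>y. lp_mass p (\<lambda>x. cauchy_op y g x - k x)) \<longlongrightarrow> 0) (at_right 0)"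
  using h k by (auto simp: is_cauchy_boundary_def)
 show ?thesis
  unfolding is_cauchy_boundary_def
 proof (intro conjI)
  show "lp_mass p (\<lambda>s. a * h s + b * k s) < \<infinity>" by (intro lp_mass_add_finite lp_mass_cmult_finite hk p) measurable
  show "((\<lambda>y. lp_mass p (\<lambda>x. cauchy_op y (\<lambda>s. a * f s + b * g s) x - (a * h x + b * k x))) \<longlongrightarrow> 0) (at_right 0)"
  proof (rule tendsto_0_le_ennreal)
   let ?B = "\<lambda>y. ennreal (2 powr p) * (ennreal (norm a powr p) * lp_mass p (\<lambda>x. cauchy_op y f x - h x) + ennreal (norm b powr p) * lp_mass p (\<lambda>x. cauchy_op y g x - k x))"
   have "((\<lambda>y. ennreal (norm a powr p) * lp_mass p (\<lambda>x. cauchy_op y f x - h x) + ennreal (norm b powr p) * lp_mass p (\<lambda>x. cauchy_op y g x - k x)) \<longlongrightarrow> 0 + 0) (at_right 0)"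
    by (intro tendsto_add tendsto_cmult_0_ennreal hk)
   then show "(?B \<longlongrightarrow> 0) (at_right 0)" by (intro tendsto_cmult_0_ennreal) simp
   show "\<forall>\<^sub>F y in at_right 0. lp_mass p (\<lambda>x. cauchy_op y (\<lambda>s. a * f s + b * g s) x - (a * h x + b * k x)) \<le> ?B y"
    using eventually_at_right_less[of "0 :: real"]
   proof eventually_elim
    case (elim y)
    have "(\<lambda>x. cauchy_op y (\<lambda>s. a * f s + b * g s) x - (a * h x + b * k x)) = (\<lambda>x. a * (cauchy_op y f x - h x) + b * (cauchy_op y g x - k x))"
     by (rule ext) (simp add: cauchy_op_lincomb[OF f p fin elim] algebra_simps)
    then have "lp_mass p (\<lambda>x. cauchy_op y (\<lambda>s. a * f s + b * g s) x - (a * h x + b * k x))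
     \<le> ennreal (2 powr p) * (lp_mass p (\<lambda>x. a * (cauchy_op y f x - h x)) + lp_mass p (\<lambda>x. b * (cauchy_op y g x - k x)))"
     by (simp only:) (rule lp_mass_add_le[OF _ _ p]; measurable)
    also have "\<dots> = ?B y" by (subst (1 2) lp_mass_cmult) auto
    finally show ?case .
   qed
  qed
 qed measurable
qed

text \<open>The choice fixes one boundary function among those equal almost everywhere, so that the
  Hilbert transform becomes a function on L^p representatives, linear up to null sets.\<close>

definition hilbert_op :: "real => (real => complex) => real => complex" where
 "hilbert_op p g t = (SOME h. is_cauchy_boundary p g h) t - g t"

lemma cauchy_boundary_some:
 assumes "borel_fun g" "1 < p" "lp_mass p g < \<infinity>"
 shows "is_cauchy_boundary p g (SOME h. is_cauchy_boundary p g h)"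
 by (rule someI_ex[OF cauchy_boundary_exists[OF assms]])

text \<open>Passing to boundary functions commutes with \<open>tR\<close>: for \<alpha> = 0 by
  uniqueness, otherwise because \<open>tR\<close> is a dilation operator. Subtracting the identity
  preserves the relation.\<close>

lemma tp_deriv_hilbert:
 assumes d: "tp_deriv \<alpha> p f g" and a: "0 \<le> \<alpha>" and p: "1 < p"
 shows "tp_deriv \<alpha> p (hilbert f) (hilbert_op p g)"
proof -
 have g[measurable]: "borel_fun g" and gf: "lp_mass p g < \<infinity>" and ae: "AE t in lborel. f t = tR \<alpha> g t"
  using d by (auto simp: tp_deriv_def)
 define b where "b = (SOME h. is_cauchy_boundary p g h)"
 have b: "is_cauchy_boundary p g b" unfolding b_def by (rule cauchy_boundary_some[OF g p gf])
 then have bm[measurable]: "borel_fun b" and bf: "lp_mass p b < \<infinity>" by (auto simp: is_cauchy_boundary_def)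
 have op: "hilbert_op p g = (\<lambda>t. b t - g t)" by (rule ext) (simp add: hilbert_op_def b_def)
 note rm[measurable] = tR_measurable[OF g, of \<alpha>] and rf = tR_mass_finite[OF g gf a p]
 obtain c where c: "is_cauchy_boundary p (tR \<alpha> g) c" using cauchy_boundary_exists[OF rm p rf] by blast
 have cb: "AE t in lborel. c t = tR \<alpha> b t"
  using tR_cases[OF a p]
 proof cases
  case 1
  then show ?thesis using cauchy_boundary_unique[OF g p _ b, of c] c by (simp add: tR_def)
 next
  case (2 C)
  then show ?thesis using cauchy_boundary_dilation[OF g p gf 2(2) b, of c] c by (simp add: tR_def)
 qed
 have "AE t in lborel. tR \<alpha> (\<lambda>s. 1 * b s + (-1) * g s) t = 1 * tR \<alpha> b t + (-1) * tR \<alpha> g t"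
  by (rule tR_lincomb[OF bm g bf gf a p])
 then have "AE t in lborel. tR \<alpha> (\<lambda>s. b s - g s) t = tR \<alpha> b t - tR \<alpha> g t" by simp
 then have "AE t in lborel. hilbert f t = tR \<alpha> (\<lambda>s. b s - g s) t"
  using hilbert_AE[OF rm rf p ae c] cb by eventually_elim simp
 then show ?thesis
  unfolding tp_deriv_def op using lp_mass_diff_finite[OF bm g p bf gf] by simp
qed

text \<open>For \<alpha> > 0 both \<open>tR\<close> and the Stieltjes operator are dilation
  operators, so they commute.\<close>

lemma tp_deriv_stieltjes:
 assumes d: "tp_deriv \<alpha> p f g" and a: "0 \<le> \<alpha>" and p: "1 < p" and k: "dilation_kernel p (sker \<beta> \<mu>) C"
 shows "tp_deriv \<alpha> p (stieltjes \<beta> \<mu> f) (dilation_op (sker \<beta> \<mu>) g)"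
proof -
 have g[measurable]: "borel_fun g" and gf: "lp_mass p g < \<infinity>" and ae: "AE t in lborel. f t = tR \<alpha> g t"
  using d by (auto simp: tp_deriv_def)
 have "AE t in lborel. dilation_op (sker \<beta> \<mu>) (tR \<alpha> g) t = tR \<alpha> (dilation_op (sker \<beta> \<mu>) g) t"
  using tR_cases[OF a p]
 proof cases
  case (2 D)
  then show ?thesis using dilation_op_commute[OF p k 2(2) g gf] by (simp add: tR_def)
 qed (simp add: tR_def)
 with AE_lborel_singleton[of 0] have "AE t in lborel. stieltjes \<beta> \<mu> f t = tR \<alpha> (dilation_op (sker \<beta> \<mu>) g) t"
  by eventually_elim (simp add: stieltjes_eq(1)[OF tR_measurable[OF g] ae])
 then show ?thesis
  unfolding tp_deriv_def using dilation_op_mass_finite[OF p k g gf] by simp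
qed

lemma tp_bounded_hilbert:
 assumes a: "0 \<le> \<alpha>" "\<alpha> < real n" and p: "1 < p"
 shows "tp_bounded_operator n \<alpha> p hilbert"
proof -
 obtain K :: real where K: "0 < K"
  "\<And>f g. [|f \<in> borel_measurable borel; lp_mass p f < \<infinity>; is_cauchy_boundary p f g|] ==> lp_mass p g \<le> ennreal K * lp_mass p f"
  using cauchy_boundary_mass[OF p] by blast
 show ?thesis
 proof (rule tp_bounded_operatorI[OF a p, where T="hilbert_op p" and c="2 powr p * (K + 1)"])
  fix g :: "real => complex" assume g[measurable]: "borel_fun g" and gf: "lp_mass p g < \<infinity>"
  define b where "b = (SOME h. is_cauchy_boundary p g h)"
  have b: "is_cauchy_boundary p g b" unfolding b_def by (rule cauchy_boundary_some[OF g p gf])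
  then have bm[measurable]: "borel_fun b" by (auto simp: is_cauchy_boundary_def)
  have op: "hilbert_op p g = (\<lambda>t. b t - g t)" by (rule ext) (simp add: hilbert_op_def b_def)
  have "lp_mass p (\<lambda>t. b t - g t) \<le> ennreal (2 powr p) * (lp_mass p (\<lambda>t. b t - 0) + lp_mass p (\<lambda>t. 0 - g t))"
   by (rule lp_mass_diff_le[OF _ _ _ p]) measurable
  also have "\<dots> \<le> ennreal (2 powr p) * (ennreal K * lp_mass p g + 1 * lp_mass p g)"
   using K(2)[OF g gf b] by (intro mult_left_mono add_mono) auto
  also have "\<dots> = ennreal (2 powr p * (K + 1)) * lp_mass p g"
   using K(1) by (simp add: ennreal_mult ennreal_plus distrib_right mult.assoc)
  finally show "hilbert_op p g \<in> borel_measurable borel \<and> lp_mass p (hilbert_op p g) \<le> ennreal (2 powr p * (K + 1)) * lp_mass p g"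
   unfolding op by simp
 next
  fix g h :: "real => complex" and a b
  assume g[measurable]: "borel_fun g" and gf: "lp_mass p g < \<infinity>" and h[measurable]: "borel_fun h" and hf: "lp_mass p h < \<infinity>"
  have s[measurable]: "borel_fun (\<lambda>s. a * g s + b * h s)" by measurable
  have sf: "lp_mass p (\<lambda>s. a * g s + b * h s) < \<infinity>" by (intro lp_mass_add_finite lp_mass_cmult_finite gf hf p) measurable
  show "AE t in lborel. hilbert_op p (\<lambda>s. a * g s + b * h s) t = a * hilbert_op p g t + b * hilbert_op p h t"
   using cauchy_boundary_unique[OF s p cauchy_boundary_some[OF s p sf]
     is_cauchy_boundary_lincomb[OF g h gf hf p cauchy_boundary_some[OF g p gf] cauchy_boundary_some[OF h p hf]]]
   by eventually_elim (simp add: hilbert_op_def algebra_simps)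
 qed (use K a p tp_deriv_hilbert in auto)
qed

lemma tp_bounded_stieltjes:
 assumes a: "0 \<le> \<alpha>" "\<alpha> < real n" and p: "1 < p" and k: "dilation_kernel p (sker \<beta> \<mu>) C"
 shows "tp_bounded_operator n \<alpha> p (stieltjes \<beta> \<mu>)"
proof (rule tp_bounded_operatorI[OF a p, where T="dilation_op (sker \<beta> \<mu>)" and c="C powr p"])
 fix g :: "real => complex" assume g: "borel_fun g"
 show "dilation_op (sker \<beta> \<mu>) g \<in> borel_measurable borel \<and> lp_mass p (dilation_op (sker \<beta> \<mu>) g) \<le> ennreal (C powr p) * lp_mass p g"
  using dilation_op_mass[OF p k g] g by simp
next
 fix g h :: "real => complex" and a b
 assume "borel_fun g" "lp_mass p g < \<infinity>" "borel_fun h" "lp_mass p h < \<infinity>"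
 then show "AE t in lborel. dilation_op (sker \<beta> \<mu>) (\<lambda>s. a * g s + b * h s) t
   = a * dilation_op (sker \<beta> \<mu>) g t + b * dilation_op (sker \<beta> \<mu>) h t"
  by (intro dilation_op_lincomb[OF p k])
next
 fix f g assume "tp_deriv \<alpha> p f g"
 then show "tp_deriv \<alpha> p (stieltjes \<beta> \<mu> f) (dilation_op (sker \<beta> \<mu>) g)" by (rule tp_deriv_stieltjes[OF _ a(1) p k])
qed simp

text \<open>The definedness conjunct certifies that \<open>hilbert\<close> and
  \<open>stieltjes\<close> do not return the default values of \<open>Lim\<close> and of the Bochner
  integral. The commutation is proved for Borel representatives in L^p, from the commutation of
  boundary functions with dilations.\<close>

theorem mainTheorem13:
  fixes \<alpha> p \<beta> \<mu> :: real and n :: nat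
  assumes "0 \<le> \<alpha>" and "\<alpha> < real n" and "1 < p"
    and "0 < \<beta> - 1 / p" and "\<beta> - 1 / p < \<mu>"
  shows "(\<forall>f\<in>tp_space n \<alpha> p. AE t in lebesgue.
            hilbert_defined_at f t \<and> stieltjes_defined_at \<beta> \<mu> f t)
       \<and> tp_bounded_operator n \<alpha> p hilbert
       \<and> tp_bounded_operator n \<alpha> p (stieltjes \<beta> \<mu>)
       \<and> (\<forall>f\<in>tp_space n \<alpha> p. AE t in lebesgue.
            hilbert (stieltjes \<beta> \<mu> f) t = stieltjes \<beta> \<mu> (hilbert f) t)"
proof -
 note a = assms(1,2) and p = assms(3)
 obtain C where k: "dilation_kernel p (sker \<beta> \<mu>) C" using dilation_kernel_stieltjes[OF assms(4,5)] by blast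
 let ?S = "dilation_op (sker \<beta> \<mu>)"
 have "(AE t in lborel. hilbert_defined_at f t \<and> stieltjes_defined_at \<beta> \<mu> f t) \<and>
   (AE t in lborel. hilbert (stieltjes \<beta> \<mu> f) t = stieltjes \<beta> \<mu> (hilbert f) t)" if "f \<in> tp_space n \<alpha> p" for f
 proof -
  have "f \<in> lp_space p" using that by (simp add: tp_space_def)
  then obtain h where h[measurable]: "borel_fun h" and hf: "lp_mass p h < \<infinity>" and ae: "AE t in lborel. f t = h t"
   by (rule lp_spaceE)
  obtain g where g: "is_cauchy_boundary p h g" using cauchy_boundary_exists[OF h p hf] by blast
  have gm[measurable]: "borel_fun g" and gf: "lp_mass p g < \<infinity>" using g by (auto simp: is_cauchy_boundary_def)
  note H = hilbert_AE[OF h hf p ae g]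
  note Sf = dilation_op_mass_finite[OF p k h hf]
  have Sm[measurable]: "?S h \<in> borel_measurable borel" by measurable
  have S: "AE t in lborel. stieltjes \<beta> \<mu> f t = ?S h t"
   using AE_lborel_singleton[of 0] by eventually_elim (rule stieltjes_eq(1)[OF h ae])
  have defd: "AE t in lborel. hilbert_defined_at f t \<and> stieltjes_defined_at \<beta> \<mu> f t"
   using H dilation_AE_integrable[OF p k h hf] AE_lborel_singleton[of 0]
   by eventually_elim (simp add: stieltjes_eq(2)[OF h ae])
  obtain b where b: "is_cauchy_boundary p (?S h) b" using cauchy_boundary_exists[OF Sm p Sf] by blast
  \<comment> \<open>The coefficients 1 and -1 match the linear combination rule of dilation
    operators.\<close>
  have Hae: "AE t in lborel. hilbert f t = 1 * g t + (-1) * h t" using H by eventually_elim simp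
  have "AE t in lborel. hilbert (stieltjes \<beta> \<mu> f) t = stieltjes \<beta> \<mu> (hilbert f) t"
   using hilbert_AE[OF Sm Sf p S b] cauchy_boundary_dilation[OF h p hf k g b]
    dilation_op_lincomb[OF p k gm h gf hf, of 1 "-1"] AE_lborel_singleton[of 0]
  proof eventually_elim
   case (elim t)
   have "stieltjes \<beta> \<mu> (hilbert f) t = ?S (\<lambda>s. 1 * g s + (-1) * h s) t"
    using elim by (intro stieltjes_eq(1) Hae) auto
   then show ?case using elim by simp
  qed
  with defd show ?thesis by blast
 qed
 then show ?thesis
  using tp_bounded_hilbert[OF a p] tp_bounded_stieltjes[OF a p k] by (simp add: AE_completion_iff)
qed

end
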